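(* For $n\geq 1$, $\mathcal{A}(n)^{Sp(2n)}$ is freely generated by $\{j^0,j^2,\dots,j^{2n-2}\}$, where $j^{2m}=\frac12\sum_{i=1}^n\big(:e^i\,\partial^{2m}f^i:+:\partial^{2m}e^i\,f^i:\big)$. In other words, there are no nontrivial normally ordered polynomial relations among these generators and their derivatives.
   Context: The rank $n$ symplectic fermion algebra $\mathcal{A}(n)$ is the vertex (super)algebra over $\mathbb{C}$ freely generated by odd elements $e^i,f^i$, $i=1,\dots,n$, with operator product expansions $e^i(z)f^j(w)\sim\delta_{i,j}(z-w)^{-2}$, $f^j(z)e^i(w)\sim-\delta_{i,j}(z-w)^{-2}$, $e^i(z)e^j(w)\sim 0$, $f^i(z)f^j(w)\sim 0$. Its full automorphism group is $Sp(2n)$, acting linearly on the span of the generators, which is the standard module $\mathbb{C}^{2n}$ with symplectic basis $\{e^i,f^i\}$. $\mathcal{A}(n)^{Sp(2n)}$ is the subalgebra of invariants. A subset $\{a_i\}$ of a vertex algebra strongly generates it if the algebra is spanned by the iterated Wick products $:\partial^{k_1}a_{i_1}\cdots\partial^{k_t}a_{i_t}:$ with $k_1,\dots,k_t\geq 0$. It freely generates the algebra if it strongly generates it and there are no nontrivial normally ordered polynomial relations among the generators and their derivatives. *)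

theory Defs
  imports Complex_Main "HOL-Library.Groups_Big_Fun" "Jordan_Normal_Form.Matrix"
begin

section \<open>Vertex superalgebras\<close>

text \<open>
  \<open>nprod V k a b\<close> is the \<open>k\<close>-th product \<open>a\<^sub>(\<^sub>k\<^sub>) b\<close>, that is
  \<open>Y(a,z) b = \<Sum>k. a\<^sub>(\<^sub>k\<^sub>) b z^(-k-1)\<close>. The state space is the whole type \<open>'v\<close>.
\<close>

record 'v vertex_data =
  scal :: "complex \<Rightarrow> 'v \<Rightarrow> 'v"
  even_part :: "'v set"
  odd_part :: "'v set"
  vac :: 'v
  nprod :: "int \<Rightarrow> 'v \<Rightarrow> 'v \<Rightarrow> 'v"

definition koszul_sign :: "('v, 'x) vertex_data_scheme \<Rightarrow> 'v \<Rightarrow> 'v \<Rightarrow> complex" where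
  "koszul_sign V a b = (if a \<in> odd_part V \<and> b \<in> odd_part V then - 1 else 1)"

text \<open>
  Axioms in the form of vacuum axioms plus the Borcherds (Jacobi) identity. By \<open>truncation\<close>, all
  sums over \<open>j\<close> in \<open>borcherds\<close> have finitely many nonzero terms, so that \<open>Sum_any\<close> is the
  actual sum.
\<close>

locale vertex_superalgebra = vector_space "scal V"
  for V :: "('v::ab_group_add, 'x) vertex_data_scheme" +
  assumes subspace_even: "subspace (even_part V)"
    and subspace_odd: "subspace (odd_part V)"
    and even_odd_disjoint: "even_part V \<inter> odd_part V = {0}"
    and even_odd_sum: "\<And>v. \<exists>a \<in> even_part V. \<exists>b \<in> odd_part V. v = a + b"
    and linear_right: "\<And>k a. Vector_Spaces.linear (scal V) (scal V) (\<lambda>b. nprod V k a b)"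
    and linear_left: "\<And>k b. Vector_Spaces.linear (scal V) (scal V) (\<lambda>a. nprod V k a b)"
    and nprod_even_even: "\<And>k a b. a \<in> even_part V \<Longrightarrow> b \<in> even_part V \<Longrightarrow> nprod V k a b \<in> even_part V"
    and nprod_even_odd: "\<And>k a b. a \<in> even_part V \<Longrightarrow> b \<in> odd_part V \<Longrightarrow> nprod V k a b \<in> odd_part V"
    and nprod_odd_even: "\<And>k a b. a \<in> odd_part V \<Longrightarrow> b \<in> even_part V \<Longrightarrow> nprod V k a b \<in> odd_part V"
    and nprod_odd_odd: "\<And>k a b. a \<in> odd_part V \<Longrightarrow> b \<in> odd_part V \<Longrightarrow> nprod V k a b \<in> even_part V"
    and truncation: "\<And>a b. \<exists>N. \<forall>k \<ge> N. nprod V k a b = 0"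
    and vac_even: "vac V \<in> even_part V"
    and vac_left: "\<And>k a. nprod V k (vac V) a = (if k = - 1 then a else 0)"
    and vac_right: "\<And>k a. k \<ge> 0 \<Longrightarrow> nprod V k a (vac V) = 0"
    and creation: "\<And>a. nprod V (- 1) a (vac V) = a"
    and borcherds:
      "\<And>a b c k l m.
         a \<in> even_part V \<union> odd_part V \<Longrightarrow> b \<in> even_part V \<union> odd_part V \<Longrightarrow>
         (\<Sum>j. scal V (of_int m gchoose j)
                 (nprod V (m + k - int j) (nprod V (l + int j) a b) c))
         = (\<Sum>j. scal V ((- 1) ^ j * (of_int l gchoose j))
                 (nprod V (m + l - int j) a (nprod V (k + int j) b c)
                  - scal V ((- 1) powi l * koszul_sign V a b)
                      (nprod V (l + k - int j) b (nprod V (m + int j) a c))))"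

definition deriv_op :: "('v, 'x) vertex_data_scheme \<Rightarrow> 'v \<Rightarrow> 'v" where
  "deriv_op V a = nprod V (- 2) a (vac V)"

text \<open>Iterated Wick products are nested to the right, \<open>:abc: = :a(:bc:):\<close>; the empty product is
  the vacuum.\<close>

definition wick :: "('v, 'x) vertex_data_scheme \<Rightarrow> 'v list \<Rightarrow> 'v" where
  "wick V xs = foldr (nprod V (- 1)) xs (vac V)"

definition strongly_generates ::
  "('v::ab_group_add, 'x) vertex_data_scheme \<Rightarrow> 'v set \<Rightarrow> 'v set \<Rightarrow> bool" where
  "strongly_generates V W S \<longleftrightarrow>
     W = Modules.module.span (scal V)
           {wick V xs | xs. set xs \<subseteq> {(deriv_op V ^^ k) a | k a. a \<in> S}}"

text \<open>
  For an ordered list \<open>gens\<close> of homogeneous elements, the pair \<open>(i, k)\<close> encodes the \<open>k\<close>-th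
  derivative of \<open>gens ! i\<close>. A normally ordered monomial is a list of such pairs with \<open>i\<close>
  weakly increasing and, for constant \<open>i\<close>, \<open>k\<close> weakly decreasing; factors coming from odd
  generators are not repeated.
\<close>

definition no_monomials :: "('v, 'x) vertex_data_scheme \<Rightarrow> 'v list \<Rightarrow> (nat \<times> nat) list set" where
  "no_monomials V gens =
     {ms. (\<forall>(i, k) \<in> set ms. i < length gens) \<and>
          sorted_wrt (\<lambda>(i, k) (i', k').
            i < i' \<or> i = i' \<and> (k' < k \<or> k' = k \<and> gens ! i \<notin> odd_part V)) ms}"

definition no_monomial_value ::
  "('v, 'x) vertex_data_scheme \<Rightarrow> 'v list \<Rightarrow> (nat \<times> nat) list \<Rightarrow> 'v" where
  "no_monomial_value V gens ms = wick V (map (\<lambda>(i, k). (deriv_op V ^^ k) (gens ! i)) ms)"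

text \<open>A normally ordered polynomial is given by its coefficients \<open>P\<close>.\<close>

definition no_nontrivial_relations ::
  "('v::ab_group_add, 'x) vertex_data_scheme \<Rightarrow> 'v list \<Rightarrow> bool" where
  "no_nontrivial_relations V gens \<longleftrightarrow>
     (\<forall>P :: (nat \<times> nat) list \<Rightarrow> complex.
        finite {ms. P ms \<noteq> 0} \<longrightarrow> {ms. P ms \<noteq> 0} \<subseteq> no_monomials V gens \<longrightarrow>
        (\<Sum>ms | P ms \<noteq> 0. scal V (P ms) (no_monomial_value V gens ms)) = 0 \<longrightarrow>
        (\<forall>ms. P ms = 0))"

definition freely_generates ::
  "('v::ab_group_add, 'x) vertex_data_scheme \<Rightarrow> 'v set \<Rightarrow> 'v list \<Rightarrow> bool" where
  "freely_generates V W gens \<longleftrightarrow>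
     set gens \<subseteq> even_part V \<union> odd_part V \<and>
     strongly_generates V W (set gens) \<and>
     no_nontrivial_relations V gens"

definition vertex_automorphism ::
  "('v::ab_group_add, 'x) vertex_data_scheme \<Rightarrow> ('v \<Rightarrow> 'v) \<Rightarrow> bool" where
  "vertex_automorphism V \<phi> \<longleftrightarrow>
     Vector_Spaces.linear (scal V) (scal V) \<phi> \<and> bij \<phi> \<and>
     \<phi> ` even_part V \<subseteq> even_part V \<and> \<phi> ` odd_part V \<subseteq> odd_part V \<and>
     \<phi> (vac V) = vac V \<and>
     (\<forall>k a b. \<phi> (nprod V k a b) = nprod V k (\<phi> a) (\<phi> b))"

section \<open>The symplectic fermion algebra and its invariants\<close>

text \<open>
  Indices run over \<open>0, \<dots>, n - 1\<close>. The operator product expansion is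
  \<open>a(z) b(w) \<sim> \<Sum>k\<ge>0. (a\<^sub>(\<^sub>k\<^sub>) b)(w) (z - w)^(-k-1)\<close>, so a double pole with constant coefficient
  is the product with \<open>k = 1\<close> being a multiple of the vacuum.
\<close>

definition sf_gens :: "nat \<Rightarrow> (nat \<Rightarrow> 'v) \<Rightarrow> (nat \<Rightarrow> 'v) \<Rightarrow> 'v list" where
  "sf_gens n e f = map e [0..<n] @ map f [0..<n]"

locale symplectic_fermion_algebra = vertex_superalgebra V
  for V :: "('v::ab_group_add, 'x) vertex_data_scheme"
    and n :: nat and e f :: "nat \<Rightarrow> 'v" +
  assumes gens_odd: "set (sf_gens n e f) \<subseteq> odd_part V"
    and ope_ef: "\<And>i j k. i < n \<Longrightarrow> j < n \<Longrightarrow> k \<ge> 0 \<Longrightarrow>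
      nprod V k (e i) (f j) = (if k = 1 \<and> i = j then vac V else 0)"
    and ope_fe: "\<And>i j k. i < n \<Longrightarrow> j < n \<Longrightarrow> k \<ge> 0 \<Longrightarrow>
      nprod V k (f j) (e i) = (if k = 1 \<and> i = j then - vac V else 0)"
    and ope_ee: "\<And>i j k. i < n \<Longrightarrow> j < n \<Longrightarrow> k \<ge> 0 \<Longrightarrow> nprod V k (e i) (e j) = 0"
    and ope_ff: "\<And>i j k. i < n \<Longrightarrow> j < n \<Longrightarrow> k \<ge> 0 \<Longrightarrow> nprod V k (f i) (f j) = 0"
    and free: "freely_generates V UNIV (sf_gens n e f)"

definition symplectic_form :: "nat \<Rightarrow> complex mat" where
  "symplectic_form n = four_block_mat (0\<^sub>m n n) (1\<^sub>m n) (- 1\<^sub>m n) (0\<^sub>m n n)"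

definition Sp :: "nat \<Rightarrow> complex mat set" where
  "Sp n = {g \<in> carrier_mat (2 * n) (2 * n).
             transpose_mat g * symplectic_form n * g = symplectic_form n}"

text \<open>
  \<open>extends_matrix V n e f g \<phi>\<close>: the automorphism \<open>\<phi>\<close> acts on the span of the generators by the
  matrix \<open>g\<close> in the basis \<open>e 0, \<dots>, e (n - 1), f 0, \<dots>, f (n - 1)\<close>. Since the generators strongly
  generate, \<open>\<phi>\<close> is determined by \<open>g\<close>. Automorphisms not preserving the span of the generators
  (hence not preserving the conformal weight), such as \<open>e 0 \<mapsto> e 0 + \<partial>\<^sup>2(f 0)\<close>, do not belong to
  the symplectic group.
\<close>

definition extends_matrix ::
  "('v::ab_group_add, 'x) vertex_data_scheme \<Rightarrow> nat \<Rightarrow> (nat \<Rightarrow> 'v) \<Rightarrow> (nat \<Rightarrow> 'v)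
     \<Rightarrow> complex mat \<Rightarrow> ('v \<Rightarrow> 'v) \<Rightarrow> bool" where
  "extends_matrix V n e f g \<phi> \<longleftrightarrow>
     vertex_automorphism V \<phi> \<and>
     (\<forall>j < 2 * n. \<phi> (sf_gens n e f ! j) = (\<Sum>i < 2 * n. scal V (g $$ (i, j)) (sf_gens n e f ! i)))"

definition Sp_invariants ::
  "('v::ab_group_add, 'x) vertex_data_scheme \<Rightarrow> nat \<Rightarrow> (nat \<Rightarrow> 'v) \<Rightarrow> (nat \<Rightarrow> 'v) \<Rightarrow> 'v set" where
  "Sp_invariants V n e f = {v. \<forall>g \<in> Sp n. \<forall>\<phi>. extends_matrix V n e f g \<phi> \<longrightarrow> \<phi> v = v}"

definition j_gen ::
  "('v::ab_group_add, 'x) vertex_data_scheme \<Rightarrow> nat \<Rightarrow> (nat \<Rightarrow> 'v) \<Rightarrow> (nat \<Rightarrow> 'v) \<Rightarrow> nat \<Rightarrow> 'v" where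
  "j_gen V n e f k =
     scal V (1 / 2) (\<Sum>i < n. wick V [e i, (deriv_op V ^^ k) (f i)]
                            + wick V [(deriv_op V ^^ k) (e i), f i])"

end

theory Submission
  imports Defs "HOL-Library.Product_Lexorder"
    "HOL-Computational_Algebra.Polynomial" "Jordan_Normal_Form.Determinant"
begin

text \<open>
  The modes of the generators satisfy canonical anticommutation relations, so the vertex algebra is a
  Fock space with an inner product. The transvections \<open>x \<mapsto> x + \<omega>(w, x) w\<close> lift to automorphisms, hence
  an invariant is killed by their infinitesimal versions; a norm computation in the orthogonal
  complement of the words in the bilinear invariants \<open>\<Sum>\<^sub>i e\<^sub>i(-a) f\<^sub>i(-b) - f\<^sub>i(-a) e\<^sub>i(-b)\<close> shows that these
  words span all invariants. Filtering by the number of factors turns the words into ordered monomials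
  in the derivatives of all \<open>j\<^sup>2\<^sup>m\<close>, \<open>m \<ge> 0\<close>.

  For independence, substitute \<open>e = b\<close>, \<open>f = \<partial>c\<close> with charged fermions \<open>b, c\<close>. The modes of \<open>j\<^sup>2\<^sup>m\<close> then
  act like differential operators of degree \<open>2m + 2\<close>, and iterated commutators with multiplication
  by functions \<open>g\<^sub>1, \<dots>, g\<^sub>n\<close> extract as top symbol of a relation a polynomial in the jets of the power
  sums \<open>\<Sum>\<^sub>c g\<^sub>c^(2m + 2)\<close>, \<open>m < n\<close>, which are algebraically independent.

  Finally, the \<open>(n + 1)\<close>-st power of the part of \<open>j\<^sup>0\<^sub>(\<^sub>-\<^sub>1\<^sub>)\<close> made of creation operators vanishes, and
  independence forces \<open>j\<^sup>2\<^sup>n\<close> to occur in the resulting relation. For \<open>m > n\<close> one uses that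
  \<open>j\<^sup>2\<^sub>(\<^sub>1\<^sub>) j\<^sup>2\<^sup>m\<^sup>-\<^sup>2\<close> is a nonzero multiple of \<open>j\<^sup>2\<^sup>m\<close> up to a derivative, and that \<open>j\<^sup>2\<^sub>(\<^sub>1\<^sub>)\<close> acts as a derivation
  of the \<open>(-1)\<close>-product on monomials because \<open>j\<^sup>2\<^sub>(\<^sub>0\<^sub>)\<close> maps the generators to derivatives.
\<close>

text \<open>The zero modes of the generators act as zero (\<open>u_mode_0\<close>), whereas
  multiplying a fermion field by a function mixes all of its modes; this is the reason for the
  detour through b and c. A mode of j^(2m) has a symbol of degree 2m + 1 there. Commutators with
  currents lower this degree to zero, and one further commutator yields the central term of a
  Heisenberg algebra, which explains the total degree 2m + 2.

  Evenness of 2m enters twice: the two halves of the symbol add up instead of cancelling, and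
  quadratic invariants of odd weight are total derivatives.

  The (-1)-product is neither commutative nor associative. Its comparison with commuting products of
  creation operators is therefore made modulo words with fewer factors, and the elimination of
  j^(2m) for m >= n is an induction on the conformal weight. Bounding the weight also leaves only
  finitely many words, so that orthogonal projection onto their span is available.\<close>

section \<open>Jets of power sums are algebraically independent\<close>

text \<open>Dedekind's argument: the relation at \<open>m y z\<close> minus
  \<open>\<chi> j z\<close> times the relation at \<open>y\<close> no longer contains the character
  \<open>\<chi> j\<close>. Applied below with \<open>m\<close> the pointwise product of
  functions.\<close>

lemma independence_of_characters:
  fixes \<chi> :: "'i \<Rightarrow> 'y \<Rightarrow> complex"
  assumes "finite F"
    and mult: "\<And>i y z. \<chi> i (m y z) = \<chi> i y * \<chi> i z" and one: "\<And>i. \<chi> i unit = 1"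
    and dist: "inj_on \<chi> F" and zero: "\<And>y. (\<Sum>i\<in>F. a i * \<chi> i y) = 0"
  shows "\<forall>i\<in>F. a i = 0"
  using assms(1) dist zero
proof (induction F arbitrary: a rule: finite_induct)
  case (insert j F)
  have z: "a j * \<chi> j y = - (\<Sum>i\<in>F. a i * \<chi> i y)" for y
    using insert.prems(2)[of y] insert.hyps by (simp add: eq_neg_iff_add_eq_0)
  have "a i * (\<chi> i z - \<chi> j z) = 0" if "i \<in> F" for i z
  proof -
    have "\<forall>i\<in>F. a i * (\<chi> i z - \<chi> j z) = 0"
    proof (rule insert.IH)
      show "inj_on \<chi> F" using insert.prems(1) by (simp add: inj_on_insert)
      fix y
      have "(\<Sum>i\<in>F. a i * \<chi> i (m y z)) = (\<Sum>i\<in>F. a i * \<chi> i y) * \<chi> j z"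
      proof -
        have "- (\<Sum>i\<in>F. a i * \<chi> i (m y z)) = a j * \<chi> j y * \<chi> j z"
          using z[of "m y z"] by (simp add: mult mult.assoc)
        also have "\<dots> = - (\<Sum>i\<in>F. a i * \<chi> i y) * \<chi> j z" by (simp only: z)
        finally show ?thesis by simp
      qed
      then show "(\<Sum>i\<in>F. a i * (\<chi> i z - \<chi> j z) * \<chi> i y) = 0"
        by (simp add: mult algebra_simps sum_subtractf sum_distrib_left)
    qed
    then show ?thesis using that by blast
  qed
  moreover have "\<exists>z. \<chi> i z \<noteq> \<chi> j z" if "i \<in> F" for i
  proof -
    have "\<chi> i \<noteq> \<chi> j" using insert.prems(1) insert.hyps(2) that by (metis inj_on_def insertCI)
    then show ?thesis by (auto simp: fun_eq_iff)
  qed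
  ultimately have "\<forall>i\<in>F. a i = 0" by (metis eq_iff_diff_eq_0 mult_eq_0_iff)
  moreover from this have "a j = 0" using z[of unit] by (simp add: one)
  ultimately show ?case by simp
qed simp

lemma prod_list_two_power:
  "prod_list (map (\<lambda>x. if x = v then 2 else (1::complex)) ms) = 2 ^ count (mset ms) v"
  by (induction ms) auto

text \<open>Monomials are characters of the multiplicative monoid of points \<open>y\<close>. The
  point that is 2 at one variable and 1 elsewhere reads off the exponent of this variable, so
  different multisets give different characters.\<close>

lemma polynomial_function_zero:
  fixes P :: "'x list \<Rightarrow> complex"
  assumes "finite F" "inj_on mset F"
    and zero: "\<And>y. (\<Sum>ms\<in>F. P ms * prod_list (map y ms)) = 0"
  shows "\<forall>ms\<in>F. P ms = 0"
proof (rule independence_of_characters[where \<chi> = "\<lambda>ms y. prod_list (map y ms)" and m = "\<lambda>y z x. y x * z x" and unit = "\<lambda>x. 1"])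
  show "prod_list (map (\<lambda>x. y x * z x) ms) = prod_list (map y ms) * prod_list (map z ms)"
    for y z :: "'x \<Rightarrow> complex" and ms
    by (induction ms) auto
  show "prod_list (map (\<lambda>x. 1) ms) = (1::complex)" for ms :: "'x list"
    by (induction ms) auto
  show "inj_on (\<lambda>ms y. prod_list (map y ms) :: complex) F"
  proof (rule inj_onI)
    fix xs ys assume F: "xs \<in> F" "ys \<in> F"
      and eq: "(\<lambda>y. prod_list (map y xs) :: complex) = (\<lambda>y. prod_list (map y ys))"
    have "count (mset xs) v = count (mset ys) v" for v
    proof -
      have "(2::complex) ^ count (mset xs) v = 2 ^ count (mset ys) v"
        using fun_cong[OF eq, of "\<lambda>x. if x = v then 2 else 1"] by (simp only: prod_list_two_power)
      then have "norm ((2::complex) ^ count (mset xs) v) = norm ((2::complex) ^ count (mset ys) v)" by simp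
      then have "(2::real) ^ count (mset xs) v = 2 ^ count (mset ys) v" by (simp add: norm_power)
      then show ?thesis by simp
    qed
    then have "mset xs = mset ys" by (simp add: multiset_eq_iff)
    then show "xs = ys" using assms(2) F by (auto dest: inj_onD)
  qed
qed (use assms in auto)

text \<open>Lagrange interpolation inverts the Vandermonde system: a solution is read off from the
  coefficients of the basis polynomials \<open>L c\<close>.\<close>

lemma vandermonde_surjective:
  fixes x :: "nat \<Rightarrow> complex"
  assumes inj: "inj_on x {..<n}"
  shows "\<exists>v. \<forall>m<n. (\<Sum>c<n. x c ^ m * v c) = r m"
proof -
  define L where "L c = smult (1 / (\<Prod>d\<in>{..<n}-{c}. x c - x d)) (\<Prod>d\<in>{..<n}-{c}. [:- x d, 1:])" for c
  have polyL: "poly (L c) (x d) = (if d = c then 1 else 0)" if "c < n" "d < n" for c d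
  proof (cases "d = c")
    case True
    have "(\<Prod>d\<in>{..<n}-{c}. x c - x d) \<noteq> 0"
      using inj that by (auto simp: inj_on_def)
    then show ?thesis using True by (simp add: L_def poly_prod)
  next
    case False
    then have "(\<Prod>e\<in>{..<n}-{c}. x d - x e) = 0"
      using that by (intro prod_zero bexI[of _ d]) auto
    then show ?thesis using False by (simp add: L_def poly_prod)
  qed
  have degL: "degree (L c) < n" if "c < n" for c
  proof -
    have "degree (L c) \<le> degree (\<Prod>d\<in>{..<n}-{c}. [:- x d, 1:])"
      unfolding L_def by (rule degree_smult_le)
    also have "\<dots> = (\<Sum>d\<in>{..<n}-{c}. degree [:- x d, 1:])"
      by (rule degree_prod_sum_eq) auto
    also have "\<dots> = n - 1" using that by simp
    finally show ?thesis using that by simp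
  qed
  have interp: "(\<Sum>c<n. smult (x c ^ m) (L c)) = monom 1 m" if m: "m < n" for m
  proof (rule poly_eqI_degree)
    show "poly (\<Sum>c<n. smult (x c ^ m) (L c)) y = poly (monom 1 m) y" if yx: "y \<in> x ` {..<n}" for y
    proof -
      obtain d where d: "d < n" "y = x d" using yx by blast
      have "poly (\<Sum>c<n. smult (x c ^ m) (L c)) y = (\<Sum>c<n. if d = c then x c ^ m else 0)"
        unfolding poly_sum by (rule sum.cong) (auto simp: polyL d)
      then show ?thesis using d by (simp add: poly_monom)
    qed
    have "degree (\<Sum>c<n. smult (x c ^ m) (L c)) \<le> n - 1"
    proof (rule degree_sum_le)
      fix c assume "c \<in> {..<n}"
      then show "degree (smult (x c ^ m) (L c)) \<le> n - 1"
        using degL[of c] degree_smult_le[of "x c ^ m" "L c"] by simp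
    qed simp
    then show "degree (\<Sum>c<n. smult (x c ^ m) (L c)) < card (x ` {..<n})"
      using m inj by (simp add: card_image)
    show "degree (monom (1::complex) m) < card (x ` {..<n})"
      using m inj by (simp add: card_image degree_monom_eq)
  qed
  have "(\<Sum>c<n. x c ^ m * (\<Sum>m'<n. coeff (L c) m' * r m')) = r m" if m: "m < n" for m
  proof -
    have "(\<Sum>c<n. x c ^ m * (\<Sum>m'<n. coeff (L c) m' * r m'))
       = (\<Sum>c<n. \<Sum>m'<n. coeff (smult (x c ^ m) (L c)) m' * r m')"
      by (simp add: sum_distrib_left mult.assoc)
    also have "\<dots> = (\<Sum>m'<n. \<Sum>c<n. coeff (smult (x c ^ m) (L c)) m' * r m')"
      by (rule sum.swap)
    also have "\<dots> = (\<Sum>m'<n. coeff (\<Sum>c<n. smult (x c ^ m) (L c)) m' * r m')"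
      by (simp add: coeff_sum sum_distrib_right)
    also have "\<dots> = (\<Sum>m'<n. if m' = m then r m' else 0)"
      unfolding interp[OF m] by (rule sum.cong) auto
    also have "\<dots> = r m" using m by simp
    finally show ?thesis .
  qed
  then show ?thesis by (intro exI[of _ "\<lambda>c. \<Sum>m'<n. coeff (L c) m' * r m'"]) simp
qed

section \<open>Lifting of power sums, order by order\<close>

definition coeffs_agree :: "nat \<Rightarrow> complex poly \<Rightarrow> complex poly \<Rightarrow> bool" where
  "coeffs_agree N p q \<longleftrightarrow> (\<forall>j<N. coeff p j = coeff q j)"

lemma coeffs_agree_mult:
  "coeffs_agree N p q \<Longrightarrow> coeffs_agree N p' q' \<Longrightarrow> coeffs_agree N (p * p') (q * q')"
  unfolding coeffs_agree_def coeff_mult by (intro allI impI sum.cong) auto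

text \<open>First-order Taylor expansion: terms quadratic in the perturbation have order at least
  2N, which exceeds N because of \<open>N \<ge> 1\<close>.\<close>

lemma coeffs_agree_power_perturb:
  assumes "N \<ge> 1"
  shows "coeffs_agree (Suc N) ((g + monom v N) ^ k) (g ^ k + monom (of_nat k * coeff g 0 ^ (k - 1) * v) N)"
proof (induction k)
  case (Suc k)
  let ?a = "of_nat k * coeff g 0 ^ (k - 1) * v"
  have "coeffs_agree (Suc N) ((g + monom v N) * (g + monom v N) ^ k) ((g + monom v N) * (g ^ k + monom ?a N))"
    by (rule coeffs_agree_mult[OF _ Suc]) (simp add: coeffs_agree_def)
  moreover have "coeffs_agree (Suc N) ((g + monom v N) * (g ^ k + monom ?a N))
     (g ^ Suc k + monom (of_nat (Suc k) * coeff g 0 ^ (Suc k - 1) * v) N)"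
    unfolding coeffs_agree_def
  proof (intro allI impI)
    fix j assume j: "j < Suc N"
    have "(g + monom v N) * (g ^ k + monom ?a N) = g ^ Suc k + monom v N * g ^ k + monom ?a N * g + monom v N * monom ?a N"
      by (simp add: algebra_simps)
    then have "coeff ((g + monom v N) * (g ^ k + monom ?a N)) j
        = coeff (g ^ Suc k) j + coeff (monom v N * g ^ k) j + coeff (monom ?a N * g) j + coeff (monom v N * monom ?a N) j"
      by (simp only: coeff_add)
    also have "coeff (monom v N * monom ?a N) j = 0"
      using j assms by (simp add: mult_monom)
    also have "coeff (monom v N * g ^ k) j = (if j = N then v * coeff g 0 ^ k else 0)"
    proof -
      have "coeff (g ^ k) 0 = coeff g 0 ^ k" by (induction k) (simp_all add: coeff_mult_0)
      then show ?thesis using j by (simp add: coeff_monom_mult)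
    qed
    also have "coeff (monom ?a N * g) j = (if j = N then of_nat k * coeff g 0 ^ k * v else 0)"
    proof -
      have "of_nat k * (coeff g 0 ^ (k - 1) * coeff g 0) = of_nat k * coeff g 0 ^ k" by (cases k) auto
      then have "?a * coeff g 0 = of_nat k * coeff g 0 ^ k * v" by (simp add: mult_ac)
      then show ?thesis using j by (simp add: coeff_monom_mult)
    qed
    finally show "coeff ((g + monom v N) * (g ^ k + monom ?a N)) j
        = coeff (g ^ Suc k + monom (of_nat (Suc k) * coeff g 0 ^ (Suc k - 1) * v) N) j"
      by (simp add: distrib_right)
  qed
  ultimately show ?case by (simp add: coeffs_agree_def)
qed (simp add: coeffs_agree_def)

text \<open>The power sums at the point (1, ..., n). Its entries are nonzero and have distinct
  squares, so the Jacobian of the first \<open>n\<close> even power sums is invertible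
  there.\<close>

definition base_value :: "nat \<Rightarrow> nat \<Rightarrow> complex" where
  "base_value n m = (\<Sum>c<n. of_nat (Suc c) ^ (2 * m + 2))"

text \<open>Newton lifting: a change of the coefficients of order \<open>Suc N\<close> of the
  \<open>g c\<close> acts on the power sums through the invertible Jacobian at the base point in
  order \<open>Suc N\<close>, and not at all in lower orders.\<close>

lemma power_sums_lift:
  assumes y0: "\<And>m. m < n \<Longrightarrow> coeff (y m) 0 = base_value n m"
  shows "\<exists>g. (\<forall>c. coeff (g c) 0 = of_nat (Suc c)) \<and>
     (\<forall>m<n. coeffs_agree (Suc N) (\<Sum>c<n. g c ^ (2 * m + 2)) (y m))"
proof (induction N)
  case 0
  have "coeffs_agree 1 (\<Sum>c<n. [:of_nat (Suc c):] ^ (2 * m + 2)) (y m)" if "m < n" for m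
  proof -
    have "coeff ([:a:] ^ k) 0 = (a :: complex) ^ k" for a k by (induction k) (simp_all add: coeff_mult_0)
    then show ?thesis using y0[OF that]
      by (simp only: coeffs_agree_def coeff_sum base_value_def) (simp add: mult_ac)
  qed
  then show ?case by (intro exI[of _ "\<lambda>c. [:of_nat (Suc c):]"]) auto
next
  case (Suc N)
  then obtain g where g: "\<And>c. coeff (g c) 0 = of_nat (Suc c)"
    "\<And>m. m < n \<Longrightarrow> coeffs_agree (Suc N) (\<Sum>c<n. g c ^ (2 * m + 2)) (y m)" by blast
  define r where "r m = (coeff (y m) (Suc N) - coeff (\<Sum>c<n. g c ^ (2 * m + 2)) (Suc N)) / of_nat (2 * m + 2)" for m
  have "inj_on (\<lambda>c. (of_nat (Suc c) :: complex) ^ 2) {..<n}"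
  proof (rule inj_onI)
    fix c d assume "(of_nat (Suc c) :: complex) ^ 2 = of_nat (Suc d) ^ 2"
    then have "(Suc c) ^ 2 = (Suc d) ^ 2" by (metis of_nat_eq_iff of_nat_power)
    then show "c = d" by (simp add: power2_eq_iff)
  qed
  then obtain w where w: "\<And>m. m < n \<Longrightarrow> (\<Sum>c<n. ((of_nat (Suc c) :: complex) ^ 2) ^ m * w c) = r m"
    using vandermonde_surjective by blast
  \<comment> \<open>The Jacobian has entries \<open>(2 m + 2) (c + 1)^(2 m + 1)\<close>. Division by
    \<open>c + 1\<close> leaves a Vandermonde system in the squares; the factor
    \<open>2 m + 2\<close> is already part of \<open>r\<close>.\<close>
  define v where "v c = w c / of_nat (Suc c)" for c
  define g' where "g' c = g c + monom (v c) (Suc N)" for c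
  have "coeffs_agree (Suc (Suc N)) (\<Sum>c<n. g' c ^ (2 * m + 2)) (y m)" if m: "m < n" for m
    unfolding coeffs_agree_def
  proof (intro allI impI)
    fix j assume j: "j < Suc (Suc N)"
    have "coeff (\<Sum>c<n. g' c ^ (2 * m + 2)) j
      = (\<Sum>c<n. coeff (g c ^ (2 * m + 2) + monom (of_nat (2 * m + 2) * of_nat (Suc c) ^ (2 * m + 1) * v c) (Suc N)) j)"
      unfolding coeff_sum
    proof (rule sum.cong[OF refl])
      fix c
      show "coeff (g' c ^ (2 * m + 2)) j = coeff (g c ^ (2 * m + 2) + monom (of_nat (2 * m + 2) * of_nat (Suc c) ^ (2 * m + 1) * v c) (Suc N)) j"
        using coeffs_agree_power_perturb[of "Suc N" "g c" "v c" "2 * m + 2"] j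
        unfolding coeffs_agree_def g'_def g(1) by auto
    qed
    also have "\<dots> = coeff (\<Sum>c<n. g c ^ (2 * m + 2)) j
        + (if j = Suc N then of_nat (2 * m + 2) * (\<Sum>c<n. of_nat (Suc c) ^ (2 * m + 1) * v c) else 0)"
      by (simp add: coeff_sum sum.distrib sum_distrib_left mult.assoc del: of_nat_Suc)
    also have "(\<Sum>c<n. of_nat (Suc c) ^ (2 * m + 1) * v c) = r m"
    proof -
      have "of_nat (Suc c) ^ (2 * m + 1) * v c = ((of_nat (Suc c) :: complex) ^ 2) ^ m * w c" for c
        using of_nat_neq_0[of c, where 'a = complex] by (simp add: v_def power_mult del: of_nat_Suc)
      then show ?thesis using w[OF m] by simp
    qed
    also have "coeff (\<Sum>c<n. g c ^ (2 * m + 2)) j + (if j = Suc N then of_nat (2 * m + 2) * r m else 0) = coeff (y m) j"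
    proof -
      have "(of_nat (2 * m + 2) :: complex) \<noteq> 0" by (metis Suc_eq_plus1 add_2_eq_Suc' of_nat_neq_0)
      then show ?thesis using g(2)[OF m] j by (auto simp: r_def coeffs_agree_def less_Suc_eq)
    qed
    finally show "coeff (\<Sum>c<n. g' c ^ (2 * m + 2)) j = coeff (y m) j" .
  qed
  moreover have "coeff (g' c) 0 = of_nat (Suc c)" for c by (simp add: g'_def g)
  ultimately show ?case by blast
qed

text \<open>The divided derivative, whose value at a point is the Taylor coefficient there
  (\<open>poly_hasse\<close>).\<close>

definition hasse :: "nat \<Rightarrow> complex poly \<Rightarrow> complex poly" where
  "hasse t p = smult (1 / fact t) ((pderiv ^^ t) p)"

lemma coeff_pderiv_pow_0: "coeff ((pderiv ^^ t) p) 0 = fact t * coeff (p :: complex poly) t"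
proof (induction t arbitrary: p)
  case (Suc t)
  have "(pderiv ^^ Suc t) p = (pderiv ^^ t) (pderiv p)" by (simp add: funpow_swap1)
  then show ?case using Suc[of "pderiv p"] by (simp add: coeff_pderiv mult_ac)
qed simp

lemma poly_hasse: "poly (hasse t p) \<tau> = coeff (pcompose p [:\<tau>, 1:]) t"
proof -
  have "(pderiv ^^ t) (pcompose p [:\<tau>, 1:]) = pcompose ((pderiv ^^ t) p) [:\<tau>, 1:]"
    by (induction t) (simp_all add: pderiv_pcompose pderiv_pCons)
  then have "fact t * coeff (pcompose p [:\<tau>, 1:]) t = poly ((pderiv ^^ t) p) \<tau>"
    using coeff_pderiv_pow_0[of t "pcompose p [:\<tau>, 1:]"] by simp
  then show ?thesis by (simp add: hasse_def field_simps)
qed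

lemma hasse_agree: "coeffs_agree (N + t) p q \<Longrightarrow> coeffs_agree N (hasse t p) (hasse t q)"
proof -
  have "coeffs_agree (N + t) p q \<Longrightarrow> coeffs_agree N ((pderiv ^^ t) p) ((pderiv ^^ t) q)"
  proof (induction t arbitrary: N)
    case (Suc t)
    then have "coeffs_agree (Suc N) ((pderiv ^^ t) p) ((pderiv ^^ t) q)" by simp
    then show ?case by (auto simp: coeffs_agree_def coeff_pderiv)
  qed simp
  then show "coeffs_agree (N + t) p q \<Longrightarrow> coeffs_agree N (hasse t p) (hasse t q)"
    by (simp add: coeffs_agree_def hasse_def)
qed

text \<open>The jets of the power sums at a generic base point are arbitrary above order zero; moving the
  evaluation point away from the base point makes the jet of order zero arbitrary, too.\<close>

theorem power_sum_jets_independent: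
  fixes P :: "(nat \<times> nat) list \<Rightarrow> complex"
  assumes F: "finite F" "inj_on mset F" "\<And>ms m t. ms \<in> F \<Longrightarrow> (m, t) \<in> set ms \<Longrightarrow> m < n"
    and zero: "\<And>g. (\<Sum>ms\<in>F. P ms * prod_list (map (\<lambda>(m, t). coeff (\<Sum>c<n. g c ^ (2 * m + 2)) t) ms)) = 0"
  shows "\<forall>ms\<in>F. P ms = 0"
proof (rule polynomial_function_zero[OF F(1,2)])
  \<comment> \<open>\<open>R p\<close> collects the values of the relation on the jets of
    \<open>p\<close> at all points into one polynomial in the expansion point.\<close>
  define R where "R p = (\<Sum>ms\<in>F. smult (P ms) (prod_list (map (\<lambda>(m, t). hasse t (p m)) ms)))" for p :: "nat \<Rightarrow> complex poly"
  have polyR: "poly (R p) \<tau> = (\<Sum>ms\<in>F. P ms * prod_list (map (\<lambda>(m, t). coeff (pcompose (p m) [:\<tau>, 1:]) t) ms))" for p \<tau>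
  proof -
    have "poly (prod_list (map (\<lambda>(m, t). hasse t (p m)) ms)) \<tau>
      = prod_list (map (\<lambda>(m, t). coeff (pcompose (p m) [:\<tau>, 1:]) t) ms)" for ms
      by (induction ms) (auto simp: poly_hasse)
    then show ?thesis by (simp add: R_def poly_sum)
  qed
  \<comment> \<open>Translating the \<open>g c\<close> turns jets at \<open>\<tau>\<close> into jets
    at 0, where \<open>zero\<close> applies.\<close>
  have Rg: "R (\<lambda>m. \<Sum>c<n. g c ^ (2 * m + 2)) = 0" for g
  proof -
    have "pcompose (\<Sum>c<n. g c ^ (2 * m + 2)) q = (\<Sum>c<n. pcompose (g c) q ^ (2 * m + 2))" for m q
    proof -
      have "pcompose (p ^ k) q = pcompose p q ^ k" for p :: "complex poly" and k
        by (induction k) (simp_all add: pcompose_mult pcompose_1)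
      then show ?thesis by (simp only: pcompose_sum)
    qed
    then have "poly (R (\<lambda>m. \<Sum>c<n. g c ^ (2 * m + 2))) \<tau> = 0" for \<tau>
      unfolding polyR using zero[of "\<lambda>c. pcompose (g c) [:\<tau>, 1:]"] by simp
    then show ?thesis by (simp add: poly_all_0_iff_0[symmetric])
  qed
  obtain K where K: "\<And>ms m t. ms \<in> F \<Longrightarrow> (m, t) \<in> set ms \<Longrightarrow> t \<le> K"
  proof -
    have "finite (snd ` (\<Union>ms\<in>F. set ms))" using F(1) by simp
    then obtain K where "\<forall>t\<in>snd ` (\<Union>ms\<in>F. set ms). t \<le> K" using finite_nat_set_iff_bounded_le by blast
    then show ?thesis using that by force
  qed
  \<comment> \<open>To any prescribed order such a \<open>y\<close> is a tuple of power sums, so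
    every coefficient of \<open>R y\<close> vanishes.\<close>
  have Ry: "R y = 0" if y0: "\<And>m. m < n \<Longrightarrow> coeff (y m) 0 = base_value n m" for y
  proof (rule poly_eqI)
    fix i
    obtain g where g: "\<And>m. m < n \<Longrightarrow> coeffs_agree (Suc (i + K)) (\<Sum>c<n. g c ^ (2 * m + 2)) (y m)"
      using power_sums_lift[where n = n and y = y and N = "i + K", OF y0] by blast
    have agree: "coeffs_agree (Suc i) (prod_list (map (\<lambda>(m, t). hasse t (\<Sum>c<n. g c ^ (2 * m + 2))) ms))
        (prod_list (map (\<lambda>(m, t). hasse t (y m)) ms))"
      if "\<forall>(m, t)\<in>set ms. m < n \<and> t \<le> K" for ms
      using that
    proof (induction ms)
      case (Cons x ms)
      obtain m t where x: "x = (m, t)" by (cases x)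
      have "coeffs_agree (Suc i + t) (\<Sum>c<n. g c ^ (2 * m + 2)) (y m)"
        using g[of m] Cons.prems x by (auto simp: coeffs_agree_def)
      then have "coeffs_agree (Suc i) (hasse t (\<Sum>c<n. g c ^ (2 * m + 2))) (hasse t (y m))" by (rule hasse_agree)
      then show ?case using Cons x by (auto intro: coeffs_agree_mult)
    qed (simp add: coeffs_agree_def)
    have "coeff (R (\<lambda>m. \<Sum>c<n. g c ^ (2 * m + 2))) i = coeff (R y) i"
      unfolding R_def coeff_sum coeff_smult
    proof (rule sum.cong[OF refl])
      fix ms assume "ms \<in> F"
      then have "\<forall>(m, t)\<in>set ms. m < n \<and> t \<le> K" using F(3) K by auto
      from agree[OF this] show "P ms * coeff (prod_list (map (\<lambda>(m, t). hasse t (\<Sum>c<n. g c ^ (2 * m + 2))) ms)) i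
         = P ms * coeff (prod_list (map (\<lambda>(m, t). hasse t (y m)) ms)) i"
        by (simp add: coeffs_agree_def)
    qed
    then show "coeff (R y) i = coeff 0 i" by (simp only: Rg)
  qed
  fix Y :: "nat \<times> nat \<Rightarrow> complex"
  define Z0 where "Z0 m = (\<Sum>t\<le>K. monom (Y (m, t)) t)" for m
  \<comment> \<open>\<open>Z0\<close> has the prescribed jets at 0. The term of order
    \<open>Suc K\<close> leaves them intact and corrects the value at -1 to the base value; after
    moving -1 to 0, \<open>Ry\<close> applies to \<open>y\<close>, and the prescribed jets sit at
    the point 1.\<close>
  define Z where "Z m = Z0 m + monom ((base_value n m - poly (Z0 m) (-1)) * (-1) ^ Suc K) (Suc K)" for m
  define y where "y m = pcompose (Z m) [:-1, 1:]" for m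
  have "coeff (y m) 0 = base_value n m" for m
  proof -
    have "(-1 :: complex) ^ Suc K * (-1) ^ Suc K = 1" by (simp flip: power_mult_distrib)
    then show ?thesis by (simp add: y_def Z_def poly_monom mult.assoc del: power_Suc)
  qed
  then have "poly (R y) 1 = 0" by (simp add: Ry)
  moreover have "pcompose (y m) [:1, 1:] = Z m" for m
  proof -
    have "pcompose (y m) [:1, 1:] = pcompose (Z m) (pcompose [:-1, 1:] [:1, 1:])"
      unfolding y_def by (rule pcompose_assoc[symmetric])
    also have "pcompose [:-1, 1:] [:1, 1:] = ([:0, 1:] :: complex poly)" by (simp add: pcompose_pCons)
    finally show ?thesis by (simp add: pcompose_idR)
  qed
  ultimately have "(\<Sum>ms\<in>F. P ms * prod_list (map (\<lambda>(m, t). coeff (Z m) t) ms)) = 0"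
    unfolding polyR by simp
  moreover have "prod_list (map (\<lambda>(m, t). coeff (Z m) t) ms) = prod_list (map Y ms)" if "ms \<in> F" for ms
  proof -
    have "coeff (Z m) t = Y (m, t)" if "t \<le> K" for m t
      using that by (simp add: Z_def Z0_def coeff_sum_monom)
    then show ?thesis using K[OF that] by (intro arg_cong[of _ _ prod_list] map_cong) auto
  qed
  ultimately show "(\<Sum>ms\<in>F. P ms * prod_list (map Y ms)) = 0" by simp
qed

section \<open>Linear operators\<close>

locale complex_space = vector_space scale
  for scale :: "complex \<Rightarrow> 'b::ab_group_add \<Rightarrow> 'b"
begin

definition lin :: "('b \<Rightarrow> 'b) \<Rightarrow> bool" where
  "lin f \<longleftrightarrow> (\<forall>x y. f (x + y) = f x + f y) \<and> (\<forall>c x. f (scale c x) = scale c (f x))"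

lemma linI:
  assumes "\<And>x y. f (x + y) = f x + f y" and "\<And>c x. f (scale c x) = scale c (f x)"
  shows "lin f"
  using assms by (simp add: lin_def)

lemma lin_add: "lin f \<Longrightarrow> f (x + y) = f x + f y"
  and lin_scale: "lin f \<Longrightarrow> f (scale c x) = scale c (f x)"
  by (simp_all add: lin_def)

lemma lin_0: "lin f \<Longrightarrow> f 0 = 0"
  using lin_scale[of f 0 0] by simp

lemma lin_neg: "lin f \<Longrightarrow> f (- x) = - f x"
  using lin_scale[of f "-1" x] by simp

lemma lin_diff: "lin f \<Longrightarrow> f (x - y) = f x - f y"
  using lin_add[of f x "- y"] lin_neg[of f y] by simp

lemma lin_sum: "lin f \<Longrightarrow> f (sum g A) = (\<Sum>x\<in>A. f (g x))"
  by (induction A rule: infinite_finite_induct) (simp_all add: lin_0 lin_add)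

lemma lin_iff_linear: "lin f \<longleftrightarrow> Vector_Spaces.linear scale scale f"
proof -
  show ?thesis
    by (auto simp: lin_def Vector_Spaces.linear_iff vector_space_axioms)
qed

lemma lin_id: "lin (\<lambda>x. x)"
  and lin_zero: "lin (\<lambda>x. 0)"
  and lin_scale_op: "lin (scale c)"
  by (auto simp: lin_def scale_right_distrib scale_left_commute)

lemma lin_comp: "lin f \<Longrightarrow> lin g \<Longrightarrow> lin (\<lambda>x. f (g x))"
  and lin_plus: "lin f \<Longrightarrow> lin g \<Longrightarrow> lin (\<lambda>x. f x + g x)"
  and lin_minus: "lin f \<Longrightarrow> lin g \<Longrightarrow> lin (\<lambda>x. f x - g x)"
  and lin_smult: "lin f \<Longrightarrow> lin (\<lambda>x. scale c (f x))"
  by (auto simp: lin_def scale_right_distrib scale_right_diff_distrib scale_left_commute algebra_simps)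

lemma lin_sum_op: "(\<And>i. i \<in> A \<Longrightarrow> lin (F i)) \<Longrightarrow> lin (\<lambda>x. \<Sum>i\<in>A. F i x)"
  by (induction A rule: infinite_finite_induct) (simp_all add: lin_zero lin_plus)

lemma lin_funpow: "lin f \<Longrightarrow> lin (f ^^ k)"
  by (induction k) (auto simp: lin_def)

lemma lin_Sum_any:
  assumes "\<And>i. lin (F i)" and "\<And>x. finite {i. F i x \<noteq> 0}"
  shows "lin (\<lambda>x. Sum_any (\<lambda>i. F i x))"
proof (rule linI)
  fix x y
  let ?S = "{i. F i x \<noteq> 0} \<union> {i. F i y \<noteq> 0}"
  have "Sum_any (\<lambda>i. F i (x + y)) = (\<Sum>i\<in>?S. F i (x + y))"
    by (rule Sum_any.expand_superset) (auto simp: assms lin_add)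
  also have "\<dots> = (\<Sum>i\<in>?S. F i x) + (\<Sum>i\<in>?S. F i y)"
    by (simp add: lin_add assms sum.distrib)
  also have "(\<Sum>i\<in>?S. F i x) = Sum_any (\<lambda>i. F i x)"
    by (rule Sum_any.expand_superset[symmetric]) (auto simp: assms)
  also have "(\<Sum>i\<in>?S. F i y) = Sum_any (\<lambda>i. F i y)"
    by (rule Sum_any.expand_superset[symmetric]) (auto simp: assms)
  finally show "Sum_any (\<lambda>i. F i (x + y)) = Sum_any (\<lambda>i. F i x) + Sum_any (\<lambda>i. F i y)" .
next
  fix c x
  have "Sum_any (\<lambda>i. F i (scale c x)) = (\<Sum>i\<in>{i. F i x \<noteq> 0}. F i (scale c x))"
    by (rule Sum_any.expand_superset) (auto simp: assms lin_scale)
  also have "\<dots> = scale c (\<Sum>i\<in>{i. F i x \<noteq> 0}. F i x)"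
    by (simp add: lin_scale assms scale_sum_right)
  finally show "Sum_any (\<lambda>i. F i (scale c x)) = scale c (Sum_any (\<lambda>i. F i x))"
    by (simp add: Sum_any.expand_set)
qed

lemma lin_span_subset:
  assumes "lin f" and "\<And>x. x \<in> B \<Longrightarrow> f x \<in> S" and "subspace S" and "v \<in> span B"
  shows "f v \<in> S"
  using assms(4)
proof (induction v rule: span_induct_alt)
  case base
  then show ?case by (simp add: lin_0 assms subspace_0)
next
  case (step c x y)
  then show ?case by (simp add: lin_add lin_scale assms subspace_add subspace_scale)
qed

lemma lin_eq_on_span:
  assumes "lin f" "lin g" and "\<And>x. x \<in> B \<Longrightarrow> f x = g x" and "v \<in> span B"
  shows "f v = g v"
  using assms(4)
proof (induction v rule: span_induct_alt)
  case base
  then show ?case by (simp add: lin_0 assms)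
next
  case (step c x y)
  then show ?case by (simp add: lin_add lin_scale assms)
qed

end

section \<open>Consequences of the Borcherds identity\<close>

sublocale vertex_superalgebra \<subseteq> complex_space "scal V"
  by unfold_locales

context vertex_superalgebra
begin

abbreviation sc :: "complex \<Rightarrow> 'v \<Rightarrow> 'v" where "sc \<equiv> scal V"
abbreviation hom :: "'v set" where "hom \<equiv> even_part V \<union> odd_part V"
abbreviation D :: "'v \<Rightarrow> 'v" where "D \<equiv> deriv_op V"

lemma lin_nprod: "lin (nprod V k a)"
  using linear_right by (simp add: lin_iff_linear)

lemma lin_nprod_left: "lin (\<lambda>a. nprod V k a b)"
  using linear_left by (simp add: lin_iff_linear)

lemmas nprod_add_right = lin_add[OF lin_nprod]
  and nprod_scale_right = lin_scale[OF lin_nprod]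
  and nprod_zero_right = lin_0[OF lin_nprod]
  and nprod_add_left = lin_add[OF lin_nprod_left]
  and nprod_scale_left = lin_scale[OF lin_nprod_left]
  and nprod_zero_left = lin_0[OF lin_nprod_left]
  and nprod_sum_left = lin_sum[OF lin_nprod_left]

text \<open>Replaces the formally infinite sum by all sufficiently long finite ones, so that a
  common length can be chosen when several expansions meet.\<close>

lemma Sum_any_eventually:
  fixes F :: "nat \<Rightarrow> 'v"
  assumes "\<exists>M. \<forall>j\<ge>M. F j = 0"
  shows "\<exists>M. \<forall>N\<ge>M. Sum_any F = (\<Sum>j<N. F j)"
proof -
  obtain M where M: "\<forall>j\<ge>M. F j = 0" using assms by blast
  have "Sum_any F = (\<Sum>j<N. F j)" if "N \<ge> M" for N
  proof (rule Sum_any.expand_superset)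
    show "{j. F j \<noteq> 0} \<subseteq> {..<N}"
    proof
      fix j assume "j \<in> {j. F j \<noteq> 0}"
      then have "\<not> M \<le> j" using M by auto
      then show "j \<in> {..<N}" using that by simp
    qed
  qed simp
  then show ?thesis by blast
qed

lemma truncation_nat: "\<exists>M::nat. \<forall>j\<ge>M. nprod V (k + int j) a b = 0"
proof -
  obtain N where "\<forall>i\<ge>N. nprod V i a b = 0" using truncation by blast
  then have "\<forall>j\<ge>nat (N - k). nprod V (k + int j) a b = 0" by auto
  then show ?thesis by blast
qed

text \<open>The case \<open>l = 0\<close> of the Borcherds identity, where only \<open>j = 0\<close>
  survives on the right-hand side.\<close>

lemma commutator_formula:
  assumes "a \<in> hom" "b \<in> hom"
  shows "\<exists>M. \<forall>N\<ge>M. nprod V m a (nprod V k b c) - sc (koszul_sign V a b) (nprod V k b (nprod V m a c))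
     = (\<Sum>j<N. sc (of_int m gchoose j) (nprod V (m + k - int j) (nprod V (int j) a b) c))"
proof -
  let ?L = "\<lambda>j. sc (of_int m gchoose j) (nprod V (m + k - int j) (nprod V (int j) a b) c)"
  obtain M where M: "\<forall>j\<ge>M. nprod V (0 + int j) a b = 0" using truncation_nat by blast
  have "\<exists>M. \<forall>N\<ge>M. Sum_any ?L = (\<Sum>j<N. ?L j)"
    by (rule Sum_any_eventually, rule exI[of _ M]) (use M in \<open>auto simp: nprod_zero_left\<close>)
  moreover have "Sum_any ?L = nprod V m a (nprod V k b c) - sc (koszul_sign V a b) (nprod V k b (nprod V m a c))"
  proof -
    let ?R = "\<lambda>j. sc ((-1) ^ j * (of_int 0 gchoose j))
                (nprod V (m + 0 - int j) a (nprod V (k + int j) b c)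
                  - sc ((- 1) powi 0 * koszul_sign V a b)
                      (nprod V (0 + k - int j) b (nprod V (m + int j) a c)))"
    have "Sum_any ?L = Sum_any ?R"
      using borcherds[OF assms, of m k 0 c] by simp
    also have "\<dots> = sum ?R {0}"
    proof (rule Sum_any.expand_superset)
      have "(0 gchoose j) = (0::complex)" if "j \<noteq> 0" for j
        using that by (cases j) auto
      then show "{j. ?R j \<noteq> 0} \<subseteq> {0}" by (auto intro: ccontr)
    qed simp
    finally show ?thesis by simp
  qed
  ultimately show ?thesis by simp
qed

text \<open>The case \<open>m = 0\<close> of the Borcherds identity, where only \<open>j = 0\<close>
  survives on the left-hand side.\<close>

lemma associator_formula:
  assumes "a \<in> hom" "b \<in> hom"
  shows "\<exists>M. \<forall>N\<ge>M. nprod V k (nprod V l a b) c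
     = (\<Sum>j<N. sc ((-1) ^ j * (of_int l gchoose j))
                (nprod V (l - int j) a (nprod V (k + int j) b c)
                  - sc ((- 1) powi l * koszul_sign V a b)
                      (nprod V (l + k - int j) b (nprod V (int j) a c))))"
proof -
  let ?R = "\<lambda>j. sc ((-1) ^ j * (of_int l gchoose j))
                (nprod V (0 + l - int j) a (nprod V (k + int j) b c)
                  - sc ((- 1) powi l * koszul_sign V a b)
                      (nprod V (l + k - int j) b (nprod V (0 + int j) a c)))"
  let ?L = "\<lambda>j. sc (of_int 0 gchoose j) (nprod V (0 + k - int j) (nprod V (l + int j) a b) c)"
  obtain M1 where M1: "\<forall>j\<ge>M1. nprod V (0 + int j) a c = 0" using truncation_nat by blast
  obtain M2 where M2: "\<forall>j\<ge>M2. nprod V (k + int j) b c = 0" using truncation_nat by blast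
  have "\<exists>M. \<forall>N\<ge>M. Sum_any ?R = (\<Sum>j<N. ?R j)"
    by (rule Sum_any_eventually, rule exI[of _ "max M1 M2"])
      (use M1 M2 in \<open>auto simp: nprod_zero_right\<close>)
  moreover have "Sum_any ?R = nprod V k (nprod V l a b) c"
  proof -
    have "Sum_any ?R = Sum_any ?L"
      using borcherds[OF assms, of 0 k l c] by simp
    also have "\<dots> = sum ?L {0}"
    proof (rule Sum_any.expand_superset)
      have "(0 gchoose j) = (0::complex)" if "j \<noteq> 0" for j
        using that by (cases j) auto
      then show "{j. ?L j \<noteq> 0} \<subseteq> {0}" by (auto intro: ccontr)
    qed simp
    finally show ?thesis by simp
  qed
  ultimately show ?thesis by simp
qed

lemma koszul_vac: "sc (koszul_sign V a (vac V)) (nprod V k (vac V) x) = nprod V k (vac V) x"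
proof (cases "vac V \<in> odd_part V")
  case True
  then have "vac V = 0" using vac_even even_odd_disjoint by blast
  then show ?thesis by (simp add: nprod_zero_left)
qed (simp add: koszul_sign_def)

lemma sum_eq_single:
  assumes "finite A" "i \<in> A" "\<And>j. j \<in> A \<Longrightarrow> j \<noteq> i \<Longrightarrow> F j = (0::'z::comm_monoid_add)"
  shows "sum F A = F i"
  using sum.mono_neutral_right[of A "{i}" F] assms by auto

text \<open>Associator formula with the vacuum as second factor. All modes of the vacuum vanish
  except the one of index -1, so a single term is left: from the first summand for negative
  \<open>k\<close>, from the second for positive \<open>k\<close>.\<close>

lemma deriv_nprod_hom:
  assumes "a \<in> hom"
  shows "nprod V k (D a) c = sc (- of_int k) (nprod V (k - 1) a c)"
proof -
  have vh: "vac V \<in> hom" using vac_even by simp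
  obtain M where M: "\<forall>N\<ge>M. nprod V k (nprod V (-2) a (vac V)) c
     = (\<Sum>j<N. sc ((-1) ^ j * (of_int (-2) gchoose j))
                (nprod V ((-2) - int j) a (nprod V (k + int j) (vac V) c)
                  - sc ((- 1) powi (-2) * koszul_sign V a (vac V))
                      (nprod V ((-2) + k - int j) (vac V) (nprod V (int j) a c))))"
    using associator_formula[OF assms vh, of k "-2" c] by blast
  define N where "N = M + nat \<bar>k\<bar> + 3"
  have bin: "(-1) ^ j * (of_int (-2) gchoose j) = (of_nat (Suc j) :: complex)" for j
  proof -
    have "(of_int (-2) gchoose j) = (-1::complex) ^ j * ((2 + of_nat j - 1) gchoose j)"
      using gbinomial_minus[of "2::complex" j] by simp
    also have "(2 + of_nat j - 1 :: complex) = of_nat (Suc j)" by simp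
    also have "(of_nat (Suc j) gchoose j) = (of_nat (Suc j choose j) :: complex)"
      by (simp only: binomial_gbinomial)
    also have "Suc j choose j = Suc j" by (induction j) auto
    finally show ?thesis by (simp add: mult.assoc[symmetric] flip: power_mult_distrib)
  qed
  have "nprod V k (D a) c = (\<Sum>j<N. sc (of_nat (Suc j))
                (nprod V ((-2) - int j) a (nprod V (k + int j) (vac V) c)
                  - nprod V ((-2) + k - int j) (vac V) (nprod V (int j) a c)))"
    using M[rule_format, of N] unfolding deriv_op_def bin
    by (simp add: N_def koszul_vac flip: scale_scale)
  also have "\<dots> = (\<Sum>j<N. sc (of_nat (Suc j)) (if int j = - k - 1 then nprod V (k - 1) a c else 0)
       - sc (of_nat (Suc j)) (if int j = k - 1 then nprod V (k - 1) a c else 0))"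
  proof (rule sum.cong[OF refl])
    fix j
    have "nprod V ((-2) - int j) a (nprod V (k + int j) (vac V) c)
       = (if int j = - k - 1 then nprod V (k - 1) a c else 0)"
    proof (cases "int j = - k - 1")
      case True
      then have "- 2 - int j = k - 1" "k + int j = - 1" by auto
      then show ?thesis using True by (simp only: vac_left if_True refl)
    qed (auto simp: vac_left nprod_zero_right)
    moreover have "nprod V ((-2) + k - int j) (vac V) (nprod V (int j) a c)
       = (if int j = k - 1 then nprod V (k - 1) a c else 0)"
      by (auto simp: vac_left algebra_simps)
    ultimately show "sc (of_nat (Suc j)) (nprod V ((-2) - int j) a (nprod V (k + int j) (vac V) c)
                  - nprod V ((-2) + k - int j) (vac V) (nprod V (int j) a c)) =
       sc (of_nat (Suc j)) (if int j = - k - 1 then nprod V (k - 1) a c else 0)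
       - sc (of_nat (Suc j)) (if int j = k - 1 then nprod V (k - 1) a c else 0)"
      by (simp only: scale_right_diff_distrib)
  qed
  also have "\<dots> = (\<Sum>j<N. sc (of_nat (Suc j)) (if int j = - k - 1 then nprod V (k - 1) a c else 0))
       - (\<Sum>j<N. sc (of_nat (Suc j)) (if int j = k - 1 then nprod V (k - 1) a c else 0))"
    by (rule sum_subtractf)
  also have "(\<Sum>j<N. sc (of_nat (Suc j)) (if int j = - k - 1 then nprod V (k - 1) a c else 0))
      = (if k < 0 then sc (- of_int k) (nprod V (k - 1) a c) else 0)"
  proof (cases "k < 0")
    case True
    have "(\<Sum>j<N. sc (of_nat (Suc j)) (if int j = - k - 1 then nprod V (k - 1) a c else 0))
      = sc (of_nat (Suc (nat (-k-1)))) (if int (nat (-k-1)) = - k - 1 then nprod V (k - 1) a c else 0)"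
      by (rule sum_eq_single) (use True in \<open>auto simp: N_def\<close>)
    also have "\<dots> = sc (- of_int k) (nprod V (k - 1) a c)"
    proof -
      have "(of_nat (Suc (nat (-k-1))) :: complex) = of_int (int (Suc (nat (-k-1))))" by simp
      also have "int (Suc (nat (-k-1))) = -k" using True by simp
      finally show ?thesis using True by simp
    qed
    finally show ?thesis using True by simp
  next
    case False
    have "(\<Sum>j<N. sc (of_nat (Suc j)) (if int j = - k - 1 then nprod V (k - 1) a c else 0)) = 0"
      by (rule sum.neutral) (use False in auto)
    then show ?thesis using False by simp
  qed
  also have "(\<Sum>j<N. sc (of_nat (Suc j)) (if int j = k - 1 then nprod V (k - 1) a c else 0))
      = (if k > 0 then sc (of_int k) (nprod V (k - 1) a c) else 0)"
  proof (cases "k > 0")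
    case True
    have "(\<Sum>j<N. sc (of_nat (Suc j)) (if int j = k - 1 then nprod V (k - 1) a c else 0))
      = sc (of_nat (Suc (nat (k-1)))) (if int (nat (k-1)) = k - 1 then nprod V (k - 1) a c else 0)"
      by (rule sum_eq_single) (use True in \<open>auto simp: N_def\<close>)
    also have "\<dots> = sc (of_int k) (nprod V (k - 1) a c)"
    proof -
      have "(of_nat (Suc (nat (k-1))) :: complex) = of_int (int (Suc (nat (k-1))))" by simp
      also have "int (Suc (nat (k-1))) = k" using True by simp
      finally show ?thesis using True by simp
    qed
    finally show ?thesis using True by simp
  next
    case False
    have "(\<Sum>j<N. sc (of_nat (Suc j)) (if int j = k - 1 then nprod V (k - 1) a c else 0)) = 0"
      by (rule sum.neutral) (use False in auto)
    then show ?thesis using False by simp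
  qed
  finally show ?thesis by (auto simp: scale_minus_left not_less)
qed

lemma lin_D: "lin D"
  unfolding deriv_op_def by (rule lin_nprod_left)

lemma hom_decomp: obtains a0 a1 where "a0 \<in> hom" "a1 \<in> hom" "a = a0 + a1"
  using even_odd_sum by blast

lemma deriv_nprod: "nprod V k (D a) c = sc (- of_int k) (nprod V (k - 1) a c)"
proof -
  obtain a0 a1 where "a0 \<in> hom" "a1 \<in> hom" "a = a0 + a1" by (rule hom_decomp)
  then show ?thesis
    by (simp add: lin_add[OF lin_D] nprod_add_left deriv_nprod_hom scale_right_distrib del: Un_iff)
qed

lemma deriv_vac: "D (vac V) = 0"
  by (simp add: deriv_op_def vac_left)

text \<open>Modes of nonnegative index kill the vacuum, which leaves \<open>j = 0\<close> and
  \<open>j = 1\<close> in the associator formula.\<close>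

lemma deriv_prod_hom:
  assumes "a \<in> hom" "b \<in> hom"
  shows "D (nprod V l a b) = nprod V l (D a) b + nprod V l a (D b)"
proof -
  obtain M where M: "\<forall>N\<ge>M. nprod V (-2) (nprod V l a b) (vac V)
     = (\<Sum>j<N. sc ((-1) ^ j * (of_int l gchoose j))
                (nprod V (l - int j) a (nprod V ((-2) + int j) b (vac V))
                  - sc ((- 1) powi l * koszul_sign V a b)
                      (nprod V (l + (-2) - int j) b (nprod V (int j) a (vac V)))))"
    using associator_formula[OF assms, of "-2" l "vac V"] by blast
  have "D (nprod V l a b) = (\<Sum>j<M+2. sc ((-1) ^ j * (of_int l gchoose j))
                (nprod V (l - int j) a (nprod V ((-2) + int j) b (vac V))))"
    unfolding deriv_op_def using M[rule_format, of "M+2"]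
    by (simp add: vac_right nprod_zero_right)
  also have "\<dots> = (\<Sum>j<2. sc ((-1) ^ j * (of_int l gchoose j))
                (nprod V (l - int j) a (nprod V ((-2) + int j) b (vac V))))"
    by (rule sum.mono_neutral_right) (auto simp: vac_right nprod_zero_right)
  also have "\<dots> = nprod V l a (D b) + sc (- of_int l) (nprod V (l - 1) a b)"
    by (simp add: numeral_2_eq_2 deriv_op_def creation)
  finally show ?thesis by (simp add: deriv_nprod)
qed

lemma deriv_prod: "D (nprod V l a b) = nprod V l (D a) b + nprod V l a (D b)"
proof -
  obtain a0 a1 where a: "a0 \<in> hom" "a1 \<in> hom" "a = a0 + a1" by (rule hom_decomp)
  obtain b0 b1 where b: "b0 \<in> hom" "b1 \<in> hom" "b = b0 + b1" by (rule hom_decomp)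
  show ?thesis
    unfolding a(3) b(3)
    by (simp add: lin_add[OF lin_D] nprod_add_left nprod_add_right deriv_prod_hom a b del: Un_iff)
qed

lemma nprod_deriv_pow:
  "nprod V (-1 - int i) a b = sc (1 / fact i) (nprod V (-1) ((D ^^ i) a) b)"
proof (induction i arbitrary: a)
  case (Suc i)
  have "nprod V (-1 - int (Suc i)) a b = sc (1 / of_nat (Suc i)) (nprod V (-1 - int i) (D a) b)"
  proof -
    have "-1 - int (Suc i) = -1 - int i - 1" by simp
    moreover have "of_int (- (-1 - int i)) = (of_nat (Suc i) :: complex)" by simp
    moreover have "(of_nat (Suc i) :: complex) \<noteq> 0" by (rule of_nat_neq_0)
    ultimately show ?thesis by (simp only: deriv_nprod of_int_minus[symmetric] scale_scale) simp
  qed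
  also have "\<dots> = sc (1 / fact (Suc i)) (nprod V (-1) ((D ^^ Suc i) a) b)"
    by (simp add: Suc.IH funpow_swap1)
  finally show ?case .
qed simp

end

section \<open>Fock spaces of anticommuting operators\<close>

text \<open>Only spanning by the creation words is postulated. Their linear independence, up to
  order and repetition, follows from the relations and \<open>vac_nonzero\<close>.\<close>

locale fock = complex_space scale
  for scale :: "complex \<Rightarrow> 'b::ab_group_add \<Rightarrow> 'b" +
  fixes I :: "'i::linorder set" and cr an :: "'i \<Rightarrow> 'b \<Rightarrow> 'b" and vac :: 'b
  assumes lin_cr: "a \<in> I \<Longrightarrow> lin (cr a)"
    and lin_an: "a \<in> I \<Longrightarrow> lin (an a)"
    and cr_cr: "a \<in> I \<Longrightarrow> b \<in> I \<Longrightarrow> cr a (cr b v) = - cr b (cr a v)"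
    and an_an: "a \<in> I \<Longrightarrow> b \<in> I \<Longrightarrow> an a (an b v) = - an b (an a v)"
    and an_cr: "a \<in> I \<Longrightarrow> b \<in> I \<Longrightarrow> an a (cr b v) = (if a = b then v else 0) - cr b (an a v)"
    and an_vac: "a \<in> I \<Longrightarrow> an a vac = 0"
    and vac_nonzero: "vac \<noteq> 0"
    and words_span: "span {foldr cr xs vac | xs. set xs \<subseteq> I} = UNIV"
begin

lemma self_neg_zero: "x = - x \<Longrightarrow> x = (0::'b)"
proof -
  assume "x = - x"
  then have "scale 2 x = 0"
    using scale_left_distrib[of 1 1 x] by (metis add.right_inverse one_add_one scale_one)
  then show "x = 0" by simp
qed

lemma cr_self: "a \<in> I \<Longrightarrow> cr a (cr a v) = 0"
  using cr_cr self_neg_zero by blast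

lemma an_self: "a \<in> I \<Longrightarrow> an a (an a v) = 0"
  using an_an self_neg_zero by blast

lemma fock_induct [case_names vac add scale cr]:
  assumes "P vac" and "\<And>x y. P x \<Longrightarrow> P y \<Longrightarrow> P (x + y)" and "\<And>c x. P x \<Longrightarrow> P (scale c x)"
    and "\<And>a x. a \<in> I \<Longrightarrow> P x \<Longrightarrow> P (cr a x)"
  shows "P v"
proof -
  have w: "P (foldr cr xs vac)" if "set xs \<subseteq> I" for xs
    using that by (induction xs) (auto intro: assms)
  have "v \<in> span {foldr cr xs vac | xs. set xs \<subseteq> I}" using words_span by simp
  then show ?thesis
  proof (induction v rule: span_induct_alt)
    case base
    then show ?case using assms(3)[OF assms(1), of 0] by simp
  next
    case (step c x y)
    then show ?case using w assms by blast
  qed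
qed

text \<open>\<open>an a (cr a v)\<close> removes from \<open>v\<close> the part that contains the
  mode \<open>a\<close>, so the product projects to the states in which no mode of \<open>ys\<close>
  is occupied.\<close>

definition proj :: "'i list \<Rightarrow> 'b \<Rightarrow> 'b" where
  "proj ys v = foldr (\<lambda>a v. an a (cr a v)) ys v"

lemma lin_proj: "set ys \<subseteq> I \<Longrightarrow> lin (proj ys)"
proof (induction ys)
  case Nil
  then show ?case by (simp add: proj_def[abs_def] lin_id)
next
  case (Cons y ys)
  then have "lin (\<lambda>v. an y (cr y (proj ys v)))"
    by (intro lin_comp[OF lin_an] lin_comp[OF lin_cr]) auto
  then show ?case by (simp add: proj_def[abs_def])
qed

lemma proj_vac: "set ys \<subseteq> I \<Longrightarrow> proj ys vac = vac"
  by (induction ys) (auto simp: proj_def an_cr an_vac lin_0[OF lin_cr])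

lemma proj_cr:
  assumes "set ys \<subseteq> I" "b \<in> I"
  shows "proj ys (cr b v) = (if b \<in> set ys then 0 else cr b (proj ys v))"
  using assms(1)
proof (induction ys)
  case (Cons y ys)
  then have y: "y \<in> I" by simp
  have "an y (cr y (cr b z)) = cr b (an y (cr y z))" if "y \<noteq> b" for z
    using that y assms by (simp add: cr_cr[of y b] an_cr lin_neg[OF lin_an])
  with Cons y assms show ?case
    by (auto simp: proj_def cr_self lin_0[OF lin_an] lin_0[OF lin_cr])
qed (simp add: proj_def)

text \<open>Projecting away the leading letters of all words kills a combination of nonempty words,
  whereas the projections fix the vacuum.\<close>

lemma vac_not_in_span: "vac \<notin> span {foldr cr xs vac | xs. set xs \<subseteq> I \<and> xs \<noteq> []}"
proof
  \<comment> \<open>Quantifying over all larger \<open>zs\<close> makes the property stable under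
    adding further words.\<close>
  let ?P = "\<lambda>v. \<exists>ys. set ys \<subseteq> I \<and> (\<forall>zs. set ys \<subseteq> set zs \<longrightarrow> set zs \<subseteq> I \<longrightarrow> proj zs v = 0)"
  assume "vac \<in> span {foldr cr xs vac | xs. set xs \<subseteq> I \<and> xs \<noteq> []}"
  then have "?P vac"
  proof (induction vac rule: span_induct_alt)
    case base
    show ?case by (intro exI[of _ "[]"]) (auto simp: lin_0[OF lin_proj])
  next
    case (step c x y)
    then obtain xs where xs: "x = foldr cr xs vac" "set xs \<subseteq> I" "xs \<noteq> []" by blast
    then obtain b xs' where b: "xs = b # xs'" by (cases xs) auto
    from step obtain ys where ys: "set ys \<subseteq> I"
      "\<forall>zs. set ys \<subseteq> set zs \<longrightarrow> set zs \<subseteq> I \<longrightarrow> proj zs y = 0" by blast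
    have "proj zs (scale c x + y) = 0" if "set (b # ys) \<subseteq> set zs" "set zs \<subseteq> I" for zs
    proof -
      have "proj zs x = 0" using xs b that by (simp add: proj_cr)
      then show ?thesis using that ys by (simp add: lin_add[OF lin_proj] lin_scale[OF lin_proj])
    qed
    then show ?case using ys xs b by (intro exI[of _ "b # ys"]) auto
  qed
  then obtain ys where "set ys \<subseteq> I" "proj ys vac = 0" by blast
  then show False using proj_vac vac_nonzero by simp
qed

text \<open>The vacuum expectation. A basis of the span of the nonempty words stays independent when
  the vacuum is added, so the values 0 and 1 can be prescribed.\<close>

lemma ex_vacuum_functional:
  "\<exists>g :: 'b \<Rightarrow> complex. (\<forall>x y. g (x + y) = g x + g y) \<and> (\<forall>c x. g (scale c x) = c * g x) \<and>
     g vac = 1 \<and> (\<forall>a\<in>I. \<forall>v. g (cr a v) = 0)"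
proof -
  interpret p: vector_space_pair scale "(*) :: complex \<Rightarrow> complex \<Rightarrow> complex"
    by unfold_locales (auto simp: algebra_simps)
  let ?W = "{foldr cr xs vac | xs. set xs \<subseteq> I \<and> xs \<noteq> []}"
  obtain B where B: "B \<subseteq> span ?W" "independent B" "span ?W \<subseteq> span B"
    using maximal_independent_subset by blast
  have "span B \<subseteq> span ?W" using B span_minimal by blast
  then have "independent (insert vac B)"
    using B vac_not_in_span by (intro independent_insertI) auto
  then obtain g where g: "Vector_Spaces.linear scale (*) g"
    "\<forall>x\<in>insert vac B. g x = (if x = vac then 1 else 0)"
    using p.linear_independent_extend[of "insert vac B" "\<lambda>x. if x = vac then 1 else 0"] by blast
  have add: "g (x + y) = g x + g y" and sca: "g (scale c x) = c * g x" for x y c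
    using g(1) by (auto simp: Vector_Spaces.linear_iff)
  have vB: "vac \<notin> span B" using vac_not_in_span \<open>span B \<subseteq> span ?W\<close> by blast
  have zero: "g x = 0" if "x \<in> span B" for x
    using that
  proof (induction x rule: span_induct_alt)
    case base
    then show ?case using sca[of 0 0] by simp
  next
    case (step c x y)
    then have "x \<noteq> vac" using vB span_base by blast
    then show ?case using step g(2) by (simp add: add sca)
  qed
  have "cr a v \<in> span ?W" if "a \<in> I" for a v
  proof (rule lin_span_subset[OF lin_cr[OF that]])
    show "v \<in> span {foldr cr xs vac | xs. set xs \<subseteq> I}" using words_span by simp
  next
    fix x assume "x \<in> {foldr cr xs vac | xs. set xs \<subseteq> I}"
    then obtain xs where "x = foldr cr xs vac" "set xs \<subseteq> I" by blast
    then have "cr a x = foldr cr (a # xs) vac" "set (a # xs) \<subseteq> I" using that by auto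
    then show "cr a x \<in> span ?W" by (intro span_base) blast
  qed simp
  then have "g (cr a v) = 0" if "a \<in> I" for a v using that zero B(3) by blast
  then show ?thesis using add sca g(2) by (intro exI[of _ g]) auto
qed

definition eps :: "'b \<Rightarrow> complex" where
  "eps = (SOME g. (\<forall>x y. g (x + y) = g x + g y) \<and> (\<forall>c x. g (scale c x) = c * g x) \<and>
     g vac = 1 \<and> (\<forall>a\<in>I. \<forall>v. g (cr a v) = 0))"

lemma eps_add: "eps (x + y) = eps x + eps y"
  and eps_scale: "eps (scale c x) = c * eps x"
  and eps_vac: "eps vac = 1"
  and eps_cr: "a \<in> I \<Longrightarrow> eps (cr a v) = 0"
  using someI_ex[OF ex_vacuum_functional] unfolding eps_def[symmetric] by blast+

lemma eps_0: "eps 0 = 0"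
  using eps_scale[of 0 0] by simp

lemma eps_neg: "eps (- x) = - eps x"
  using eps_scale[of "-1" x] by simp

lemma eps_diff: "eps (x - y) = eps x - eps y"
  using eps_add[of x "- y"] eps_neg by simp

lemma eps_sum: "eps (sum f A) = (\<Sum>x\<in>A. eps (f x))"
  by (induction A rule: infinite_finite_induct) (simp_all add: eps_0 eps_add)

lemma lin_fold_an: "set xs \<subseteq> I \<Longrightarrow> lin (fold an xs)"
proof (induction xs)
  case (Cons z zs)
  then show ?case using lin_comp[of "fold an zs" "an z"] lin_an by (simp add: o_def)
qed (simp add: lin_id id_def)

lemma fold_an_insort:
  assumes "sorted_wrt (<) xs" "a \<notin> set xs" "set xs \<subseteq> I" "a \<in> I"
  shows "fold an (insort a xs) v = scale ((-1) ^ card {x \<in> set xs. x < a}) (fold an xs (an a v))"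
  using assms
proof (induction xs arbitrary: v)
  case (Cons x xs)
  show ?case
  proof (cases "a \<le> x")
    case True
    then have "{y \<in> set (x # xs). y < a} = {}" using Cons.prems by auto
    then show ?thesis using True by (simp only: card.empty) simp
  next
    case False
    have e: "{y \<in> set (x # xs). y < a} = insert x {y \<in> set xs. y < a}" using False by auto
    have "x \<notin> set xs" using Cons.prems by auto
    moreover have "fold an (insort a (x # xs)) v
       = scale ((-1) ^ card {y \<in> set xs. y < a}) (fold an xs (- an x (an a v)))"
      using False Cons by (simp add: an_an[of a x])
    ultimately show ?thesis unfolding e using Cons.prems
      by (simp add: lin_neg[OF lin_fold_an])
  qed
qed simp

text \<open>Formulated for arbitrary anticommuting operators \<open>C\<close>, because it is applied
  to the operators that replace the creation operators in \<open>subst_cr\<close>.\<close>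

lemma foldr_insort:
  assumes lin: "\<And>b. b \<in> I \<Longrightarrow> lin (C b)"
    and anti: "\<And>b c v. b \<in> I \<Longrightarrow> c \<in> I \<Longrightarrow> C b (C c v) = - C c (C b v)"
    and "sorted_wrt (<) xs" "a \<notin> set xs" "set xs \<subseteq> I" "a \<in> I"
  shows "foldr C (insort a xs) v = scale ((-1) ^ card {x \<in> set xs. x < a}) (C a (foldr C xs v))"
  using assms(3-)
proof (induction xs)
  case (Cons x xs)
  show ?case
  proof (cases "a \<le> x")
    case True
    then have "{y \<in> set (x # xs). y < a} = {}" using Cons.prems by auto
    then show ?thesis using True by (simp only: card.empty) simp
  next
    case False
    have e: "{y \<in> set (x # xs). y < a} = insert x {y \<in> set xs. y < a}" using False by auto
    have "x \<notin> set xs" using Cons.prems by auto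
    then show ?thesis unfolding e using False Cons
      by (simp add: anti[of a x] lin_scale[OF lin])
  qed
qed simp

section \<open>Coordinates in the basis of ordered creation monomials\<close>

definition Fin :: "'i set set" where "Fin = {S. finite S \<and> S \<subseteq> I}"

lemma FinD: "S \<in> Fin \<Longrightarrow> finite S" "S \<in> Fin \<Longrightarrow> x \<in> S \<Longrightarrow> x \<in> I"
  by (auto simp: Fin_def)

lemma Fin_insert: "S \<in> Fin \<Longrightarrow> a \<in> I \<Longrightarrow> insert a S \<in> Fin"
  and Fin_remove: "S \<in> Fin \<Longrightarrow> S - {a} \<in> Fin"
  and Fin_empty: "{} \<in> Fin"
  by (auto simp: Fin_def)

definition sgn_ins :: "'i \<Rightarrow> 'i set \<Rightarrow> complex" where
  "sgn_ins a S = (-1) ^ card {x \<in> S. x < a}"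

lemma sgn_ins_sq: "sgn_ins a S * sgn_ins a S = 1"
  by (simp add: sgn_ins_def flip: power_mult_distrib)

lemma sgn_ins_cnj: "cnj (sgn_ins a S) = sgn_ins a S"
  by (simp add: sgn_ins_def)

lemma sgn_ins_remove: "sgn_ins a (S - {a}) = sgn_ins a S"
  and sgn_ins_insert: "sgn_ins a (insert a S) = sgn_ins a S"
  by (auto simp: sgn_ins_def intro!: arg_cong[where f = "\<lambda>A. (-1) ^ card A"])

text \<open>The smallest mode is annihilated first; this matches \<open>word cr S\<close>, in which
  it is created last.\<close>

definition coord :: "'i set \<Rightarrow> 'b \<Rightarrow> complex" where
  "coord S v = eps (fold an (sorted_list_of_set S) v)"

lemma lin_fold_Fin: "S \<in> Fin \<Longrightarrow> lin (fold an (sorted_list_of_set S))"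
  by (rule lin_fold_an) (auto simp: Fin_def)

lemma coord_add: "S \<in> Fin \<Longrightarrow> coord S (x + y) = coord S x + coord S y"
  and coord_scale: "S \<in> Fin \<Longrightarrow> coord S (scale c x) = c * coord S x"
  by (simp_all add: coord_def lin_add[OF lin_fold_Fin] lin_scale[OF lin_fold_Fin] eps_add eps_scale)

lemma eps_fold_an_cr:
  assumes "set xs \<subseteq> I" "a \<in> I" "a \<notin> set xs"
  shows "eps (fold an xs (cr a z)) = 0"
  using assms
proof (induction xs arbitrary: z)
  case (Cons x xs)
  then have "x \<noteq> a" by auto
  with Cons show ?case by (simp add: an_cr lin_neg[OF lin_fold_an] eps_neg)
qed (simp add: eps_cr)

lemma fold_an_insert:
  assumes "S \<in> Fin" "a \<in> I" "a \<notin> S"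
  shows "fold an (sorted_list_of_set (insert a S)) v
       = scale (sgn_ins a S) (fold an (sorted_list_of_set S) (an a v))"
  using assms fold_an_insort[of "sorted_list_of_set S" a v]
  by (simp add: Fin_def sgn_ins_def)

lemma coord_an:
  assumes "S \<in> Fin" "a \<in> I"
  shows "coord S (an a v) = (if a \<in> S then 0 else sgn_ins a S * coord (insert a S) v)"
proof (cases "a \<in> S")
  case True
  then have "coord S (an a v) = coord (insert a (S - {a})) (an a v)" by (simp add: insert_absorb)
  also have "\<dots> = 0"
    unfolding coord_def using assms
    by (subst fold_an_insert) (auto simp: Fin_remove an_self lin_0[OF lin_fold_Fin] eps_0)
  finally show ?thesis using True by simp
next
  case False
  then show ?thesis using assms
    by (simp add: coord_def fold_an_insert eps_scale sgn_ins_sq mult.assoc[symmetric])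
qed

lemma coord_cr:
  assumes "S \<in> Fin" "a \<in> I"
  shows "coord S (cr a v) = (if a \<in> S then sgn_ins a S * coord (S - {a}) v else 0)"
proof (cases "a \<in> S")
  case True
  let ?F = "fold an (sorted_list_of_set (S - {a}))"
  have S: "S - {a} \<in> Fin" using assms Fin_remove by blast
  have "coord S (cr a v) = coord (insert a (S - {a})) (cr a v)" using True by (simp add: insert_absorb)
  also have "\<dots> = sgn_ins a S * eps (?F (v - cr a (an a v)))"
    unfolding coord_def using assms S
    by (subst fold_an_insert) (auto simp: an_cr eps_scale sgn_ins_remove)
  also have "eps (?F (v - cr a (an a v))) = eps (?F v) - eps (?F (cr a (an a v)))"
    by (simp add: lin_diff[OF lin_fold_Fin[OF S]] eps_diff)
  also have "eps (?F (cr a (an a v))) = 0"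
    using S assms by (intro eps_fold_an_cr) (auto simp: Fin_def)
  finally show ?thesis using True by (simp add: coord_def)
next
  case False
  then show ?thesis using assms
    by (simp add: coord_def) (intro eps_fold_an_cr, auto simp: Fin_def)
qed

lemma coord_vac: "S \<in> Fin \<Longrightarrow> coord S vac = (if S = {} then 1 else 0)"
proof (cases "S = {}")
  case False
  assume S: "S \<in> Fin"
  from False obtain a where a: "a \<in> S" by blast
  then have "coord S vac = coord (insert a (S - {a})) vac" by (simp add: insert_absorb)
  then show ?thesis unfolding coord_def using S a False FinD[OF S]
    by (subst (asm) fold_an_insert) (auto simp: Fin_remove an_vac lin_0[OF lin_fold_Fin] eps_0 eps_scale)
qed (simp add: coord_def eps_vac)

definition supp :: "'b \<Rightarrow> 'i set set" where
  "supp v = {S \<in> Fin. coord S v \<noteq> 0}"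

lemma finite_supp: "finite (supp v)"
proof (induction v rule: fock_induct)
  case vac
  then show ?case
    by (rule finite_subset[of _ "{{}}"]) (auto simp: supp_def coord_vac split: if_splits)
next
  case (add x y)
  then show ?case
    by (rule finite_subset[of _ "supp x \<union> supp y", rotated, OF finite_UnI]) (auto simp: supp_def coord_add)
next
  case (scale c x)
  then show ?case
    by (rule finite_subset[rotated]) (auto simp: supp_def coord_scale)
next
  case (cr a x)
  have "supp (cr a x) \<subseteq> insert a ` supp x"
  proof
    fix S assume "S \<in> supp (cr a x)"
    then have "S \<in> Fin" "a \<in> S" "coord (S - {a}) x \<noteq> 0"
      using cr by (auto simp: supp_def coord_cr split: if_splits)
    then show "S \<in> insert a ` supp x"
      by (intro image_eqI[of _ _ "S - {a}"]) (auto simp: supp_def Fin_remove)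
  qed
  then show ?case using cr finite_subset by blast
qed

lemma supp_subset_Fin: "supp v \<subseteq> Fin"
  by (auto simp: supp_def)

definition word :: "('i \<Rightarrow> 'b \<Rightarrow> 'b) \<Rightarrow> 'i set \<Rightarrow> 'b" where
  "word C S = foldr C (sorted_list_of_set S) vac"

text \<open>For anticommuting linear \<open>C\<close> this is the map that fixes the vacuum and
  turns each creation operator into \<open>C\<close> (\<open>subst_cr_cr\<close>); it later yields
  the realization \<open>iota\<close>.\<close>

definition subst_cr :: "('i \<Rightarrow> 'b \<Rightarrow> 'b) \<Rightarrow> 'b \<Rightarrow> 'b" where
  "subst_cr C v = (\<Sum>S\<in>supp v. scale (coord S v) (word C S))"

lemma subst_cr_superset:
  assumes "finite F" "F \<subseteq> Fin" "supp v \<subseteq> F"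
  shows "subst_cr C v = (\<Sum>S\<in>F. scale (coord S v) (word C S))"
  unfolding subst_cr_def
  by (rule sum.mono_neutral_left) (use assms in \<open>auto simp: supp_def\<close>)

lemma lin_subst_cr: "lin (subst_cr C)"
proof (rule linI)
  fix x y
  let ?F = "supp x \<union> supp y"
  have F: "finite ?F" "?F \<subseteq> Fin" "supp (x + y) \<subseteq> ?F"
    by (auto simp: finite_supp) (auto simp: supp_def coord_add)
  show "subst_cr C (x + y) = subst_cr C x + subst_cr C y"
  proof -
    have "subst_cr C (x + y) = (\<Sum>S\<in>?F. scale (coord S x) (word C S) + scale (coord S y) (word C S))"
      unfolding subst_cr_superset[OF F]
      by (rule sum.cong[OF refl]) (use F(2) in \<open>auto simp: coord_add scale_left_distrib\<close>)
    also have "\<dots> = subst_cr C x + subst_cr C y"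
      using F(1,2) by (simp add: sum.distrib subst_cr_superset[of ?F])
    finally show ?thesis .
  qed
next
  fix c x
  have F: "supp (scale c x) \<subseteq> supp x"
    by (auto simp: supp_def coord_scale)
  show "subst_cr C (scale c x) = scale c (subst_cr C x)"
    using F supp_subset_Fin[of x] finite_supp[of x]
    by (simp add: subst_cr_superset[of "supp x"] coord_scale scale_sum_right subset_iff)
qed

lemma subst_cr_vac: "subst_cr C vac = vac"
proof -
  have "subst_cr C vac = (\<Sum>S\<in>{{}}. scale (coord S vac) (word C S))"
    by (rule subst_cr_superset) (auto simp: Fin_empty supp_def coord_vac split: if_splits)
  then show ?thesis by (simp add: coord_vac Fin_empty word_def)
qed

text \<open>\<open>cr a\<close> kills the monomials of \<open>v\<close> that contain
  \<open>a\<close> and sends the others bijectively to monomials via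
  \<open>insert a\<close>.\<close>

lemma sum_supp_cr:
  assumes "a \<in> I" and "\<And>S. S \<in> Fin \<Longrightarrow> coord S (cr a v) = 0 \<Longrightarrow> f S = (0 :: 'z::comm_monoid_add)"
  shows "sum f (supp (cr a v)) = (\<Sum>T\<in>{T \<in> supp v. a \<notin> T}. f (insert a T))"
proof -
  let ?T = "{T \<in> supp v. a \<notin> T}"
  have "sum f (supp (cr a v)) = sum f (insert a ` ?T)"
  proof (rule sum.mono_neutral_left)
    show "finite (insert a ` ?T)" using finite_supp by simp
    show "supp (cr a v) \<subseteq> insert a ` ?T"
    proof
      fix S assume "S \<in> supp (cr a v)"
      then have "S \<in> Fin" "a \<in> S" "coord (S - {a}) v \<noteq> 0"
        using assms(1) by (auto simp: supp_def coord_cr split: if_splits)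
      then show "S \<in> insert a ` ?T"
        by (intro image_eqI[of _ _ "S - {a}"]) (auto simp: supp_def Fin_remove)
    qed
    show "\<forall>i\<in>insert a ` ?T - supp (cr a v). f i = 0"
      using assms supp_subset_Fin by (auto simp: supp_def Fin_insert)
  qed
  also have "\<dots> = (\<Sum>T\<in>?T. f (insert a T))"
    by (rule sum.reindex_cong[of "insert a"]) (auto simp: inj_on_def)
  finally show ?thesis .
qed

lemma subst_cr_cr:
  assumes lin: "\<And>b. b \<in> I \<Longrightarrow> lin (C b)"
    and anti: "\<And>b c v. b \<in> I \<Longrightarrow> c \<in> I \<Longrightarrow> C b (C c v) = - C c (C b v)"
    and a: "a \<in> I"
  shows "subst_cr C (cr a v) = C a (subst_cr C v)"
proof -
  have self: "C a (C a x) = 0" for x using anti[OF a a] self_neg_zero by blast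
  have ins: "word C (insert a T) = scale (sgn_ins a T) (C a (word C T))" if "T \<in> Fin" "a \<notin> T" for T
    using that a foldr_insort[OF lin anti, where xs = "sorted_list_of_set T" and a = a and v = vac]
    by (simp add: word_def Fin_def sgn_ins_def)
  have "subst_cr C (cr a v) = (\<Sum>T\<in>{T \<in> supp v. a \<notin> T}.
      scale (coord (insert a T) (cr a v)) (word C (insert a T)))"
    unfolding subst_cr_def by (rule sum_supp_cr) (auto simp: a)
  also have "\<dots> = (\<Sum>T\<in>{T \<in> supp v. a \<notin> T}. scale (coord T v) (C a (word C T)))"
  proof (rule sum.cong[OF refl])
    fix T assume "T \<in> {T \<in> supp v. a \<notin> T}"
    then have T: "T \<in> Fin" "a \<notin> T" by (auto simp: supp_def)
    then have "coord (insert a T) (cr a v) = sgn_ins a T * coord T v"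
      by (simp add: coord_cr Fin_insert a sgn_ins_insert)
    moreover have "sgn_ins a T * coord T v * sgn_ins a T = coord T v"
      using sgn_ins_sq[of a T] by (simp add: mult.commute mult.left_commute)
    ultimately show "scale (coord (insert a T) (cr a v)) (word C (insert a T)) = scale (coord T v) (C a (word C T))"
      using T by (simp add: ins)
  qed
  also have "\<dots> = (\<Sum>T\<in>supp v. scale (coord T v) (C a (word C T)))"
  proof (rule sum.mono_neutral_left)
    show "\<forall>T\<in>supp v - {T \<in> supp v. a \<notin> T}. scale (coord T v) (C a (word C T)) = 0"
    proof
      fix T assume "T \<in> supp v - {T \<in> supp v. a \<notin> T}"
      then have T: "T \<in> Fin" "a \<in> T" by (auto simp: supp_def)
      then have "word C T = scale (sgn_ins a T) (C a (word C (T - {a})))"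
        using ins[of "T - {a}"] by (simp add: Fin_remove insert_absorb sgn_ins_remove)
      then show "scale (coord T v) (C a (word C T)) = 0"
        by (simp add: self lin_scale[OF lin[OF a]])
    qed
  qed (auto simp: finite_supp)
  also have "\<dots> = C a (subst_cr C v)"
    by (simp add: subst_cr_def lin_sum[OF lin[OF a]] lin_scale[OF lin[OF a]])
  finally show ?thesis .
qed

text \<open>Substituting the creation operators for themselves fixes the vacuum and commutes with
  all of them, hence is the identity.\<close>

lemma expansion: "v = (\<Sum>S\<in>supp v. scale (coord S v) (word cr S))"
proof -
  have "subst_cr cr v = v"
  proof (induction v rule: fock_induct)
    case (cr a x)
    then show ?case by (subst subst_cr_cr) (auto simp: lin_cr intro: cr_cr)
  qed (simp_all add: subst_cr_vac lin_add[OF lin_subst_cr] lin_scale[OF lin_subst_cr])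
  then show ?thesis by (simp add: subst_cr_def)
qed

lemma coord_eq_0D: "(\<And>S. S \<in> Fin \<Longrightarrow> coord S v = 0) \<Longrightarrow> v = 0"
  using expansion[of v] by (auto simp: supp_def intro: sum.neutral)

text \<open>Every coordinate with nonempty \<open>S\<close> factors through an annihilator, so only
  the coordinate at the vacuum can be nonzero.\<close>

lemma an_all_zero:
  assumes "\<And>a. a \<in> I \<Longrightarrow> an a v = 0"
  shows "v = scale (eps v) vac"
proof -
  have "coord S v = 0" if "S \<in> Fin" "S \<noteq> {}" for S
  proof -
    from that obtain a where a: "a \<in> S" by blast
    then have "coord S v = coord (insert a (S - {a})) v" by (simp add: insert_absorb)
    then show ?thesis unfolding coord_def using that a assms FinD[OF that(1)]
      by (subst (asm) fold_an_insert) (auto simp: Fin_remove an_vac lin_0[OF lin_fold_Fin] eps_0 eps_scale)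
  qed
  then have "supp v \<subseteq> {{}}" by (auto simp: supp_def)
  then have "(\<Sum>S\<in>supp v. scale (coord S v) (word cr S)) = (\<Sum>S\<in>{{}}. scale (coord S v) (word cr S))"
    by (intro sum.mono_neutral_left) (auto simp: supp_def Fin_empty)
  also have "\<dots> = scale (eps v) vac" by (simp add: coord_def word_def)
  finally show ?thesis using expansion[of v] by simp
qed

subsection \<open>The inner product making the monomials orthonormal\<close>

definition ip :: "'b \<Rightarrow> 'b \<Rightarrow> complex" where
  "ip x y = (\<Sum>S\<in>supp x. coord S x * cnj (coord S y))"

lemma ip_superset:
  assumes "finite F" "F \<subseteq> Fin" "supp x \<subseteq> F \<or> supp y \<subseteq> F"
  shows "ip x y = (\<Sum>S\<in>F. coord S x * cnj (coord S y))"
proof -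
  have "finite (supp x \<union> F)" using finite_supp assms by blast
  then have "ip x y = (\<Sum>S\<in>supp x \<union> F. coord S x * cnj (coord S y))"
    unfolding ip_def by (rule sum.mono_neutral_left)
      (use assms supp_subset_Fin[of x] in \<open>auto simp: supp_def\<close>)
  also have "\<dots> = (\<Sum>S\<in>F. coord S x * cnj (coord S y))"
    by (rule sum.mono_neutral_right)
      (use \<open>finite (supp x \<union> F)\<close> assms supp_subset_Fin[of x] in \<open>auto simp: supp_def\<close>)
  finally show ?thesis .
qed

lemma ip_cnj: "ip y x = cnj (ip x y)"
proof -
  have "ip y x = (\<Sum>S\<in>supp x. coord S y * cnj (coord S x))"
    by (rule ip_superset) (simp_all add: finite_supp supp_subset_Fin)
  then show ?thesis by (simp add: ip_def mult.commute)
qed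

lemma ip_add_left: "ip (x + y) z = ip x z + ip y z"
  and ip_scale_left: "ip (scale c x) z = c * ip x z"
proof -
  have z: "ip w z = (\<Sum>S\<in>supp z. coord S w * cnj (coord S z))" for w
    by (rule ip_superset) (simp_all add: finite_supp supp_subset_Fin)
  have "S \<in> supp z \<Longrightarrow> S \<in> Fin" for S using supp_subset_Fin by blast
  then show "ip (x + y) z = ip x z + ip y z" "ip (scale c x) z = c * ip x z"
    unfolding z by (simp_all add: coord_add coord_scale algebra_simps sum.distrib sum_distrib_left)
qed

lemma ip_0_left: "ip 0 y = 0"
  using ip_scale_left[of 0 0 y] by simp

lemma ip_0_right: "ip y 0 = 0"
  using ip_cnj[of y 0] by (simp add: ip_0_left)

lemma ip_add_right: "ip z (x + y) = ip z x + ip z y"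
  by (metis ip_add_left ip_cnj complex_cnj_add)

lemma ip_scale_right: "ip z (scale c x) = cnj c * ip z x"
  by (metis ip_scale_left ip_cnj complex_cnj_mult)

lemma ip_neg_left: "ip (- x) y = - ip x y"
  using ip_scale_left[of "-1" x y] by simp

lemma ip_neg_right: "ip y (- x) = - ip y x"
  using ip_scale_right[of y "-1" x] by simp

lemma ip_diff_left: "ip (x - y) z = ip x z - ip y z"
  using ip_add_left[of x "- y" z] by (simp add: ip_neg_left)

lemma ip_diff_right: "ip z (x - y) = ip z x - ip z y"
  using ip_add_right[of z x "- y"] by (simp add: ip_neg_right)

lemma ip_sum_left: "ip (sum f A) y = (\<Sum>i\<in>A. ip (f i) y)"
  by (induction A rule: infinite_finite_induct) (simp_all add: ip_0_left ip_add_left)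

lemma ip_sum_right: "ip y (sum f A) = (\<Sum>i\<in>A. ip y (f i))"
  by (induction A rule: infinite_finite_induct) (simp_all add: ip_0_right ip_add_right)

lemma ip_self: "ip x x = of_real (\<Sum>S\<in>supp x. (cmod (coord S x))\<^sup>2)"
  by (simp add: ip_def complex_norm_square del: of_real_power)

lemma ip_self_nonneg: "0 \<le> Re (ip x x)"
  unfolding ip_self by (simp add: sum_nonneg)

lemma ip_self_zero: "Re (ip x x) = 0 \<Longrightarrow> x = 0"
proof -
  assume "Re (ip x x) = 0"
  then have "\<forall>S\<in>supp x. coord S x = 0"
    unfolding ip_self Re_complex_of_real by (subst (asm) sum_nonneg_eq_0_iff) (auto simp: finite_supp)
  then show "x = 0" by (intro coord_eq_0D) (auto simp: supp_def)
qed

text \<open>Creating and annihilating the mode \<open>a\<close> involve the same real sign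
  \<open>sgn_ins\<close>, which makes the two operators adjoint.\<close>

lemma ip_cr: "a \<in> I \<Longrightarrow> ip (cr a x) y = ip x (an a y)"
proof -
  assume a: "a \<in> I"
  have "ip (cr a x) y = (\<Sum>T\<in>{T \<in> supp x. a \<notin> T}. coord (insert a T) (cr a x) * cnj (coord (insert a T) y))"
    unfolding ip_def by (rule sum_supp_cr) (auto simp: a)
  also have "\<dots> = (\<Sum>T\<in>{T \<in> supp x. a \<notin> T}. coord T x * cnj (coord T (an a y)))"
  proof (rule sum.cong[OF refl])
    fix T assume "T \<in> {T \<in> supp x. a \<notin> T}"
    then have T: "T \<in> Fin" "a \<notin> T" by (auto simp: supp_def)
    then show "coord (insert a T) (cr a x) * cnj (coord (insert a T) y) = coord T x * cnj (coord T (an a y))"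
      by (simp add: coord_cr coord_an a Fin_insert sgn_ins_insert sgn_ins_cnj)
  qed
  also have "\<dots> = (\<Sum>T\<in>supp x. coord T x * cnj (coord T (an a y)))"
    by (rule sum.mono_neutral_left) (auto simp: finite_supp, auto simp: supp_def coord_an a)
  finally show ?thesis by (simp add: ip_def)
qed

lemma ip_an: "a \<in> I \<Longrightarrow> ip (an a x) y = ip x (cr a y)"
  by (metis ip_cnj ip_cr)

lemma ip_span_zero:
  assumes "\<And>b. b \<in> B \<Longrightarrow> ip x b = 0" and "y \<in> span B"
  shows "ip x y = 0"
  using assms(2)
  by (induction y rule: span_induct_alt) (simp_all add: ip_0_right ip_add_right ip_scale_right assms)

text \<open>Gram-Schmidt, one vector at a time; if the new vector has orthogonal part of norm zero,
  definiteness shows that it was already in the span.\<close>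

lemma orthogonal_projection:
  assumes "finite B"
  shows "\<exists>y\<in>span B. \<forall>b\<in>B. ip (x - y) b = 0"
  using assms
proof (induction B arbitrary: x rule: finite_induct)
  case empty
  show ?case by (intro bexI[of _ 0]) (auto simp: span_zero)
next
  case (insert b B)
  obtain p where p: "p \<in> span B" "\<forall>c\<in>B. ip (b - p) c = 0" using insert.IH by blast
  obtain y where y: "y \<in> span B" "\<forall>c\<in>B. ip (x - y) c = 0" using insert.IH by blast
  have mono: "span B \<subseteq> span (insert b B)" by (rule span_mono) auto
  let ?b = "b - p"
  have bb: "ip u b = ip u ?b + ip u p" for u by (simp add: ip_diff_right)
  show ?case
  proof (cases "ip ?b ?b = 0")
    case True
    then have "b = p" using ip_self_zero[of ?b] by simp
    then have "ip (x - y) b = 0" using ip_span_zero[of B "x - y" p] p y by blast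
    then show ?thesis using y mono by auto
  next
    case False
    define c where "c = ip (x - y) ?b / ip ?b ?b"
    define z where "z = y + scale c ?b"
    have "z \<in> span (insert b B)" unfolding z_def using y p mono
      by (intro span_add span_scale span_diff) (auto intro: span_base)
    moreover have B0: "ip (x - z) d = 0" if "d \<in> B" for d
      using that p y by (simp add: z_def ip_diff_left ip_add_left ip_scale_left)
    moreover have "ip (x - z) ?b = 0" using False
      by (simp add: z_def c_def ip_diff_left[of x] ip_diff_left[of x y] ip_add_left ip_scale_left)
    moreover have "ip (x - z) p = 0" using ip_span_zero[of B "x - z" p] B0 p by blast
    ultimately show ?thesis using bb[of "x - z"] by (intro bexI[of _ z]) auto
  qed
qed

end

section \<open>Modes of the symplectic fermions\<close>

context complex_space
begin

text \<open>Normally ordered quadratic operators: it suffices that the right factors are locally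
  finite.\<close>

definition bil :: "('i \<Rightarrow> 'b \<Rightarrow> 'b) \<Rightarrow> ('i \<Rightarrow> 'b \<Rightarrow> 'b) \<Rightarrow> 'b \<Rightarrow> 'b" where
  "bil P Q v = Sum_any (\<lambda>i. P i (Q i v))"

lemma bil_finite:
  assumes "\<And>i. lin (P i)" "finite {i. Q i v \<noteq> 0}"
  shows "finite {i. P i (Q i v) \<noteq> 0}"
  by (rule finite_subset[OF _ assms(2)]) (auto simp: lin_0[OF assms(1)])

lemma lin_bil:
  assumes "\<And>i. lin (P i)" "\<And>i. lin (Q i)" "\<And>v. finite {i. Q i v \<noteq> 0}"
  shows "lin (bil P Q)"
  unfolding bil_def[abs_def]
  by (rule lin_Sum_any) (use assms bil_finite[of P Q] in \<open>auto intro: lin_comp\<close>)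

text \<open>The identity \<open>[PQ, R] = P {Q, R} - {P, R} Q\<close> with scalar anticommutators,
  summed over the finite set \<open>A\<close> outside of which the scalars vanish.\<close>

lemma bil_commutator:
  assumes P: "\<And>i. lin (P i)" and fin: "\<And>v. finite {i. Q i v \<noteq> 0}" and R: "lin R"
    and PR: "\<And>i v. P i (R v) = scale (\<alpha> i) v - R (P i v)"
    and QR: "\<And>i v. Q i (R v) = scale (\<beta> i) v - R (Q i v)"
    and A: "finite A" "\<And>i. i \<notin> A \<Longrightarrow> \<alpha> i = 0 \<and> \<beta> i = 0"
  shows "bil P Q (R v) = R (bil P Q v) + (\<Sum>i\<in>A. scale (\<beta> i) (P i v) - scale (\<alpha> i) (Q i v))"
proof -
  let ?S = "{i. Q i v \<noteq> 0} \<union> A"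
  have S: "finite ?S" using fin A by simp
  have tm: "P i (Q i (R v)) = R (P i (Q i v)) + (scale (\<beta> i) (P i v) - scale (\<alpha> i) (Q i v))" for i
    by (simp add: QR PR lin_diff[OF P] lin_scale[OF P])
  have "bil P Q (R v) = (\<Sum>i\<in>?S. P i (Q i (R v)))"
    unfolding bil_def
    by (rule Sum_any.expand_superset[OF S])
      (auto simp: tm A lin_0[OF P] lin_0[OF R] intro: ccontr)
  also have "\<dots> = R (\<Sum>i\<in>?S. P i (Q i v)) + (\<Sum>i\<in>?S. scale (\<beta> i) (P i v) - scale (\<alpha> i) (Q i v))"
    by (simp only: tm sum.distrib lin_sum[OF R])
  also have "(\<Sum>i\<in>?S. P i (Q i v)) = bil P Q v"
    unfolding bil_def
    by (rule Sum_any.expand_superset[OF S, symmetric]) (auto simp: lin_0[OF P])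
  also have "(\<Sum>i\<in>?S. scale (\<beta> i) (P i v) - scale (\<alpha> i) (Q i v))
      = (\<Sum>i\<in>A. scale (\<beta> i) (P i v) - scale (\<alpha> i) (Q i v))"
    by (rule sum.mono_neutral_right[OF S]) (auto simp: A)
  finally show ?thesis .
qed

end

context symplectic_fermion_algebra
begin

definition gen :: "nat \<Rightarrow> 'v" where "gen p = sf_gens n e f ! p"

definition u :: "nat \<Rightarrow> int \<Rightarrow> 'v \<Rightarrow> 'v" where "u p k = nprod V k (gen p)"

text \<open>Indices below \<open>n\<close> stand for e, the others for f. \<open>conj\<close>
  exchanges the partners e and f of a pair; with the sign \<open>eta\<close>,
  \<open>omega p q\<close> becomes the coefficient of the vacuum in the first product of two
  generators.\<close>

definition conj :: "nat \<Rightarrow> nat" where "conj p = (if p < n then p + n else p - n)"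

definition eta :: "nat \<Rightarrow> complex" where "eta p = (if p < n then - 1 else 1)"

definition omega :: "nat \<Rightarrow> nat \<Rightarrow> complex" where
  "omega p q = (if q = conj p then - eta p else 0)"

lemma gen_e: "i < n \<Longrightarrow> gen i = e i"
  and gen_f: "i < n \<Longrightarrow> gen (n + i) = f i"
  by (simp_all add: gen_def sf_gens_def nth_append)

lemma gen_cases:
  assumes "p < 2 * n"
  obtains i where "i < n" "p = i" "gen p = e i" | i where "i < n" "p = n + i" "gen p = f i"
proof (cases "p < n")
  case True
  then show ?thesis using that(1)[of p] by (simp add: gen_e)
next
  case False
  then show ?thesis using that(2)[of "p - n"] assms gen_f[of "p - n"] by simp
qed

lemma set_gens: "set (sf_gens n e f) = gen ` {..<2 * n}"
proof -
  have "length (sf_gens n e f) = 2 * n" by (simp add: sf_gens_def)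
  then show ?thesis unfolding gen_def by (force simp: set_conv_nth)
qed

lemma gen_odd: "p < 2 * n \<Longrightarrow> gen p \<in> odd_part V"
  using gens_odd set_gens by blast

lemma conj_less: "p < 2 * n \<Longrightarrow> conj p < 2 * n"
  and conj_conj: "p < 2 * n \<Longrightarrow> conj (conj p) = p"
  and eta_conj: "p < 2 * n \<Longrightarrow> eta (conj p) = - eta p"
  and eta_sq: "eta p * eta p = 1"
  by (auto simp: conj_def eta_def)

lemma gen_ope:
  assumes "p < 2 * n" "q < 2 * n" "k \<ge> 0"
  shows "nprod V k (gen p) (gen q) = sc (if k = 1 then omega p q else 0) (vac V)"
  using assms(1)
proof (cases rule: gen_cases)
  case (1 i)
  from assms(2) show ?thesis
    by (cases rule: gen_cases)
      (use 1 assms ope_ee ope_ef in \<open>auto simp: omega_def conj_def eta_def\<close>)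
next
  case (2 i)
  from assms(2) show ?thesis
    by (cases rule: gen_cases)
      (use 2 assms ope_ff ope_fe in \<open>auto simp: omega_def conj_def eta_def\<close>)
qed

lemma lin_u: "lin (u p k)"
  unfolding u_def by (rule lin_nprod)

lemmas u_add = lin_add[OF lin_u]
  and u_scale = lin_scale[OF lin_u]
  and u_zero = lin_0[OF lin_u]
  and u_neg = lin_neg[OF lin_u]
  and u_diff = lin_diff[OF lin_u]
  and u_sum = lin_sum[OF lin_u]

lemma u_vac: "k \<ge> 0 \<Longrightarrow> u p k (vac V) = 0"
  by (simp add: u_def vac_right)

text \<open>Canonical anticommutation relations: the operator product is a pure double pole, so only
  \<open>j = 1\<close> survives in the commutator formula and contributes the factor
  \<open>k\<close>.\<close>

lemma u_u:
  assumes "p < 2 * n" "q < 2 * n"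
  shows "u p k (u q l v) = sc (if k + l = 0 then of_int k * omega p q else 0) v - u q l (u p k v)"
proof -
  have odd: "gen p \<in> odd_part V" "gen q \<in> odd_part V" using assms gen_odd by auto
  then have hom: "gen p \<in> hom" "gen q \<in> hom" by auto
  have ks: "koszul_sign V (gen p) (gen q) = - 1" using odd by (simp add: koszul_sign_def)
  obtain M where M: "\<forall>N\<ge>M. nprod V k (gen p) (nprod V l (gen q) v)
      - sc (koszul_sign V (gen p) (gen q)) (nprod V l (gen q) (nprod V k (gen p) v))
     = (\<Sum>j<N. sc (of_int k gchoose j) (nprod V (k + l - int j) (nprod V (int j) (gen p) (gen q)) v))"
    using commutator_formula[OF hom, of k l v] by blast
  have "u p k (u q l v) + u q l (u p k v)
     = (\<Sum>j<M+2. sc (of_int k gchoose j) (nprod V (k + l - int j) (nprod V (int j) (gen p) (gen q)) v))"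
    using M[rule_format, of "M+2"] by (simp add: u_def ks)
  also have "\<dots> = sc (of_int k gchoose 1) (nprod V (k + l - int 1) (nprod V (int 1) (gen p) (gen q)) v)"
    by (rule sum_eq_single) (auto simp: gen_ope assms nprod_zero_left)
  also have "\<dots> = sc (if k + l = 0 then of_int k * omega p q else 0) v"
    by (simp add: gen_ope assms nprod_scale_left vac_left)
  finally show ?thesis by (simp add: eq_diff_eq)
qed

lemma D_pow_gen: "nprod V (-1) ((D ^^ k) (gen p)) v = sc (fact k) (u p (-1 - int k) v)"
  by (simp add: u_def nprod_deriv_pow)

definition modes :: "(nat \<times> nat) set" where "modes = {(p, k). p < 2 * n \<and> k \<ge> 1}"

definition crop :: "nat \<times> nat \<Rightarrow> 'v \<Rightarrow> 'v" where
  "crop a = (case a of (p, k) \<Rightarrow> u p (- int k))"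

text \<open>The factor makes the anticommutator with \<open>crop a\<close> equal to 1, as
  \<open>omega (conj p) p\<close> is \<open>eta p\<close>.\<close>

definition anop :: "nat \<times> nat \<Rightarrow> 'v \<Rightarrow> 'v" where
  "anop a v = (case a of (p, k) \<Rightarrow> sc (eta p / of_nat k) (u (conj p) (int k) v))"

text \<open>Otherwise the empty monomial alone would be a nontrivial relation.\<close>

lemma vac_nonzero: "vac V \<noteq> 0"
proof
  assume v: "vac V = 0"
  let ?P = "\<lambda>ms :: (nat \<times> nat) list. if ms = [] then 1 else (0::complex)"
  have nn: "no_nontrivial_relations V (sf_gens n e f)"
    using free by (simp add: freely_generates_def)
  have supp: "{ms. ?P ms \<noteq> 0} = {[]}" by auto
  have "\<forall>ms. ?P ms = 0"
    by (rule nn[unfolded no_nontrivial_relations_def, rule_format, of ?P, THEN allI])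
      (unfold supp, auto simp: no_monomials_def no_monomial_value_def wick_def v)
  then show False by (metis one_neq_zero)
qed

lemma crop_words_span: "span {foldr crop xs (vac V) | xs. set xs \<subseteq> modes} = UNIV"
proof -
  let ?W = "{foldr crop xs (vac V) | xs. set xs \<subseteq> modes}"
  let ?X = "{(D ^^ k) a | k a. a \<in> set (sf_gens n e f)}"
  have w: "wick V xs \<in> span ?W" if "set xs \<subseteq> ?X" for xs
  proof -
    have "\<exists>c ys. set ys \<subseteq> modes \<and> wick V xs = sc c (foldr crop ys (vac V))"
      using that
    proof (induction xs)
      case Nil
      show ?case by (intro exI[of _ 1] exI[of _ "[]"]) (simp add: wick_def)
    next
      case (Cons x xs)
      then obtain c ys where c: "set ys \<subseteq> modes" "wick V xs = sc c (foldr crop ys (vac V))" by auto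
      obtain k p where x: "x = (D ^^ k) (gen p)" "p < 2 * n"
        using Cons.prems by (auto simp: set_gens)
      have "wick V (x # xs) = nprod V (-1) x (wick V xs)" by (simp add: wick_def)
      also have "\<dots> = sc (c * fact k) (crop (p, Suc k) (foldr crop ys (vac V)))"
        by (simp add: c x nprod_scale_right D_pow_gen crop_def)
      finally show ?case using c x
        by (intro exI[of _ "c * fact k"] exI[of _ "(p, Suc k) # ys"]) (auto simp: modes_def)
    qed
    then obtain c ys where "set ys \<subseteq> modes" "wick V xs = sc c (foldr crop ys (vac V))" by blast
    moreover from this have "foldr crop ys (vac V) \<in> span ?W" by (intro span_base) blast
    ultimately show ?thesis by (simp add: span_scale)
  qed
  have "strongly_generates V UNIV (set (sf_gens n e f))"
    using free by (simp add: freely_generates_def)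
  then have "UNIV = span {wick V xs | xs. set xs \<subseteq> ?X}"
    by (simp add: strongly_generates_def)
  also have "\<dots> \<subseteq> span ?W" by (rule span_minimal) (use w in auto)
  finally show ?thesis by auto
qed

end

sublocale symplectic_fermion_algebra \<subseteq> fock "scal V" modes crop anop "vac V"
proof unfold_locales
  fix a b :: "nat \<times> nat" and v
  assume "a \<in> modes"
  then obtain p k where a: "a = (p, k)" "p < 2 * n" "k \<ge> 1" by (auto simp: modes_def)
  show "lin (crop a)" "lin (anop a)"
    by (auto simp: a crop_def anop_def[abs_def] lin_u lin_smult)
  show "anop a (vac V) = 0" by (simp add: a anop_def u_vac)
  assume "b \<in> modes"
  then obtain q l where b: "b = (q, l)" "q < 2 * n" "l \<ge> 1" by (auto simp: modes_def)
  show "crop a (crop b v) = - crop b (crop a v)"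
    using a b by (simp add: crop_def u_u[of p q])
  show "anop a (anop b v) = - anop b (anop a v)"
    using a b u_u[OF conj_less conj_less, of p q "int k" "int l" v]
    by (simp add: anop_def u_scale u_neg mult.commute)
  have om: "omega (conj p) q = (if q = p then eta p else 0)"
    using a b by (simp add: omega_def conj_conj eta_conj)
  show "anop a (crop b v) = (if a = b then v else 0) - crop b (anop a v)"
    using a b eta_sq[of p] om u_u[OF conj_less, of p q "int k" "- int l" v]
    by (auto simp: anop_def crop_def u_scale scale_right_diff_distrib split: if_splits)
next
  show "vac V \<noteq> 0" by (rule vac_nonzero)
  show "span {foldr crop xs (vac V) |xs. set xs \<subseteq> modes} = UNIV" by (rule crop_words_span)
qed

context symplectic_fermion_algebra
begin

lemma state_induct [case_names vac add scale u]:
  assumes "P (vac V)" and "\<And>x y. P x \<Longrightarrow> P y \<Longrightarrow> P (x + y)" and "\<And>c x. P x \<Longrightarrow> P (sc c x)"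
    and "\<And>p k x. p < 2 * n \<Longrightarrow> k \<ge> 1 \<Longrightarrow> P x \<Longrightarrow> P (u p (- int k) x)"
  shows "P v"
  by (induction v rule: fock_induct) (use assms in \<open>auto simp: modes_def crop_def\<close>)

text \<open>The scalar in \<open>u_u\<close> carries the factor \<open>k\<close>, so the zero mode
  anticommutes with all modes, and it kills the vacuum.\<close>

lemma u_mode_0: "p < 2 * n \<Longrightarrow> u p 0 v = 0"
proof (induction v rule: state_induct)
  case (u q k x)
  then show ?case by (simp add: u_u[of p q] u_zero)
qed (simp_all add: u_vac u_add u_scale)

lemma u_truncation: "\<exists>N. \<forall>p<2*n. \<forall>k\<ge>N. u p k v = 0"
proof -
  have "\<forall>p. \<exists>N. \<forall>k\<ge>N. u p k v = 0" unfolding u_def using truncation by blast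
  then obtain N where N: "\<And>p k. k \<ge> N p \<Longrightarrow> u p k v = 0" by metis
  have "u p k v = 0" if "p < 2 * n" "k \<ge> (\<Sum>q<2*n. \<bar>N q\<bar>)" for p k
  proof -
    have "\<bar>N p\<bar> \<le> (\<Sum>q<2*n. \<bar>N q\<bar>)" using that by (intro member_le_sum) auto
    then show ?thesis using N[of p k] that by linarith
  qed
  then show ?thesis by blast
qed

text \<open>Schur's lemma for the Fock space: the image of the vacuum is killed by all annihilators
  and hence is a multiple of the vacuum.\<close>

lemma commuting_scalar:
  assumes T: "lin T" and comm: "\<And>p k v. p < 2 * n \<Longrightarrow> k \<noteq> 0 \<Longrightarrow> T (u p k v) = u p k (T v)"
  shows "T v = sc (eps (T (vac V))) v"
proof -
  have "anop a (T (vac V)) = 0" if am: "a \<in> modes" for a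
  proof -
    obtain p k where a: "a = (p, k)" "p < 2 * n" "k \<ge> 1" using am by (auto simp: modes_def)
    then have "u (conj p) (int k) (T (vac V)) = T (u (conj p) (int k) (vac V))"
      using conj_less by (subst comm) auto
    then show ?thesis by (simp add: a anop_def u_vac lin_0[OF T])
  qed
  then have vac: "T (vac V) = sc (eps (T (vac V))) (vac V)" by (rule an_all_zero)
  show ?thesis
  proof (induction v rule: state_induct)
    case (u p k x)
    then show ?case by (simp add: comm u_scale)
  qed (use vac in \<open>simp_all add: lin_add[OF T] lin_scale[OF T] scale_right_distrib mult.commute\<close>)
qed

end

section \<open>Symplectic transvections as automorphisms\<close>

context complex_space
begin

lemma subspace_Sum_any:
  assumes "subspace S" "\<And>i. F i \<in> S"
  shows "Sum_any F \<in> S"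
  unfolding Sum_any.expand_set using assms by (intro subspace_sum) auto

end

context symplectic_fermion_algebra
begin

lemma u_even: "p < 2 * n \<Longrightarrow> x \<in> even_part V \<Longrightarrow> u p k x \<in> odd_part V"
  and u_odd: "p < 2 * n \<Longrightarrow> x \<in> odd_part V \<Longrightarrow> u p k x \<in> even_part V"
  by (simp_all add: u_def gen_odd nprod_odd_even nprod_odd_odd)

lemma parity_unique:
  assumes "x0 + x1 = y0 + y1" "x0 \<in> even_part V" "y0 \<in> even_part V" "x1 \<in> odd_part V" "y1 \<in> odd_part V"
  shows "x0 = y0 \<and> x1 = y1"
proof -
  have "x0 - y0 = y1 - x1" using assms(1) by (simp add: algebra_simps)
  moreover have "x0 - y0 \<in> even_part V" "y1 - x1 \<in> odd_part V"
    using assms subspace_even subspace_odd by (auto intro: subspace_diff)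
  ultimately have "y1 - x1 \<in> even_part V \<inter> odd_part V" "x0 - y0 = y1 - x1" by auto
  then show ?thesis unfolding even_odd_disjoint by simp
qed

text \<open>The associator formula needs states of definite parity; the induction is therefore run
  on both parity components at once.\<close>

lemma hom_state_induct [case_names vac add scale u]:
  assumes "P (vac V)" and "\<And>x y. P x \<Longrightarrow> P y \<Longrightarrow> P (x + y)" and "\<And>c x. P x \<Longrightarrow> P (sc c x)"
    and "\<And>p k x. p < 2 * n \<Longrightarrow> k \<ge> 1 \<Longrightarrow> x \<in> hom \<Longrightarrow> P x \<Longrightarrow> P (u p (- int k) x)"
  shows "P v"
proof -
  let ?Q = "\<lambda>x. \<forall>x0\<in>even_part V. \<forall>x1\<in>odd_part V. x = x0 + x1 \<longrightarrow> P x0 \<and> P x1"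
  have P0: "P 0" using assms(3)[OF assms(1), of 0] by simp
  have z: "0 \<in> even_part V" "0 \<in> odd_part V"
    using subspace_even subspace_odd by (auto intro: subspace_0)
  have "?Q v"
  proof (induction v rule: state_induct)
    case vac
    show ?case using parity_unique[of "vac V" 0] z vac_even P0 assms(1) by fastforce
  next
    case (add x y)
    obtain x0 x1 where x: "x0 \<in> even_part V" "x1 \<in> odd_part V" "x = x0 + x1" using even_odd_sum by blast
    obtain y0 y1 where y: "y0 \<in> even_part V" "y1 \<in> odd_part V" "y = y0 + y1" using even_odd_sum by blast
    have "P (x0 + y0)" "P (x1 + y1)" using add x y assms(2) by blast+
    moreover have "x0 + y0 \<in> even_part V" "x1 + y1 \<in> odd_part V"
      using x y subspace_even subspace_odd by (auto intro: subspace_add)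
    ultimately show ?case
      using parity_unique[of "x0 + y0" "x1 + y1"] x(3) y(3) by (metis add.assoc add.left_commute)
  next
    case (scale c x)
    obtain x0 x1 where x: "x0 \<in> even_part V" "x1 \<in> odd_part V" "x = x0 + x1" using even_odd_sum by blast
    have "P (sc c x0)" "P (sc c x1)" using scale x assms(3) by blast+
    moreover have "sc c x0 \<in> even_part V" "sc c x1 \<in> odd_part V"
      using x subspace_even subspace_odd by (auto intro: subspace_scale)
    ultimately show ?case
      using parity_unique[of "sc c x0" "sc c x1"] x(3) by (metis scale_right_distrib)
  next
    case (u p k x)
    obtain x0 x1 where x: "x0 \<in> even_part V" "x1 \<in> odd_part V" "x = x0 + x1" using even_odd_sum by blast
    have "P (u p (- int k) x0)" "P (u p (- int k) x1)" using u x assms(4) by blast+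
    moreover have "u p (- int k) x1 \<in> even_part V" "u p (- int k) x0 \<in> odd_part V"
      using x u u_even u_odd by auto
    ultimately show ?case
      using parity_unique[of "u p (- int k) x1" "u p (- int k) x0"] x(3) by (metis add.commute u_add)
  qed
  moreover obtain v0 v1 where "v0 \<in> even_part V" "v1 \<in> odd_part V" "v = v0 + v1" using even_odd_sum by blast
  ultimately show ?thesis using assms(2) by blast
qed

text \<open>\<open>s\<close> is the Koszul sign; it is not unique only for \<open>b = 0\<close>.\<close>

lemma associator_odd:
  assumes "a \<in> odd_part V" and s: "s = 1 \<and> b \<in> even_part V \<or> s = - 1 \<and> b \<in> odd_part V"
  shows "\<exists>M. \<forall>N\<ge>M. nprod V k (nprod V l a b) c
     = (\<Sum>j<N. sc ((-1) ^ j * (of_int l gchoose j))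
                (nprod V (l - int j) a (nprod V (k + int j) b c)
                  - sc ((- 1) powi l * s) (nprod V (l + k - int j) b (nprod V (int j) a c))))"
proof -
  have "a \<in> hom" "b \<in> hom" using assms by auto
  moreover have "sc ((- 1) powi l * koszul_sign V a b) (nprod V i b y) = sc ((- 1) powi l * s) (nprod V i b y)" for i y
  proof (cases "b = 0")
    case False
    then have "koszul_sign V a b = s"
      using assms even_odd_disjoint by (auto simp: koszul_sign_def)
    then show ?thesis by simp
  qed (simp add: nprod_zero_left)
  ultimately show ?thesis using associator_formula[of a b k l c] by (simp only:)
qed

lemma omega_skew: "p < 2 * n \<Longrightarrow> q < 2 * n \<Longrightarrow> omega q p = - omega p q"
  by (auto simp: omega_def conj_def eta_def)

definition wm :: "(nat \<Rightarrow> complex) \<Rightarrow> int \<Rightarrow> 'v \<Rightarrow> 'v" where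
  "wm w k v = (\<Sum>p<2*n. sc (w p) (u p k v))"

definition wpair :: "(nat \<Rightarrow> complex) \<Rightarrow> nat \<Rightarrow> complex" where
  "wpair w r = (\<Sum>p<2*n. w p * omega p r)"

lemma conj_eq_iff: "p < 2 * n \<Longrightarrow> q < 2 * n \<Longrightarrow> p = conj q \<longleftrightarrow> q = conj p"
  by (auto simp: conj_conj)

lemma wpair_eq: "p < 2 * n \<Longrightarrow> wpair w p = eta p * w (conj p)"
proof -
  assume p: "p < 2 * n"
  have "wpair w p = w (conj p) * omega (conj p) p"
    unfolding wpair_def
    by (rule sum_eq_single) (use p conj_less in \<open>auto simp: omega_def conj_eq_iff\<close>)
  then show ?thesis using p by (simp add: omega_def conj_conj eta_conj)
qed

lemma sum_conj: "(\<Sum>p<2*n. F (conj p)) = (\<Sum>p<2*n. F p)"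
  by (rule sum.reindex_bij_witness[of _ conj conj]) (auto simp: conj_conj conj_less)

text \<open>Skewness makes \<open>w\<close> isotropic, which is the source of all nilpotency
  below.\<close>

lemma wpair_self: "(\<Sum>r<2*n. w r * wpair w r) = 0"
proof -
  have "(\<Sum>r<2*n. w r * wpair w r) = (\<Sum>r<2*n. eta r * (w r * w (conj r)))"
    by (rule sum.cong) (auto simp: wpair_eq)
  also have "\<dots> = 0"
  proof -
    have "(\<Sum>r<2*n. eta r * (w r * w (conj r))) = (\<Sum>r<2*n. eta (conj r) * (w (conj r) * w (conj (conj r))))"
      by (rule sum_conj[symmetric])
    also have "\<dots> = - (\<Sum>r<2*n. eta r * (w r * w (conj r)))"
      unfolding sum_negf[symmetric] by (rule sum.cong) (auto simp: conj_conj eta_conj)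
    finally show ?thesis by (simp add: eq_neg_iff_add_eq_0)
  qed
  finally show ?thesis .
qed

lemma lin_wm: "lin (wm w k)"
  unfolding wm_def[abs_def] by (intro lin_sum_op lin_smult lin_u)

lemma wm_vac: "k \<ge> 0 \<Longrightarrow> wm w k (vac V) = 0"
  by (simp add: wm_def u_vac)

lemma wm_0: "wm w 0 v = 0"
  by (simp add: wm_def u_mode_0)

lemma wm_u:
  assumes "r < 2 * n"
  shows "wm w k (u r l v) = sc (if k + l = 0 then of_int k * wpair w r else 0) v - u r l (wm w k v)"
proof -
  have "wm w k (u r l v) = (\<Sum>p<2*n. sc (w p * (if k + l = 0 then of_int k * omega p r else 0)) v
      - sc (w p) (u r l (u p k v)))"
    unfolding wm_def
    by (rule sum.cong[OF refl]) (simp add: u_u[OF _ assms] scale_right_diff_distrib)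
  also have "\<dots> = sc (\<Sum>p<2*n. w p * (if k + l = 0 then of_int k * omega p r else 0)) v - u r l (wm w k v)"
    by (simp add: sum_subtractf scale_sum_left wm_def u_sum u_scale)
  also have "(\<Sum>p<2*n. w p * (if k + l = 0 then of_int k * omega p r else 0))
      = (if k + l = 0 then of_int k * wpair w r else 0)"
    by (auto simp: wpair_def sum_distrib_left mult.left_commute)
  finally show ?thesis .
qed

lemma wm_finite: "finite {i. wm w (1 + int i) v \<noteq> 0}"
proof -
  obtain N where N: "\<forall>p<2*n. \<forall>k\<ge>N. u p k v = 0" using u_truncation by blast
  have "{i. wm w (1 + int i) v \<noteq> 0} \<subseteq> {..nat N}"
  proof
    fix i assume i: "i \<in> {i. wm w (1 + int i) v \<noteq> 0}"
    show "i \<in> {..nat N}"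
    proof (rule ccontr)
      assume "i \<notin> {..nat N}"
      then have "1 + int i \<ge> N" by auto
      then have "wm w (1 + int i) v = 0" using N by (auto simp: wm_def intro: sum.neutral)
      with i show False by simp
    qed
  qed
  then show ?thesis by (rule finite_subset) simp
qed

text \<open>The infinitesimal transvection \<open>x \<mapsto> \<omega>(w, x) w\<close> acting on the Fock space.\<close>

definition dw :: "(nat \<Rightarrow> complex) \<Rightarrow> 'v \<Rightarrow> 'v" where
  "dw w = bil (\<lambda>i v. sc (1 / of_nat (Suc i)) (wm w (-1 - int i) v)) (\<lambda>i. wm w (1 + int i))"

lemma lin_dw: "lin (dw w)"
  unfolding dw_def by (intro lin_bil lin_smult lin_wm wm_finite)

lemma dw_vac: "dw w (vac V) = 0"
  by (simp add: dw_def bil_def wm_vac lin_0[OF lin_wm])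

text \<open>The weights \<open>1 / Suc i\<close> in \<open>dw\<close> cancel the mode index in the
  anticommutator, so that all modes of a generator are transformed by the same linear map.\<close>

lemma dw_u:
  assumes r: "r < 2 * n"
  shows "dw w (u r m v) = u r m (dw w v) + sc (wpair w r) (wm w m v)"
proof -
  let ?\<alpha> = "\<lambda>i. if m = 1 + int i then - wpair w r else 0"
  let ?\<beta> = "\<lambda>i. if m = - 1 - int i then of_nat (Suc i) * wpair w r else 0"
  let ?P = "\<lambda>i v. sc (1 / of_nat (Suc i)) (wm w (-1 - int i) v)"
  let ?Q = "\<lambda>i. wm w (1 + int i)"
  let ?i = "nat (\<bar>m\<bar> - 1)"
  have nz: "(1 + of_nat i :: complex) \<noteq> 0" for i
    using of_nat_neq_0[of i, where 'a = complex] by simp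
  have "bil ?P ?Q (u r m v) = u r m (bil ?P ?Q v) + (\<Sum>i\<in>{?i}. sc (?\<beta> i) (?P i v) - sc (?\<alpha> i) (?Q i v))"
  proof (rule bil_commutator)
    show "?P i (u r m v) = sc (?\<alpha> i) v - u r m (?P i v)" for i v
    proof -
      have eq: "1 / of_nat (Suc i) * (if -1 - int i + m = 0 then of_int (-1 - int i) * wpair w r else 0) = ?\<alpha> i"
        using nz[of i] by (auto simp: field_simps)
      have "?P i (u r m v) = sc (1 / of_nat (Suc i) * (if -1 - int i + m = 0 then of_int (-1 - int i) * wpair w r else 0)) v
          - u r m (?P i v)"
        unfolding wm_u[OF r] by (simp only: scale_right_diff_distrib scale_scale u_scale)
      then show ?thesis unfolding eq .
    qed
    show "?Q i (u r m v) = sc (?\<beta> i) v - u r m (?Q i v)" for i v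
    proof -
      have "(if 1 + int i + m = 0 then of_int (1 + int i) * wpair w r else 0) = ?\<beta> i"
        by auto
      then show ?thesis using wm_u[OF r, of w "1 + int i" m v] by (simp only:)
    qed
  qed (auto intro: lin_smult lin_wm wm_finite lin_u)
  also have "(\<Sum>i\<in>{?i}. sc (?\<beta> i) (?P i v) - sc (?\<alpha> i) (?Q i v)) = sc (wpair w r) (wm w m v)"
  proof -
    consider "m = 0" | i where "m = 1 + int i" | i where "m = - 1 - int i"
    proof -
      have "m = 0 \<or> m = 1 + int (nat (m - 1)) \<or> m = - 1 - int (nat (- 1 - m))" by linarith
      then show ?thesis using that by blast
    qed
    then show ?thesis
    proof cases
      case 1
      then show ?thesis by (simp add: wm_0)
    next
      case (2 i)
      then have "?i = i" by simp
      then show ?thesis using 2 by simp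
    next
      case (3 i)
      then have "?i = i" by simp
      moreover have "of_nat (Suc i) * wpair w r * (1 / of_nat (Suc i)) = wpair w r"
        using nz[of i] by simp
      ultimately show ?thesis using 3 by simp
    qed
  qed
  finally show ?thesis unfolding dw_def .
qed

lemma dw_wm_other: "dw w (wm w' m v) = wm w' m (dw w v) + sc (\<Sum>r<2*n. w' r * wpair w r) (wm w m v)"
proof -
  have "dw w (wm w' m v) = (\<Sum>r<2*n. sc (w' r) (u r m (dw w v)) + sc (w' r * wpair w r) (wm w m v))"
    unfolding wm_def[of w' m v] lin_sum[OF lin_dw]
    by (rule sum.cong[OF refl]) (simp add: lin_scale[OF lin_dw] dw_u scale_right_distrib)
  then show ?thesis by (simp add: sum.distrib wm_def[of w' m "dw w v"] scale_sum_left)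
qed

lemma dw_wm: "dw w (wm w m v) = wm w m (dw w v)"
  by (simp add: dw_wm_other wpair_self)

text \<open>By isotropy the commutator with \<open>dw w\<close> has square zero on the modes, so the
  Leibniz rule stops after the first-order term.\<close>

lemma dw_pow_u:
  assumes "r < 2 * n"
  shows "(dw w ^^ k) (u r m v) = u r m ((dw w ^^ k) v)
     + sc (of_nat k * wpair w r) (wm w m ((dw w ^^ (k - 1)) v))"
proof (induction k)
  case (Suc k)
  have "(dw w ^^ Suc k) (u r m v) = u r m ((dw w ^^ Suc k) v) + sc (wpair w r) (wm w m ((dw w ^^ k) v))
     + sc (of_nat k * wpair w r) (dw w (wm w m ((dw w ^^ (k - 1)) v)))"
    by (simp add: Suc.IH lin_add[OF lin_dw] lin_scale[OF lin_dw] dw_u assms)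
  also have "sc (of_nat k * wpair w r) (dw w (wm w m ((dw w ^^ (k - 1)) v)))
     = sc (of_nat k * wpair w r) (wm w m ((dw w ^^ k) v))"
    by (cases k) (simp_all add: dw_wm)
  finally show ?case
    by (simp add: distrib_right scale_left_distrib algebra_simps)
qed simp

lemma dw_pow_zero_mono: "(dw w ^^ N) v = 0 \<Longrightarrow> N \<le> k \<Longrightarrow> (dw w ^^ k) v = 0"
proof -
  assume "(dw w ^^ N) v = 0" "N \<le> k"
  then have "(dw w ^^ ((k - N) + N)) v = (dw w ^^ (k - N)) 0"
    by (simp only: funpow_add o_apply)
  with \<open>N \<le> k\<close> have "(dw w ^^ k) v = (dw w ^^ (k - N)) 0" by simp
  then show ?thesis by (simp add: lin_0[OF lin_funpow[OF lin_dw]])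
qed

text \<open>A creation operator raises the order of nilpotency by at most one.\<close>

lemma dw_nilpotent: "\<exists>N. (dw w ^^ N) v = 0"
proof (induction v rule: state_induct)
  case vac
  show ?case by (rule exI[of _ 1]) (simp add: dw_vac)
next
  case (add x y)
  then obtain N M where "(dw w ^^ N) x = 0" "(dw w ^^ M) y = 0" by blast
  then have "(dw w ^^ (N + M)) x = 0" "(dw w ^^ (N + M)) y = 0"
    using dw_pow_zero_mono[where k = "N + M"] by auto
  then have "(dw w ^^ (N + M)) (x + y) = 0"
    by (simp add: lin_add[OF lin_funpow[OF lin_dw]])
  then show ?case by blast
next
  case (scale c x)
  then show ?case by (auto simp: lin_scale[OF lin_funpow[OF lin_dw]])
next
  case (u p k x)
  then obtain N where "(dw w ^^ N) x = 0" by blast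
  then have "(dw w ^^ Suc N) (u p (- int k) x) = 0"
    using u dw_pow_u[where r = p and w = w and k = "Suc N" and m = "- int k" and v = x] dw_pow_zero_mono[where N = N and k = "Suc N" and v = x]
    by (simp add: u_zero lin_0[OF lin_wm] lin_0[OF lin_dw])
  then show ?case by blast
qed

text \<open>The exponential of \<open>dw w\<close>, a finite sum on each state by
  \<open>dw_nilpotent\<close>.\<close>

definition tv :: "(nat \<Rightarrow> complex) \<Rightarrow> 'v \<Rightarrow> 'v" where
  "tv w v = Sum_any (\<lambda>k. sc (1 / fact k) ((dw w ^^ k) v))"

lemma tv_eventually: "\<exists>M. \<forall>N\<ge>M. tv w v = (\<Sum>k<N. sc (1 / fact k) ((dw w ^^ k) v))"
proof -
  obtain N where "(dw w ^^ N) v = 0" using dw_nilpotent by blast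
  then show ?thesis unfolding tv_def
    by (intro Sum_any_eventually exI[of _ N]) (auto simp: dw_pow_zero_mono)
qed

lemma lin_tv: "lin (tv w)"
  unfolding tv_def[abs_def]
proof (rule lin_Sum_any)
  show "finite {i. sc (1 / fact i) ((dw w ^^ i) x) \<noteq> 0}" for x
  proof -
    obtain N where "(dw w ^^ N) x = 0" using dw_nilpotent by blast
    then have "{i. sc (1 / fact i) ((dw w ^^ i) x) \<noteq> 0} \<subseteq> {..N}"
      using dw_pow_zero_mono[where N = N and w = w and v = x] by (auto intro: ccontr simp: not_le less_imp_le)
    then show ?thesis by (rule finite_subset) simp
  qed
qed (intro lin_smult lin_funpow lin_dw)

lemma tv_vac: "tv w (vac V) = vac V"
proof -
  have "(dw w ^^ k) (vac V) = (if k = 0 then vac V else 0)" for k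
    by (induction k) (auto simp: dw_vac lin_0[OF lin_dw])
  then have "tv w (vac V) = (\<Sum>k\<in>{0}. sc (1 / fact k) ((dw w ^^ k) (vac V)))"
    unfolding tv_def by (intro Sum_any.expand_superset) auto
  then show ?thesis by simp
qed

lemma tv_u:
  assumes "r < 2 * n"
  shows "tv w (u r m v) = u r m (tv w v) + sc (wpair w r) (wm w m (tv w v))"
proof -
  obtain M1 where M1: "\<forall>N\<ge>M1. tv w v = (\<Sum>k<N. sc (1 / fact k) ((dw w ^^ k) v))"
    using tv_eventually by blast
  obtain M2 where M2: "\<forall>N\<ge>M2. tv w (u r m v) = (\<Sum>k<N. sc (1 / fact k) ((dw w ^^ k) (u r m v)))"
    using tv_eventually by blast
  define N where "N = max M1 M2"
  let ?d = "\<lambda>k. (dw w ^^ k) v"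
  have "tv w (u r m v) = (\<Sum>k<Suc N. sc (1 / fact k) (u r m (?d k)) + sc (1 / fact k * (of_nat k * wpair w r)) (wm w m (?d (k - 1))))"
    using M2[rule_format, of "Suc N"] by (simp add: N_def dw_pow_u assms scale_right_distrib)
  also have "\<dots> = (\<Sum>k<Suc N. sc (1 / fact k) (u r m (?d k)))
      + (\<Sum>k<Suc N. sc (1 / fact k * (of_nat k * wpair w r)) (wm w m (?d (k - 1))))"
    by (rule sum.distrib)
  also have "(\<Sum>k<Suc N. sc (1 / fact k) (u r m (?d k))) = u r m (tv w v)"
    using M1[rule_format, of "Suc N"] by (simp add: N_def u_sum u_scale u_add)
  also have "(\<Sum>k<Suc N. sc (1 / fact k * (of_nat k * wpair w r)) (wm w m (?d (k - 1))))
      = (\<Sum>k<N. sc (1 / fact (Suc k) * (of_nat (Suc k) * wpair w r)) (wm w m (?d k)))"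
    by (simp only: sum.lessThan_Suc_shift) simp
  also have "\<dots> = (\<Sum>k<N. sc (wpair w r) (sc (1 / fact k) (wm w m (?d k))))"
  proof (rule sum.cong[OF refl])
    fix k
    have "1 / fact (Suc k) * (of_nat (Suc k) * wpair w r) = wpair w r * (1 / fact k)"
      using of_nat_neq_0[of k, where 'a = complex] by (simp add: field_simps del: of_nat_Suc)
    then show "sc (1 / fact (Suc k) * (of_nat (Suc k) * wpair w r)) (wm w m (?d k))
        = sc (wpair w r) (sc (1 / fact k) (wm w m (?d k)))" by simp
  qed
  also have "\<dots> = sc (wpair w r) (wm w m (tv w v))"
    using M1[rule_format, of N]
    by (simp add: N_def lin_sum[OF lin_wm] lin_scale[OF lin_wm] scale_sum_right)
  finally show ?thesis .
qed

lemma tv_gen: "r < 2 * n \<Longrightarrow> tv w (gen r) = gen r + sc (wpair w r) (\<Sum>p<2*n. sc (w p) (gen p))"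
  using tv_u[of r w "-1" "vac V"] by (simp add: tv_vac wm_def u_def creation)

lemma tv_gen_nprod: "r < 2 * n \<Longrightarrow> tv w (u r m v) = nprod V m (tv w (gen r)) (tv w v)"
  by (simp only: tv_u tv_gen) (simp add: nprod_add_left nprod_scale_left nprod_sum_left u_def wm_def)

lemma dw_parity:
  assumes "S = even_part V \<or> S = odd_part V" "x \<in> S"
  shows "dw w x \<in> S"
proof -
  have sub: "subspace (even_part V)" "subspace (odd_part V)" using subspace_even subspace_odd by auto
  have "wm w k y \<in> odd_part V" if "y \<in> even_part V" for k y
    unfolding wm_def using that sub by (intro subspace_sum subspace_scale) (auto intro: u_even)
  moreover have "wm w k y \<in> even_part V" if "y \<in> odd_part V" for k y
    unfolding wm_def using that sub by (intro subspace_sum subspace_scale) (auto intro: u_odd)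
  ultimately show ?thesis unfolding dw_def bil_def
    using assms sub by (intro subspace_Sum_any subspace_scale) auto
qed

lemma tv_parity:
  assumes "S = even_part V \<or> S = odd_part V" "x \<in> S"
  shows "tv w x \<in> S"
proof -
  have "(dw w ^^ k) x \<in> S" for k
    by (induction k) (use assms dw_parity in auto)
  then show ?thesis unfolding tv_def
    using assms subspace_even subspace_odd by (intro subspace_Sum_any subspace_scale) auto
qed

text \<open>Induction on the left factor: the associator formula reduces products with
  \<open>u p ?l x\<close> to products with \<open>x\<close> and to modes of a generator, for which
  \<open>tv_gen_nprod\<close> holds.\<close>

lemma tv_nprod: "tv w (nprod V k a b) = nprod V k (tv w a) (tv w b)"
proof (induction a arbitrary: k b rule: hom_state_induct)
  case vac
  then show ?case by (simp add: tv_vac vac_left lin_0[OF lin_tv])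
next
  case (u p m x)
  let ?l = "- int m"
  obtain s :: complex where s: "s = 1 \<and> x \<in> even_part V \<or> s = - 1 \<and> x \<in> odd_part V" using u by blast
  then have s': "s = 1 \<and> tv w x \<in> even_part V \<or> s = - 1 \<and> tv w x \<in> odd_part V"
    using tv_parity by blast
  have odd: "gen p \<in> odd_part V" "tv w (gen p) \<in> odd_part V"
    using u gen_odd tv_parity by blast+
  obtain M1 where M1: "\<forall>N\<ge>M1. nprod V k (nprod V ?l (gen p) x) b
     = (\<Sum>j<N. sc ((-1) ^ j * (of_int ?l gchoose j))
                (nprod V (?l - int j) (gen p) (nprod V (k + int j) x b)
                  - sc ((- 1) powi ?l * s) (nprod V (?l + k - int j) x (nprod V (int j) (gen p) b))))"
    using associator_odd[OF odd(1) s] by blast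
  obtain M2 where M2: "\<forall>N\<ge>M2. nprod V k (nprod V ?l (tv w (gen p)) (tv w x)) (tv w b)
     = (\<Sum>j<N. sc ((-1) ^ j * (of_int ?l gchoose j))
                (nprod V (?l - int j) (tv w (gen p)) (nprod V (k + int j) (tv w x) (tv w b))
                  - sc ((- 1) powi ?l * s) (nprod V (?l + k - int j) (tv w x) (nprod V (int j) (tv w (gen p)) (tv w b)))))"
    using associator_odd[OF odd(2) s'] by blast
  define N where "N = max M1 M2"
  have "tv w (nprod V k (u p ?l x) b) = (\<Sum>j<N. sc ((-1) ^ j * (of_int ?l gchoose j))
                (tv w (u p (?l - int j) (nprod V (k + int j) x b))
                  - sc ((- 1) powi ?l * s) (tv w (nprod V (?l + k - int j) x (u p (int j) b)))))"
    using M1[rule_format, of N]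
    by (simp add: N_def u_def lin_sum[OF lin_tv] lin_scale[OF lin_tv] lin_diff[OF lin_tv])
  also have "\<dots> = nprod V k (nprod V ?l (tv w (gen p)) (tv w x)) (tv w b)"
    using M2[rule_format, of N] u(1) by (simp add: N_def u.IH tv_gen_nprod)
  finally show ?case using u(1) by (simp add: tv_gen_nprod)
qed (simp_all add: nprod_add_left nprod_scale_left lin_add[OF lin_tv] lin_scale[OF lin_tv])

lemma wm_times: "wm (\<lambda>p. c * w p) m v = sc c (wm w m v)"
  by (simp add: wm_def scale_sum_right)

lemma wpair_times: "wpair (\<lambda>p. c * w p) r = c * wpair w r"
  by (simp add: wpair_def sum_distrib_left mult.assoc)

text \<open>The inverse of a transvection differs from it by the sign of a term quadratic in
  \<open>w\<close>, and multiplying \<open>w\<close> by the imaginary unit changes this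
  sign.\<close>

lemma tv_inverse: "tv (\<lambda>p. \<i> * w p) (tv w v) = v"
proof (induction v rule: state_induct)
  case (u r k x)
  let ?w = "\<lambda>p. \<i> * w p"
  let ?m = "- int k"
  have ii: "a * (\<i> * c * \<i>) = - (a * c)" "\<i> * (\<i> * c) = - c" for a c :: complex
  proof -
    have "a * (\<i> * c * \<i>) = a * c * (\<i> * \<i>)" by (simp only: mult_ac)
    then show "a * (\<i> * c * \<i>) = - (a * c)" by simp
  qed (simp add: mult.assoc[symmetric])
  have "tv ?w (wm w ?m y) = (\<Sum>p<2*n. sc (w p) (u p ?m (tv ?w y)) - sc (w p * wpair w p) (wm w ?m (tv ?w y)))" for y
    unfolding wm_def[of w ?m y] lin_sum[OF lin_tv]
    by (rule sum.cong[OF refl])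
      (simp add: lin_scale[OF lin_tv] tv_u wm_times wpair_times ii scale_right_diff_distrib scale_right_distrib)
  then have wm: "tv ?w (wm w ?m y) = wm w ?m (tv ?w y)" for y
    by (simp add: sum_subtractf wpair_self wm_def[of w ?m "tv ?w y"] flip: scale_sum_left)
  show ?case using u
    by (simp add: tv_u lin_add[OF lin_tv] lin_scale[OF lin_tv] wm wm_times wpair_times ii mult.commute)
qed (simp_all add: tv_vac lin_add[OF lin_tv] lin_scale[OF lin_tv])

lemma bij_tv: "bij (tv w)"
proof (rule bijI)
  show "inj (tv w)" by (rule inj_on_inverseI[of _ "tv (\<lambda>p. \<i> * w p)"]) (rule tv_inverse)
  have "(\<lambda>p. \<i> * (- \<i> * w p)) = w" by (auto simp: mult.assoc[symmetric])
  then show "surj (tv w)"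
    using tv_inverse[of "\<lambda>p. - \<i> * w p"] by (metis surjI)
qed

lemma tv_automorphism: "vertex_automorphism V (tv w)"
  unfolding vertex_automorphism_def
  using lin_tv tv_parity by (auto simp: lin_iff_linear[symmetric] bij_tv tv_vac tv_nprod)

definition tv_mat :: "(nat \<Rightarrow> complex) \<Rightarrow> complex mat" where
  "tv_mat w = mat (2 * n) (2 * n) (\<lambda>(i, j). (if i = j then 1 else 0) + w i * wpair w j)"

lemma symplectic_form_omega: "i < 2 * n \<Longrightarrow> j < 2 * n \<Longrightarrow> symplectic_form n $$ (i, j) = omega i j"
  by (auto simp: symplectic_form_def omega_def conj_def eta_def)

lemma symplectic_form_carrier: "symplectic_form n \<in> carrier_mat (2 * n) (2 * n)"
  unfolding symplectic_form_def mult_2 by (intro four_block_carrier_mat) auto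

lemma wpair_skew: "i < 2 * n \<Longrightarrow> (\<Sum>l<2*n. omega i l * w l) = - wpair w i"
  unfolding wpair_def sum_negf[symmetric] by (rule sum.cong) (auto simp: omega_skew[of _ i])

lemma mult_entry:
  assumes "A \<in> carrier_mat m m" "B \<in> carrier_mat m m" "i < m" "j < m"
  shows "(A * B) $$ (i, j) = (\<Sum>l<m. A $$ (i, l) * (B $$ (l, j) :: complex))"
  using assms by (auto simp: scalar_prod_def atLeast0LessThan intro!: sum.cong)

lemma tv_mat_Sp: "tv_mat w \<in> Sp n"
proof -
  let ?J = "symplectic_form n" and ?g = "tv_mat w"
  let ?d = "\<lambda>i j :: nat. if i = j then 1 else (0::complex)"
  have J: "?J \<in> carrier_mat (2 * n) (2 * n)" by (rule symplectic_form_carrier)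
  have g: "?g \<in> carrier_mat (2 * n) (2 * n)" by (simp add: tv_mat_def)
  have gT: "transpose_mat ?g \<in> carrier_mat (2 * n) (2 * n)" using g by simp
  have "transpose_mat ?g * (?J * ?g) = ?J"
  proof (rule eq_matI)
    fix i j assume "i < dim_row ?J" "j < dim_col ?J"
    then have ij: "i < 2 * n" "j < 2 * n" using J by auto
    have Jg: "(?J * ?g) $$ (k, j) = omega k j - wpair w k * wpair w j" if k: "k < 2 * n" for k
    proof -
      have "(?J * ?g) $$ (k, j) = (\<Sum>l<2*n. omega k l * (?d l j + w l * wpair w j))"
        unfolding mult_entry[OF J g k ij(2)]
        by (rule sum.cong) (use k ij in \<open>auto simp: tv_mat_def symplectic_form_omega\<close>)
      also have "\<dots> = (\<Sum>l<2*n. omega k l * ?d l j) + (\<Sum>l<2*n. omega k l * w l) * wpair w j"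
        by (simp add: distrib_left sum.distrib sum_distrib_right mult.assoc)
      also have "(\<Sum>l<2*n. omega k l * ?d l j) = omega k j"
        using ij by (simp add: if_distrib[of "(*) _"] cong: if_cong)
      finally show ?thesis using k by (simp add: wpair_skew)
    qed
    have "(transpose_mat ?g * (?J * ?g)) $$ (i, j)
        = (\<Sum>k<2*n. (?d k i + w k * wpair w i) * (omega k j - wpair w k * wpair w j))"
      unfolding mult_entry[OF gT mult_carrier_mat[OF J g] ij]
      by (rule sum.cong) (use ij Jg in \<open>auto simp: tv_mat_def\<close>)
    also have "\<dots> = (\<Sum>k<2*n. ?d k i * (omega k j - wpair w k * wpair w j))
        + wpair w i * (\<Sum>k<2*n. w k * omega k j) - wpair w i * wpair w j * (\<Sum>k<2*n. w k * wpair w k)"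
      by (simp add: sum_distrib_left sum_subtractf[symmetric] sum.distrib[symmetric] algebra_simps)
    also have "(\<Sum>k<2*n. ?d k i * (omega k j - wpair w k * wpair w j)) = omega i j - wpair w i * wpair w j"
      using ij by (simp add: if_distrib[of "\<lambda>x. x * _"] cong: if_cong)
    finally show "(transpose_mat ?g * (?J * ?g)) $$ (i, j) = ?J $$ (i, j)"
      using ij by (simp add: wpair_self symplectic_form_omega flip: wpair_def)
  qed (use J g in auto)
  then show ?thesis using J g gT by (simp add: Sp_def assoc_mult_mat[of _ "2*n" "2*n" _ "2*n" _ "2*n"])
qed

lemma tv_extends: "extends_matrix V n e f (tv_mat w) (tv w)"
  unfolding extends_matrix_def gen_def[symmetric]
proof (intro conjI allI impI)
  fix j assume j: "j < 2 * n"
  have "(\<Sum>i<2*n. sc (tv_mat w $$ (i, j)) (gen i))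
      = (\<Sum>i<2*n. (if i = j then gen j else 0) + sc (wpair w j) (sc (w i) (gen i)))"
    by (rule sum.cong) (use j in \<open>auto simp: tv_mat_def scale_left_distrib mult.commute\<close>)
  also have "\<dots> = tv w (gen j)"
    using j by (simp add: tv_gen sum.distrib scale_sum_right)
  finally show "tv w (gen j) = (\<Sum>i<2*n. sc (tv_mat w $$ (i, j)) (gen i))" by simp
qed (rule tv_automorphism)

text \<open>If \<open>Suc (Suc k)\<close> were the nilpotency order on \<open>x\<close>, the
  \<open>k\<close>-th power of \<open>dw w\<close> applied to \<open>tv w x - x = 0\<close> would
  leave exactly the last nonzero power.\<close>

lemma invariant_dw:
  assumes "x \<in> Sp_invariants V n e f"
  shows "dw w x = 0"
proof (rule ccontr)
  assume nz: "dw w x \<noteq> 0"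
  have tvx: "tv w x = x"
    using assms tv_mat_Sp tv_extends by (auto simp: Sp_invariants_def)
  define N where "N = (LEAST N. (dw w ^^ N) x = 0)"
  have N: "(dw w ^^ N) x = 0" unfolding N_def using dw_nilpotent by (rule LeastI_ex)
  have "x \<noteq> 0" using nz by (auto simp: lin_0[OF lin_dw])
  then obtain k where k: "N = Suc (Suc k)"
  proof (cases N)
    case (Suc m)
    then show ?thesis using that N nz by (cases m) auto
  qed (use N \<open>x \<noteq> 0\<close> in simp)
  have least: "(dw w ^^ Suc k) x \<noteq> 0"
    using not_less_Least[of "Suc k" "\<lambda>N. (dw w ^^ N) x = 0"] k by (simp add: N_def)
  have "tv w x = (\<Sum>i<N. sc (1 / fact i) ((dw w ^^ i) x))"
    unfolding tv_def by (rule Sum_any.expand_superset) (use N dw_pow_zero_mono in \<open>auto intro: ccontr simp: not_less\<close>)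
  also have "\<dots> = x + (\<Sum>i<Suc k. sc (1 / fact (Suc i)) ((dw w ^^ Suc i) x))"
    unfolding k by (subst sum.lessThan_Suc_shift) simp
  finally have "(\<Sum>i<Suc k. sc (1 / fact (Suc i)) ((dw w ^^ Suc i) x)) = 0" using tvx by simp
  then have "0 = (dw w ^^ k) (\<Sum>i<Suc k. sc (1 / fact (Suc i)) ((dw w ^^ Suc i) x))"
    by (simp only: lin_0[OF lin_funpow[OF lin_dw]])
  also have "\<dots> = (\<Sum>i<Suc k. sc (1 / fact (Suc i)) ((dw w ^^ (k + Suc i)) x))"
    by (simp only: lin_sum[OF lin_funpow[OF lin_dw]] lin_scale[OF lin_funpow[OF lin_dw]] funpow_add o_apply)
  also have "\<dots> = sc (1 / fact (Suc 0)) ((dw w ^^ (k + Suc 0)) x)"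
    by (rule sum_eq_single) (auto simp: k intro!: dw_pow_zero_mono[OF N] simp del: funpow.simps)
  finally show False using least by simp
qed

end

section \<open>The first fundamental theorem\<close>

context symplectic_fermion_algebra
begin

section \<open>Filtration by conformal weight\<close>

definition Vle :: "int \<Rightarrow> 'v set" where
  "Vle w = span {foldr crop xs (vac V) | xs. set xs \<subseteq> modes \<and> int (sum_list (map snd xs)) \<le> w}"

lemma subspace_Vle: "subspace (Vle w)"
  unfolding Vle_def by (rule subspace_span)

lemma Vle_mono: "w \<le> w' \<Longrightarrow> Vle w \<subseteq> Vle w'"
  unfolding Vle_def by (rule span_mono) auto

lemma vac_Vle: "0 \<le> w \<Longrightarrow> vac V \<in> Vle w"
  unfolding Vle_def by (rule span_base) (auto intro!: exI[of _ "[]"])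

lemma Vle_neg: "w < 0 \<Longrightarrow> x \<in> Vle w \<Longrightarrow> x = 0"
proof -
  assume "w < 0" "x \<in> Vle w"
  moreover from \<open>w < 0\<close> have "{foldr crop xs (vac V) | xs. set xs \<subseteq> modes \<and> int (sum_list (map snd xs)) \<le> w} = {}"
    by auto
  ultimately show "x = 0" unfolding Vle_def by (metis span_empty singletonD)
qed

lemma u_neg_Vle:
  assumes "p < 2 * n" "k \<ge> 1" "v \<in> Vle w"
  shows "u p (- int k) v \<in> Vle (w + int k)"
proof (rule lin_span_subset[OF lin_u _ subspace_Vle assms(3)[unfolded Vle_def]])
  fix x assume "x \<in> {foldr crop xs (vac V) | xs. set xs \<subseteq> modes \<and> int (sum_list (map snd xs)) \<le> w}"
  then obtain xs where xs: "x = foldr crop xs (vac V)" "set xs \<subseteq> modes" "int (sum_list (map snd xs)) \<le> w" by blast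
  then have "u p (- int k) x = foldr crop ((p, k) # xs) (vac V)" by (simp add: crop_def)
  moreover have "set ((p, k) # xs) \<subseteq> modes" "int (sum_list (map snd ((p, k) # xs))) \<le> w + int k"
    using xs assms by (auto simp: modes_def)
  ultimately show "u p (- int k) x \<in> Vle (w + int k)"
    unfolding Vle_def by (intro span_base) blast
qed

lemma u_pos_Vle_word:
  assumes "p < 2 * n" "k > 0" "set xs \<subseteq> modes" "int (sum_list (map snd xs)) \<le> w"
  shows "u p k (foldr crop xs (vac V)) \<in> Vle (w - k)"
  using assms(3,4)
proof (induction xs arbitrary: w)
  case Nil
  then show ?case using assms subspace_0[OF subspace_Vle] by (simp add: u_vac)
next
  case (Cons a xs)
  obtain q l where a: "a = (q, l)" "q < 2 * n" "l \<ge> 1" using Cons.prems by (cases a) (auto simp: modes_def)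
  let ?y = "foldr crop xs (vac V)"
  have xs: "set xs \<subseteq> modes" "int (sum_list (map snd xs)) \<le> w - int l" using Cons.prems a by auto
  have "u p k ?y \<in> Vle (w - int l - k)" using Cons.IH xs by blast
  then have 1: "u q (- int l) (u p k ?y) \<in> Vle (w - k)"
    using u_neg_Vle[of q l "u p k ?y" "w - int l - k"] a by simp
  have 2: "sc (if k + (- int l) = 0 then of_int k * omega p q else 0) ?y \<in> Vle (w - k)"
  proof (cases "k = int l")
    case True
    have "?y \<in> Vle (w - int l)" unfolding Vle_def using xs by (intro span_base) blast
    then show ?thesis using True by (intro subspace_scale[OF subspace_Vle]) simp
  qed (use subspace_0[OF subspace_Vle] in simp)
  show ?case
    using subspace_diff[OF subspace_Vle 2 1] u_u[OF assms(1) a(2), of k "- int l" ?y]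
    by (simp only: a(1) crop_def[of "(q, l)"] foldr.simps o_apply case_prod_conv)
qed

lemma u_Vle:
  assumes "p < 2 * n" "v \<in> Vle w"
  shows "u p k v \<in> Vle (w - k)"
proof -
  consider "k < 0" | "k = 0" | "k > 0" by linarith
  then show ?thesis
  proof cases
    case 1
    then show ?thesis using u_neg_Vle[of p "nat (- k)" v w] assms by simp
  next
    case 2
    then show ?thesis using assms subspace_0[OF subspace_Vle] by (simp add: u_mode_0)
  next
    case 3
    show ?thesis
    proof (rule lin_span_subset[OF lin_u _ subspace_Vle assms(2)[unfolded Vle_def]])
      fix x assume "x \<in> {foldr crop xs (vac V) | xs. set xs \<subseteq> modes \<and> int (sum_list (map snd xs)) \<le> w}"
      then obtain xs where "x = foldr crop xs (vac V)" "set xs \<subseteq> modes" "int (sum_list (map snd xs)) \<le> w" by blast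
      then show "u p k x \<in> Vle (w - k)" using u_pos_Vle_word[OF assms(1) 3] by simp
    qed
  qed
qed

lemma u_Vle_zero: "p < 2 * n \<Longrightarrow> v \<in> Vle w \<Longrightarrow> k > w \<Longrightarrow> u p k v = 0"
  using Vle_neg[OF _ u_Vle[of p v w k]] by simp

lemma ex_Vle: "\<exists>w. v \<in> Vle (int w)"
proof (induction v rule: state_induct)
  case vac
  show ?case using vac_Vle[of 0] by (intro exI[of _ 0]) simp
next
  case (add x y)
  then obtain a b where "x \<in> Vle (int a)" "y \<in> Vle (int b)" by blast
  then have "x \<in> Vle (int (a + b))" "y \<in> Vle (int (a + b))"
    using Vle_mono[of "int a" "int (a + b)"] Vle_mono[of "int b" "int (a + b)"] by auto
  then show ?case using subspace_add[OF subspace_Vle] by blast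
next
  case (scale c x)
  then show ?case using subspace_scale[OF subspace_Vle] by blast
next
  case (u p k x)
  then obtain a where "x \<in> Vle (int a)" by blast
  then have "u p (- int k) x \<in> Vle (int (a + k))" using u_Vle[of p x "int a" "- int k"] u by simp
  then show ?case by blast
qed

section \<open>Contractions with the symplectic form and their words\<close>

definition S :: "int \<Rightarrow> int \<Rightarrow> 'v \<Rightarrow> 'v" where
  "S k l v = (\<Sum>p<2*n. sc (- eta p) (u p k (u (conj p) l v)))"

lemma lin_S: "lin (S k l)"
  unfolding S_def[abs_def] by (intro lin_sum_op lin_smult lin_comp[OF lin_u] lin_u)

lemma S_u:
  assumes "r < 2 * n"
  shows "S k l (u r m v) = u r m (S k l v)
     - sc (if l + m = 0 then of_int l else 0) (u r k v) - sc (if k + m = 0 then of_int k else 0) (u r l v)"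
proof -
  let ?x = "\<lambda>p. if l + m = 0 then of_int l * omega (conj p) r else 0"
  let ?y = "\<lambda>p. if k + m = 0 then of_int k * omega p r else 0"
  have cr: "conj r < 2 * n" using conj_less assms by blast
  have "S k l (u r m v) = (\<Sum>p<2*n. sc (- eta p) (u r m (u p k (u (conj p) l v)))
      + (sc (- eta p * ?x p) (u p k v) - sc (- eta p * ?y p) (u (conj p) l v)))"
    unfolding S_def
  proof (rule sum.cong[OF refl])
    fix p assume "p \<in> {..<2*n}"
    then have p: "p < 2 * n" "conj p < 2 * n" using conj_less by auto
    have "u p k (u (conj p) l (u r m v)) = sc (?x p) (u p k v) - (sc (?y p) (u (conj p) l v) - u r m (u p k (u (conj p) l v)))"
      using p assms by (simp only: u_u[of "conj p" r] u_u[of p r] u_diff u_scale)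
    then show "sc (- eta p) (u p k (u (conj p) l (u r m v))) = sc (- eta p) (u r m (u p k (u (conj p) l v)))
      + (sc (- eta p * ?x p) (u p k v) - sc (- eta p * ?y p) (u (conj p) l v))"
      by (simp only: scale_right_diff_distrib scale_scale) (simp add: algebra_simps)
  qed
  also have "\<dots> = u r m (S k l v) + ((\<Sum>p<2*n. sc (- eta p * ?x p) (u p k v)) - (\<Sum>p<2*n. sc (- eta p * ?y p) (u (conj p) l v)))"
    by (simp only: sum.distrib sum_subtractf S_def u_sum u_scale)
  also have "(\<Sum>p<2*n. sc (- eta p * ?x p) (u p k v)) = sc (- eta r * ?x r) (u r k v)"
    by (rule sum_eq_single) (use assms in \<open>auto simp: omega_def conj_conj\<close>)
  also have "(\<Sum>p<2*n. sc (- eta p * ?y p) (u (conj p) l v)) = sc (- eta (conj r) * ?y (conj r)) (u (conj (conj r)) l v)"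
    by (rule sum_eq_single) (use assms cr in \<open>auto simp: omega_def conj_eq_iff\<close>)
  also have "- eta r * ?x r = (if l + m = 0 then - of_int l else 0)"
    using assms eta_sq[of r] by (simp add: omega_def conj_conj eta_conj)
  also have "- eta (conj r) * ?y (conj r) = (if k + m = 0 then of_int k else 0)"
    using assms eta_sq[of r] by (simp add: omega_def conj_conj eta_conj)
  finally show ?thesis using assms by (simp add: conj_conj)
qed

text \<open>The sign from anticommuting the two modes cancels the sign of the skew form.\<close>

lemma S_swap: "k + l \<noteq> 0 \<Longrightarrow> S k l v = S l k v"
proof -
  assume kl: "k + l \<noteq> 0"
  have "S k l v = (\<Sum>p<2*n. sc (- eta (conj p)) (u (conj p) k (u (conj (conj p)) l v)))"
    unfolding S_def by (rule sum_conj[symmetric])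
  also have "\<dots> = S l k v"
    unfolding S_def
  proof (rule sum.cong[OF refl])
    fix p assume "p \<in> {..<2*n}"
    then have p: "p < 2 * n" "conj p < 2 * n" using conj_less by auto
    then show "sc (- eta (conj p)) (u (conj p) k (u (conj (conj p)) l v)) = sc (- eta p) (u p l (u (conj p) k v))"
      using kl by (simp add: conj_conj eta_conj u_u[of "conj p" p] u_zero)
  qed
  finally show ?thesis .
qed

lemma S_S:
  "S k l (S a b v) = S a b (S k l v)
     - sc (if l + a = 0 then of_int l else 0) (S k b v) - sc (if k + a = 0 then of_int k else 0) (S l b v)
     - sc (if l + b = 0 then of_int l else 0) (S a k v) - sc (if k + b = 0 then of_int k else 0) (S a l v)"
proof -
  let ?la = "if l + a = 0 then of_int l else (0::complex)" and ?ka = "if k + a = 0 then of_int k else (0::complex)"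
  let ?lb = "if l + b = 0 then of_int l else (0::complex)" and ?kb = "if k + b = 0 then of_int k else (0::complex)"
  have "S k l (S a b v) = (\<Sum>p<2*n. sc (- eta p) (S k l (u p a (u (conj p) b v))))"
    by (simp only: S_def[of a b v] lin_sum[OF lin_S] lin_scale[OF lin_S])
  also have "\<dots> = (\<Sum>p<2*n. sc (- eta p) (u p a (u (conj p) b (S k l v)))
      - sc ?la (sc (- eta p) (u p k (u (conj p) b v))) - sc ?ka (sc (- eta p) (u p l (u (conj p) b v)))
      - sc ?lb (sc (- eta p) (u p a (u (conj p) k v))) - sc ?kb (sc (- eta p) (u p a (u (conj p) l v))))"
  proof (rule sum.cong[OF refl])
    fix p assume "p \<in> {..<2*n}"
    then have p: "p < 2 * n" "conj p < 2 * n" using conj_less by auto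
    have "S k l (u p a (u (conj p) b v)) = u p a (u (conj p) b (S k l v))
        - sc ?lb (u p a (u (conj p) k v)) - sc ?kb (u p a (u (conj p) l v))
        - sc ?la (u p k (u (conj p) b v)) - sc ?ka (u p l (u (conj p) b v))"
      by (simp only: S_u[OF p(1)] S_u[OF p(2)] u_diff u_scale)
    then show "sc (- eta p) (S k l (u p a (u (conj p) b v))) = sc (- eta p) (u p a (u (conj p) b (S k l v)))
      - sc ?la (sc (- eta p) (u p k (u (conj p) b v))) - sc ?ka (sc (- eta p) (u p l (u (conj p) b v)))
      - sc ?lb (sc (- eta p) (u p a (u (conj p) k v))) - sc ?kb (sc (- eta p) (u p a (u (conj p) l v)))"
      by (simp only: scale_right_diff_distrib scale_left_commute[of "- eta p"]) (simp only: diff_diff_eq ac_simps)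
  qed
  finally show ?thesis by (simp only: sum_subtractf S_def scale_sum_right)
qed

lemma S_Vle: "v \<in> Vle w \<Longrightarrow> S k l v \<in> Vle (w - k - l)"
proof -
  assume v: "v \<in> Vle w"
  have "u p k (u (conj p) l v) \<in> Vle (w - k - l)" if "p < 2 * n" for p
    using u_Vle[OF that u_Vle[OF conj_less[OF that] v], of k l] by (simp add: algebra_simps)
  then show ?thesis
    unfolding S_def by (intro subspace_sum[OF subspace_Vle] subspace_scale[OF subspace_Vle]) auto
qed

text \<open>The variations of the two factors both add up to \<open>wm w k (wm w l v)\<close>, with
  opposite signs.\<close>

lemma dw_S: "dw w (S k l v) = S k l (dw w v)"
proof -
  have "dw w (S k l v) = (\<Sum>p<2*n. sc (- eta p) (u p k (u (conj p) l (dw w v)))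
      + (sc (- w (conj p)) (wm w k (u (conj p) l v)) + sc (w p) (u p k (wm w l v))))"
    unfolding S_def lin_sum[OF lin_dw]
  proof (rule sum.cong[OF refl])
    fix p assume "p \<in> {..<2*n}"
    then have p: "p < 2 * n" "conj p < 2 * n" using conj_less by auto
    have *: "- eta p * wpair w p = - w (conj p)" "- eta p * wpair w (conj p) = w p"
      using p eta_sq[of p] by (simp_all add: wpair_eq conj_conj eta_conj mult.assoc[symmetric])
    have "dw w (sc (- eta p) (u p k (u (conj p) l v))) = sc (- eta p) (u p k (u (conj p) l (dw w v)))
      + (sc (- eta p * wpair w p) (wm w k (u (conj p) l v)) + sc (- eta p * wpair w (conj p)) (u p k (wm w l v)))"
      by (simp only: lin_scale[OF lin_dw] dw_u[OF p(1)] dw_u[OF p(2)] u_add u_scale scale_right_distrib scale_scale ac_simps)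
    then show "dw w (sc (- eta p) (u p k (u (conj p) l v))) = sc (- eta p) (u p k (u (conj p) l (dw w v)))
      + (sc (- w (conj p)) (wm w k (u (conj p) l v)) + sc (w p) (u p k (wm w l v)))"
      unfolding * .
  qed
  also have "\<dots> = S k l (dw w v) + ((\<Sum>p<2*n. sc (- w (conj p)) (wm w k (u (conj p) l v))) + wm w k (wm w l v))"
    by (simp only: sum.distrib S_def wm_def[of w k "wm w l v"])
  also have "(\<Sum>p<2*n. sc (- w (conj p)) (wm w k (u (conj p) l v))) = (\<Sum>p<2*n. sc (- w p) (wm w k (u p l v)))"
    by (rule sum_conj)
  also have "\<dots> = - wm w k (wm w l v)"
    by (simp add: wm_def[of w l v] lin_sum[OF lin_wm] lin_scale[OF lin_wm] sum_negf)
  finally show ?thesis by simp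
qed

definition spairs :: "(nat \<times> nat) set" where "spairs = {(a, b). a \<ge> 1 \<and> b \<ge> 1}"

definition sop :: "nat \<times> nat \<Rightarrow> 'v \<Rightarrow> 'v" where "sop ab = S (- int (fst ab)) (- int (snd ab))"

definition swords :: "nat \<Rightarrow> int \<Rightarrow> (nat \<times> nat) list set" where
  "swords r w = {xs. set xs \<subseteq> spairs \<and> length xs \<le> r \<and> int (sum_list (map (\<lambda>(a, b). a + b) xs)) \<le> w}"

text \<open>The bound \<open>r\<close> on the number of quadratic factors serves the comparison of
  leading terms; together with the bound on the weight it also makes the set of words
  finite.\<close>

definition Qle :: "nat \<Rightarrow> int \<Rightarrow> 'v set" where
  "Qle r w = span ((\<lambda>xs. foldr sop xs (vac V)) ` swords r w)"

lemma subspace_Qle: "subspace (Qle r w)"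
  unfolding Qle_def by (rule subspace_span)

lemma vac_Qle: "0 \<le> w \<Longrightarrow> vac V \<in> Qle r w"
  unfolding Qle_def by (rule span_base) (auto simp: swords_def intro!: image_eqI[of _ _ "[]"])

lemma Qle_mono: "r \<le> r' \<Longrightarrow> w \<le> w' \<Longrightarrow> Qle r w \<subseteq> Qle r' w'"
  unfolding Qle_def by (rule span_mono) (auto simp: swords_def)

lemma sop_Qle:
  assumes "a \<ge> 1" "b \<ge> 1" "y \<in> Qle r w"
  shows "S (- int a) (- int b) y \<in> Qle (Suc r) (w + int a + int b)"
proof (rule lin_span_subset[OF lin_S _ subspace_Qle assms(3)[unfolded Qle_def]])
  fix x assume "x \<in> (\<lambda>xs. foldr sop xs (vac V)) ` swords r w"
  then obtain xs where xs: "x = foldr sop xs (vac V)" "xs \<in> swords r w" by blast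
  have "S (- int a) (- int b) x = foldr sop ((a, b) # xs) (vac V)" by (simp add: xs sop_def)
  moreover have "(a, b) # xs \<in> swords (Suc r) (w + int a + int b)"
    using xs assms by (auto simp: swords_def spairs_def)
  ultimately show "S (- int a) (- int b) x \<in> Qle (Suc r) (w + int a + int b)"
    unfolding Qle_def by (metis (no_types, lifting) image_eqI span_base)
qed

lemma finite_swords: "finite (swords r w)"
proof (rule finite_subset)
  let ?A = "{0..nat w} \<times> {0..nat w}"
  show "finite {xs. set xs \<subseteq> ?A \<and> length xs \<le> r}" by (rule finite_lists_length_le) simp
  show "swords r w \<subseteq> {xs. set xs \<subseteq> ?A \<and> length xs \<le> r}"
  proof safe
    fix xs a b assume xs: "xs \<in> swords r w" "(a, b) \<in> set xs"
    then have "a + b \<le> sum_list (map (\<lambda>(a, b). a + b) xs)"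
      using member_le_sum_list[of "a + b" "map (\<lambda>(a, b). a + b) xs"] by force
    then show "a \<in> {0..nat w}" "b \<in> {0..nat w}" using xs by (auto simp: swords_def)
  qed (auto simp: swords_def)
qed

lemma Qle_Vle: "Qle r w \<subseteq> Vle w"
proof -
  have "foldr sop xs (vac V) \<in> Vle (int (sum_list (map (\<lambda>(a, b). a + b) xs)))" for xs
  proof (induction xs)
    case (Cons x xs)
    then show ?case
      using S_Vle[OF Cons, of "- int (fst x)" "- int (snd x)"] by (simp add: sop_def case_prod_beta algebra_simps)
  qed (simp add: vac_Vle)
  then have "foldr sop xs (vac V) \<in> Vle w" if "xs \<in> swords r w" for xs
    using that Vle_mono by (auto simp: swords_def)
  then show ?thesis unfolding Qle_def by (intro span_minimal subspace_Vle) auto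
qed

lemma ip_u:
  assumes "p < 2 * n" "k \<ge> 1"
  shows "ip (u p (int k) x) y = - (of_nat k * eta p * ip x (u (conj p) (- int k) y))"
proof -
  have m: "(conj p, k) \<in> modes" using assms conj_less by (auto simp: modes_def)
  have "u p (int k) x = sc (- (of_nat k * eta p)) (anop (conj p, k) x)"
    using assms eta_sq[of p] by (simp add: anop_def conj_conj eta_conj)
  then have "ip (u p (int k) x) y = - (of_nat k * eta p) * ip (anop (conj p, k) x) y"
    by (simp only: ip_scale_left)
  then show ?thesis using m by (simp add: ip_an crop_def)
qed

lemma ip_S:
  assumes "k \<ge> 1" "l \<ge> 1"
  shows "ip (S (int k) (int l) x) y = - (of_nat k * of_nat l * ip x (S (- int l) (- int k) y))"
proof -
  have "ip (S (int k) (int l) x) y = (\<Sum>p<2*n. of_nat k * of_nat l * (eta p * ip x (u p (- int l) (u (conj p) (- int k) y))))"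
    unfolding S_def ip_sum_left
  proof (rule sum.cong[OF refl])
    fix p assume "p \<in> {..<2*n}"
    then have p: "p < 2 * n" "conj p < 2 * n" using conj_less by auto
    show "ip (sc (- eta p) (u p (int k) (u (conj p) (int l) x))) y
       = of_nat k * of_nat l * (eta p * ip x (u p (- int l) (u (conj p) (- int k) y)))"
      unfolding ip_scale_left ip_u[OF p(1) assms(1)] ip_u[OF p(2) assms(2)] conj_conj[OF p(1)] eta_conj[OF p(1)]
    proof -
      let ?I = "ip x (u p (- int l) (u (conj p) (- int k) y))"
      have "- eta p * - (of_nat k * eta p * - (of_nat l * - eta p * ?I)) = eta p * eta p * (of_nat k * of_nat l * (eta p * ?I))"
        by (simp add: mult_ac)
      then show "- eta p * - (of_nat k * eta p * - (of_nat l * - eta p * ?I)) = of_nat k * of_nat l * (eta p * ?I)"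
        by (simp add: eta_sq)
    qed
  qed
  moreover have "cnj (eta p) = eta p" for p by (simp add: eta_def)
  ultimately show ?thesis
    by (simp add: S_def ip_sum_right ip_scale_right ip_neg_right sum_distrib_left sum_negf)
qed

text \<open>Summing the squared norms of all \<open>x\<^sub>p\<^sub>r = \<Sum>k. u\<^sub>p(-k) \<partial>\<^sub>r(k) z\<close> over \<open>p, r\<close> and using
  invariance to replace one of the two factors \<open>x\<^sub>p\<^sub>r\<close> leaves, up to contractions of \<open>z\<close> by the
  quadratic invariants, minus the expectation value of the number operator.\<close>

lemma invariant_without_contractions:
  assumes z: "z \<in> Vle (int W)" and inv: "\<And>w. dw w z = 0"
    and S0: "\<And>k l. k \<ge> 1 \<Longrightarrow> l \<ge> 1 \<Longrightarrow> S (int k) (int l) z = 0"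
  shows "z = sc (eps z) (vac V)"
proof -
  \<comment> \<open>\<open>dw w z\<close> is a quadratic form in \<open>w\<close> with coefficients
    \<open>Z p q\<close>; its vanishing for all \<open>w\<close> makes \<open>Z\<close>
    skew.\<close>
  define Z where "Z p q = (\<Sum>i<W. sc (1 / of_nat (Suc i)) (u p (- 1 - int i) (u q (1 + int i) z)))" for p q
  \<comment> \<open>\<open>E p r\<close> replaces a factor with index \<open>r\<close> in
    \<open>z\<close> by one with index \<open>p\<close>, like a matrix unit of gl(2n); the skewness
    of \<open>Z\<close> becomes the symmetry \<open>Eskew\<close>.\<close>
  define E where "E p r = (\<Sum>i<W. crop (p, Suc i) (anop (r, Suc i) z))" for p r
  have dwZ: "dw w z = (\<Sum>p<2*n. \<Sum>q<2*n. sc (w p * w q) (Z p q))" for w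
  proof -
    have "wm w (1 + int i) z = 0" if "\<not> i < W" for i
      using that u_Vle_zero[OF _ z, of _ "1 + int i"] by (auto simp: wm_def intro: sum.neutral)
    then have "dw w z = (\<Sum>i<W. sc (1 / of_nat (Suc i)) (wm w (-1 - int i) (wm w (1 + int i) z)))"
      unfolding dw_def bil_def by (intro Sum_any.expand_superset) (auto simp: lin_0[OF lin_wm] intro: ccontr)
    also have "\<dots> = (\<Sum>i<W. \<Sum>p<2*n. \<Sum>q<2*n. sc (w p * w q) (sc (1 / of_nat (Suc i)) (u p (- 1 - int i) (u q (1 + int i) z))))"
      by (simp add: wm_def u_sum u_scale scale_sum_right mult_ac)
    also have "\<dots> = (\<Sum>p<2*n. \<Sum>q<2*n. \<Sum>i<W. sc (w p * w q) (sc (1 / of_nat (Suc i)) (u p (- 1 - int i) (u q (1 + int i) z))))"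
      by (subst sum.swap, rule sum.cong[OF refl], rule sum.swap)
    finally show ?thesis by (simp only: Z_def scale_sum_right)
  qed
  \<comment> \<open>Polarization: \<open>w\<close> is the indicator function of a set, used below
    with one or two elements.\<close>
  have dwA: "(\<Sum>p\<in>A. \<Sum>q\<in>A. Z p q) = 0" if "A \<subseteq> {..<2*n}" for A
  proof -
    let ?w = "\<lambda>p. if p \<in> A then 1 else (0::complex)"
    have i: "{..<2*n} \<inter> A = A" using that by blast
    have "dw ?w z = (\<Sum>p<2*n. if p \<in> A then (\<Sum>q<2*n. if q \<in> A then Z p q else 0) else 0)"
      unfolding dwZ by (intro sum.cong refl) (auto intro!: sum.cong)
    also have "\<dots> = (\<Sum>p\<in>A. \<Sum>q\<in>A. Z p q)"
      by (simp add: sum.inter_restrict[symmetric] i)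
    finally show ?thesis using inv by simp
  qed
  have Zskew: "Z p q = - Z q p" if "p < 2 * n" "q < 2 * n" for p q
  proof -
    have "Z p p = 0" "Z q q = 0" using dwA[of "{p}"] dwA[of "{q}"] that by simp_all
    moreover have "p \<noteq> q \<Longrightarrow> Z p p + Z p q + (Z q p + Z q q) = 0"
      using dwA[of "{p, q}"] that by simp
    ultimately show ?thesis by (cases "p = q") (auto simp: eq_neg_iff_add_eq_0)
  qed
  have EZ: "E p r = sc (eta r) (Z p (conj r))" if "r < 2 * n" for p r
    unfolding E_def Z_def scale_sum_right
    by (rule sum.cong) (simp_all add: crop_def anop_def u_scale add.commute)
  have Eskew: "E p r = sc (eta p * eta r) (E (conj r) (conj p))" if "p < 2 * n" "r < 2 * n" for p r
  proof -
    have "E p r = sc (- eta r) (Z (conj r) p)"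
      using that Zskew[of p "conj r"] by (simp add: EZ conj_less)
    also have "\<dots> = sc (eta p * eta r) (E (conj r) (conj p))"
      using that eta_sq[of p] EZ[of "conj p" "conj r"] conj_less
      by (simp add: conj_conj eta_conj mult.assoc[symmetric] mult.commute)
    finally show ?thesis .
  qed
  let ?a = "\<lambda>r i. anop (r, Suc i) z"
  have Re_cnj: "cnj (eta p) = eta p" for p by (simp add: eta_def)
  have contr: "(\<Sum>p<2*n. sc (eta p) (anop (p, Suc i) (anop (conj p, Suc j) z))) = 0" for i j
  proof -
    have "(\<Sum>p<2*n. sc (eta p) (anop (p, Suc i) (anop (conj p, Suc j) z)))
      = (\<Sum>p<2*n. sc (eta (conj p) / (of_nat (Suc i) * of_nat (Suc j))) (u (conj p) (int (Suc i)) (u (conj (conj p)) (int (Suc j)) z)))"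
    proof (rule sum.cong[OF refl])
      fix p assume "p \<in> {..<2*n}"
      have "eta p * (eta p / of_nat (Suc i) * (eta (conj p) / of_nat (Suc j))) = eta (conj p) / (of_nat (Suc i) * of_nat (Suc j))"
        using eta_sq[of p] by (simp add: mult.assoc[symmetric])
      then show "sc (eta p) (anop (p, Suc i) (anop (conj p, Suc j) z))
         = sc (eta (conj p) / (of_nat (Suc i) * of_nat (Suc j))) (u (conj p) (int (Suc i)) (u (conj (conj p)) (int (Suc j)) z))"
        unfolding anop_def case_prod_conv u_scale scale_scale by (simp only:)
    qed
    also have "\<dots> = (\<Sum>q<2*n. sc (eta q / (of_nat (Suc i) * of_nat (Suc j))) (u q (int (Suc i)) (u (conj q) (int (Suc j)) z)))"
      by (rule sum_conj[of "\<lambda>q. sc (eta q / (of_nat (Suc i) * of_nat (Suc j))) (u q (int (Suc i)) (u (conj q) (int (Suc j)) z))"])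
    also have "\<dots> = sc (- 1 / (of_nat (Suc i) * of_nat (Suc j))) (S (int (Suc i)) (int (Suc j)) z)"
      unfolding S_def scale_sum_right by (rule sum.cong[OF refl]) simp
    finally show ?thesis using S0[of "Suc i" "Suc j"] by simp
  qed
  \<comment> \<open>Moving the creation operator from the left argument to an annihilator on the
    right gives a contraction and a term in which both arguments have lost two factors.\<close>
  have T: "ip (crop (p, Suc i) (?a r i)) (crop (conj r, Suc j) (anop (conj p, Suc j) z))
     = (if p = conj r \<and> i = j then ip (?a r i) (?a r i) else 0)
       - ip (anop (conj r, Suc j) (?a r i)) (anop (p, Suc i) (anop (conj p, Suc j) z))"
    if "p < 2 * n" "r < 2 * n" for p r i j
  proof -
    have m: "(p, Suc i) \<in> modes" "(conj r, Suc j) \<in> modes" using that conj_less by (auto simp: modes_def)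
    then have "ip (crop (p, Suc i) (?a r i)) (crop (conj r, Suc j) (anop (conj p, Suc j) z))
      = ip (?a r i) ((if (p, Suc i) = (conj r, Suc j) then anop (conj p, Suc j) z else 0)
          - crop (conj r, Suc j) (anop (p, Suc i) (anop (conj p, Suc j) z)))"
      by (simp only: ip_cr an_cr)
    also have "\<dots> = (if p = conj r \<and> i = j then ip (?a r i) (?a r i) else 0)
       - ip (anop (conj r, Suc j) (?a r i)) (anop (p, Suc i) (anop (conj p, Suc j) z))"
      using that m by (auto simp: ip_diff_right ip_an ip_neg_right conj_conj ip_0_right)
    finally show ?thesis .
  qed
  \<comment> \<open>One of the two factors is rewritten by \<open>Eskew\<close>. Summation over
    \<open>p\<close> then removes the terms with two annihilators by \<open>contr\<close>, and the
    contractions come with the sign of \<open>eta p * eta r\<close> at \<open>p = conj r\<close>,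
    which is -1.\<close>
  have "(\<Sum>p<2*n. \<Sum>r<2*n. ip (E p r) (E p r)) = (\<Sum>p<2*n. \<Sum>r<2*n. \<Sum>i<W. \<Sum>j<W. eta p * eta r *
      ((if p = conj r \<and> i = j then ip (?a r i) (?a r i) else 0)
       - ip (anop (conj r, Suc j) (?a r i)) (anop (p, Suc i) (anop (conj p, Suc j) z))))"
  proof (intro sum.cong refl)
    fix p r assume "p \<in> {..<2*n}" "r \<in> {..<2*n}"
    then have pr: "p < 2 * n" "r < 2 * n" by auto
    have "ip (E p r) (E p r) = ip (E p r) (sc (eta p * eta r) (E (conj r) (conj p)))"
      using Eskew[OF pr] by simp
    also have "\<dots> = eta p * eta r * ip (E p r) (E (conj r) (conj p))"
      by (simp add: ip_scale_right Re_cnj)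
    also have "ip (E p r) (E (conj r) (conj p))
       = (\<Sum>i<W. \<Sum>j<W. ip (crop (p, Suc i) (?a r i)) (crop (conj r, Suc j) (anop (conj p, Suc j) z)))"
      unfolding E_def by (simp only: ip_sum_left) (simp only: ip_sum_right)
    also have "eta p * eta r * \<dots> = (\<Sum>i<W. \<Sum>j<W. eta p * eta r *
      ((if p = conj r \<and> i = j then ip (?a r i) (?a r i) else 0)
       - ip (anop (conj r, Suc j) (?a r i)) (anop (p, Suc i) (anop (conj p, Suc j) z))))"
      using pr by (simp only: T sum_distrib_left)
    finally show "ip (E p r) (E p r) = (\<Sum>i<W. \<Sum>j<W. eta p * eta r *
      ((if p = conj r \<and> i = j then ip (?a r i) (?a r i) else 0)
       - ip (anop (conj r, Suc j) (?a r i)) (anop (p, Suc i) (anop (conj p, Suc j) z))))" .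
  qed
  also have "\<dots> = (\<Sum>r<2*n. \<Sum>i<W. \<Sum>j<W. \<Sum>p<2*n. eta p * eta r *
      ((if p = conj r \<and> i = j then ip (?a r i) (?a r i) else 0)
       - ip (anop (conj r, Suc j) (?a r i)) (anop (p, Suc i) (anop (conj p, Suc j) z))))"
    by (subst sum.swap, rule sum.cong[OF refl], subst sum.swap, rule sum.cong[OF refl], rule sum.swap)
  also have "\<dots> = (\<Sum>r<2*n. \<Sum>i<W. \<Sum>j<W. if i = j then - ip (?a r i) (?a r i) else 0)"
  proof (intro sum.cong refl)
    fix r i j assume "r \<in> {..<2*n}"
    then have r: "r < 2 * n" "conj r < 2 * n" using conj_less by auto
    let ?x = "anop (conj r, Suc j) (?a r i)"
    have "(\<Sum>p<2*n. eta p * eta r *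
      ((if p = conj r \<and> i = j then ip (?a r i) (?a r i) else 0) - ip ?x (anop (p, Suc i) (anop (conj p, Suc j) z))))
      = (\<Sum>p<2*n. if p = conj r then (if i = j then eta (conj r) * eta r * ip (?a r i) (?a r i) else 0) else 0)
        - eta r * ip ?x (\<Sum>p<2*n. sc (eta p) (anop (p, Suc i) (anop (conj p, Suc j) z)))"
      unfolding ip_sum_right ip_scale_right Re_cnj sum_distrib_left sum_subtractf[symmetric]
      by (rule sum.cong[OF refl]) (auto simp: algebra_simps)
    also have "\<dots> = (if i = j then - ip (?a r i) (?a r i) else 0)"
      using r eta_sq[of r] by (simp add: contr ip_0_right eta_conj)
    finally show "(\<Sum>p<2*n. eta p * eta r *
      ((if p = conj r \<and> i = j then ip (?a r i) (?a r i) else 0) - ip ?x (anop (p, Suc i) (anop (conj p, Suc j) z))))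
      = (if i = j then - ip (?a r i) (?a r i) else 0)" .
  qed
  also have "\<dots> = - (\<Sum>r<2*n. \<Sum>i<W. ip (?a r i) (?a r i))"
    by (simp add: sum_negf)
  finally have "Re (\<Sum>p<2*n. \<Sum>r<2*n. ip (E p r) (E p r)) = - Re (\<Sum>r<2*n. \<Sum>i<W. ip (?a r i) (?a r i))"
    by simp
  \<comment> \<open>One sum of squared norms equals the negative of another, so both vanish.\<close>
  then have tot: "(\<Sum>r<2*n. \<Sum>i<W. Re (ip (?a r i) (?a r i))) = - (\<Sum>p<2*n. \<Sum>r<2*n. Re (ip (E p r) (E p r)))"
    by simp
  have "(\<Sum>p<2*n. \<Sum>r<2*n. Re (ip (E p r) (E p r))) \<ge> 0"
    by (intro sum_nonneg ip_self_nonneg)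
  moreover have nn: "(\<Sum>i<W. Re (ip (?a r i) (?a r i))) \<ge> 0" for r
    by (intro sum_nonneg ip_self_nonneg)
  moreover have "(\<Sum>r<2*n. \<Sum>i<W. Re (ip (?a r i) (?a r i))) \<ge> 0"
    by (intro sum_nonneg ip_self_nonneg)
  ultimately have "(\<Sum>r<2*n. \<Sum>i<W. Re (ip (?a r i) (?a r i))) = 0"
    using tot by linarith
  then have "\<forall>r<2*n. (\<Sum>i<W. Re (ip (?a r i) (?a r i))) = 0"
    using nn by (simp add: sum_nonneg_eq_0_iff)
  then have "\<forall>r<2*n. \<forall>i<W. Re (ip (?a r i) (?a r i)) = 0"
    using ip_self_nonneg by (simp add: sum_nonneg_eq_0_iff)
  then have a0: "anop (r, Suc i) z = 0" if "r < 2 * n" "i < W" for r i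
    using that ip_self_zero by blast
  show ?thesis
  proof (rule an_all_zero)
    fix a assume "a \<in> modes"
    then obtain r k where a: "a = (r, k)" "r < 2 * n" "k \<ge> 1" by (auto simp: modes_def)
    show "anop a z = 0"
    proof (cases "k \<le> W")
      case True
      then show ?thesis using a0[of r "k - 1"] a by simp
    next
      case False
      then show ?thesis using a u_Vle_zero[OF conj_less z, of r "int k"] by (simp add: anop_def)
    qed
  qed
qed

text \<open>A contraction of \<open>z\<close> has smaller weight, stays invariant and, by
  adjointness, stays orthogonal to all words; by induction it is zero. What remains is a multiple of
  the vacuum, which is itself a word.\<close>

lemma invariant_orthogonal_zero:
  assumes "z \<in> Vle (int W)" "\<And>w. dw w z = 0" "\<And>y. y \<in> Qle W (int W) \<Longrightarrow> ip z y = 0"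
  shows "z = 0"
  using assms
proof (induction W arbitrary: z rule: less_induct)
  case (less W)
  have "S (int k) (int l) z = 0" if kl: "k \<ge> 1" "l \<ge> 1" for k l
  proof (cases "int W - int k - int l < 0")
    case True
    then show ?thesis using Vle_neg S_Vle[OF less.prems(1), of "int k" "int l"] by blast
  next
    case False
    define W' where "W' = W - k - l"
    have W': "int W' = int W - int k - int l" "W' < W" using False kl by (auto simp: W'_def)
    show ?thesis
    proof (rule less.IH[OF W'(2)])
      show "S (int k) (int l) z \<in> Vle (int W')" using S_Vle[OF less.prems(1)] W' by simp
      show "dw w (S (int k) (int l) z) = 0" for w by (simp add: dw_S less.prems lin_0[OF lin_S])
      fix y assume "y \<in> Qle W' (int W')"
      then have "S (- int l) (- int k) y \<in> Qle (Suc W') (int W' + int l + int k)"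
        using sop_Qle kl by blast
      also have "\<dots> \<subseteq> Qle W (int W)" using W' by (intro Qle_mono) auto
      finally show "ip (S (int k) (int l) z) y = 0" using kl less.prems(3) by (simp add: ip_S)
    qed
  qed
  then have z: "z = sc (eps z) (vac V)"
    using invariant_without_contractions less.prems(1,2) by blast
  have "ip z (vac V) = 0" using less.prems(3) vac_Qle by simp
  then have "ip z (sc (eps z) (vac V)) = 0" by (simp only: ip_scale_right mult_zero_right)
  then have "ip z z = 0" using z by simp
  then show ?case using ip_self_zero by simp
qed

text \<open>The words are invariant, so the part of \<open>x\<close> orthogonal to them is invariant
  as well and vanishes. The length bound \<open>W\<close> is harmless because every letter has
  weight at least 2.\<close>

theorem first_fundamental_theorem:
  assumes x: "x \<in> Vle (int W)" and inv: "\<And>w. dw w x = 0"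
  shows "x \<in> Qle W (int W)"
proof -
  let ?B = "(\<lambda>xs. foldr sop xs (vac V)) ` swords W (int W)"
  have inv_word: "dw w (foldr sop xs (vac V)) = 0" for w xs
    by (induction xs) (simp_all add: dw_vac sop_def dw_S lin_0[OF lin_S])
  obtain y where y: "y \<in> span ?B" "\<forall>b\<in>?B. ip (x - y) b = 0"
    using orthogonal_projection[of ?B x] finite_swords by auto
  have inv_y: "dw w y = 0" for w
    by (rule lin_eq_on_span[OF lin_dw lin_zero _ y(1)]) (auto simp: inv_word)
  have yQ: "y \<in> Qle W (int W)" using y by (simp add: Qle_def)
  have "x - y = 0"
  proof (rule invariant_orthogonal_zero)
    show "x - y \<in> Vle (int W)"
      using x yQ Qle_Vle by (intro subspace_diff[OF subspace_Vle]) auto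
    show "dw w (x - y) = 0" for w by (simp add: lin_diff[OF lin_dw] inv inv_y)
    fix q assume "q \<in> Qle W (int W)"
    then have "q \<in> span ?B" by (simp only: Qle_def)
    then show "ip (x - y) q = 0" by (rule ip_span_zero[rotated]) (use y(2) in blast)
  qed
  then show ?thesis using yQ by simp
qed

end

section \<open>The quadratic generators\<close>

context symplectic_fermion_algebra
begin

text \<open>Normalized by divided derivatives, whence the factor \<open>fact k / 2\<close> in
  \<open>j_gen_sst\<close>.\<close>

abbreviation sst :: "nat \<Rightarrow> 'v" where "sst k \<equiv> S (-1) (-1 - int k) (vac V)"

lemma D_pow_creation: "u p (-1 - int k) (vac V) = sc (1 / fact k) ((D ^^ k) (gen p))"
  using nprod_deriv_pow[of k "gen p" "vac V"] by (simp add: u_def creation)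

lemma D_pow_nprod:
  "nprod V N ((D ^^ k) a) v = sc ((-1) ^ k * fact k * (of_int N gchoose k)) (nprod V (N - int k) a v)"
proof (induction k arbitrary: N)
  case (Suc k)
  have "nprod V N ((D ^^ Suc k) a) v = sc (- of_int N) (nprod V (N - 1) ((D ^^ k) a) v)"
    by (simp add: deriv_nprod)
  also have "\<dots> = sc (- of_int N * ((-1) ^ k * fact k * (of_int (N - 1) gchoose k))) (nprod V (N - int (Suc k)) a v)"
    by (simp add: Suc.IH diff_diff_eq)
  also have "- of_int N * ((-1) ^ k * fact k * (of_int (N - 1) gchoose k))
      = ((-1) ^ Suc k * fact (Suc k) * (of_int N gchoose Suc k) :: complex)"
  proof -
    have "of_nat (Suc k) * (of_int N gchoose Suc k) = (of_int N * ((of_int N - 1) gchoose k) :: complex)"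
      by (rule gbinomial_absorption)
    then have "fact k * (of_int N * (of_int (N - 1) gchoose k)) = fact (Suc k) * (of_int N gchoose Suc k :: complex)"
      by (simp add: mult_ac)
    then show ?thesis by (simp add: mult_ac)
  qed
  finally show ?case .
qed simp

text \<open>The \<open>N\<close>-th mode of the \<open>k\<close>-th divided derivative of a field is
  \<open>cb k N\<close> times the mode of index \<open>N - k\<close> of the field.\<close>

definition cb :: "nat \<Rightarrow> int \<Rightarrow> complex" where "cb k N = (-1) ^ k * (of_int N gchoose k)"

lemma nprod_u_creation:
  "nprod V N (u p (-1 - int k) (vac V)) v = sc (cb k N) (u p (N - int k) v)"
  unfolding D_pow_creation by (simp add: nprod_scale_left D_pow_nprod cb_def u_def)

text \<open>All terms are normally ordered: annihilation operators stand to the right.\<close>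

lemma jop_eventually:
  "\<exists>B. \<forall>N\<ge>B. nprod V M (sst k) v =
     (\<Sum>j<N. sc (cb k (M + int j)) (S (-1 - int j) (M + int j - int k) v)
       + sc (cb k (M - 1 - int j)) (S (M - 1 - int j - int k) (int j) v))"
proof -
  let ?y = "\<lambda>p. u (conj p) (-1 - int k) (vac V)"
  have ex: "\<exists>B. \<forall>N\<ge>B. nprod V M (u p (-1) (?y p)) v =
     (\<Sum>j<N. sc (cb k (M + int j)) (u p (-1 - int j) (u (conj p) (M + int j - int k) v))
       - sc (cb k (M - 1 - int j)) (u (conj p) (M - 1 - int j - int k) (u p (int j) v)))"
    if p: "p < 2 * n" for p
  proof -
    have odd: "?y p \<in> odd_part V" using u_even[OF conj_less[OF p] vac_even] .
    have c: "(-1) ^ j * (of_int (-1) gchoose j) = (1 :: complex)" for j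
    proof -
      have "(of_int (-1) gchoose j) = (-1::complex) ^ j * ((1 + of_nat j - 1) gchoose j)"
        using gbinomial_minus[of "1::complex" j] by simp
      also have "((1 + of_nat j - 1) gchoose j) = (1::complex)" by (simp flip: binomial_gbinomial)
      finally show ?thesis by (simp flip: power_mult_distrib)
    qed
    obtain B where B: "\<forall>N\<ge>B. nprod V M (nprod V (-1) (gen p) (?y p)) v
     = (\<Sum>j<N. sc ((-1) ^ j * (of_int (-1) gchoose j))
                (nprod V ((-1) - int j) (gen p) (nprod V (M + int j) (?y p) v)
                  - sc ((- 1) powi (-1) * (- 1)) (nprod V ((-1) + M - int j) (?y p) (nprod V (int j) (gen p) v))))"
      using associator_odd[OF gen_odd[OF p], of "-1" "?y p" M "-1" v] odd by auto
    have i: "-1 + M - int j = M - 1 - int j" for j by simp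
    show ?thesis
      using B unfolding c i nprod_u_creation by (intro exI[of _ B]) (simp add: u_def nprod_scale_right)
  qed
  have "\<forall>p. \<exists>B. p < 2 * n \<longrightarrow> (\<forall>N\<ge>B. nprod V M (u p (-1) (?y p)) v =
     (\<Sum>j<N. sc (cb k (M + int j)) (u p (-1 - int j) (u (conj p) (M + int j - int k) v))
       - sc (cb k (M - 1 - int j)) (u (conj p) (M - 1 - int j - int k) (u p (int j) v))))"
    using ex by blast
  from choice[OF this] obtain B where B: "\<forall>p. p < 2 * n \<longrightarrow> (\<forall>N\<ge>B p. nprod V M (u p (-1) (?y p)) v =
     (\<Sum>j<N. sc (cb k (M + int j)) (u p (-1 - int j) (u (conj p) (M + int j - int k) v))
       - sc (cb k (M - 1 - int j)) (u (conj p) (M - 1 - int j - int k) (u p (int j) v))))" ..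
  have "nprod V M (sst k) v =
     (\<Sum>j<N. sc (cb k (M + int j)) (S (-1 - int j) (M + int j - int k) v)
       + sc (cb k (M - 1 - int j)) (S (M - 1 - int j - int k) (int j) v))" if N: "N \<ge> (\<Sum>p<2*n. B p)" for N
  proof -
    have "N \<ge> B p" if "p < 2 * n" for p
      using member_le_sum[of p "{..<2*n}" B] that N by simp
    then have "nprod V M (sst k) v = (\<Sum>p<2*n. sc (- eta p) (\<Sum>j<N. sc (cb k (M + int j)) (u p (-1 - int j) (u (conj p) (M + int j - int k) v))
       - sc (cb k (M - 1 - int j)) (u (conj p) (M - 1 - int j - int k) (u p (int j) v))))"
      unfolding S_def nprod_sum_left nprod_scale_left
      by (intro sum.cong refl) (use B in auto)
    also have "\<dots> = (\<Sum>j<N. sc (cb k (M + int j)) (S (-1 - int j) (M + int j - int k) v)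
       - sc (cb k (M - 1 - int j)) (\<Sum>p<2*n. sc (- eta p) (u (conj p) (M - 1 - int j - int k) (u p (int j) v))))"
      unfolding scale_sum_right S_def
      by (subst sum.swap, rule sum.cong[OF refl])
        (simp only: scale_right_diff_distrib sum_subtractf scale_sum_right scale_scale mult.commute)
    also have "\<dots> = (\<Sum>j<N. sc (cb k (M + int j)) (S (-1 - int j) (M + int j - int k) v)
       + sc (cb k (M - 1 - int j)) (S (M - 1 - int j - int k) (int j) v))"
    proof (rule sum.cong[OF refl])
      fix j
      let ?b = "M - 1 - int j - int k"
      have "(\<Sum>p<2*n. sc (- eta p) (u (conj p) ?b (u p (int j) v)))
        = (\<Sum>p<2*n. sc (- eta (conj p)) (u (conj (conj p)) ?b (u (conj p) (int j) v)))"
        by (rule sum_conj[symmetric])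
      also have "\<dots> = - S ?b (int j) v"
        unfolding S_def sum_negf[symmetric]
        by (rule sum.cong[OF refl]) (simp add: conj_conj eta_conj)
      finally show "sc (cb k (M + int j)) (S (-1 - int j) (M + int j - int k) v)
         - sc (cb k (M - 1 - int j)) (\<Sum>p<2*n. sc (- eta p) (u (conj p) ?b (u p (int j) v)))
        = sc (cb k (M + int j)) (S (-1 - int j) (M + int j - int k) v)
         + sc (cb k (M - 1 - int j)) (S ?b (int j) v)" by simp
    qed
    finally show ?thesis .
  qed
  then show ?thesis by blast
qed

definition gam :: "nat \<Rightarrow> int \<Rightarrow> int \<Rightarrow> complex" where
  "gam k M m = of_int m * (cb k (int k - m) + cb k (M - 1 + m))"

text \<open>A commutator of a quadratic operator with a mode is linear in the modes; the mode index
  is shifted and the coefficient \<open>gam\<close> is polynomial in \<open>m\<close>.\<close>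

lemma jop_u:
  assumes r: "r < 2 * n"
  shows "nprod V M (sst k) (u r m v) = u r m (nprod V M (sst k) v) + sc (gam k M m) (u r (M - 1 - int k + m) v)"
proof -
  let ?F = "\<lambda>v j. sc (cb k (M + int j)) (S (-1 - int j) (M + int j - int k) v)
       + sc (cb k (M - 1 - int j)) (S (M - 1 - int j - int k) (int j) v)"
  obtain B1 where B1: "\<forall>N\<ge>B1. nprod V M (sst k) v = (\<Sum>j<N. ?F v j)" using jop_eventually by blast
  obtain B2 where B2: "\<forall>N\<ge>B2. nprod V M (sst k) (u r m v) = (\<Sum>j<N. ?F (u r m v) j)" using jop_eventually by blast
  define N where "N = B1 + B2 + nat \<bar>m\<bar> + nat \<bar>M\<bar> + k + 5"
  let ?s = "M - 1 - int k + m"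
  \<comment> \<open>Four contractions, each at a single index. The indices of \<open>?A\<close> and
    \<open>?D\<close> add up to -1, and so do those of \<open>?B\<close> and \<open>?C\<close>;
    hence exactly one of each pair is nonnegative and occurs in the sum.\<close>
  let ?A = "\<lambda>j. if int j = int k - M - m then sc (of_int m * cb k (int k - m)) (u r ?s v) else 0"
  let ?B = "\<lambda>j. if int j = m - 1 then sc (of_int m * cb k (M - 1 + m)) (u r ?s v) else 0"
  let ?C = "\<lambda>j. if int j = - m then sc (of_int m * cb k (M - 1 + m)) (u r ?s v) else 0"
  let ?D = "\<lambda>j. if int j = ?s then sc (of_int m * cb k (int k - m)) (u r ?s v) else 0"
  have F: "?F (u r m v) j = u r m (?F v j) + ((?A j + ?B j) + (?C j + ?D j))" for j
  proof -
    have a: "- sc (cb k (M + int j)) (sc (if M + int j - int k + m = 0 then of_int (M + int j - int k) else 0) (u r (-1 - int j) v)) = ?A j"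
    proof (cases "int j = int k - M - m")
      case True
      then have "M + int j - int k + m = 0" "M + int j - int k = - m" "M + int j = int k - m" "-1 - int j = ?s" by auto
      then show ?thesis using True by (simp only: if_True) (simp add: mult.commute)
    qed auto
    have b: "- sc (cb k (M + int j)) (sc (if -1 - int j + m = 0 then of_int (-1 - int j) else 0) (u r (M + int j - int k) v)) = ?B j"
    proof (cases "int j = m - 1")
      case True
      then have "-1 - int j + m = 0" "-1 - int j = - m" "M + int j = M - 1 + m" "M + int j - int k = ?s" by auto
      then show ?thesis using True by (simp only: if_True) (simp add: mult.commute)
    qed auto
    have c: "- sc (cb k (M - 1 - int j)) (sc (if int j + m = 0 then of_int (int j) else 0) (u r (M - 1 - int j - int k) v)) = ?C j"
    proof (cases "int j = - m")
      case True
      then have "int j + m = 0" "M - 1 - int j = M - 1 + m" "M - 1 - int j - int k = ?s" by auto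
      then show ?thesis using True by (simp only: if_True) (simp add: mult.commute)
    qed auto
    have d: "- sc (cb k (M - 1 - int j)) (sc (if M - 1 - int j - int k + m = 0 then of_int (M - 1 - int j - int k) else 0) (u r (int j) v)) = ?D j"
    proof (cases "int j = ?s")
      case True
      then have "M - 1 - int j - int k + m = 0" "M - 1 - int j - int k = - m" "M - 1 - int j = int k - m" by auto
      then show ?thesis using True by (simp only: if_True) (simp add: mult.commute)
    qed auto
    show ?thesis
      unfolding S_u[OF r] a[symmetric] b[symmetric] c[symmetric] d[symmetric]
      by (simp only: scale_right_diff_distrib u_add u_scale) (simp add: algebra_simps)
  qed
  have delta: "(\<Sum>j<N. if int j = x then y else 0) = (if x \<ge> 0 then y else 0)" if "x < int N" for x :: int and y :: 'v
  proof (cases "x \<ge> 0")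
    case True
    have "(\<Sum>j<N. if int j = x then y else 0) = (if int (nat x) = x then y else 0)"
      by (rule sum_eq_single) (use True that in auto)
    then show ?thesis using True by simp
  qed (auto intro!: sum.neutral)
  have "nprod V M (sst k) (u r m v) = (\<Sum>j<N. u r m (?F v j) + ((?A j + ?B j) + (?C j + ?D j)))"
    using B2[rule_format, of N] by (simp only: F) (simp add: N_def)
  also have "\<dots> = u r m (\<Sum>j<N. ?F v j) + ((sum ?A {..<N} + sum ?B {..<N}) + (sum ?C {..<N} + sum ?D {..<N}))"
    by (simp only: sum.distrib u_sum u_add)
  also have "(\<Sum>j<N. ?F v j) = nprod V M (sst k) v" using B1[rule_format, of N] by (simp add: N_def)
  also have "(sum ?A {..<N} + sum ?B {..<N}) + (sum ?C {..<N} + sum ?D {..<N})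
     = sc (of_int m * cb k (int k - m)) (u r ?s v) + sc (of_int m * cb k (M - 1 + m)) (u r ?s v)"
  proof -
    have "int k - M - m < int N" "m - 1 < int N" "- m < int N" "?s < int N" by (auto simp: N_def)
    then show ?thesis by (simp only: delta) auto
  qed
  finally show ?thesis by (simp add: gam_def distrib_left scale_left_distrib)
qed

lemma D_u: "D (u r m v) = u r m (D v) - sc (of_int m) (u r (m - 1) v)"
  by (simp add: u_def deriv_prod deriv_nprod)

lemma shift_S:
  assumes T: "lin T" and c: "\<And>r m v. r < 2 * n \<Longrightarrow> T (u r m v) = u r m (T v) + sc (g m) (u r (m + s) v)"
  shows "T (S a b v) = S a b (T v) + sc (g a) (S (a + s) b v) + sc (g b) (S a (b + s) v)"
proof -
  have "T (S a b v) = (\<Sum>p<2*n. sc (- eta p) (u p a (u (conj p) b (T v)))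
     + sc (g a) (sc (- eta p) (u p (a + s) (u (conj p) b v))) + sc (g b) (sc (- eta p) (u p a (u (conj p) (b + s) v))))"
    unfolding S_def lin_sum[OF T] lin_scale[OF T]
  proof (rule sum.cong[OF refl])
    fix p assume "p \<in> {..<2*n}"
    then have p: "p < 2 * n" "conj p < 2 * n" using conj_less by auto
    show "sc (- eta p) (T (u p a (u (conj p) b v))) = sc (- eta p) (u p a (u (conj p) b (T v)))
     + sc (g a) (sc (- eta p) (u p (a + s) (u (conj p) b v))) + sc (g b) (sc (- eta p) (u p a (u (conj p) (b + s) v)))"
      unfolding c[OF p(1)] c[OF p(2)] u_add u_scale scale_right_distrib scale_left_commute[of "- eta p"]
      by (simp only: ac_simps)
  qed
  then show ?thesis by (simp only: sum.distrib S_def scale_sum_right)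
qed

lemma jop_S: "nprod V M (sst k) (S a b v) = S a b (nprod V M (sst k) v)
    + sc (gam k M a) (S (a + (M - 1 - int k)) b v) + sc (gam k M b) (S a (b + (M - 1 - int k)) v)"
  by (rule shift_S[OF lin_nprod]) (simp add: jop_u add.commute)

lemma D_S: "D (S a b v) = S a b (D v) + sc (- of_int a) (S (a - 1) b v) + sc (- of_int b) (S a (b - 1) v)"
  using shift_S[OF lin_D, of "\<lambda>m. - of_int m" "-1" a b v] by (simp add: D_u)

abbreviation jm :: "nat \<Rightarrow> 'v" where "jm m \<equiv> j_gen V n e f (2 * m)"

lemma sum_lessThan_add: "(\<Sum>p<k + l. F p) = (\<Sum>p<k. F p) + (\<Sum>p<l. F (k + p :: nat) :: 'z::comm_monoid_add)"
  by (induction l) (simp_all add: add.assoc)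

lemma j_gen_sst: "j_gen V n e f k = sc (fact k / 2) (sst k)"
proof -
  have ef: "wick V [e i, (D ^^ k) (f i)] + wick V [(D ^^ k) (e i), f i]
     = sc (fact k) (u i (-1) (u (n + i) (-1 - int k) (vac V)) - u (n + i) (-1) (u i (-1 - int k) (vac V)))"
    if i: "i < n" for i
  proof -
    have "wick V [e i, (D ^^ k) (f i)] = sc (fact k) (u i (-1) (u (n + i) (-1 - int k) (vac V)))"
      using D_pow_gen[of k "n + i"] i
      by (simp add: wick_def gen_f) (simp add: u_def gen_e nprod_scale_right)
    moreover have "wick V [(D ^^ k) (e i), f i] = sc (fact k) (u i (-1 - int k) (u (n + i) (-1) (vac V)))"
      using D_pow_gen[of k "i"] i
      by (simp add: wick_def gen_e) (simp add: u_def gen_f)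
    moreover have "u i (-1 - int k) (u (n + i) (-1) (vac V)) = - u (n + i) (-1) (u i (-1 - int k) (vac V))"
      using i u_u[of i "n + i" "-1 - int k" "-1" "vac V"] by simp
    ultimately show ?thesis by (simp add: scale_right_diff_distrib)
  qed
  have "sst k = (\<Sum>p<n. sc (- eta p) (u p (-1) (u (conj p) (-1 - int k) (vac V))))
      + (\<Sum>p<n. sc (- eta (n + p)) (u (n + p) (-1) (u (conj (n + p)) (-1 - int k) (vac V))))"
    unfolding S_def mult_2 by (rule sum_lessThan_add)
  also have "\<dots> = (\<Sum>i<n. u i (-1) (u (n + i) (-1 - int k) (vac V)) - u (n + i) (-1) (u i (-1 - int k) (vac V)))"
    unfolding sum.distrib[symmetric]
    by (rule sum.cong[OF refl]) (simp add: eta_def conj_def add.commute)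
  finally have s: "sst k = (\<Sum>i<n. u i (-1) (u (n + i) (-1 - int k) (vac V)) - u (n + i) (-1) (u i (-1 - int k) (vac V)))" .
  have "j_gen V n e f k = sc (1 / 2) (\<Sum>i<n. sc (fact k) (u i (-1) (u (n + i) (-1 - int k) (vac V)) - u (n + i) (-1) (u i (-1 - int k) (vac V))))"
    unfolding j_gen_def using ef by (intro arg_cong[of _ _ "sc _"] sum.cong refl) simp
  then show ?thesis by (simp add: s flip: scale_sum_right)
qed

section \<open>Ordered monomials and the creation parts of their factors\<close>

definition jop :: "nat \<times> nat \<Rightarrow> 'v \<Rightarrow> 'v" where
  "jop mt = nprod V (-1) ((D ^^ snd mt) (jm (fst mt)))"

definition mwt :: "nat \<times> nat \<Rightarrow> nat" where "mwt mt = 2 * fst mt + 2 + snd mt"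

definition mon :: "(nat \<times> nat) list \<Rightarrow> 'v" where "mon ms = foldr jop ms (vac V)"

lemma lin_jop: "lin (jop mt)"
  unfolding jop_def by (rule lin_nprod)

lemma jop_eq: "jop (m, t) v = sc (fact t * fact (2 * m) / 2) (nprod V (-1 - int t) (sst (2 * m)) v)"
proof -
  have "jop (m, t) v = sc (fact t) (nprod V (-1 - int t) (jm m) v)"
    by (simp add: jop_def nprod_deriv_pow)
  then show ?thesis by (simp add: j_gen_sst nprod_scale_left)
qed

text \<open>The part of \<open>jop\<close> consisting of two creation operators; it is obtained from the creation
  part of \<open>j\<^sup>2\<^sup>m\<close> by repeated commutators with the translation operator.\<close>

primrec cre :: "nat \<Rightarrow> nat \<Rightarrow> 'v \<Rightarrow> 'v" where
  "cre m 0 = (\<lambda>v. sc (fact (2 * m) / 2) (S (-1) (-1 - int (2 * m)) v))"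
| "cre m (Suc t) = (\<lambda>v. D (cre m t v) - cre m t (D v))"

text \<open>Homogeneous quadratic expressions in creation modes. They commute with each other
  (\<open>is_quad_commute\<close>), in contrast to the full operators \<open>jop\<close>.\<close>

definition is_quad :: "nat \<Rightarrow> ('v \<Rightarrow> 'v) \<Rightarrow> bool" where
  "is_quad w T \<longleftrightarrow> (\<exists>c. \<forall>v. T v = (\<Sum>a\<in>{1..<w}. sc (c a) (S (- int a) (- int (w - a)) v)))"

lemma is_quad_S:
  assumes "a \<ge> 1" "b \<ge> 1"
  shows "is_quad (a + b) (S (- int a) (- int b))"
  unfolding is_quad_def
proof (intro exI[of _ "\<lambda>i. if i = a then 1 else 0"] allI)
  fix v
  have "(\<Sum>i\<in>{1..<a+b}. sc (if i = a then 1 else 0) (S (- int i) (- int (a + b - i)) v))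
     = sc (if a = a then 1 else 0) (S (- int a) (- int (a + b - a)) v)"
    by (rule sum_eq_single) (use assms in auto)
  then show "S (- int a) (- int b) v = (\<Sum>i\<in>{1..<a+b}. sc (if i = a then 1 else 0) (S (- int i) (- int (a + b - i)) v))"
    by simp
qed

lemma is_quad_add: "is_quad w T \<Longrightarrow> is_quad w T' \<Longrightarrow> is_quad w (\<lambda>v. T v + T' v)"
proof -
  assume "is_quad w T" "is_quad w T'"
  then obtain c c' where "\<forall>v. T v = (\<Sum>a\<in>{1..<w}. sc (c a) (S (- int a) (- int (w - a)) v))"
    "\<forall>v. T' v = (\<Sum>a\<in>{1..<w}. sc (c' a) (S (- int a) (- int (w - a)) v))"
    unfolding is_quad_def by blast
  then show ?thesis unfolding is_quad_def
    by (intro exI[of _ "\<lambda>a. c a + c' a"]) (simp add: scale_left_distrib sum.distrib)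
qed

lemma is_quad_scale: "is_quad w T \<Longrightarrow> is_quad w (\<lambda>v. sc d (T v))"
proof -
  assume "is_quad w T"
  then obtain c where "\<forall>v. T v = (\<Sum>a\<in>{1..<w}. sc (c a) (S (- int a) (- int (w - a)) v))"
    unfolding is_quad_def by blast
  then show ?thesis unfolding is_quad_def
    by (intro exI[of _ "\<lambda>a. d * c a"]) (simp add: scale_sum_right)
qed

lemma is_quad_zero: "is_quad w (\<lambda>v. 0)"
  unfolding is_quad_def by (intro exI[of _ "\<lambda>_. 0"]) simp

lemma is_quad_sum: "(\<And>i. i \<in> A \<Longrightarrow> is_quad w (T i)) \<Longrightarrow> is_quad w (\<lambda>v. \<Sum>i\<in>A. T i v)"
  by (induction A rule: infinite_finite_induct) (simp_all add: is_quad_zero is_quad_add)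

lemma is_quad_D:
  assumes "is_quad w T"
  shows "is_quad (Suc w) (\<lambda>v. D (T v) - T (D v))"
proof -
  obtain c where c: "\<And>v. T v = (\<Sum>a\<in>{1..<w}. sc (c a) (S (- int a) (- int (w - a)) v))"
    using assms unfolding is_quad_def by blast
  have eq: "D (T v) - T (D v) = (\<Sum>a\<in>{1..<w}. sc (c a) (sc (of_nat a) (S (- int (Suc a)) (- int (w - a)) v)
      + sc (of_nat (w - a)) (S (- int a) (- int (Suc (w - a))) v)))" for v
  proof -
    have i: "- int x - 1 = - int (Suc x)" for x by simp
    have "D (T v) - T (D v) = (\<Sum>a\<in>{1..<w}. sc (c a) (D (S (- int a) (- int (w - a)) v) - S (- int a) (- int (w - a)) (D v)))"
      unfolding c by (simp only: lin_sum[OF lin_D] lin_scale[OF lin_D] sum_subtractf[symmetric] scale_right_diff_distrib)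
    then show ?thesis unfolding D_S i by simp
  qed
  show ?thesis unfolding eq
  proof (intro is_quad_sum is_quad_scale is_quad_add)
    fix a assume "a \<in> {1..<w}"
    then have "Suc a + (w - a) = Suc w" "a + Suc (w - a) = Suc w" "a \<ge> 1" "w - a \<ge> 1" by auto
    then show "is_quad (Suc w) (S (- int (Suc a)) (- int (w - a)))" "is_quad (Suc w) (S (- int a) (- int (Suc (w - a))))"
      using is_quad_S[of "Suc a" "w - a"] is_quad_S[of a "Suc (w - a)"] by simp_all
  qed
qed

lemma is_quad_cre: "is_quad (mwt (m, t)) (cre m t)"
proof (induction t)
  case 0
  have "is_quad (1 + (1 + 2 * m)) (S (- int 1) (- int (1 + 2 * m)))" by (rule is_quad_S) auto
  then show ?case using is_quad_scale by (simp add: mwt_def)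
next
  case (Suc t)
  then show ?case using is_quad_D by (simp add: mwt_def)
qed

lemma is_quad_lin: "is_quad w T \<Longrightarrow> lin T"
proof -
  assume "is_quad w T"
  then obtain c where "T = (\<lambda>v. \<Sum>a\<in>{1..<w}. sc (c a) (S (- int a) (- int (w - a)) v))"
    unfolding is_quad_def by blast
  then show ?thesis by (simp only:) (intro lin_sum_op lin_smult lin_S)
qed

lemma cre_vac: "cre m t (vac V) = (D ^^ t) (jm m)"
proof (induction t)
  case (Suc t)
  have "lin (cre m t)" using is_quad_cre is_quad_lin by blast
  then show ?case using Suc by (simp add: deriv_vac lin_0)
qed (simp add: j_gen_sst)

lemma is_quad_commute:
  assumes "is_quad w T" "is_quad w' T'"
  shows "T (T' v) = T' (T v)"
proof -
  obtain c c' where c: "\<And>v. T v = (\<Sum>a\<in>{1..<w}. sc (c a) (S (- int a) (- int (w - a)) v))"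
    and c': "\<And>v. T' v = (\<Sum>a\<in>{1..<w'}. sc (c' a) (S (- int a) (- int (w' - a)) v))"
    using assms unfolding is_quad_def by blast
  have comm: "S (- int a) (- int b) (S (- int a') (- int b') v) = S (- int a') (- int b') (S (- int a) (- int b) v)" if "a \<ge> 1" "b \<ge> 1" "a' \<ge> 1" "b' \<ge> 1" for a b a' b' v
    using that by (simp add: S_S[of "- int a" "- int b" "- int a'" "- int b'"])
  have "T (T' v) = (\<Sum>a\<in>{1..<w}. \<Sum>a'\<in>{1..<w'}. sc (c a * c' a') (S (- int a) (- int (w - a)) (S (- int a') (- int (w' - a')) v)))"
    unfolding c c' by (simp add: lin_sum[OF lin_S] lin_scale[OF lin_S] scale_sum_right)
  also have "\<dots> = (\<Sum>a\<in>{1..<w}. \<Sum>a'\<in>{1..<w'}. sc (c' a' * c a) (S (- int a') (- int (w' - a')) (S (- int a) (- int (w - a)) v)))"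
  proof (intro sum.cong refl)
    fix a a' assume "a \<in> {1..<w}" "a' \<in> {1..<w'}"
    then have b: "a \<ge> 1" "w - a \<ge> 1" "a' \<ge> 1" "w' - a' \<ge> 1" by auto
    show "sc (c a * c' a') (S (- int a) (- int (w - a)) (S (- int a') (- int (w' - a')) v))
      = sc (c' a' * c a) (S (- int a') (- int (w' - a')) (S (- int a) (- int (w - a)) v))"
      by (simp only: comm[OF b] mult.commute)
  qed
  also have "\<dots> = T' (T v)"
    unfolding c c' by (subst sum.swap) (simp add: lin_sum[OF lin_S] lin_scale[OF lin_S] scale_sum_right)
  finally show ?thesis .
qed

lemma is_quad_Qle:
  assumes "is_quad w T" "y \<in> Qle r x"
  shows "T y \<in> Qle (Suc r) (x + int w)"
proof -
  obtain c where c: "\<And>v. T v = (\<Sum>a\<in>{1..<w}. sc (c a) (S (- int a) (- int (w - a)) v))"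
    using assms unfolding is_quad_def by blast
  have "S (- int a) (- int (w - a)) y \<in> Qle (Suc r) (x + int w)" if "a \<in> {1..<w}" for a
  proof -
    have "x + int a + int (w - a) = x + int w" using that by simp
    then show ?thesis using sop_Qle[of a "w - a" y r x] assms(2) that by (simp only:) auto
  qed
  then show ?thesis unfolding c
    by (intro subspace_sum[OF subspace_Qle] subspace_scale[OF subspace_Qle])
qed

text \<open>Modulo \<open>[D, -]\<close> an operator \<open>S (-a) (-b)\<close> can be replaced by a multiple of \<open>S (-a-1) (-b+1)\<close>,
  so \<open>S\<close>-operators of even weight reduce to \<open>S (-1) (-w+1)\<close>, and those of odd weight to zero by symmetry.\<close>

definition cre_span :: "nat \<Rightarrow> ('v \<Rightarrow> 'v) \<Rightarrow> bool" where
  "cre_span w T \<longleftrightarrow> (\<exists>c. \<forall>v. T v = (\<Sum>m\<in>{m. 2 * m + 2 \<le> w}. sc (c m) (cre m (w - 2 * m - 2) v)))"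

lemma finite_half: "finite {m. 2 * m + 2 \<le> (w::nat)}"
  by (rule finite_subset[of _ "{..w}"]) auto

lemma cre_span_lin_comb:
  assumes "cre_span w T" "cre_span w T'"
  shows "cre_span w (\<lambda>v. sc x (T v) + sc y (T' v))"
proof -
  obtain c c' where "\<forall>v. T v = (\<Sum>m\<in>{m. 2 * m + 2 \<le> w}. sc (c m) (cre m (w - 2 * m - 2) v))"
    "\<forall>v. T' v = (\<Sum>m\<in>{m. 2 * m + 2 \<le> w}. sc (c' m) (cre m (w - 2 * m - 2) v))"
    using assms unfolding cre_span_def by blast
  then show ?thesis unfolding cre_span_def
    by (intro exI[of _ "\<lambda>m. x * c m + y * c' m"]) (simp add: scale_left_distrib sum.distrib scale_sum_right)
qed

lemma cre_span_zero: "cre_span w (\<lambda>v. 0)"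
  unfolding cre_span_def by (intro exI[of _ "\<lambda>_. 0"]) simp

lemma cre_span_scale: "cre_span w T \<Longrightarrow> cre_span w (\<lambda>v. sc x (T v))"
  using cre_span_lin_comb[of w T T x 0] by simp

lemma cre_span_D:
  assumes "cre_span w T"
  shows "cre_span (Suc w) (\<lambda>v. D (T v) - T (D v))"
proof -
  obtain c where c: "\<And>v. T v = (\<Sum>m\<in>{m. 2 * m + 2 \<le> w}. sc (c m) (cre m (w - 2 * m - 2) v))"
    using assms unfolding cre_span_def by blast
  have "D (T v) - T (D v) = (\<Sum>m\<in>{m. 2 * m + 2 \<le> Suc w}. sc (if 2 * m + 2 \<le> w then c m else 0) (cre m (Suc w - 2 * m - 2) v))" for v
  proof -
    have "D (T v) - T (D v) = (\<Sum>m\<in>{m. 2 * m + 2 \<le> w}. sc (c m) (cre m (Suc (w - 2 * m - 2)) v))"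
      unfolding c by (simp add: lin_sum[OF lin_D] lin_scale[OF lin_D] sum_subtractf[symmetric] scale_right_diff_distrib)
    also have "\<dots> = (\<Sum>m\<in>{m. 2 * m + 2 \<le> w}. sc (if 2 * m + 2 \<le> w then c m else 0) (cre m (Suc w - 2 * m - 2) v))"
    proof (intro sum.cong refl)
      fix m assume "m \<in> {m. 2 * m + 2 \<le> w}"
      moreover from this have "Suc (w - 2 * m - 2) = Suc w - 2 * m - 2" by auto
      ultimately show "sc (c m) (cre m (Suc (w - 2 * m - 2)) v) = sc (if 2 * m + 2 \<le> w then c m else 0) (cre m (Suc w - 2 * m - 2) v)"
        by (simp only: mem_Collect_eq if_True)
    qed
    also have "\<dots> = (\<Sum>m\<in>{m. 2 * m + 2 \<le> Suc w}. sc (if 2 * m + 2 \<le> w then c m else 0) (cre m (Suc w - 2 * m - 2) v))"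
      by (rule sum.mono_neutral_left) (use finite_half[of "Suc w"] in auto)
    finally show ?thesis .
  qed
  then show ?thesis unfolding cre_span_def
    by (intro exI[of _ "\<lambda>m. if 2 * m + 2 \<le> w then c m else 0"]) simp
qed

lemma cre_span_S:
  "a \<ge> 1 \<Longrightarrow> b \<ge> 1 \<Longrightarrow> a + b = w \<Longrightarrow> cre_span w (S (- int a) (- int b))"
proof (induction w arbitrary: a b)
  case (Suc w)
  have shift: "cre_span (Suc w) (\<lambda>v. sc (of_nat a) (S (- int (Suc a)) (- int b) v) + sc (of_nat b) (S (- int a) (- int (Suc b)) v))"
    if "a \<ge> 1" "b \<ge> 1" "a + b = w" for a b
  proof -
    have "cre_span (Suc w) (\<lambda>v. D (S (- int a) (- int b) v) - S (- int a) (- int b) (D v))"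
      using that by (intro cre_span_D Suc.IH)
    moreover have "- int x - 1 = - int (Suc x)" for x by simp
    ultimately show ?thesis unfolding D_S by simp
  qed
  let ?T = "S (-1) (- int w)"
  \<comment> \<open>The positivity of \<open>r\<close> is kept apart from the sign, as it excludes a
    cancellation in odd total weight.\<close>
  have first: "\<exists>r>0. cre_span (Suc w) (\<lambda>v. S (- int (Suc a)) (- int (w - a)) v - sc ((-1) ^ a * of_real r) (?T v))"
    if "a < w" for a
    using that
  proof (induction a)
    case 0
    show ?case by (rule exI[of _ 1]) (simp add: cre_span_zero)
  next
    case (Suc a)
    let ?X = "S (- int (Suc (Suc a))) (- int (w - Suc a))" and ?Y = "S (- int (Suc a)) (- int (w - a))"
    obtain r where r: "r > 0" "cre_span (Suc w) (\<lambda>v. ?Y v - sc ((-1) ^ a * of_real r) (?T v))"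
      using Suc.IH Suc_lessD[OF Suc.prems] by blast
    define A where "A = real (Suc a)"
    define W where "W = real (w - Suc a)"
    have pos: "A > 0" "W > 0" using Suc.prems by (auto simp: A_def W_def)
    have XY: "cre_span (Suc w) (\<lambda>v. sc (of_real A) (?X v) + sc (of_real W) (?Y v))"
      using shift[of "Suc a" "w - Suc a"] Suc.prems
      unfolding Suc_diff_Suc[OF Suc_lessD[OF Suc.prems]] A_def W_def by auto
    have "cre_span (Suc w) (\<lambda>v. sc (1 / of_real A) (sc (of_real A) (?X v) + sc (of_real W) (?Y v))
       + sc (- (of_real W / of_real A)) (?Y v - sc ((-1) ^ a * of_real r) (?T v)))"
      using cre_span_lin_comb[OF XY r(2)] by blast
    moreover have "sc (1 / of_real A) (sc (of_real A) (?X v) + sc (of_real W) (?Y v))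
       + sc (- (of_real W / of_real A)) (?Y v - sc ((-1) ^ a * of_real r) (?T v))
       = ?X v - sc ((-1) ^ Suc a * of_real (W / A * r)) (?T v)" for v
      using pos by (simp add: scale_right_distrib scale_right_diff_distrib mult.left_commute)
    ultimately have "cre_span (Suc w) (\<lambda>v. ?X v - sc ((-1) ^ Suc a * of_real (W / A * r)) (?T v))"
      by (simp only:)
    moreover have "W / A * r > 0" using pos r by simp
    ultimately show ?case by blast
  qed
  have T: "cre_span (Suc w) (S (-1) (- int w))" if w: "w \<ge> 1"
  proof (cases "odd w")
    case True
    then obtain m where m: "w = 2 * m + 1" by (elim oddE)
    have eq: "S (-1) (- int w) v = (\<Sum>m'\<in>{m'. 2 * m' + 2 \<le> Suc w}. sc (if m' = m then 2 / fact (2 * m) else 0) (cre m' (Suc w - 2 * m' - 2) v))" for v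
    proof -
      have "(\<Sum>m'\<in>{m'. 2 * m' + 2 \<le> Suc w}. sc (if m' = m then 2 / fact (2 * m) else 0) (cre m' (Suc w - 2 * m' - 2) v))
        = sc (if m = m then 2 / fact (2 * m) else 0) (cre m (Suc w - 2 * m - 2) v)"
        by (rule sum_eq_single) (use m finite_half[of "Suc w"] in auto)
      then show ?thesis by (simp add: m)
    qed
    show ?thesis unfolding cre_span_def
      by (rule exI[of _ "\<lambda>m'. if m' = m then 2 / fact (2 * m) else 0"]) (use eq in blast)
  next
    case False
    \<comment> \<open>For odd total weight, \<open>S (- int w) (- 1)\<close> is congruent to
      \<open>- r\<close> times \<open>?T\<close> modulo the span and equal to \<open>?T\<close> by
      symmetry; so \<open>1 + r\<close> times \<open>?T\<close> lies in the span.\<close>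
    obtain r where r: "r > 0" "cre_span (Suc w) (\<lambda>v. S (- int (Suc (w - 1))) (- int (w - (w - 1))) v - sc ((-1) ^ (w - 1) * of_real r) (?T v))"
      using first[of "w - 1"] w by auto
    moreover have "(-1::complex) ^ (w - 1) = - 1" using False w by simp
    moreover have "S (- int w) (- 1) v = ?T v" for v by (rule S_swap) (use w in auto)
    ultimately have "cre_span (Suc w) (\<lambda>v. ?T v + sc (of_real r) (?T v))" using w by simp
    then have "cre_span (Suc w) (\<lambda>v. sc (1 / of_real (1 + r)) (?T v + sc (of_real r) (?T v)))" by (rule cre_span_scale)
    moreover have "sc (1 / of_real (1 + r)) (x + sc (of_real r) x) = x" for x
    proof -
      have nz: "(of_real (1 + r) :: complex) \<noteq> 0" using r(1) by (subst of_real_eq_0_iff) linarith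
      have "x + sc (of_real r) x = sc (of_real (1 + r)) x" by (simp add: scale_left_distrib)
      then show ?thesis using nz by (simp del: of_real_add)
    qed
    ultimately show ?thesis by simp
  qed
  obtain a' where a': "a = Suc a'" "a' < w" "b = w - a'" using Suc.prems by (cases a) auto
  obtain r where "cre_span (Suc w) (\<lambda>v. S (- int (Suc a')) (- int (w - a')) v - sc ((-1) ^ a' * of_real r) (?T v))"
    using first a' by blast
  then have "cre_span (Suc w) (\<lambda>v. sc 1 (S (- int (Suc a')) (- int (w - a')) v - sc ((-1) ^ a' * of_real r) (?T v))
      + sc ((-1) ^ a' * of_real r) (?T v))"
    using a' by (intro cre_span_lin_comb T) auto
  then show ?case using a' by simp
qed simp

end

section \<open>Invariants as normally ordered polynomials in the quadratic generators\<close>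

context symplectic_fermion_algebra
begin

definition jgam :: "nat \<Rightarrow> nat \<Rightarrow> int \<Rightarrow> complex" where
  "jgam m t k = fact t * fact (2 * m) / 2 * gam (2 * m) (-1 - int t) k"

lemma jop_u':
  assumes "r < 2 * n"
  shows "jop (m, t) (u r k v) = u r k (jop (m, t) v) + sc (jgam m t k) (u r (k - int (mwt (m, t))) v)"
proof -
  have "-1 - int t - 1 - int (2 * m) + k = k - int (mwt (m, t))" by (simp add: mwt_def)
  then show ?thesis
    by (simp only: jop_eq jop_u[OF assms] scale_right_distrib u_scale scale_scale jgam_def)
qed

lemma jop_S': "jop (m, t) (S a b v) = S a b (jop (m, t) v)
    + sc (jgam m t a) (S (a - int (mwt (m, t))) b v) + sc (jgam m t b) (S a (b - int (mwt (m, t))) v)"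
  using shift_S[OF lin_jop, of "(m, t)" "jgam m t" "- int (mwt (m, t))" a b v] by (simp add: jop_u')

lemma jop_vac': "jop (m, t) (vac V) = (D ^^ t) (jm m)"
  by (simp add: jop_def creation)

lemma sop_word_Qle:
  "set xs \<subseteq> spairs \<Longrightarrow> foldr sop xs (vac V) \<in> Qle (length xs) (int (sum_list (map (\<lambda>(a, b). a + b) xs)))"
  unfolding Qle_def by (rule span_base) (auto simp: swords_def)

text \<open>Commuted past a letter of the word, \<open>jop\<close> merely shifts an index of this
  letter, which adds weight but no further letter. On the vacuum \<open>jop\<close> and
  \<open>cre\<close> agree.\<close>

lemma jop_minus_cre_word:
  assumes "set xs \<subseteq> spairs"
  shows "jop (m, t) (foldr sop xs (vac V)) - cre m t (foldr sop xs (vac V))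
    \<in> Qle (length xs) (int (sum_list (map (\<lambda>(a, b). a + b) xs)) + int (mwt (m, t)))"
  using assms
proof (induction xs)
  case Nil
  then show ?case by (simp add: jop_vac' cre_vac subspace_0[OF subspace_Qle])
next
  case (Cons x xs)
  obtain a b where x: "x = (a, b)" "a \<ge> 1" "b \<ge> 1" using Cons.prems by (cases x) (auto simp: spairs_def)
  let ?y = "foldr sop xs (vac V)" and ?w = "int (sum_list (map (\<lambda>(a, b). a + b) xs))" and ?m = "mwt (m, t)"
  have y: "?y \<in> Qle (length xs) ?w" using sop_word_Qle Cons.prems by simp
  have IH: "jop (m, t) ?y - cre m t ?y \<in> Qle (length xs) (?w + int ?m)" using Cons by simp
  have comm: "cre m t (S (- int a) (- int b) ?y) = S (- int a) (- int b) (cre m t ?y)"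
    by (rule is_quad_commute[OF is_quad_cre is_quad_S]) (use x in auto)
  have e: "- int a - int ?m = - int (a + ?m)" "- int b - int ?m = - int (b + ?m)" by simp_all
  have eq: "jop (m, t) (S (- int a) (- int b) ?y) - cre m t (S (- int a) (- int b) ?y)
     = S (- int a) (- int b) (jop (m, t) ?y - cre m t ?y)
       + sc (jgam m t (- int a)) (S (- int (a + ?m)) (- int b) ?y) + sc (jgam m t (- int b)) (S (- int a) (- int (b + ?m)) ?y)"
    unfolding jop_S' comm e lin_diff[OF lin_S] by simp
  have "S (- int a) (- int b) (jop (m, t) ?y - cre m t ?y) \<in> Qle (Suc (length xs)) (?w + int ?m + int a + int b)"
    by (rule sop_Qle) (use x IH in auto)
  moreover have "S (- int (a + ?m)) (- int b) ?y \<in> Qle (Suc (length xs)) (?w + int (a + ?m) + int b)"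
    by (rule sop_Qle) (use x y in auto)
  moreover have "S (- int a) (- int (b + ?m)) ?y \<in> Qle (Suc (length xs)) (?w + int a + int (b + ?m))"
    by (rule sop_Qle) (use x y in auto)
  moreover have "?w + int ?m + int a + int b = int (sum_list (map (\<lambda>(a, b). a + b) (x # xs))) + int ?m"
    "?w + int (a + ?m) + int b = int (sum_list (map (\<lambda>(a, b). a + b) (x # xs))) + int ?m"
    "?w + int a + int (b + ?m) = int (sum_list (map (\<lambda>(a, b). a + b) (x # xs))) + int ?m"
    by (simp_all add: x)
  ultimately have "S (- int a) (- int b) (jop (m, t) ?y - cre m t ?y)
       + sc (jgam m t (- int a)) (S (- int (a + ?m)) (- int b) ?y) + sc (jgam m t (- int b)) (S (- int a) (- int (b + ?m)) ?y)
     \<in> Qle (Suc (length xs)) (int (sum_list (map (\<lambda>(a, b). a + b) (x # xs))) + int ?m)"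
    by (metis subspace_add[OF subspace_Qle] subspace_scale[OF subspace_Qle])
  moreover have "foldr sop (x # xs) (vac V) = S (- int a) (- int b) ?y" by (simp add: sop_def x)
  ultimately show ?case unfolding eq[symmetric] by (simp only: length_Cons)
qed

lemma lin_cre: "lin (cre m t)"
  using is_quad_lin is_quad_cre by blast

lemma jop_minus_cre:
  assumes "y \<in> Qle r w"
  shows "jop (m, t) y - cre m t y \<in> Qle r (w + int (mwt (m, t)))"
proof (rule lin_span_subset[of "\<lambda>y. jop (m, t) y - cre m t y", OF _ _ subspace_Qle assms[unfolded Qle_def]])
  show "lin (\<lambda>y. jop (m, t) y - cre m t y)" by (intro lin_minus lin_jop lin_cre)
  fix x assume "x \<in> (\<lambda>xs. foldr sop xs (vac V)) ` swords r w"
  then obtain xs where xs: "x = foldr sop xs (vac V)" "set xs \<subseteq> spairs" "length xs \<le> r"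
    "int (sum_list (map (\<lambda>(a, b). a + b) xs)) \<le> w" by (auto simp: swords_def)
  have "jop (m, t) x - cre m t x \<in> Qle (length xs) (int (sum_list (map (\<lambda>(a, b). a + b) xs)) + int (mwt (m, t)))"
    unfolding xs(1) by (rule jop_minus_cre_word) (rule xs(2))
  also have "\<dots> \<subseteq> Qle r (w + int (mwt (m, t)))" by (rule Qle_mono) (use xs in auto)
  finally show "jop (m, t) x - cre m t x \<in> Qle r (w + int (mwt (m, t)))" .
qed

lemma cre_Qle: "y \<in> Qle r w \<Longrightarrow> cre m t y \<in> Qle (Suc r) (w + int (mwt (m, t)))"
  by (rule is_quad_Qle[OF is_quad_cre])

lemma jop_Qle: "y \<in> Qle r w \<Longrightarrow> jop mt y \<in> Qle (Suc r) (w + int (mwt mt))"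
proof (cases mt)
  case (Pair m t)
  assume y: "y \<in> Qle r w"
  have "jop (m, t) y - cre m t y \<in> Qle (Suc r) (w + int (mwt (m, t)))"
    using jop_minus_cre[OF y] Qle_mono[of r "Suc r" "w + int (mwt (m, t))" "w + int (mwt (m, t))"] by auto
  from subspace_add[OF subspace_Qle this cre_Qle[OF y]] show ?thesis by (simp add: Pair)
qed

definition crew :: "(nat \<times> nat) list \<Rightarrow> 'v" where
  "crew ms = foldr (\<lambda>(m, t). cre m t) ms (vac V)"

definition mwts :: "(nat \<times> nat) list \<Rightarrow> nat" where "mwts ms = sum_list (map mwt ms)"

lemma mon_Qle: "mon ms \<in> Qle (length ms) (int (mwts ms))"
proof (induction ms)
  case (Cons x ms)
  then show ?case using jop_Qle[OF Cons, of x] by (simp add: mon_def mwts_def add.commute)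
qed (simp add: mon_def mwts_def vac_Qle)

text \<open>Each replacement of \<open>jop\<close> by \<open>cre\<close> has an error without the
  additional letter, so the two words agree up to shorter ones.\<close>

lemma mon_minus_crew: "mon ms - crew ms \<in> Qle (length ms - 1) (int (mwts ms))"
proof (induction ms)
  case Nil
  then show ?case by (simp add: mon_def crew_def subspace_0[OF subspace_Qle])
next
  case (Cons x ms)
  obtain m t where x: "x = (m, t)" by (cases x)
  have 1: "jop (m, t) (mon ms) - cre m t (mon ms) \<in> Qle (length ms) (int (mwts (x # ms)))"
    using jop_minus_cre[OF mon_Qle, of m t ms] by (simp add: mwts_def x add.commute)
  have 2: "cre m t (mon ms - crew ms) \<in> Qle (length ms) (int (mwts (x # ms)))"
  proof (cases ms)
    case Nil
    then show ?thesis by (simp add: mon_def crew_def lin_0[OF lin_cre] subspace_0[OF subspace_Qle])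
  next
    case (Cons y ys)
    then show ?thesis using cre_Qle[OF Cons.IH, of m t] by (simp add: mwts_def x algebra_simps)
  qed
  have "mon (x # ms) - crew (x # ms) = (jop (m, t) (mon ms) - cre m t (mon ms)) + cre m t (mon ms - crew ms)"
    by (simp add: mon_def crew_def x lin_diff[OF lin_cre])
  then show ?case using subspace_add[OF subspace_Qle 1 2] by simp
qed

lemma crew_permute: "mset xs = mset ys \<Longrightarrow> crew xs = crew ys"
proof -
  assume "mset xs = mset ys"
  then have "mset (rev xs) = mset (rev ys)" by simp
  moreover have "(case x of (m, t) \<Rightarrow> cre m t) \<circ> (case y of (m, t) \<Rightarrow> cre m t) = (case y of (m, t) \<Rightarrow> cre m t) \<circ> (case x of (m, t) \<Rightarrow> cre m t)" for x y
    by (cases x; cases y) (auto intro!: ext is_quad_commute[OF is_quad_cre is_quad_cre])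
  ultimately have "fold (\<lambda>(m, t). cre m t) (rev xs) = fold (\<lambda>(m, t). cre m t) (rev ys)"
    by (intro fold_multiset_equiv)
  then show ?thesis by (simp add: crew_def foldr_conv_fold)
qed

lemma sop_word_crew:
  "set xs \<subseteq> spairs \<Longrightarrow> foldr sop xs (vac V)
     \<in> span {crew ms | ms. length ms = length xs \<and> mwts ms = sum_list (map (\<lambda>(a, b). a + b) xs)}"
proof (induction xs)
  case Nil
  show ?case by (rule span_base) (auto simp: crew_def mwts_def intro!: exI[of _ "[]"])
next
  case (Cons x xs)
  obtain a b where x: "x = (a, b)" "a \<ge> 1" "b \<ge> 1" using Cons.prems by (cases x) (auto simp: spairs_def)
  let ?w = "sum_list (map (\<lambda>(a, b). a + b) xs)"
  let ?B = "{crew ms | ms. length ms = length xs \<and> mwts ms = ?w}"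
  let ?B' = "{crew ms | ms. length ms = length (x # xs) \<and> mwts ms = a + b + ?w}"
  obtain c where c: "\<And>v. S (- int a) (- int b) v = (\<Sum>m\<in>{m. 2 * m + 2 \<le> a + b}. sc (c m) (cre m (a + b - 2 * m - 2) v))"
    using cre_span_S[OF x(2,3) refl] unfolding cre_span_def by blast
  have "S (- int a) (- int b) (foldr sop xs (vac V)) \<in> span ?B'"
  proof (rule lin_span_subset[OF lin_S, of ?B])
    show "foldr sop xs (vac V) \<in> span ?B" using Cons by simp
    fix z assume "z \<in> ?B"
    then obtain ms where ms: "z = crew ms" "length ms = length xs" "mwts ms = ?w" by blast
    have "cre m (a + b - 2 * m - 2) z \<in> span ?B'" if "2 * m + 2 \<le> a + b" for m
    proof (rule span_base)
      have "cre m (a + b - 2 * m - 2) z = crew ((m, a + b - 2 * m - 2) # ms)" by (simp add: crew_def ms)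
      moreover have "length ((m, a + b - 2 * m - 2) # ms) = length (x # xs)" "mwts ((m, a + b - 2 * m - 2) # ms) = a + b + ?w"
        using ms that by (auto simp: mwts_def mwt_def)
      ultimately show "cre m (a + b - 2 * m - 2) z \<in> ?B'" by blast
    qed
    then show "S (- int a) (- int b) z \<in> span ?B'"
      unfolding c by (intro span_sum span_scale) auto
  qed (rule subspace_span)
  then show ?case by (simp add: sop_def[of "(a, b)"] x)
qed

text \<open>Sorting by this key gives the order of factors in \<open>no_monomials\<close>:
  \<open>m\<close> ascending and, for equal \<open>m\<close>, \<open>t\<close> descending.\<close>

definition mkey :: "nat \<times> nat \<Rightarrow> nat \<times> int" where "mkey mt = (fst mt, - int (snd mt))"

definition srt :: "(nat \<times> nat) list \<Rightarrow> bool" where "srt ms \<longleftrightarrow> sorted (map mkey ms)"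

definition Mle :: "nat \<Rightarrow> int \<Rightarrow> 'v set" where
  "Mle r w = span {mon ms | ms. srt ms \<and> length ms \<le> r \<and> int (mwts ms) \<le> w}"

lemma Mle_mono: "r \<le> r' \<Longrightarrow> w \<le> w' \<Longrightarrow> Mle r w \<subseteq> Mle r' w'"
  unfolding Mle_def by (rule span_mono) auto

text \<open>Words in the commuting operators \<open>cre\<close> may be sorted. Replacing
  \<open>cre\<close> by \<open>jop\<close> afterwards costs shorter words, which are covered by
  induction on \<open>r\<close>.\<close>

lemma Qle_subset_Mle: "Qle r w \<subseteq> Mle r w"
proof (induction r arbitrary: w rule: less_induct)
  case (less r)
  have crew: "crew ms \<in> Mle r w" if ms: "length ms \<le> r" "int (mwts ms) \<le> w" for ms
  proof -
    define ns where "ns = sort_key mkey ms"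
    have ns: "crew ns = crew ms" "length ns = length ms" "srt ns"
      by (auto simp: ns_def srt_def intro: crew_permute)
    have "mset (map mwt ns) = mset (map mwt ms)" by (simp add: ns_def)
    then have wt: "mwts ns = mwts ms" unfolding mwts_def by (metis sum_mset_sum_list)
    have mon: "mon ns \<in> Mle r w"
      unfolding Mle_def by (rule span_base) (use ns wt ms in auto)
    show ?thesis
    proof (cases ns)
      case Nil
      then have "crew ms = mon ns" using ns(1) by (simp add: crew_def mon_def)
      then show ?thesis using mon by simp
    next
      case (Cons a list)
      then have lt: "length ns - 1 < r" using ns ms by simp
      have "mon ns - crew ns \<in> Qle (length ns - 1) (int (mwts ns))" by (rule mon_minus_crew)
      also have "\<dots> \<subseteq> Mle (length ns - 1) (int (mwts ns))" using less.IH[OF lt] .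
      also have "\<dots> \<subseteq> Mle r w" by (rule Mle_mono) (use lt wt ms in auto)
      finally have "mon ns - crew ns \<in> Mle r w" .
      with mon have "mon ns - (mon ns - crew ns) \<in> Mle r w"
        unfolding Mle_def by (rule span_diff)
      then show ?thesis by (simp add: ns)
    qed
  qed
  have "foldr sop xs (vac V) \<in> Mle r w" if xs: "xs \<in> swords r w" for xs
  proof -
    have "foldr sop xs (vac V) \<in> span {crew ms | ms. length ms = length xs \<and> mwts ms = sum_list (map (\<lambda>(a, b). a + b) xs)}"
      using xs by (intro sop_word_crew) (simp add: swords_def)
    also have "\<dots> \<subseteq> Mle r w"
      unfolding Mle_def by (rule span_minimal) (use crew xs in \<open>auto simp: swords_def Mle_def\<close>)
    finally show ?thesis .
  qed
  then show ?case unfolding Qle_def Mle_def by (intro span_minimal) auto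
qed

text \<open>\<open>cre 0 0\<close> is a sum of \<open>n\<close> commuting operators of square zero,
  one for each pair of generators e and f.\<close>

lemma cre_0_0_nilpotent: "(cre 0 0 ^^ Suc n) v = 0"
proof -
  define A where "A i = (\<lambda>v. u i (-1) (u (n + i) (-1) v))" for i
  define P where "P r = (\<lambda>v. \<Sum>i<r. A i v)" for r
  have linA: "lin (A i)" for i unfolding A_def by (intro lin_comp[OF lin_u] lin_u)
  have linP: "lin (P r)" for r unfolding P_def by (intro lin_sum_op linA)
  have anti: "u p (-1) (u q (-1) v) = - u q (-1) (u p (-1) v)" if "p < 2 * n" "q < 2 * n" for p q v
    using that by (simp add: u_u[of p q])
  have sq: "u p (-1) (u p (-1) v) = 0" if "p < 2 * n" for p v
    using anti[OF that that] self_neg_zero by blast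
  have AA: "A i (A j v) = A j (A i v)" if "i < n" "j < n" for i j v
  proof -
    have "A i (A j v) = u i (-1) (u j (-1) (u (n + j) (-1) (u (n + i) (-1) v)))"
      using that unfolding A_def by (simp add: anti[of "n + i" j] anti[of "n + i" "n + j"] u_neg)
    also have "\<dots> = A j (A i v)"
      using that unfolding A_def
      by (simp add: anti[of i j] anti[of i "n + j"] u_neg)
    finally show ?thesis .
  qed
  have A2: "A i (A i v) = 0" if "i < n" for i v
    using that unfolding A_def by (simp add: anti[of "n + i" i] sq u_neg u_zero)
  have AP: "A i (P r v) = P r (A i v)" if "i < n" "r \<le> n" for i r v
    unfolding P_def lin_sum[OF linA] by (rule sum.cong) (use that AA in auto)
  have APk: "A i ((P r ^^ k) v) = (P r ^^ k) (A i v)" if "i < n" "r \<le> n" for i r k v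
    by (induction k) (simp_all add: AP that)
  \<comment> \<open>Binomial theorem for commuting operators, cut off after the linear term because
    \<open>A r\<close> has square zero.\<close>
  have pow: "(P (Suc r) ^^ k) v = (P r ^^ k) v + sc (of_nat k) (A r ((P r ^^ (k - 1)) v))" if r: "Suc r \<le> n" for r k v
  proof (induction k)
    case (Suc k)
    have PS: "P (Suc r) x = P r x + A r x" for x by (simp add: P_def)
    have "(P (Suc r) ^^ Suc k) v = P r ((P r ^^ k) v) + sc (of_nat k) (P r (A r ((P r ^^ (k - 1)) v)))
        + (A r ((P r ^^ k) v) + sc (of_nat k) (A r (A r ((P r ^^ (k - 1)) v))))"
      by (simp add: Suc PS lin_add[OF linP] lin_scale[OF linP] lin_add[OF linA] lin_scale[OF linA] scale_right_distrib)
    also have "sc (of_nat k) (P r (A r ((P r ^^ (k - 1)) v))) = sc (of_nat k) (A r ((P r ^^ k) v))"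
      using r by (cases k) (simp_all add: AP)
    also have "A r (A r ((P r ^^ (k - 1)) v)) = 0" using r A2 by simp
    finally show ?case by (simp add: scale_left_distrib algebra_simps)
  qed simp
  have "\<forall>v. (P r ^^ Suc r) v = 0" if "r \<le> n" for r
    using that
  proof (induction r)
    case 0
    then show ?case by (simp add: P_def)
  next
    case (Suc r)
    have z: "(P r ^^ Suc r) v = 0" for v using Suc by simp
    have "(P r ^^ Suc (Suc r)) v = P r ((P r ^^ Suc r) v)" for v by simp
    then have "(P r ^^ Suc (Suc r)) v = 0" for v by (simp only: z lin_0[OF linP])
    moreover have "(P r ^^ (Suc (Suc r) - 1)) v = 0" for v using z by simp
    ultimately show ?case by (simp only: pow[OF Suc.prems]) (simp add: lin_0[OF linA])
  qed
  moreover have "cre 0 0 = P n"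
  proof
    fix v
    have "S (-1) (-1) v = (\<Sum>p<n. sc (- eta p) (u p (-1) (u (conj p) (-1) v)))
      + (\<Sum>p<n. sc (- eta (n + p)) (u (n + p) (-1) (u (conj (n + p)) (-1) v)))"
      unfolding S_def mult_2 by (rule sum_lessThan_add)
    also have "\<dots> = (\<Sum>i<n. sc 2 (A i v))"
      unfolding sum.distrib[symmetric]
    proof (rule sum.cong[OF refl])
      fix i assume "i \<in> {..<n}"
      then have i: "i < n" "i < 2 * n" "n + i < 2 * n" by auto
      have "sc 2 (A i v) = A i v + A i v" using scale_left_distrib[of 1 1 "A i v"] by simp
      then show "sc (- eta i) (u i (-1) (u (conj i) (-1) v)) + sc (- eta (n + i)) (u (n + i) (-1) (u (conj (n + i)) (-1) v)) = sc 2 (A i v)"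
        using i anti[OF i(3,2), of v] by (simp add: eta_def conj_def A_def add.commute)
    qed
    finally show "cre 0 0 v = P n v" by (simp add: P_def scale_sum_right)
  qed
  ultimately show ?thesis by simp
qed

text \<open>The leading word of the (n + 1)-st power of j^0 vanishes, so this monomial is a
  combination of ones with at most \<open>n\<close> factors. Its weight is that of j^(2n).\<close>

lemma replicate_mon_Mle: "mon (replicate (Suc n) (0, 0)) \<in> Mle n (int (2 * n + 2))"
proof -
  let ?ms = "replicate (Suc n) (0, 0) :: (nat \<times> nat) list"
  have "crew (replicate k (0, 0)) = (cre 0 0 ^^ k) (vac V)" for k
    by (induction k) (simp_all add: crew_def)
  then have "crew ?ms = 0" by (simp only: cre_0_0_nilpotent)
  moreover have "mwts ?ms = 2 * n + 2" by (simp add: mwts_def mwt_def sum_list_replicate)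
  ultimately have "mon ?ms \<in> Qle n (int (2 * n + 2))" using mon_minus_crew[of ?ms] by simp
  then show ?thesis using Qle_subset_Mle by blast
qed

end

section \<open>Linear independence of the monomials\<close>

context symplectic_fermion_algebra
begin

text \<open>The modes of a system of \<open>n\<close> charged fermions \<open>b, c\<close> with
  \<open>b\<^sub>k c\<^sub>l + c\<^sub>l b\<^sub>k = \<delta>\<^sub>k\<^sub>+\<^sub>l\<^sub>,\<^sub>0\<close>, realized on the same Fock space by relabelling. The substitution
  \<open>e = b\<close>, \<open>f = \<partial>c\<close> embeds the symplectic fermions; the additional zero modes make multiplication
  of \<open>b\<close> and division of \<open>c\<close> by a function of the coordinate available.\<close>

definition bop :: "nat \<Rightarrow> int \<Rightarrow> 'v \<Rightarrow> 'v" where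
  "bop c k = (if k \<ge> 0 then u c (k + 1) else u c k)"

text \<open>The branch \<open>k \<le> 0\<close> consists of creation operators: the zero mode of c
  creates, that of b annihilates. The factors normalize the anticommutator with \<open>bop\<close>
  to 1.\<close>

definition cop :: "nat \<Rightarrow> int \<Rightarrow> 'v \<Rightarrow> 'v" where
  "cop c k = (\<lambda>v. if k \<le> 0 then sc (1 / of_int (1 - k)) (u (n + c) (k - 1) v)
                else sc (- 1 / of_int k) (u (n + c) k v))"

lemma lin_bop: "lin (bop c k)"
  by (simp add: bop_def lin_u)

lemma lin_cop: "lin (cop c k)"
  by (cases "k \<le> 0") (simp_all add: cop_def lin_smult lin_u del: scale_minus_left)

lemmas bop_neg = lin_neg[OF lin_bop] and cop_neg = lin_neg[OF lin_cop]

lemma bop_vac: "k \<ge> 0 \<Longrightarrow> bop c k (vac V) = 0"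
  by (simp add: bop_def u_vac)

lemma cop_vac: "k \<ge> 1 \<Longrightarrow> cop c k (vac V) = 0"
  by (simp add: cop_def u_vac)

lemma omega_ef: "c < n \<Longrightarrow> d < n \<Longrightarrow> omega c (n + d) = (if c = d then 1 else 0)"
  and omega_ee: "c < n \<Longrightarrow> d < n \<Longrightarrow> omega c d = 0"
  and omega_ff: "c < n \<Longrightarrow> d < n \<Longrightarrow> omega (n + c) (n + d) = 0"
  and omega_fe: "c < n \<Longrightarrow> d < n \<Longrightarrow> omega (n + c) d = (if c = d then - 1 else 0)"
  by (auto simp: omega_def conj_def eta_def)

lemma bop_bop: "c < n \<Longrightarrow> d < n \<Longrightarrow> bop c k (bop d l v) = - bop d l (bop c k v)"
  by (simp add: bop_def u_u[of c d] omega_ee)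

lemma cop_cop: "c < n \<Longrightarrow> d < n \<Longrightarrow> cop c k (cop d l v) = - cop d l (cop c k v)"
  by (simp add: cop_def u_scale u_neg u_u[of "n + c" "n + d"] omega_ff mult.commute scale_right_diff_distrib)

lemma bop_cop:
  assumes "c < n" "d < n"
  shows "bop c k (cop d l v) = sc (if c = d \<and> k + l = 0 then 1 else 0) v - cop d l (bop c k v)"
proof -
  have *: "u c k' (u (n + d) l' v) = sc (if k' + l' = 0 then of_int k' * (if c = d then 1 else 0) else 0) v
      - u (n + d) l' (u c k' v)" for k' l'
    using u_u[of c "n + d" k' l' v] assms by (simp add: omega_ef)
  have nz: "(1 + of_int k :: complex) \<noteq> 0" if "k \<ge> 0"
  proof -
    have "of_int (1 + k) \<noteq> (0 :: complex)" using that by (simp only: of_int_eq_0_iff)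
    then show ?thesis by simp
  qed
  consider "k \<ge> 0" "l \<le> 0" | "k \<ge> 0" "l > 0" | "k < 0" "l \<le> 0" | "k < 0" "l > 0" by linarith
  then show ?thesis
  proof cases
    case 1
    have "(of_int k :: complex) = - of_int l" if "k + l = 0"
      using that by (simp add: eq_neg_iff_add_eq_0 flip: of_int_add)
    then show ?thesis using 1 nz by (auto simp: bop_def cop_def u_scale u_neg * scale_right_diff_distrib)
  next
    case 4
    have "(of_int k :: complex) = - of_int l" if "k + l = 0"
      using that by (simp add: eq_neg_iff_add_eq_0 flip: of_int_add)
    then show ?thesis using 4 by (auto simp: bop_def cop_def u_scale u_neg * scale_right_diff_distrib)
  qed (auto simp: bop_def cop_def u_scale u_neg * scale_right_diff_distrib)
qed

lemma cop_bop:
  assumes "c < n" "d < n"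
  shows "cop c k (bop d l v) = sc (if c = d \<and> k + l = 0 then 1 else 0) v - bop d l (cop c k v)"
  using bop_cop[OF assms(2,1), of l k v] by (auto simp: add.commute algebra_simps)

text \<open>An operator that commutes with all b and c therefore commutes with all nonzero modes of
  the generators, as required by \<open>commuting_scalar\<close>.\<close>

lemma modes_bc:
  assumes "p < 2 * n" "k \<noteq> 0"
  shows "(\<exists>c j a. c < n \<and> (\<forall>v. u p k v = sc a (bop c j v))) \<or> (\<exists>c j a. c < n \<and> (\<forall>v. u p k v = sc a (cop c j v)))"
proof (cases "p < n")
  case True
  have "u p k v = sc 1 (bop p (if k > 0 then k - 1 else k) v)" for v
    using assms by (auto simp: bop_def)
  then show ?thesis using True by blast
next
  case False
  have nz: "(of_int k :: complex) \<noteq> 0" using assms by simp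
  have "u p k v = sc (if k > 0 then - of_int k else - of_int k) (cop (p - n) (if k > 0 then k else k + 1) v)" for v
    using assms False nz by (auto simp: cop_def)
  moreover have "p - n < n" using assms False by linarith
  ultimately show ?thesis by blast
qed

text \<open>The modes of b and of the derivative of c; differentiation produces the factor
  \<open>- k\<close>, which removes the zero mode of c.\<close>

definition utl :: "nat \<Rightarrow> int \<Rightarrow> 'v \<Rightarrow> 'v" where
  "utl p k = (if p < n then bop p k else (\<lambda>v. sc (- of_int k) (cop (p - n) k v)))"

lemma lin_utl: "lin (utl p k)"
  by (simp add: utl_def lin_bop lin_smult lin_cop del: scale_minus_left)

lemma utl_utl:
  assumes "p < 2 * n" "q < 2 * n"
  shows "utl p k (utl q l v) = sc (if k + l = 0 then of_int k * omega p q else 0) v - utl q l (utl p k v)"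
proof -
  have lt: "\<not> p < n \<Longrightarrow> p - n < n" "\<not> q < n \<Longrightarrow> q - n < n" using assms by auto
  have om: "\<not> p < n \<Longrightarrow> p = n + (p - n)" "\<not> q < n \<Longrightarrow> q = n + (q - n)" by auto
  consider "p < n" "q < n" | "p < n" "\<not> q < n" | "\<not> p < n" "q < n" | "\<not> p < n" "\<not> q < n" by blast
  then show ?thesis
  proof cases
    case 1
    then show ?thesis by (simp add: utl_def bop_bop[of p q] omega_ee)
  next
    case 2
    have "omega p q = (if p = q - n then 1 else 0)" using omega_ef[of p "q - n"] 2 lt om by metis
    moreover have "(of_int k :: complex) = - of_int l" if "k + l = 0"
      using that by (simp add: eq_neg_iff_add_eq_0 flip: of_int_add)
    ultimately show ?thesis using 2 lt
      by (auto simp: utl_def lin_scale[OF lin_bop] bop_neg bop_cop scale_right_diff_distrib)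
  next
    case 3
    have "omega p q = (if p - n = q then - 1 else 0)" using omega_fe[of "p - n" q] 3 lt om by metis
    then show ?thesis using 3 lt
      by (auto simp: utl_def lin_scale[OF lin_bop] bop_neg cop_bop scale_right_diff_distrib)
  next
    case 4
    have "omega p q = 0" using omega_ff[of "p - n" "q - n"] 4 lt om by metis
    then show ?thesis using 4 lt
      by (simp add: utl_def lin_scale[OF lin_cop] cop_neg cop_cop[of "p - n" "q - n"] mult.commute)
  qed
qed

lemma utl_vac: "k \<ge> 0 \<Longrightarrow> utl p k (vac V) = 0"
  by (cases "k = 0") (auto simp: utl_def bop_vac cop_vac)

text \<open>The realization e = b, f = derivative of c, defined on creation words;
  \<open>iota_u\<close> shows that it intertwines the annihilators, too.\<close>

definition iota :: "'v \<Rightarrow> 'v" where "iota = subst_cr (\<lambda>(p, k). utl p (- int k))"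

lemma lin_iota: "lin iota"
  unfolding iota_def by (rule lin_subst_cr)

lemma iota_vac: "iota (vac V) = vac V"
  unfolding iota_def by (rule subst_cr_vac)

lemma iota_creation: "p < 2 * n \<Longrightarrow> k \<ge> 1 \<Longrightarrow> iota (u p (- int k) v) = utl p (- int k) (iota v)"
proof -
  assume "p < 2 * n" "k \<ge> 1"
  then have m: "(p, k) \<in> modes" by (simp add: modes_def)
  have "subst_cr (\<lambda>(p, k). utl p (- int k)) (crop (p, k) v)
     = (case (p, k) of (p, k) \<Rightarrow> utl p (- int k)) (subst_cr (\<lambda>(p, k). utl p (- int k)) v)"
  proof (rule subst_cr_cr[OF _ _ m])
    fix a b v assume "a \<in> modes" "b \<in> modes"
    then show "(case a of (p, k) \<Rightarrow> utl p (- int k)) ((case b of (p, k) \<Rightarrow> utl p (- int k)) v)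
       = - (case b of (p, k) \<Rightarrow> utl p (- int k)) ((case a of (p, k) \<Rightarrow> utl p (- int k)) v)"
      using utl_utl[of "fst a" "fst b" "- int (snd a)" "- int (snd b)" v]
      by (cases a; cases b) (simp add: modes_def)
  qed (simp add: lin_utl split: prod.split)
  then show ?thesis by (simp add: iota_def crop_def)
qed

lemma iota_neg: "p < 2 * n \<Longrightarrow> k < 0 \<Longrightarrow> iota (u p k v) = utl p k (iota v)"
  using iota_creation[of p "nat (- k)" v] by simp

lemma iota_u: "p < 2 * n \<Longrightarrow> k \<ge> 1 \<Longrightarrow> iota (u p k v) = utl p k (iota v)"
proof (induction v rule: state_induct)
  case vac
  then show ?case by (simp add: u_vac iota_vac utl_vac lin_0[OF lin_iota])
next
  case (u q l x)
  then show ?case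
    by (simp add: u_u[of p q] utl_utl[of p q] iota_creation lin_diff[OF lin_iota] lin_scale[OF lin_iota])
qed (simp_all add: u_add u_scale lin_add[OF lin_iota] lin_scale[OF lin_iota] lin_add[OF lin_utl] lin_scale[OF lin_utl])

text \<open>The zero mode of b anticommutes with all modes of b and of the derivative of c, and it
  kills the vacuum.\<close>

lemma bop_0_iota: "c < n \<Longrightarrow> bop c 0 (iota v) = 0"
proof (induction v rule: state_induct)
  case vac
  then show ?case by (simp add: iota_vac bop_vac)
next
  case (u q l x)
  have "bop c 0 = utl c 0" using u by (simp add: utl_def)
  then show ?case using u
    by (simp add: utl_utl[of c q] iota_creation lin_0[OF lin_utl])
qed (simp_all add: lin_add[OF lin_iota] lin_scale[OF lin_iota] lin_add[OF lin_bop] lin_scale[OF lin_bop])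

text \<open>\<open>ctype T p s\<close>: commutation with \<open>T\<close> acts on the modes like the commutation with
  \<open>\<Sum>l. p(l) b\<^sub>s\<^sub>-\<^sub>l c\<^sub>l\<close>.\<close>

definition ctype :: "('v \<Rightarrow> 'v) \<Rightarrow> (nat \<Rightarrow> int \<Rightarrow> complex) \<Rightarrow> int \<Rightarrow> bool" where
  "ctype T p s \<longleftrightarrow> lin T \<and>
     (\<forall>c k v. c < n \<longrightarrow> T (bop c k v) = bop c k (T v) + sc (p c (- k)) (bop c (k + s) v)) \<and>
     (\<forall>c k v. c < n \<longrightarrow> T (cop c k v) = cop c k (T v) - sc (p c (k + s)) (cop c (k + s) v))"

lemma ctypeD:
  assumes "ctype T p s"
  shows "lin T"
    and "\<And>c k v. c < n \<Longrightarrow> T (bop c k v) = bop c k (T v) + sc (p c (- k)) (bop c (k + s) v)"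
    and "\<And>c k v. c < n \<Longrightarrow> T (cop c k v) = cop c k (T v) - sc (p c (k + s)) (cop c (k + s) v)"
  using assms by (auto simp: ctype_def)

text \<open>The symbol determines the commutators with all modes, hence determines the operator up
  to a scalar.\<close>

lemma ctype_zero_scalar:
  assumes T: "ctype T p s" and p: "\<And>c l. c < n \<Longrightarrow> p c l = 0"
  shows "T v = sc (eps (T (vac V))) v"
proof (rule commuting_scalar[OF ctypeD(1)[OF T]])
  fix q k w assume "q < 2 * n" "k \<noteq> (0::int)"
  from modes_bc[OF this] show "T (u q k w) = u q k (T w)"
    using ctypeD[OF T] by (auto simp: lin_scale p)
qed

text \<open>\<open>bcP\<close> and \<open>bcQ\<close> are the left and right factors of the normally
  ordered product of \<open>b\<close> and \<open>c\<close> modes. For \<open>l \<le> 0\<close> the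
  order is reversed, with a sign, which makes the sum over \<open>l\<close> locally finite.\<close>

definition bcP :: "nat \<Rightarrow> (int \<Rightarrow> complex) \<Rightarrow> int \<Rightarrow> int \<Rightarrow> 'v \<Rightarrow> 'v" where
  "bcP c A s l v = (if l \<ge> 1 then sc (A l) (bop c (s - l) v) else sc (- A l) (cop c l v))"

definition bcQ :: "nat \<Rightarrow> int \<Rightarrow> int \<Rightarrow> 'v \<Rightarrow> 'v" where
  "bcQ c s l v = (if l \<ge> 1 then cop c l v else bop c (s - l) v)"

definition bc :: "nat \<Rightarrow> (int \<Rightarrow> complex) \<Rightarrow> int \<Rightarrow> 'v \<Rightarrow> 'v" where
  "bc c A s = bil (bcP c A s) (bcQ c s)"

lemma lin_bcP: "lin (bcP c A s l)"
  by (cases "l \<ge> 1") (simp_all add: bcP_def[abs_def] lin_smult lin_bop lin_cop del: scale_minus_left)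

lemma lin_bcQ: "lin (bcQ c s l)"
  by (cases "l \<ge> 1") (simp_all add: bcQ_def[abs_def] lin_bop lin_cop)

lemma finite_bcQ:
  assumes "c < n"
  shows "finite {l. bcQ c s l v \<noteq> 0}"
proof -
  obtain N where N: "\<forall>p<2*n. \<forall>k\<ge>N. u p k v = 0" using u_truncation by blast
  have "{l. bcQ c s l v \<noteq> 0} \<subseteq> {- \<bar>N\<bar> - \<bar>s\<bar> .. \<bar>N\<bar> + \<bar>s\<bar>}"
  proof
    fix l assume l: "l \<in> {l. bcQ c s l v \<noteq> 0}"
    show "l \<in> {- \<bar>N\<bar> - \<bar>s\<bar> .. \<bar>N\<bar> + \<bar>s\<bar>}"
    proof (rule ccontr)
      assume out: "l \<notin> {- \<bar>N\<bar> - \<bar>s\<bar> .. \<bar>N\<bar> + \<bar>s\<bar>}"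
      have "bcQ c s l v = 0"
      proof (cases "l \<ge> 1")
        case True
        then have "l \<ge> N" using out by auto
        then show ?thesis using True N assms by (simp add: bcQ_def cop_def)
      next
        case False
        then have "s - l \<ge> N" "s - l \<ge> 0" using out by auto
        then show ?thesis using False N assms by (simp add: bcQ_def bop_def)
      qed
      with l show False by simp
    qed
  qed
  then show ?thesis by (rule finite_subset) simp
qed

lemma lin_bc: "c < n \<Longrightarrow> lin (bc c A s)"
  unfolding bc_def by (intro lin_bil lin_bcP lin_bcQ finite_bcQ)

lemma bc_bop:
  assumes "c < n" "d < n"
  shows "bc c A s (bop d k v) = bop d k (bc c A s v) + sc (if d = c then A (- k) else 0) (bop d (k + s) v)"
proof -
  let ?\<alpha> = "\<lambda>l. if l \<le> 0 \<and> c = d \<and> l + k = 0 then - A l else 0"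
  let ?\<beta> = "\<lambda>l. if l \<ge> 1 \<and> c = d \<and> l + k = 0 then 1 else 0"
  have "bc c A s (bop d k v) = bop d k (bc c A s v)
     + (\<Sum>l\<in>{- k}. sc (?\<beta> l) (bcP c A s l v) - sc (?\<alpha> l) (bcQ c s l v))"
    unfolding bc_def
  proof (rule bil_commutator[OF lin_bcP finite_bcQ[OF assms(1)] lin_bop])
    show "bcP c A s l (bop d k w) = sc (?\<alpha> l) w - bop d k (bcP c A s l w)" for l w
      using assms by (auto simp: bcP_def bop_bop[of c d] cop_bop[of c d] lin_scale[OF lin_bop] bop_neg scale_right_diff_distrib)
    show "bcQ c s l (bop d k w) = sc (?\<beta> l) w - bop d k (bcQ c s l w)" for l w
      using assms by (auto simp: bcQ_def bop_bop[of c d] cop_bop[of c d])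
  qed auto
  also have "(\<Sum>l\<in>{- k}. sc (?\<beta> l) (bcP c A s l v) - sc (?\<alpha> l) (bcQ c s l v))
     = sc (if d = c then A (- k) else 0) (bop d (k + s) v)"
    by (auto simp: bcP_def bcQ_def add.commute)
  finally show ?thesis .
qed

lemma bc_cop:
  assumes "c < n" "d < n"
  shows "bc c A s (cop d k v) = cop d k (bc c A s v) - sc (if d = c then A (k + s) else 0) (cop d (k + s) v)"
proof -
  let ?\<alpha> = "\<lambda>l. if l \<ge> 1 \<and> c = d \<and> s - l + k = 0 then A l else 0"
  let ?\<beta> = "\<lambda>l. if l \<le> 0 \<and> c = d \<and> s - l + k = 0 then 1 else 0"
  have "bc c A s (cop d k v) = cop d k (bc c A s v)
     + (\<Sum>l\<in>{k + s}. sc (?\<beta> l) (bcP c A s l v) - sc (?\<alpha> l) (bcQ c s l v))"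
    unfolding bc_def
  proof (rule bil_commutator[OF lin_bcP finite_bcQ[OF assms(1)] lin_cop])
    show "bcP c A s l (cop d k w) = sc (?\<alpha> l) w - cop d k (bcP c A s l w)" for l w
      using assms by (auto simp: bcP_def cop_cop[of c d] bop_cop[of c d] lin_scale[OF lin_cop] cop_neg scale_right_diff_distrib)
    show "bcQ c s l (cop d k w) = sc (?\<beta> l) w - cop d k (bcQ c s l w)" for l w
      using assms by (auto simp: bcQ_def cop_cop[of c d] bop_cop[of c d])
  qed auto
  also have "(\<Sum>l\<in>{k + s}. sc (?\<beta> l) (bcP c A s l v) - sc (?\<alpha> l) (bcQ c s l v))
     = - sc (if d = c then A (k + s) else 0) (cop d (k + s) v)"
    by (auto simp: bcP_def bcQ_def)
  finally show ?thesis by simp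
qed

lemma ctype_bc: "c < n \<Longrightarrow> ctype (bc c A s) (\<lambda>d. if d = c then A else (\<lambda>_. 0)) s"
  unfolding ctype_def using lin_bc bc_bop bc_cop by (auto split: if_splits)

lemma ctype_sum:
  assumes "finite A" "\<And>i. i \<in> A \<Longrightarrow> ctype (T i) (p i) s"
  shows "ctype (\<lambda>v. \<Sum>i\<in>A. T i v) (\<lambda>c l. \<Sum>i\<in>A. p i c l) s"
  unfolding ctype_def
proof (intro conjI allI impI)
  show "lin (\<lambda>v. \<Sum>i\<in>A. T i v)" using assms ctypeD(1) by (intro lin_sum_op) blast
  fix c k v assume c: "c < n"
  show "(\<Sum>i\<in>A. T i (bop c k v)) = bop c k (\<Sum>i\<in>A. T i v) + sc (\<Sum>i\<in>A. p i c (- k)) (bop c (k + s) v)"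
    using ctypeD(2)[OF assms(2)] c by (simp add: lin_sum[OF lin_bop] scale_sum_left sum.distrib)
  show "(\<Sum>i\<in>A. T i (cop c k v)) = cop c k (\<Sum>i\<in>A. T i v) - sc (\<Sum>i\<in>A. p i c (k + s)) (cop c (k + s) v)"
    using ctypeD(3)[OF assms(2)] c by (simp add: lin_sum[OF lin_cop] scale_sum_left sum_subtractf)
qed

lemma ctype_shift_scalar: "ctype T p s \<Longrightarrow> ctype (\<lambda>v. T v - sc a v) p s"
  unfolding ctype_def
  by (auto intro!: lin_minus lin_scale_op
      simp: lin_scale[OF lin_bop] lin_scale[OF lin_cop] lin_diff[OF lin_bop] lin_diff[OF lin_cop] scale_left_commute)

text \<open>A current mode acts as a shift by \<open>j\<close>, so its commutator replaces the
  symbol by a backward difference and lowers its degree as a polynomial.\<close>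

lemma ctype_commutator_bc:
  assumes T: "ctype T p s" and c: "c < n"
  shows "ctype (\<lambda>v. bc c (\<lambda>_. 1) j (T v) - T (bc c (\<lambda>_. 1) j v))
     (\<lambda>d l. if d = c then p c l - p c (l - j) else 0) (s + j)"
  unfolding ctype_def
proof (intro conjI allI impI)
  note linT = ctypeD(1)[OF T]
  let ?B = "bc c (\<lambda>_. 1) j"
  show "lin (\<lambda>v. ?B (T v) - T (?B v))"
    by (intro lin_minus lin_comp[OF lin_bc] lin_comp[OF linT] linT lin_bc c)
  fix d k v assume d: "d < n"
  have e: "- (k + j) = - k - j" "k + s + j = k + j + s" "k + j + s = k + (s + j)" "k + (s + j) - j = k + s" by auto
  show "?B (T (bop d k v)) - T (?B (bop d k v)) = bop d k (?B (T v) - T (?B v))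
     + sc (if d = c then p c (- k) - p c (- k - j) else 0) (bop d (k + (s + j)) v)"
    using c d
    by (simp add: ctypeD(2)[OF T] bc_bop lin_add[OF linT] lin_add[OF lin_bc[OF c]] lin_scale[OF linT] lin_scale[OF lin_bc[OF c]]
        lin_diff[OF lin_bop] e) (auto simp: scale_left_diff_distrib scale_right_distrib algebra_simps)
  show "?B (T (cop d k v)) - T (?B (cop d k v)) = cop d k (?B (T v) - T (?B v))
     - sc (if d = c then p c (k + (s + j)) - p c (k + (s + j) - j) else 0) (cop d (k + (s + j)) v)"
    using c d
    by (simp add: ctypeD(3)[OF T] bc_cop lin_diff[OF linT] lin_diff[OF lin_bc[OF c]] lin_scale[OF linT] lin_scale[OF lin_bc[OF c]]
        lin_diff[OF lin_cop] e) (auto simp: scale_left_diff_distrib scale_right_diff_distrib algebra_simps)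
qed

lemma bc_vac_pos: "j \<ge> 1 \<Longrightarrow> bc c A j (vac V) = 0"
proof -
  assume "j \<ge> 1"
  then have "bcQ c j l (vac V) = 0" for l by (auto simp: bcQ_def bop_vac cop_vac)
  then show ?thesis by (simp add: bc_def bil_def lin_0[OF lin_bcP])
qed

lemma eps_bop: "c < n \<Longrightarrow> k < 0 \<Longrightarrow> eps (bop c k v) = 0"
  and eps_cop: "c < n \<Longrightarrow> k \<le> 0 \<Longrightarrow> eps (cop c k v) = 0"
proof -
  have "eps (u p k v) = 0" if "p < 2 * n" "k < 0" for p k v
    using eps_cr[of "(p, nat (- k))" v] that by (simp add: modes_def crop_def)
  then show "c < n \<Longrightarrow> k < 0 \<Longrightarrow> eps (bop c k v) = 0" "c < n \<Longrightarrow> k \<le> 0 \<Longrightarrow> eps (cop c k v) = 0"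
    by (simp_all add: bop_def cop_def eps_scale)
qed

text \<open>The vacuum expectation kills each term whose outer factor creates, which leaves a range
  independent of \<open>x\<close>.\<close>

lemma eps_bc:
  assumes "c < n" "j \<ge> 1"
  shows "eps (bc c (\<lambda>_. 1) j x) = (\<Sum>l\<in>{1..j}. eps (bop c (j - l) (cop c l x)))"
proof -
  let ?F = "\<lambda>l. bcP c (\<lambda>_. 1) j l (bcQ c j l x)"
  let ?S = "{l. bcQ c j l x \<noteq> 0} \<union> {1..j}"
  have fin: "finite ?S" using finite_bcQ assms by blast
  have "bc c (\<lambda>_. 1) j x = (\<Sum>l\<in>?S. ?F l)"
    unfolding bc_def bil_def by (rule Sum_any.expand_superset[OF fin]) (auto simp: lin_0[OF lin_bcP])
  then have "eps (bc c (\<lambda>_. 1) j x) = (\<Sum>l\<in>?S. eps (?F l))" by (simp only: eps_sum)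
  also have "\<dots> = (\<Sum>l\<in>{1..j}. eps (?F l))"
  proof (rule sum.mono_neutral_right[OF fin])
    show "\<forall>l\<in>?S - {1..j}. eps (?F l) = 0"
    proof
      fix l assume "l \<in> ?S - {1..j}"
      then consider "l \<le> 0" | "l > j" by fastforce
      then show "eps (?F l) = 0"
        by cases (use assms in \<open>auto simp: bcP_def eps_scale eps_cop eps_bop eps_neg\<close>)
    qed
  qed auto
  also have "\<dots> = (\<Sum>l\<in>{1..j}. eps (bop c (j - l) (cop c l x)))"
    by (rule sum.cong) (auto simp: bcP_def bcQ_def)
  finally show ?thesis .
qed

text \<open>A constant symbol has difference zero, so the commutator is a scalar. Its value is the
  central term of the Heisenberg algebra: for \<open>j + s = 0\<close> each of the \<open>j\<close>
  terms in \<open>eps_bc\<close> contributes \<open>a\<close>.\<close>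

lemma commutator_bc_scalar:
  assumes T: "ctype T p s" and c: "c < n" and p: "\<And>l. p c l = a" and j: "j \<ge> 1"
  shows "bc c (\<lambda>_. 1) j (T v) - T (bc c (\<lambda>_. 1) j v) = sc (if j + s = 0 then of_int j * a else 0) v"
proof -
  let ?C = "\<lambda>v. bc c (\<lambda>_. 1) j (T v) - T (bc c (\<lambda>_. 1) j v)"
  have "?C v = sc (eps (?C (vac V))) v"
    by (rule ctype_zero_scalar[OF ctype_commutator_bc[OF T c, of j]]) (simp add: p)
  moreover have "eps (?C (vac V)) = (if j + s = 0 then of_int j * a else 0)"
  proof -
    have "?C (vac V) = bc c (\<lambda>_. 1) j (T (vac V))"
      using j by (simp add: bc_vac_pos lin_0[OF ctypeD(1)[OF T]])
    then have "eps (?C (vac V)) = (\<Sum>l\<in>{1..j}. eps (bop c (j - l) (cop c l (T (vac V)))))"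
      using eps_bc[OF c j] by simp
    also have "\<dots> = (\<Sum>l\<in>{1..j}. if j + s = 0 then a else 0)"
    proof (rule sum.cong[OF refl])
      fix l assume l: "l \<in> {1..j}"
      have "T (cop c l (vac V)) = 0" using l by (simp add: cop_vac lin_0[OF ctypeD(1)[OF T]])
      then have "cop c l (T (vac V)) = sc a (cop c (l + s) (vac V))"
        using ctypeD(3)[OF T c, of l "vac V"] by (simp add: p)
      then have "bop c (j - l) (cop c l (T (vac V))) = sc a (sc (if j - l + (l + s) = 0 then 1 else 0) (vac V))"
        using l c by (simp add: lin_scale[OF lin_bop] bop_cop bop_vac lin_0[OF lin_cop])
      then show "eps (bop c (j - l) (cop c l (T (vac V)))) = (if j + s = 0 then a else 0)"
        by (simp add: eps_scale eps_vac)
    qed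
    also have "\<dots> = (if j + s = 0 then of_int j * a else 0)" using j by simp
    finally show ?thesis .
  qed
  ultimately show ?thesis by simp
qed

end

context complex_space
begin

text \<open>\<open>degT T d A \<sigma>\<close>: the \<open>d\<close>-fold commutator of \<open>T\<close> with \<open>A\<close> is the scalar \<open>d! \<sigma>\<close>. This behaves
  like "\<open>A\<close> has degree \<open>d\<close> with symbol \<open>\<sigma>\<close>".\<close>

primrec degT :: "('b \<Rightarrow> 'b) \<Rightarrow> nat \<Rightarrow> ('b \<Rightarrow> 'b) \<Rightarrow> complex \<Rightarrow> bool" where
  "degT T 0 = (\<lambda>A \<sigma>. \<forall>v. A v = scale \<sigma> v)"
| "degT T (Suc d) = (\<lambda>A \<sigma>. degT T d (\<lambda>v. T (A v) - A (T v)) (of_nat (Suc d) * \<sigma>))"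

lemma degT_add:
  assumes "lin T"
  shows "degT T d A \<sigma> \<Longrightarrow> degT T d B \<tau> \<Longrightarrow> degT T d (\<lambda>v. A v + B v) (\<sigma> + \<tau>)"
proof (induction d arbitrary: A B \<sigma> \<tau>)
  case 0
  then show ?case by (simp add: scale_left_distrib)
next
  case (Suc d)
  have "(\<lambda>v. T (A v + B v) - (A (T v) + B (T v))) = (\<lambda>v. (T (A v) - A (T v)) + (T (B v) - B (T v)))"
    using assms by (auto simp: lin_add)
  then show ?case
    using Suc.IH[OF Suc.prems(1)[unfolded degT.simps] Suc.prems(2)[unfolded degT.simps]]
    by (simp only: degT.simps distrib_left)
qed

lemma degT_scale:
  assumes "lin T"
  shows "degT T d A \<sigma> \<Longrightarrow> degT T d (\<lambda>v. scale c (A v)) (c * \<sigma>)"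
proof (induction d arbitrary: A \<sigma>)
  case (Suc d)
  have "(\<lambda>v. T (scale c (A v)) - scale c (A (T v))) = (\<lambda>v. scale c (T (A v) - A (T v)))"
    using assms by (auto simp: lin_scale scale_right_diff_distrib)
  then show ?case
    using Suc.IH[OF Suc.prems[unfolded degT.simps]]
    by (simp only: degT.simps mult.left_commute)
qed simp

lemma degT_zero:
  assumes "lin T"
  shows "degT T d (\<lambda>v. 0) 0"
  by (induction d) (simp_all add: lin_0 assms)

lemma degT_sum:
  assumes "lin T" "\<And>i. i \<in> I \<Longrightarrow> degT T d (A i) (\<sigma> i)"
  shows "degT T d (\<lambda>v. \<Sum>i\<in>I. A i v) (\<Sum>i\<in>I. \<sigma> i)"
  using assms(2)
  by (induction I rule: infinite_finite_induct) (auto intro: degT_zero degT_add assms(1))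

text \<open>Leibniz rule for commutators; the factorial in the normalization absorbs the binomial
  coefficients, so that symbols simply multiply.\<close>

lemma degT_mult:
  assumes T: "lin T"
  shows "lin A \<Longrightarrow> degT T d1 A \<sigma> \<Longrightarrow> degT T d2 B \<tau> \<Longrightarrow> degT T (d1 + d2) (\<lambda>v. A (B v)) (\<sigma> * \<tau>)"
proof (induction "d1 + d2" arbitrary: d1 d2 A B \<sigma> \<tau> rule: less_induct)
  case less
  consider "d1 = 0" | "d2 = 0" | i j where "d1 = Suc i" "d2 = Suc j"
    by (cases d1; cases d2) auto
  then show ?case
  proof cases
    case 1
    then have "(\<lambda>v. A (B v)) = (\<lambda>v. scale \<sigma> (B v))" using less.prems by auto
    then show ?thesis using degT_scale[OF T less.prems(3)] 1 by simp
  next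
    case 2
    then have "(\<lambda>v. A (B v)) = (\<lambda>v. scale \<tau> (A v))" using less.prems by (auto simp: lin_scale)
    then show ?thesis using degT_scale[OF T less.prems(2), of \<tau>] 2 by (simp add: mult.commute)
  next
    case 3
    let ?A' = "\<lambda>v. T (A v) - A (T v)" and ?B' = "\<lambda>v. T (B v) - B (T v)"
    have linA: "lin ?A'"
      by (rule lin_minus[OF lin_comp[OF T less.prems(1)] lin_comp[OF less.prems(1) T]])
    have "degT T (i + d2) (\<lambda>v. ?A' (B v)) (of_nat d1 * \<sigma> * \<tau>)"
      using less.hyps[of i d2 ?A' _ B \<tau>] less.prems linA 3 by simp
    then have a: "degT T (i + Suc j) (\<lambda>v. ?A' (B v)) (of_nat d1 * \<sigma> * \<tau>)" using 3 by simp
    have "degT T (d1 + j) (\<lambda>v. A (?B' v)) (\<sigma> * (of_nat d2 * \<tau>))"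
      using less.hyps[of d1 j A \<sigma> ?B'] less.prems 3 by simp
    then have b: "degT T (i + Suc j) (\<lambda>v. A (?B' v)) (\<sigma> * (of_nat d2 * \<tau>))" using 3 by simp
    have "(\<lambda>v. T (A (B v)) - A (B (T v))) = (\<lambda>v. ?A' (B v) + A (?B' v))"
      using less.prems(1) by (auto simp: lin_diff)
    moreover have "of_nat d1 * \<sigma> * \<tau> + \<sigma> * (of_nat d2 * \<tau>) = of_nat (Suc (i + Suc j)) * (\<sigma> * \<tau>)"
      using 3 by (simp add: algebra_simps)
    ultimately have "degT T (Suc (i + Suc j)) (\<lambda>v. A (B v)) (\<sigma> * \<tau>)"
      using degT_add[OF T a b] by (simp only: degT.simps)
    then show ?thesis using 3 by simp
  qed
qed

text \<open>Since \<open>T\<close> kills \<open>x\<close>, applying \<open>T\<close> to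
  \<open>A x\<close> is the same as applying the commutator to \<open>x\<close>.\<close>

lemma degT_pow:
  assumes T: "lin T" and x: "T x = 0"
  shows "lin A \<Longrightarrow> degT T d A \<sigma> \<Longrightarrow> (T ^^ d) (A x) = scale (fact d * \<sigma>) x"
proof (induction d arbitrary: A \<sigma>)
  case (Suc d)
  let ?A = "\<lambda>v. T (A v) - A (T v)"
  have "lin ?A" by (rule lin_minus[OF lin_comp[OF T Suc.prems(1)] lin_comp[OF Suc.prems(1) T]])
  then have "(T ^^ d) (?A x) = scale (fact d * (of_nat (Suc d) * \<sigma>)) x"
    using Suc.IH[of ?A] Suc.prems(2) by simp
  moreover have "?A x = T (A x)" using x lin_0[OF Suc.prems(1)] by simp
  ultimately show ?case by (simp add: funpow_swap1 mult_ac)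
qed simp

lemma degT_pow_zero:
  assumes T: "lin T" and x: "T x = 0" and "lin A" "degT T d A \<sigma>" "d < k"
  shows "(T ^^ k) (A x) = 0"
proof -
  obtain i where k: "k = Suc i + d" using \<open>d < k\<close> by (metis add.commute add_Suc less_imp_Suc_add)
  have "(T ^^ k) (A x) = (T ^^ i) (T ((T ^^ d) (A x)))"
    unfolding k funpow_add by (simp add: funpow_swap1)
  also have "\<dots> = 0" using degT_pow[OF T x assms(3,4)] x
    by (simp add: lin_scale[OF T] lin_0[OF lin_funpow[OF T]])
  finally show ?thesis .
qed

end

text \<open>\<open>pdeg d a p\<close>: the function \<open>p\<close> is a polynomial function of degree at most \<open>d\<close> with
  coefficient \<open>a\<close> at the \<open>d\<close>-th power.\<close>

primrec pdeg :: "nat \<Rightarrow> complex \<Rightarrow> (int \<Rightarrow> complex) \<Rightarrow> bool" where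
  "pdeg 0 = (\<lambda>a p. \<forall>l. p l = a)"
| "pdeg (Suc d) = (\<lambda>a p. \<forall>j::int. pdeg d (of_nat (Suc d) * of_int j * a) (\<lambda>l. p l - p (l - j)))"

lemma pdeg_zero: "pdeg d 0 (\<lambda>_. 0)"
  by (induction d) simp_all

lemma pdeg_add: "pdeg d a p \<Longrightarrow> pdeg d b q \<Longrightarrow> pdeg d (a + b) (\<lambda>l. p l + q l)"
proof (induction d arbitrary: a b p q)
  case (Suc d)
  show ?case unfolding pdeg.simps
  proof
    fix j
    have "pdeg d (of_nat (Suc d) * of_int j * a + of_nat (Suc d) * of_int j * b) (\<lambda>l. (p l - p (l - j)) + (q l - q (l - j)))"
      using Suc.prems by (intro Suc.IH) simp_all
    moreover have "(\<lambda>l. (p l - p (l - j)) + (q l - q (l - j))) = (\<lambda>l. p l + q l - (p (l - j) + q (l - j)))"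
      by auto
    ultimately show "pdeg d (of_nat (Suc d) * of_int j * (a + b)) (\<lambda>l. p l + q l - (p (l - j) + q (l - j)))"
      by (simp only: distrib_left)
  qed
qed simp

lemma pdeg_scale: "pdeg d a p \<Longrightarrow> pdeg d (c * a) (\<lambda>l. c * p l)"
proof (induction d arbitrary: a p)
  case (Suc d)
  show ?case unfolding pdeg.simps
  proof
    fix j
    have "pdeg d (c * (of_nat (Suc d) * of_int j * a)) (\<lambda>l. c * (p l - p (l - j)))"
      using Suc.prems by (intro Suc.IH) simp
    then show "pdeg d (of_nat (Suc d) * of_int j * (c * a)) (\<lambda>l. c * p l - c * p (l - j))"
      by (simp only: right_diff_distrib mult.left_commute)
  qed
qed simp

lemma pdeg_shift: "pdeg d a p \<Longrightarrow> pdeg d a (\<lambda>l. p (l + i))"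
proof (induction d arbitrary: a p)
  case (Suc d)
  show ?case unfolding pdeg.simps
  proof
    fix j
    have "pdeg d (of_nat (Suc d) * of_int j * a) (\<lambda>l. p (l + i) - p (l + i - j))"
      using Suc.prems Suc.IH[of _ "\<lambda>l. p l - p (l - j)"] by simp
    moreover have "(\<lambda>l. p (l + i) - p (l + i - j)) = (\<lambda>l. p (l + i) - p (l - j + i))"
      by (simp add: algebra_simps)
    ultimately show "pdeg d (of_nat (Suc d) * of_int j * a) (\<lambda>l. p (l + i) - p (l - j + i))"
      by (simp only:)
  qed
qed simp

text \<open>Product rule for differences: the linear factor contributes \<open>j\<close> times a
  shift of \<open>p\<close>, which raises the leading factor from \<open>Suc d\<close> to
  \<open>Suc (Suc d)\<close>.\<close>

lemma pdeg_linear_factor: "pdeg d a p \<Longrightarrow> pdeg (Suc d) a (\<lambda>l. (of_int l + x) * p l)"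
proof (induction d arbitrary: a p)
  case 0
  then show ?case by (simp add: algebra_simps)
next
  case (Suc d)
  show ?case unfolding pdeg.simps(2)[of "Suc d"]
  proof
    fix j :: int
    have "pdeg (Suc d) (of_nat (Suc d) * of_int j * a) (\<lambda>l. (of_int l + x) * (p l - p (l - j)))"
      using Suc.prems by (intro Suc.IH) simp
    moreover have "pdeg (Suc d) (of_int j * a) (\<lambda>l. of_int j * p (l - j))"
      using pdeg_scale[OF pdeg_shift[OF Suc.prems, of "- j"], of "of_int j"] by simp
    ultimately have "pdeg (Suc d) (of_nat (Suc d) * of_int j * a + of_int j * a)
        (\<lambda>l. (of_int l + x) * (p l - p (l - j)) + of_int j * p (l - j))"
      by (rule pdeg_add)
    moreover have "(\<lambda>l. (of_int l + x) * (p l - p (l - j)) + of_int j * p (l - j))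
       = (\<lambda>l. (of_int l + x) * p l - (of_int (l - j) + x) * p (l - j))"
      by (auto simp: algebra_simps)
    moreover have "of_nat (Suc d) * of_int j * a + of_int j * a = of_nat (Suc (Suc d)) * of_int j * a"
      by (simp add: algebra_simps)
    ultimately show "pdeg (Suc d) (of_nat (Suc (Suc d)) * of_int j * a)
       (\<lambda>l. (of_int l + x) * p l - (of_int (l - j) + x) * p (l - j))"
      by (simp only:)
  qed
qed

lemma pdeg_prod_plus: "pdeg k 1 (\<lambda>l. \<Prod>i<k. of_int l + x i)"
proof (induction k)
  case (Suc k)
  then show ?case using pdeg_linear_factor[OF Suc, of "x k"] by (simp add: mult.commute)
qed simp

section \<open>Symbols of the modes of the generators\<close>

context symplectic_fermion_algebra
begin

text \<open>The coefficients are those of the antiderivative of \<open>g c\<close>, because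
  commutators with multiplication by a function bring out powers of its derivative.\<close>

definition Top :: "(nat \<Rightarrow> complex poly) \<Rightarrow> nat \<Rightarrow> 'v \<Rightarrow> 'v" where
  "Top g K v = (\<Sum>c<n. \<Sum>j\<in>{1..K}. sc (coeff (g c) (j - 1) / of_nat j) (bc c (\<lambda>_. 1) (int j) v))"

text \<open>The coefficient of order \<open>i\<close> in the \<open>d\<close>-th power of
  \<open>z\<close> times \<open>g c\<close>, provided that \<open>K\<close> exceeds the degree
  (\<open>hc_coeff\<close>).\<close>

primrec hc :: "(nat \<Rightarrow> complex poly) \<Rightarrow> nat \<Rightarrow> nat \<Rightarrow> nat \<Rightarrow> int \<Rightarrow> complex" where
  "hc g K c 0 = (\<lambda>i. if i = 0 then 1 else 0)"
| "hc g K c (Suc d) = (\<lambda>i. \<Sum>j\<in>{1..K}. coeff (g c) (j - 1) * hc g K c d (i - int j))"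

lemma lin_Top: "lin (Top g K)"
  unfolding Top_def[abs_def] by (intro lin_sum_op lin_smult lin_bc) auto

lemma Top_vac: "Top g K (vac V) = 0"
  unfolding Top_def by (intro sum.neutral ballI) (simp add: bc_vac_pos)

lemma hc_coeff:
  assumes K: "degree (g c) < K"
  shows "hc g K c d i = (if i < int d then 0 else coeff (g c ^ d) (nat (i - int d)))"
proof (induction d arbitrary: i)
  case 0
  then show ?case by (simp add: coeff_1)
next
  case (Suc d)
  have "hc g K c (Suc d) i = (\<Sum>j\<in>{1..K}. coeff (g c) (j - 1) * (if i - int j < int d then 0 else coeff (g c ^ d) (nat (i - int j - int d))))"
    by (simp add: Suc)
  also have "\<dots> = (\<Sum>a<K. coeff (g c) a * (if i - int (Suc a) < int d then 0 else coeff (g c ^ d) (nat (i - int (Suc a) - int d))))"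
    by (rule sum.reindex_bij_witness[of _ Suc "\<lambda>j. j - 1"]) auto
  also have "\<dots> = (if i < int (Suc d) then 0 else coeff (g c ^ Suc d) (nat (i - int (Suc d))))"
  proof (cases "i < int (Suc d)")
    case False
    define N where "N = nat (i - int (Suc d))"
    have i: "i = int N + int (Suc d)" using False by (simp add: N_def)
    have "(\<Sum>a<K. coeff (g c) a * (if i - int (Suc a) < int d then 0 else coeff (g c ^ d) (nat (i - int (Suc a) - int d))))
       = (\<Sum>a<K. if a \<le> N then coeff (g c) a * coeff (g c ^ d) (N - a) else 0)"
    proof (rule sum.cong[OF refl])
      fix a
      have X: "i - int (Suc a) - int d = int N - int a" by (simp add: i)
      have Y: "nat (int N - int a) = N - a" by (simp add: nat_diff_distrib')
      have Z: "i - int (Suc a) < int d \<longleftrightarrow> \<not> a \<le> N" by (auto simp: i)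
      show "coeff (g c) a * (if i - int (Suc a) < int d then 0 else coeff (g c ^ d) (nat (i - int (Suc a) - int d)))
         = (if a \<le> N then coeff (g c) a * coeff (g c ^ d) (N - a) else 0)"
        by (simp only: X Y Z) simp
    qed
    also have "\<dots> = (\<Sum>a\<in>{..N} \<union> {..<K}. if a \<le> N then coeff (g c) a * coeff (g c ^ d) (N - a) else 0)"
      by (rule sum.mono_neutral_left) (use K in \<open>auto simp: coeff_eq_0\<close>)
    also have "\<dots> = (\<Sum>a\<le>N. if a \<le> N then coeff (g c) a * coeff (g c ^ d) (N - a) else 0)"
      by (rule sum.mono_neutral_right) auto
    also have "\<dots> = coeff (g c ^ Suc d) N" by (simp add: coeff_mult)
    finally show ?thesis using False by (simp add: N_def)
  qed (auto intro!: sum.neutral)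
  finally show ?case .
qed

text \<open>Every difference of the symbol yields a factor \<open>j\<close>, which cancels the
  denominator in \<open>Top\<close>. After \<open>d\<close> commutators the symbol is constant, and
  the last commutator is the central term; hence the degree \<open>Suc d\<close>.\<close>

lemma ctype_degT:
  assumes "ctype A p s" and "\<And>c. c < n \<Longrightarrow> pdeg d (a c) (p c)"
  shows "degT (Top g K) (Suc d) A ((\<Sum>c<n. a c * hc g K c (Suc d) (- s)) / of_nat (Suc d))"
  using assms
proof (induction d arbitrary: A p s a)
  case 0
  let ?t = "\<lambda>c j. coeff (g c) (j - 1) / of_nat j"
  note linA = ctypeD(1)[OF 0(1)]
  have "Top g K (A v) - A (Top g K v) = sc (\<Sum>c<n. a c * hc g K c (Suc 0) (- s)) v" for v
  proof -
    have "Top g K (A v) - A (Top g K v) = (\<Sum>c<n. \<Sum>j\<in>{1..K}. sc (?t c j) (bc c (\<lambda>_. 1) (int j) (A v) - A (bc c (\<lambda>_. 1) (int j) v)))"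
      by (simp add: Top_def lin_sum[OF linA] lin_scale[OF linA] scale_right_diff_distrib sum_subtractf)
    also have "\<dots> = (\<Sum>c<n. \<Sum>j\<in>{1..K}. sc (a c * (coeff (g c) (j - 1) * hc g K c 0 (- s - int j))) v)"
    proof (intro sum.cong refl)
      fix c j assume c: "c \<in> {..<n}" and j: "j \<in> {1..K}"
      have "bc c (\<lambda>_. 1) (int j) (A v) - A (bc c (\<lambda>_. 1) (int j) v) = sc (if int j + s = 0 then of_int (int j) * a c else 0) v"
        by (rule commutator_bc_scalar[OF 0(1)]) (use c j 0(2) in auto)
      moreover have "- s - int j = 0 \<longleftrightarrow> int j + s = 0" by auto
      ultimately show "sc (?t c j) (bc c (\<lambda>_. 1) (int j) (A v) - A (bc c (\<lambda>_. 1) (int j) v))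
         = sc (a c * (coeff (g c) (j - 1) * hc g K c 0 (- s - int j))) v"
        using j by auto
    qed
    finally show ?thesis by (simp add: scale_sum_left sum_distrib_left)
  qed
  then show ?case by simp
next
  case (Suc d)
  let ?t = "\<lambda>c j. coeff (g c) (j - 1) / of_nat j"
  let ?C = "\<lambda>c j v. bc c (\<lambda>_. 1) (int j) (A v) - A (bc c (\<lambda>_. 1) (int j) v)"
  note linA = ctypeD(1)[OF Suc.prems(1)]
  have "(\<lambda>v. Top g K (A v) - A (Top g K v)) = (\<lambda>v. \<Sum>c<n. \<Sum>j\<in>{1..K}. sc (?t c j) (?C c j v))"
    by (rule ext) (simp add: Top_def lin_sum[OF linA] lin_scale[OF linA] scale_right_diff_distrib sum_subtractf)
  moreover have "degT (Top g K) (Suc d) (\<lambda>v. \<Sum>c<n. \<Sum>j\<in>{1..K}. sc (?t c j) (?C c j v))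
      (\<Sum>c<n. \<Sum>j\<in>{1..K}. ?t c j * (of_int (int j) * a c * hc g K c (Suc d) (- (s + int j))))"
  proof (intro degT_sum[OF lin_Top] degT_scale[OF lin_Top])
    fix c j assume c: "c \<in> {..<n}" and j: "j \<in> {1..K}"
    let ?a = "\<lambda>d'. if d' = c then of_nat (Suc d) * of_int (int j) * a c else 0"
    have "degT (Top g K) (Suc d) (?C c j) ((\<Sum>d'<n. ?a d' * hc g K d' (Suc d) (- (s + int j))) / of_nat (Suc d))"
    proof (rule Suc.IH[OF ctype_commutator_bc[OF Suc.prems(1)]])
      show "c < n" using c by simp
      fix d' assume "d' < n"
      then show "pdeg d (?a d') (\<lambda>l. if d' = c then p c l - p c (l - int j) else 0)"
      proof (cases "d' = c")
        case True
        have "pdeg d (of_nat (Suc d) * of_int (int j) * a c) (\<lambda>l. p c l - p c (l - int j))"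
          using Suc.prems(2)[of c] c unfolding pdeg.simps by blast
        then show ?thesis unfolding True by (simp only: if_True refl)
      qed (simp add: pdeg_zero)
    qed
    moreover have "(\<Sum>d'<n. ?a d' * hc g K d' (Suc d) (- (s + int j))) = ?a c * hc g K c (Suc d) (- (s + int j))"
      by (rule sum_eq_single) (use c in auto)
    moreover have "?a c * hc g K c (Suc d) (- (s + int j)) / of_nat (Suc d) = of_int (int j) * a c * hc g K c (Suc d) (- (s + int j))"
      using of_nat_neq_0[of d, where 'a = complex] by (simp del: of_nat_Suc hc.simps)
    ultimately show "degT (Top g K) (Suc d) (?C c j) (of_int (int j) * a c * hc g K c (Suc d) (- (s + int j)))"
      by (simp only:)
  qed
  moreover have "(\<Sum>c<n. \<Sum>j\<in>{1..K}. ?t c j * (of_int (int j) * a c * hc g K c (Suc d) (- (s + int j))))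
     = (\<Sum>c<n. a c * hc g K c (Suc (Suc d)) (- s))"
  proof (rule sum.cong[OF refl])
    fix c
    have "(\<Sum>j\<in>{1..K}. ?t c j * (of_int (int j) * a c * hc g K c (Suc d) (- (s + int j))))
      = (\<Sum>j\<in>{1..K}. a c * (coeff (g c) (j - 1) * hc g K c (Suc d) (- s - int j)))"
    proof (rule sum.cong[OF refl])
      fix j assume "j \<in> {1..K}"
      then have "(of_nat j :: complex) \<noteq> 0" by simp
      moreover have "- (s + int j) = - s - int j" by simp
      ultimately show "?t c j * (of_int (int j) * a c * hc g K c (Suc d) (- (s + int j)))
        = a c * (coeff (g c) (j - 1) * hc g K c (Suc d) (- s - int j))"
        by (simp del: hc.simps)
    qed
    then show "(\<Sum>j\<in>{1..K}. ?t c j * (of_int (int j) * a c * hc g K c (Suc d) (- (s + int j)))) = a c * hc g K c (Suc (Suc d)) (- s)"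
      by (simp only: hc.simps(2)[of g K c "Suc d"] sum_distrib_left)
  qed
  moreover have "of_nat (Suc (Suc d)) * ((\<Sum>c<n. a c * hc g K c (Suc (Suc d)) (- s)) / of_nat (Suc (Suc d))) = (\<Sum>c<n. a c * hc g K c (Suc (Suc d)) (- s))"
    using of_nat_neq_0[of "Suc d", where 'a = complex] by (simp del: of_nat_Suc hc.simps)
  ultimately show ?case unfolding degT.simps(2)[of _ "Suc d"] by (simp only:)
qed

lemma cb_even: "even k \<Longrightarrow> fact k * cb k N = (\<Prod>i<k. of_int N - of_nat i)"
  by (simp add: cb_def gbinomial_prod_rev atLeast0LessThan)

text \<open>As \<open>2 * m\<close> is even, the two binomials in \<open>gam\<close> have the same
  leading coefficient in \<open>l\<close> and add up; the remaining factor is linear.\<close>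

lemma jgam_pdeg: "pdeg (2 * m + 1) (- fact t) (\<lambda>l. jgam m t (- l))"
proof -
  let ?k = "2 * m"
  have a: "pdeg ?k 1 (\<lambda>l. fact ?k * cb ?k (int ?k + l))"
  proof -
    have "(\<lambda>l. fact ?k * cb ?k (int ?k + l)) = (\<lambda>l. \<Prod>i<?k. of_int l + (of_nat ?k - of_nat i))"
      by (rule ext) (simp add: cb_even algebra_simps)
    then show ?thesis by (simp only: pdeg_prod_plus)
  qed
  have b: "pdeg ?k 1 (\<lambda>l. fact ?k * cb ?k (-1 - int t - 1 - l))"
  proof -
    have "fact ?k * cb ?k (-1 - int t - 1 - l) = (\<Prod>i<?k. of_int l + (of_nat t + 2 + of_nat i))" for l
    proof -
      have "fact ?k * cb ?k (-1 - int t - 1 - l) = (\<Prod>i<?k. - (of_int l + (of_nat t + 2 + of_nat i)) :: complex)"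
        by (subst cb_even) (auto intro!: prod.cong simp: algebra_simps)
      also have "\<dots> = (\<Prod>i<?k. (-1) * (of_int l + (of_nat t + 2 + of_nat i)))" by simp
      also have "\<dots> = (\<Prod>i<?k. of_int l + (of_nat t + 2 + of_nat i))"
        by (simp only: prod.distrib prod_constant card_lessThan) simp
      finally show ?thesis .
    qed
    then have "(\<lambda>l. fact ?k * cb ?k (-1 - int t - 1 - l)) = (\<lambda>l. \<Prod>i<?k. of_int l + (of_nat t + 2 + of_nat i))" by blast
    then show ?thesis by (simp only: pdeg_prod_plus)
  qed
  have H1: "pdeg (Suc ?k) (- fact t / 2 * (1 + 1)) (\<lambda>l. - fact t / 2 * ((of_int l + 0) * (fact ?k * cb ?k (int ?k + l) + fact ?k * cb ?k (-1 - int t - 1 - l))))"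
    by (intro pdeg_scale pdeg_linear_factor pdeg_add a b)
  have H2: "(\<lambda>l. - fact t / 2 * ((of_int l + 0) * (fact ?k * cb ?k (int ?k + l) + fact ?k * cb ?k (-1 - int t - 1 - l))))
    = (\<lambda>l. jgam m t (- l))"
  proof
    fix l
    have e: "-1 - int t - 1 + - l = -1 - int t - 1 - l" "int ?k - - l = int ?k + l" by simp_all
    show "- fact t / 2 * ((of_int l + 0) * (fact ?k * cb ?k (int ?k + l) + fact ?k * cb ?k (-1 - int t - 1 - l)))
      = jgam m t (- l)"
      unfolding jgam_def gam_def e of_int_minus
      by (simp only: distrib_left[symmetric] add_0_right) (simp add: mult_ac del: distrib_left_numeral)
  qed
  have c: "- fact t / 2 * (1 + 1) = (- fact t :: complex)" by simp
  show ?thesis using H1 unfolding H2 c by (simp only: Suc_eq_plus1)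
qed

lemma jgam_0: "jgam m t 0 = 0"
  by (simp add: jgam_def gam_def)

text \<open>This duality lets a single symbol describe the action on b and on c, although f carries
  an additional factor from differentiating c.\<close>

lemma jgam_symmetry: "of_int l * jgam m t (l + int (mwt (m, t))) = - (of_int (l + int (mwt (m, t))) * jgam m t (- l))"
proof -
  have "int (2 * m) - (l + int (mwt (m, t))) = -1 - int t - 1 - l" "-1 - int t - 1 + (l + int (mwt (m, t))) = int (2 * m) - - l"
    "-1 - int t - 1 + - l = -1 - int t - 1 - l"
    by (simp_all add: mwt_def)
  note eqs = this
  let ?\<kappa> = "fact t * fact (2 * m) / 2 :: complex" and ?X = "of_int (l + int (mwt (m, t))) :: complex"
  let ?A = "cb (2 * m) (-1 - int t - 1 - l)" and ?B = "cb (2 * m) (int (2 * m) - - l)"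
  have 1: "jgam m t (l + int (mwt (m, t))) = ?\<kappa> * (?X * (?A + ?B))"
    unfolding jgam_def gam_def eqs ..
  have 2: "jgam m t (- l) = ?\<kappa> * (- of_int l * (?B + ?A))"
    unfolding jgam_def gam_def eqs of_int_minus ..
  show ?thesis unfolding 1 2 by (simp only: mult_minus_left mult_minus_right minus_minus ac_simps)
qed

text \<open>The commutators of \<open>jop\<close> with the modes dictate the candidate
  \<open>N0\<close>. On the vacuum it differs from the image of \<open>jop\<close> by a state killed
  by all annihilators, so subtracting a scalar makes both agree.\<close>

lemma jop_image:
  "\<exists>N. ctype N (\<lambda>c l. jgam m t (- l)) (- int (mwt (m, t))) \<and> (\<forall>v. iota (jop (m, t) v) = N (iota v))"
proof -
  let ?W = "int (mwt (m, t))" and ?p = "\<lambda>l. jgam m t (- l)"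
  define N0 where "N0 v = (\<Sum>c<n. bc c ?p (- ?W) v)" for v
  have N0: "ctype N0 (\<lambda>c l. ?p l) (- ?W)"
  proof -
    have "ctype N0 (\<lambda>d l. \<Sum>c<n. (if d = c then ?p else (\<lambda>_. 0)) l) (- ?W)"
      unfolding N0_def[abs_def] by (rule ctype_sum) (auto intro: ctype_bc)
    then show ?thesis unfolding ctype_def by (auto simp: if_distribR cong: if_cong)
  qed
  let ?x = "N0 (vac V) - iota (jop (m, t) (vac V))"
  have jv: "u r k (jop (m, t) (vac V)) = - sc (jgam m t k) (u r (k - ?W) (vac V))" if "r < 2 * n" "k \<ge> 1" for r k
    using jop_u'[OF that(1), of m t k "vac V"] that(2) by (simp add: u_vac lin_0[OF lin_jop] eq_neg_iff_add_eq_0)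
  have iu: "iota (u r k (vac V)) = utl r k (vac V)" if "r < 2 * n" "k \<noteq> 0" for r k
    using that iota_u[of r k "vac V"] iota_neg[of r k "vac V"] by (cases "k \<ge> 1") (auto simp: iota_vac)
  have bx: "bop c k ?x = 0" if c: "c < n" and k: "k \<ge> 0" for c k
  proof (cases "k = 0")
    \<comment> \<open>The zero mode of b is not covered by \<open>iota_u\<close>; it kills both
      terms, by \<open>jgam_0\<close> and by \<open>bop_0_iota\<close>.\<close>
    case True
    have "bop c 0 (N0 (vac V)) = 0"
      using ctypeD(2)[OF N0 c, of 0 "vac V"] by (simp add: bop_vac lin_0[OF ctypeD(1)[OF N0]] jgam_0)
    then show ?thesis using True c by (simp add: lin_diff[OF lin_bop] bop_0_iota)
  next
    case False
    then have k1: "k \<ge> 1" using k by simp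
    have b: "bop c i = utl c i" for i using c by (simp add: utl_def)
    have "bop c k (N0 (vac V)) = - sc (jgam m t k) (bop c (k - ?W) (vac V))"
      using ctypeD(2)[OF N0 c, of k "vac V"] k by (simp add: bop_vac lin_0[OF ctypeD(1)[OF N0]] eq_neg_iff_add_eq_0)
    moreover have "bop c k (iota (jop (m, t) (vac V))) = - sc (jgam m t k) (bop c (k - ?W) (vac V))"
    proof -
      have "bop c k (iota (jop (m, t) (vac V))) = iota (u c k (jop (m, t) (vac V)))"
        using c k1 by (simp add: iota_u b)
      also have "\<dots> = - sc (jgam m t k) (iota (u c (k - ?W) (vac V)))"
        using c k1 by (simp add: jv lin_neg[OF lin_iota] lin_scale[OF lin_iota])
      also have "iota (u c (k - ?W) (vac V)) = bop c (k - ?W) (vac V)"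
        using c by (cases "k - ?W = 0") (simp_all add: iu b u_vac utl_vac lin_0[OF lin_iota])
      finally show ?thesis .
    qed
    ultimately show ?thesis by (simp add: lin_diff[OF lin_bop])
  qed
  have cx: "cop c k ?x = 0" if c: "c < n" and k: "k \<ge> 1" for c k
  proof -
    have kz: "(of_int k :: complex) \<noteq> 0" using k by simp
    have "cop c k (N0 (vac V)) = sc (?p (k - ?W)) (cop c (k - ?W) (vac V))"
      using ctypeD(3)[OF N0 c, of k "vac V"] k by (simp add: cop_vac lin_0[OF ctypeD(1)[OF N0]])
    moreover have "cop c k (iota (jop (m, t) (vac V))) = sc (?p (k - ?W)) (cop c (k - ?W) (vac V))"
    proof -
      have cu: "cop c k y = sc (- 1 / of_int k) (utl (n + c) k y)" for y
        using kz by (simp add: utl_def)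
      have "cop c k (iota (jop (m, t) (vac V))) = sc (- 1 / of_int k) (iota (u (n + c) k (jop (m, t) (vac V))))"
        using c k by (simp only: cu iota_u)
      also have "\<dots> = sc (jgam m t k / of_int k) (iota (u (n + c) (k - ?W) (vac V)))"
        using c k by (simp add: jv lin_neg[OF lin_iota] lin_scale[OF lin_iota])
      also have "iota (u (n + c) (k - ?W) (vac V)) = sc (- of_int (k - ?W)) (cop c (k - ?W) (vac V))"
        using c by (cases "k - ?W = 0") (simp_all add: iu utl_def u_vac lin_0[OF lin_iota])
      also have "sc (jgam m t k / of_int k) (sc (- of_int (k - ?W)) (cop c (k - ?W) (vac V)))
         = sc (- (of_int (k - ?W) * jgam m t k) / of_int k) (cop c (k - ?W) (vac V))"
        by (simp add: mult.commute del: of_int_diff)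
      also have "- (of_int (k - ?W) * jgam m t k) / of_int k = ?p (k - ?W)"
        using jgam_symmetry[of "k - ?W" m t] kz by (simp add: field_simps del: of_int_diff)
      finally show ?thesis .
    qed
    ultimately show ?thesis by (simp add: lin_diff[OF lin_cop])
  qed
  have "?x = sc (eps ?x) (vac V)"
  proof (rule an_all_zero)
    fix a assume "a \<in> modes"
    then obtain p k where a: "a = (p, k)" "p < 2 * n" "k \<ge> 1" by (auto simp: modes_def)
    have "u (conj p) (int k) ?x = 0"
    proof (cases "p < n")
      case True
      have "sc (- 1 / of_int (int k)) (u (n + p) (int k) ?x) = 0"
        using cx[OF True, of "int k"] a by (simp add: cop_def)
      then have "u (n + p) (int k) ?x = 0" using a by simp
      then show ?thesis using True by (simp add: conj_def add.commute)
    next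
      case False
      have "u (p - n) (int k) ?x = 0" using bx[of "p - n" "int k - 1"] a False by (simp add: bop_def)
      then show ?thesis using False by (simp add: conj_def)
    qed
    then show "anop a ?x = 0" by (simp add: a anop_def)
  qed
  then have N0v: "N0 (vac V) - sc (eps ?x) (vac V) = iota (jop (m, t) (vac V))" by (simp add: algebra_simps)
  define N where "N = (\<lambda>v. N0 v - sc (eps ?x) v)"
  have N: "ctype N (\<lambda>c l. ?p l) (- ?W)" unfolding N_def by (rule ctype_shift_scalar[OF N0])
  have Nv: "N (vac V) = iota (jop (m, t) (vac V))" using N0v by (simp add: N_def)
  have "iota (jop (m, t) v) = N (iota v)" for v
  proof (induction v rule: state_induct)
    case vac
    then show ?case using Nv by (simp add: iota_vac)
  next
    case (u r k v)
    let ?k = "- int k"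
    have neg: "?k - ?W < 0" using u by simp
    have "iota (jop (m, t) (u r ?k v)) = utl r ?k (N (iota v)) + sc (jgam m t ?k) (utl r (?k - ?W) (iota v))"
      using u neg by (simp only: jop_u' lin_add[OF lin_iota] lin_scale[OF lin_iota] iota_neg[OF u(1) neg] iota_creation u.IH)
    also have "\<dots> = N (utl r ?k (iota v))"
    proof (cases "r < n")
      case True
      then show ?thesis using ctypeD(2)[OF N True, of ?k "iota v"] by (simp add: utl_def)
    next
      case False
      then have c: "r - n < n" using u by linarith
      have "?k - ?W + ?W = ?k" by simp
      then have "- of_int ?k * ?p (?k - ?W) = jgam m t ?k * of_int (?k - ?W)"
        using jgam_symmetry[of "?k - ?W" m t] by (simp only: mult_minus_left mult.commute)
      moreover have "N (utl r ?k (iota v)) = sc (- of_int ?k) (cop (r - n) ?k (N (iota v)))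
          - sc (- of_int ?k * ?p (?k - ?W)) (cop (r - n) (?k - ?W) (iota v))"
        using False ctypeD(3)[OF N c, of ?k "iota v"] lin_scale[OF ctypeD(1)[OF N]]
        by (simp add: utl_def scale_right_diff_distrib)
      ultimately show ?thesis using False
        by (simp add: utl_def del: of_int_diff of_int_minus)
    qed
    finally show ?case using u by (simp only: iota_creation)
  qed (simp_all only: lin_add[OF lin_jop] lin_scale[OF lin_jop] lin_add[OF lin_iota] lin_scale[OF lin_iota]
        lin_add[OF ctypeD(1)[OF N]] lin_scale[OF ctypeD(1)[OF N]])
  with N show ?thesis by blast
qed

end

context symplectic_fermion_algebra
begin

definition jimg :: "nat \<times> nat \<Rightarrow> 'v \<Rightarrow> 'v" where
  "jimg mt = (SOME N. ctype N (\<lambda>c l. jgam (fst mt) (snd mt) (- l)) (- int (mwt mt)) \<and>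
     (\<forall>v. iota (jop mt v) = N (iota v)))"

lemma jimg:
  "ctype (jimg mt) (\<lambda>c l. jgam (fst mt) (snd mt) (- l)) (- int (mwt mt))"
  "iota (jop mt v) = jimg mt (iota v)"
proof -
  obtain m t where mt: "mt = (m, t)" by (cases mt)
  have "\<exists>N. ctype N (\<lambda>c l. jgam (fst mt) (snd mt) (- l)) (- int (mwt mt)) \<and> (\<forall>v. iota (jop mt v) = N (iota v))"
    unfolding mt fst_conv snd_conv by (rule jop_image)
  from someI_ex[OF this] show "ctype (jimg mt) (\<lambda>c l. jgam (fst mt) (snd mt) (- l)) (- int (mwt mt))"
    "iota (jop mt v) = jimg mt (iota v)" unfolding jimg_def[symmetric] by auto
qed

definition jsym :: "(nat \<Rightarrow> complex poly) \<Rightarrow> nat \<times> nat \<Rightarrow> complex" where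
  "jsym g mt = - fact (snd mt) / of_nat (2 * fst mt + 2) * coeff (\<Sum>c<n. g c ^ (2 * fst mt + 2)) (snd mt)"

definition mdeg :: "(nat \<times> nat) list \<Rightarrow> nat" where "mdeg ms = (\<Sum>mt\<leftarrow>ms. 2 * fst mt + 2)"

lemma jimg_degT:
  assumes "\<And>c. c < n \<Longrightarrow> degree (g c) < K"
  shows "degT (Top g K) (2 * fst mt + 2) (jimg mt) (jsym g mt)"
proof -
  obtain m t where mt: "mt = (m, t)" by (cases mt)
  have "degT (Top g K) (Suc (2 * m + 1)) (jimg mt) ((\<Sum>c<n. - fact t * hc g K c (Suc (2 * m + 1)) (- (- int (mwt mt)))) / of_nat (Suc (2 * m + 1)))"
    by (rule ctype_degT[OF jimg(1)]) (use jgam_pdeg mt in simp)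
  moreover have "hc g K c (Suc (2 * m + 1)) (- (- int (mwt mt))) = coeff (g c ^ (2 * m + 2)) t" if "c < n" for c
  proof -
    have "- (- int (mwt mt)) = int (mwt mt)" "nat (int (mwt mt) - int (Suc (2 * m + 1))) = t" "\<not> int (mwt mt) < int (Suc (2 * m + 1))"
      by (simp_all add: mt mwt_def)
    then show ?thesis
      using hc_coeff[where g = g and c = c and K = K and d = "Suc (2 * m + 1)" and i = "int (mwt mt)"] assms[OF that]
      by (simp only: if_False) simp
  qed
  then have "(\<Sum>c<n. - fact t * hc g K c (Suc (2 * m + 1)) (- (- int (mwt mt)))) / of_nat (Suc (2 * m + 1))
     = (\<Sum>c<n. - fact t * coeff (g c ^ (2 * m + 2)) t) / of_nat (Suc (2 * m + 1))" by simp
  moreover have "\<dots> = jsym g mt"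
    by (simp only: mt jsym_def coeff_sum fst_conv snd_conv sum_distrib_left[symmetric]) simp
  moreover have "Suc (2 * m + 1) = 2 * fst mt + 2" by (simp add: mt)
  ultimately show ?thesis by metis
qed

lemma mon_image: "iota (mon ms) = foldr jimg ms (vac V)"
  by (induction ms) (simp_all add: mon_def iota_vac jimg(2))

lemma foldr_jimg_degT:
  assumes "\<And>c. c < n \<Longrightarrow> degree (g c) < K"
  shows "lin (foldr jimg ms) \<and> degT (Top g K) (mdeg ms) (foldr jimg ms) (prod_list (map (jsym g) ms))"
proof (induction ms)
  case Nil
  then show ?case by (simp add: mdeg_def lin_id id_def)
next
  case (Cons x ms)
  have linx: "lin (jimg x)" using ctypeD(1)[OF jimg(1)] .
  have "lin (\<lambda>v. jimg x (foldr jimg ms v))" by (rule lin_comp[OF linx Cons[THEN conjunct1]])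
  moreover have "degT (Top g K) ((2 * fst x + 2) + mdeg ms) (\<lambda>v. jimg x (foldr jimg ms v)) (jsym g x * prod_list (map (jsym g) ms))"
    by (rule degT_mult[OF lin_Top linx jimg_degT[OF assms] Cons[THEN conjunct2]])
  moreover have "foldr jimg (x # ms) = (\<lambda>v. jimg x (foldr jimg ms v))" by (simp add: comp_def)
  moreover have "mdeg (x # ms) = (2 * fst x + 2) + mdeg ms" by (simp add: mdeg_def)
  ultimately show ?case by (simp only: list.map prod_list.Cons)
qed

lemma srt_inj: "srt xs \<Longrightarrow> srt ys \<Longrightarrow> mset xs = mset ys \<Longrightarrow> xs = ys"
proof -
  assume "srt xs" "srt ys" "mset xs = mset ys"
  then have "map mkey xs = map mkey ys"
    unfolding srt_def by (metis mset_map properties_for_sort)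
  moreover have "inj mkey" by (auto simp: inj_def mkey_def prod_eq_iff)
  ultimately show "xs = ys" by (simp add: inj_map_eq_map)
qed

text \<open>The top degree part of a relation is a polynomial relation between jets of power sums.\<close>

theorem mon_independent:
  assumes F: "finite F" "\<And>ms. ms \<in> F \<Longrightarrow> srt ms" "\<And>ms m t. ms \<in> F \<Longrightarrow> (m, t) \<in> set ms \<Longrightarrow> m < n"
    and rel: "(\<Sum>ms\<in>F. sc (P ms) (mon ms)) = 0"
  shows "\<forall>ms\<in>F. P ms = 0"
proof (rule ccontr)
  assume "\<not> (\<forall>ms\<in>F. P ms = 0)"
  define F0 where "F0 = {ms \<in> F. P ms \<noteq> 0}"
  have F0: "finite F0" "F0 \<noteq> {}" using F(1) \<open>\<not> (\<forall>ms\<in>F. P ms = 0)\<close> by (auto simp: F0_def)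
  define d where "d = Max (mdeg ` F0)"
  define F1 where "F1 = {ms \<in> F0. mdeg ms = d}"
  have d_max: "mdeg ms \<le> d" if "ms \<in> F0" for ms unfolding d_def using F0 that by simp
  have "d \<in> mdeg ` F0" unfolding d_def using F0 by (intro Max_in) auto
  then have F1: "F1 \<noteq> {}" "finite F1" using F0 by (auto simp: F1_def)
  have rel0: "(\<Sum>ms\<in>F0. sc (P ms) (foldr jimg ms (vac V))) = 0"
  proof -
    have "(\<Sum>ms\<in>F0. sc (P ms) (mon ms)) = (\<Sum>ms\<in>F. sc (P ms) (mon ms))"
      by (rule sum.mono_neutral_left) (use F(1) in \<open>auto simp: F0_def\<close>)
    then have "iota (\<Sum>ms\<in>F0. sc (P ms) (mon ms)) = 0" using rel by (simp add: lin_0[OF lin_iota])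
    then show ?thesis by (simp add: lin_sum[OF lin_iota] lin_scale[OF lin_iota] mon_image)
  qed
  \<comment> \<open>The \<open>d\<close>-th power of \<open>Top\<close> kills all monomials of
    degree below \<open>d\<close> and sends the others to their symbols times the vacuum.\<close>
  have sym: "(\<Sum>ms\<in>F1. P ms * prod_list (map (jsym g) ms)) = 0" for g
  proof -
    define K where "K = Suc (\<Sum>c<n. degree (g c))"
    have K: "degree (g c) < K" if "c < n" for c
      using member_le_sum[of c "{..<n}" "\<lambda>c. degree (g c)"] that by (simp add: K_def)
    have "(Top g K ^^ d) (\<Sum>ms\<in>F0. sc (P ms) (foldr jimg ms (vac V))) = 0"
      unfolding rel0 by (rule lin_0[OF lin_funpow[OF lin_Top]])
    then have "(\<Sum>ms\<in>F0. sc (P ms) ((Top g K ^^ d) (foldr jimg ms (vac V)))) = 0"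
      by (simp add: lin_sum[OF lin_funpow[OF lin_Top]] lin_scale[OF lin_funpow[OF lin_Top]])
    also have "(\<Sum>ms\<in>F0. sc (P ms) ((Top g K ^^ d) (foldr jimg ms (vac V))))
      = (\<Sum>ms\<in>F1. sc (P ms) ((Top g K ^^ d) (foldr jimg ms (vac V))))"
    proof (rule sum.mono_neutral_right)
      show "\<forall>ms\<in>F0 - F1. sc (P ms) ((Top g K ^^ d) (foldr jimg ms (vac V))) = 0"
      proof
        fix ms assume "ms \<in> F0 - F1"
        then have "mdeg ms < d" using d_max[of ms] by (auto simp: F1_def)
        then have "(Top g K ^^ d) (foldr jimg ms (vac V)) = 0"
          using foldr_jimg_degT[where g = g and K = K and ms = ms] K by (intro degT_pow_zero[OF lin_Top Top_vac]) auto
        then show "sc (P ms) ((Top g K ^^ d) (foldr jimg ms (vac V))) = 0" by simp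
      qed
    qed (use F0 in \<open>auto simp: F1_def\<close>)
    also have "\<dots> = (\<Sum>ms\<in>F1. sc (P ms) (sc (fact d * prod_list (map (jsym g) ms)) (vac V)))"
    proof (rule sum.cong[OF refl])
      fix ms assume "ms \<in> F1"
      then have d: "mdeg ms = d" by (simp add: F1_def)
      have "(Top g K ^^ mdeg ms) (foldr jimg ms (vac V)) = sc (fact (mdeg ms) * prod_list (map (jsym g) ms)) (vac V)"
        using foldr_jimg_degT[where g = g and K = K and ms = ms] K by (intro degT_pow[OF lin_Top Top_vac]) auto
      then show "sc (P ms) ((Top g K ^^ d) (foldr jimg ms (vac V))) = sc (P ms) (sc (fact d * prod_list (map (jsym g) ms)) (vac V))"
        by (simp only: d)
    qed
    also have "\<dots> = sc (fact d * (\<Sum>ms\<in>F1. P ms * prod_list (map (jsym g) ms))) (vac V)"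
      by (simp add: scale_sum_left sum_distrib_left mult.left_commute)
    finally show ?thesis using vac_nonzero by simp
  qed
  \<comment> \<open>The nonzero constant by which \<open>jsym\<close> differs from a jet coefficient
    of a power sum.\<close>
  define C where "C mt = - fact (snd mt) / (of_nat (2 * fst mt + 2) :: complex)" for mt :: "nat \<times> nat"
  have C: "prod_list (map C ms) \<noteq> 0" for ms
  proof (induction ms)
    case (Cons x ms)
    have "(of_nat (2 * fst x + 2) :: complex) \<noteq> 0" by (metis Suc_eq_plus1 add_2_eq_Suc' of_nat_neq_0)
    then show ?case using Cons by (simp add: C_def)
  qed simp
  have "\<forall>ms\<in>F1. P ms * prod_list (map C ms) = 0"
  proof (rule power_sum_jets_independent[where n = n])
    show "inj_on mset F1" using F(2) srt_inj by (auto simp: inj_on_def F1_def F0_def)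
    show "m < n" if "ms \<in> F1" "(m, t) \<in> set ms" for ms m t using that F(3) by (auto simp: F1_def F0_def)
    fix g
    have "prod_list (map C ms) * prod_list (map (\<lambda>(m, t). coeff (\<Sum>c<n. g c ^ (2 * m + 2)) t) ms) = prod_list (map (jsym g) ms)" for ms
      by (induction ms) (auto simp: C_def jsym_def case_prod_beta mult_ac)
    then show "(\<Sum>ms\<in>F1. P ms * prod_list (map C ms) * prod_list (map (\<lambda>(m, t). coeff (\<Sum>c<n. g c ^ (2 * m + 2)) t) ms)) = 0"
      using sym[of g] by (simp only: mult.assoc)
  qed (rule F1)
  then show False using F1 C by (auto simp: F1_def F0_def)
qed

section \<open>Decoupling of the higher generators\<close>

text \<open>The factors may come in any order, which makes the filtration stable under
  \<open>jop (m, t)\<close> for \<open>m < n\<close> (\<open>jop_Wle\<close>).\<close>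

definition Wle :: "nat \<Rightarrow> 'v set" where
  "Wle w = span {mon ms | ms. (\<forall>(m, t)\<in>set ms. m < n) \<and> mwts ms \<le> w}"

lemma subspace_Wle: "subspace (Wle w)"
  unfolding Wle_def by (rule subspace_span)

lemma Wle_mono: "w \<le> w' \<Longrightarrow> Wle w \<subseteq> Wle w'"
  unfolding Wle_def by (rule span_mono) auto

lemma mwt_ge: "mwt mt \<ge> 2"
  by (simp add: mwt_def)

lemma decoupling:
  assumes n: "n \<ge> 1"
  shows "jm n \<in> Wle (2 * n + 2)"
proof -
  let ?R = "replicate (Suc n) (0, 0) :: (nat \<times> nat) list"
  let ?L = "{ms. srt ms \<and> length ms \<le> n \<and> (\<forall>(m, t)\<in>set ms. m < n) \<and> mwts ms \<le> 2 * n + 2}"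
  have jn: "mon [(n, 0)] = jm n" by (simp add: mon_def jop_def creation)
  \<comment> \<open>For reasons of weight, j^(2n) itself is the only monomial in this range with a
    factor j^(2m), m >= n.\<close>
  have "ms \<in> ?L \<or> ms = [(n, 0)]" if ms: "srt ms" "length ms \<le> n" "mwts ms \<le> 2 * n + 2" for ms
  proof (cases "\<forall>(m, t)\<in>set ms. m < n")
    case True
    then show ?thesis using ms by simp
  next
    case False
    then obtain m t where mt: "(m, t) \<in> set ms" "m \<ge> n" by fastforce
    then obtain xs ys where split: "ms = xs @ (m, t) # ys" by (meson split_list)
    then have "mwts xs + mwt (m, t) + mwts ys \<le> 2 * n + 2" using ms by (simp add: mwts_def)
    then have "m = n" "t = 0" "mwts xs = 0" "mwts ys = 0" using mt by (auto simp: mwt_def)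
    moreover have nil: "zs = []" if "mwts zs = 0" for zs
      using that by (cases zs) (auto simp: mwts_def mwt_def)
    ultimately have "xs = []" "ys = []" by blast+
    then show ?thesis using split \<open>m = n\<close> \<open>t = 0\<close> by simp
  qed
  then have "{mon ms | ms. srt ms \<and> length ms \<le> n \<and> int (mwts ms) \<le> int (2 * n + 2)} \<subseteq> insert (jm n) (mon ` ?L)"
    using jn by fastforce
  then have "mon ?R \<in> span (insert (jm n) (mon ` ?L))"
    using replicate_mon_Mle span_mono unfolding Mle_def by blast
  then obtain k where k: "mon ?R - sc k (jm n) \<in> span (mon ` ?L)" by (auto simp: span_breakdown_eq)
  \<comment> \<open>Otherwise the power of j^0, which has \<open>n + 1\<close> factors, would be a
    combination of monomials from \<open>?L\<close> with at most \<open>n\<close> factors, against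
    \<open>mon_independent\<close>.\<close>
  have "k \<noteq> 0"
  proof
    assume "k = 0"
    then obtain t r where t: "finite t" "t \<subseteq> mon ` ?L" "mon ?R = (\<Sum>a\<in>t. sc (r a) a)"
      using k unfolding span_explicit by auto
    from t(2) obtain U where U: "U \<subseteq> ?L" "inj_on mon U" "t = mon ` U" by (meson subset_image_inj)
    have finU: "finite U" using t(1) U finite_image_iff by blast
    have RU: "?R \<notin> U" using U(1) by auto
    let ?P = "\<lambda>ms. if ms = ?R then - 1 else r (mon ms)"
    have "(\<Sum>ms\<in>insert ?R U. sc (?P ms) (mon ms)) = - mon ?R + (\<Sum>ms\<in>U. sc (r (mon ms)) (mon ms))"
      using finU RU by (simp del: replicate.simps) (rule sum.cong, auto)
    also have "(\<Sum>ms\<in>U. sc (r (mon ms)) (mon ms)) = mon ?R"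
      using U t(3) by (simp add: sum.reindex del: replicate.simps)
    finally have "(\<Sum>ms\<in>insert ?R U. sc (?P ms) (mon ms)) = 0" by simp
    moreover have "srt ?R" by (auto simp: srt_def simp del: replicate.simps)
    moreover have "m < n" if "(m, t) \<in> set ?R" for m t using that n by (auto simp del: replicate.simps)
    ultimately have "\<forall>ms\<in>insert ?R U. ?P ms = 0"
      using U(1) finU by (intro mon_independent) (auto simp del: replicate.simps)
    then show False by simp
  qed
  have L: "span (mon ` ?L) \<subseteq> Wle (2 * n + 2)"
    unfolding Wle_def by (rule span_mono) auto
  have "mon ?R \<in> Wle (2 * n + 2)"
    unfolding Wle_def
    by (rule span_base) (use n in \<open>auto simp: mwts_def mwt_def sum_list_replicate simp del: replicate.simps intro!: exI[of _ ?R]\<close>)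
  then have "mon ?R - (mon ?R - sc k (jm n)) \<in> Wle (2 * n + 2)"
    using k L subspace_diff[OF subspace_Wle] by blast
  then have "sc (1 / k) (sc k (jm n)) \<in> Wle (2 * n + 2)"
    by (intro subspace_scale[OF subspace_Wle, of "sc k (jm n)"]) simp
  then show ?thesis using \<open>k \<noteq> 0\<close> by simp
qed

section \<open>The subalgebra of invariants\<close>

abbreviation Inv :: "'v set" where "Inv \<equiv> Sp_invariants V n e f"

lemma extends_lin: "extends_matrix V n e f g \<phi> \<Longrightarrow> lin \<phi>"
  by (simp add: extends_matrix_def vertex_automorphism_def lin_iff_linear)

lemma InvI: "(\<And>g \<phi>. g \<in> Sp n \<Longrightarrow> extends_matrix V n e f g \<phi> \<Longrightarrow> \<phi> v = v) \<Longrightarrow> v \<in> Inv"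
  and InvD: "v \<in> Inv \<Longrightarrow> g \<in> Sp n \<Longrightarrow> extends_matrix V n e f g \<phi> \<Longrightarrow> \<phi> v = v"
  by (auto simp: Sp_invariants_def)

lemma subspace_Inv: "subspace Inv"
proof (rule subspaceI)
  show "0 \<in> Inv" by (rule InvI) (rule lin_0[OF extends_lin])
  show "x + y \<in> Inv" if "x \<in> Inv" "y \<in> Inv" for x y
    by (rule InvI) (simp only: lin_add[OF extends_lin] InvD[OF that(1)] InvD[OF that(2)])
  show "sc c x \<in> Inv" if "x \<in> Inv" for c x
    by (rule InvI) (simp only: lin_scale[OF extends_lin] InvD[OF that])
qed

lemma vac_Inv: "vac V \<in> Inv"
  by (auto simp: Sp_invariants_def extends_matrix_def vertex_automorphism_def)

lemma nprod_Inv: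
  assumes "a \<in> Inv" "b \<in> Inv"
  shows "nprod V k a b \<in> Inv"
proof (rule InvI)
  fix g \<phi> assume g: "g \<in> Sp n" and ext: "extends_matrix V n e f g \<phi>"
  have "\<phi> (nprod V k a b) = nprod V k (\<phi> a) (\<phi> b)"
    using ext by (simp add: extends_matrix_def vertex_automorphism_def)
  then show "\<phi> (nprod V k a b) = nprod V k a b" by (simp only: InvD[OF assms(1) g ext] InvD[OF assms(2) g ext])
qed

lemma D_Inv: "a \<in> Inv \<Longrightarrow> D a \<in> Inv"
  unfolding deriv_op_def by (intro nprod_Inv vac_Inv)

text \<open>Membership in \<open>Sp\<close> preserves the form, whereas invariance of the contracted
  tensor in \<open>S_omega\<close> is the transposed identity. Since J squares to -1,
  \<open>A\<close> is an explicit left inverse of \<open>g\<close>, hence also a right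
  inverse.\<close>

lemma Sp_transpose:
  assumes g: "g \<in> Sp n" and ij: "i < 2 * n" "j < 2 * n"
  shows "(\<Sum>p<2*n. \<Sum>q<2*n. g $$ (i, p) * omega p q * g $$ (j, q)) = omega i j"
proof -
  let ?J = "symplectic_form n"
  have J: "?J \<in> carrier_mat (2 * n) (2 * n)" by (rule symplectic_form_carrier)
  have gc: "g \<in> carrier_mat (2 * n) (2 * n)" and gJ: "transpose_mat g * ?J * g = ?J"
    using g by (auto simp: Sp_def)
  have gt: "transpose_mat g \<in> carrier_mat (2 * n) (2 * n)" using gc by simp
  have JJ: "?J * ?J = - 1\<^sub>m (2 * n)"
  proof (rule eq_matI)
    fix a b assume "a < dim_row (- 1\<^sub>m (2 * n) :: complex mat)" "b < dim_col (- 1\<^sub>m (2 * n) :: complex mat)"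
    then have ab: "a < 2 * n" "b < 2 * n" by auto
    have "(?J * ?J) $$ (a, b) = (\<Sum>l<2*n. ?J $$ (a, l) * ?J $$ (l, b))" by (rule mult_entry[OF J J ab])
    also have "\<dots> = (\<Sum>l<2*n. omega a l * omega l b)"
      by (rule sum.cong) (use ab in \<open>auto simp: symplectic_form_omega\<close>)
    also have "\<dots> = omega a (conj a) * omega (conj a) b"
      by (rule sum_eq_single) (use ab conj_less in \<open>auto simp: omega_def\<close>)
    also have "\<dots> = (- 1\<^sub>m (2 * n)) $$ (a, b)"
      using ab eta_sq[of a] by (auto simp: omega_def conj_conj eta_conj)
    finally show "(?J * ?J) $$ (a, b) = (- 1\<^sub>m (2 * n)) $$ (a, b)" .
  qed (use J in auto)
  define A where "A = - (?J * transpose_mat g * ?J)"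
  have A: "A \<in> carrier_mat (2 * n) (2 * n)" using J gt by (auto simp: A_def)
  have "A * g = - (?J * (transpose_mat g * ?J * g))"
    unfolding A_def using J gt gc
    by (simp add: uminus_mult_left_mat assoc_mult_mat[of _ "2*n" "2*n" _ "2*n" _ "2*n"])
  also have "\<dots> = 1\<^sub>m (2 * n)" by (simp add: gJ JJ)
  finally have "g * A = 1\<^sub>m (2 * n)" using mat_mult_left_right_inverse[OF A gc] by simp
  then have "g * A * ?J = ?J" using J by simp
  moreover have "g * A * ?J = g * ?J * transpose_mat g"
  proof -
    have "A * ?J = - (?J * transpose_mat g * (?J * ?J))"
      unfolding A_def using J gt
      by (simp add: uminus_mult_left_mat assoc_mult_mat[of _ "2*n" "2*n" _ "2*n" _ "2*n"])
    also have "\<dots> = ?J * transpose_mat g"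
      unfolding JJ using J gt by (simp add: uminus_mult_right_mat)
    finally show ?thesis using J gt gc A
      by (simp add: assoc_mult_mat[of _ "2*n" "2*n" _ "2*n" _ "2*n"])
  qed
  ultimately have eq: "g * (?J * transpose_mat g) = ?J" using J gt gc
    by (simp add: assoc_mult_mat[of _ "2*n" "2*n" _ "2*n" _ "2*n"])
  have "omega i j = (g * (?J * transpose_mat g)) $$ (i, j)" using ij by (simp add: eq symplectic_form_omega)
  also have "\<dots> = (\<Sum>p<2*n. g $$ (i, p) * (?J * transpose_mat g) $$ (p, j))"
    by (rule mult_entry[OF gc mult_carrier_mat[OF J gt] ij])
  also have "\<dots> = (\<Sum>p<2*n. g $$ (i, p) * (\<Sum>q<2*n. omega p q * g $$ (j, q)))"
  proof (rule sum.cong[OF refl])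
    fix p assume "p \<in> {..<2*n}"
    then have p: "p < 2 * n" by simp
    have "(?J * transpose_mat g) $$ (p, j) = (\<Sum>q<2*n. omega p q * g $$ (j, q))"
      unfolding mult_entry[OF J gt p ij(2)]
      by (rule sum.cong) (use p ij gc in \<open>auto simp: symplectic_form_omega\<close>)
    then show "g $$ (i, p) * (?J * transpose_mat g) $$ (p, j) = g $$ (i, p) * (\<Sum>q<2*n. omega p q * g $$ (j, q))" by simp
  qed
  finally show ?thesis by (simp add: sum_distrib_left mult.assoc)
qed

lemma S_omega: "S k l v = (\<Sum>p<2*n. \<Sum>q<2*n. sc (omega p q) (u p k (u q l v)))"
  unfolding S_def
proof (rule sum.cong[OF refl])
  fix p assume "p \<in> {..<2*n}"
  then have p: "p < 2 * n" "conj p < 2 * n" using conj_less by auto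
  have "(\<Sum>q<2*n. sc (omega p q) (u p k (u q l v))) = sc (omega p (conj p)) (u p k (u (conj p) l v))"
    by (rule sum_eq_single) (use p in \<open>auto simp: omega_def\<close>)
  then show "sc (- eta p) (u p k (u (conj p) l v)) = (\<Sum>q<2*n. sc (omega p q) (u p k (u q l v)))"
    by (simp add: omega_def)
qed

lemma jm_Inv: "j_gen V n e f k \<in> Inv"
  unfolding Sp_invariants_def
proof (intro CollectI ballI allI impI)
  fix g \<phi> assume g: "g \<in> Sp n" and ext: "extends_matrix V n e f g \<phi>"
  have lin: "lin \<phi>" using ext by (rule extends_lin)
  have gen: "\<phi> (gen p) = (\<Sum>i<2*n. sc (g $$ (i, p)) (gen i))" if "p < 2 * n" for p
    using ext that by (simp add: extends_matrix_def gen_def)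
  have ph: "\<phi> (nprod V m a b) = nprod V m (\<phi> a) (\<phi> b)" "\<phi> (vac V) = vac V" for m a b
    using ext by (auto simp: extends_matrix_def vertex_automorphism_def)
  have phu: "\<phi> (u p m x) = (\<Sum>i<2*n. sc (g $$ (i, p)) (u i m (\<phi> x)))" if "p < 2 * n" for p m x
    using that by (simp add: u_def ph gen nprod_sum_left nprod_scale_left)
  let ?U = "\<lambda>i j. u i (-1) (u j (-1 - int k) (vac V))"
  have "\<phi> (sst k) = (\<Sum>p<2*n. \<Sum>q<2*n. \<Sum>i<2*n. \<Sum>j<2*n. sc (g $$ (i, p) * omega p q * g $$ (j, q)) (?U i j))"
    unfolding S_omega lin_sum[OF lin] lin_scale[OF lin]
  proof (intro sum.cong refl)
    fix p q assume "p \<in> {..<2*n}" "q \<in> {..<2*n}"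
    then show "sc (omega p q) (\<phi> (?U p q)) = (\<Sum>i<2*n. \<Sum>j<2*n. sc (g $$ (i, p) * omega p q * g $$ (j, q)) (?U i j))"
      by (simp add: phu ph u_sum u_scale scale_sum_right mult_ac)
  qed
  also have "\<dots> = (\<Sum>i<2*n. \<Sum>j<2*n. \<Sum>p<2*n. \<Sum>q<2*n. sc (g $$ (i, p) * omega p q * g $$ (j, q)) (?U i j))"
  proof -
    have "(\<Sum>p\<in>A. \<Sum>q\<in>A. \<Sum>i\<in>A. \<Sum>j\<in>A. F p q i j) = (\<Sum>i\<in>A. \<Sum>j\<in>A. \<Sum>p\<in>A. \<Sum>q\<in>A. F p q i j)"
      for A :: "nat set" and F :: "nat \<Rightarrow> nat \<Rightarrow> nat \<Rightarrow> nat \<Rightarrow> 'v"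
    proof -
      have "(\<Sum>p\<in>A. \<Sum>q\<in>A. \<Sum>i\<in>A. \<Sum>j\<in>A. F p q i j) = (\<Sum>p\<in>A. \<Sum>i\<in>A. \<Sum>q\<in>A. \<Sum>j\<in>A. F p q i j)"
        by (rule sum.cong[OF refl]) (rule sum.swap)
      also have "\<dots> = (\<Sum>i\<in>A. \<Sum>p\<in>A. \<Sum>j\<in>A. \<Sum>q\<in>A. F p q i j)"
        using sum.swap[of "\<lambda>p i. \<Sum>q\<in>A. \<Sum>j\<in>A. F p q i j" A A] sum.swap[of "\<lambda>q j. F _ q _ j" A A] by simp
      also have "\<dots> = (\<Sum>i\<in>A. \<Sum>j\<in>A. \<Sum>p\<in>A. \<Sum>q\<in>A. F p q i j)"
        by (rule sum.cong[OF refl]) (rule sum.swap)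
      finally show ?thesis .
    qed
    then show ?thesis .
  qed
  also have "\<dots> = sst k"
    unfolding S_omega
    by (intro sum.cong refl) (simp add: Sp_transpose[OF g] flip: scale_sum_left)
  finally show "\<phi> (j_gen V n e f k) = j_gen V n e f k"
    by (simp add: j_gen_sst lin_scale[OF lin])
qed

lemma D_pow_Inv: "a \<in> Inv \<Longrightarrow> (D ^^ t) a \<in> Inv"
  by (induction t) (simp_all add: D_Inv)

lemma mon_Inv: "mon ms \<in> Inv"
  by (induction ms) (simp_all add: mon_def vac_Inv jop_def nprod_Inv D_pow_Inv jm_Inv)

lemma Qle_Inv: "Qle r w \<subseteq> Inv"
proof -
  have "Mle r w \<subseteq> Inv" unfolding Mle_def by (rule span_minimal[OF _ subspace_Inv]) (auto simp: mon_Inv)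
  then show ?thesis using Qle_subset_Mle by blast
qed

lemma Inv_Qle: "x \<in> Inv \<Longrightarrow> x \<in> Vle (int W) \<Longrightarrow> x \<in> Qle W (int W)"
  using first_fundamental_theorem invariant_dw by blast

lemma mon_Vle: "mon ms \<in> Vle (int (mwts ms))"
  using mon_Qle Qle_Vle by blast

section \<open>Weights of products, and derivatives of monomials\<close>

lemma nprod_Vle_word:
  "set xs \<subseteq> modes \<Longrightarrow> b \<in> Vle y \<Longrightarrow>
     nprod V k (foldr crop xs (vac V)) b \<in> Vle (int (sum_list (map snd xs)) + y - k - 1)"
proof (induction xs arbitrary: k b y)
  case Nil
  then show ?case using subspace_0[OF subspace_Vle] by (simp add: vac_left)
next
  case (Cons a xs)
  obtain p l where a: "a = (p, l)" "p < 2 * n" "l \<ge> 1" using Cons.prems by (cases a) (auto simp: modes_def)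
  let ?x = "foldr crop xs (vac V)" and ?w = "int (sum_list (map snd xs))"
  have xs: "set xs \<subseteq> modes" using Cons.prems by simp
  have "foldr crop xs (vac V) \<in> even_part V \<or> foldr crop xs (vac V) \<in> odd_part V"
    using xs
  proof (induction xs)
    case (Cons z xs)
    then show ?case by (cases z) (auto simp: crop_def modes_def u_even u_odd)
  qed (simp add: vac_even)
  then obtain s :: complex where s: "s = 1 \<and> ?x \<in> even_part V \<or> s = - 1 \<and> ?x \<in> odd_part V" by blast
  obtain M where M: "\<forall>N\<ge>M. nprod V k (nprod V (- int l) (gen p) ?x) b
     = (\<Sum>j<N. sc ((-1) ^ j * (of_int (- int l) gchoose j))
                (nprod V (- int l - int j) (gen p) (nprod V (k + int j) ?x b)
                  - sc ((- 1) powi (- int l) * s) (nprod V (- int l + k - int j) ?x (nprod V (int j) (gen p) b))))"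
    using associator_odd[OF gen_odd[OF a(2)] s] by blast
  have "nprod V k (u p (- int l) ?x) b
     = (\<Sum>j<M. sc ((-1) ^ j * (of_int (- int l) gchoose j))
                (u p (- int l - int j) (nprod V (k + int j) ?x b)
                  - sc ((- 1) powi (- int l) * s) (nprod V (- int l + k - int j) ?x (u p (int j) b))))"
    using M by (simp add: u_def)
  also have "\<dots> \<in> Vle (int (sum_list (map snd (a # xs))) + y - k - 1)"
  proof (intro subspace_sum[OF subspace_Vle] subspace_scale[OF subspace_Vle] subspace_diff[OF subspace_Vle])
    fix j
    have "u p (- int l - int j) (nprod V (k + int j) ?x b) \<in> Vle (?w + y - (k + int j) - 1 - (- int l - int j))"
      by (intro u_Vle a Cons.IH xs Cons.prems)
    also have "?w + y - (k + int j) - 1 - (- int l - int j) = int (sum_list (map snd (a # xs))) + y - k - 1"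
      by (simp add: a)
    finally show "u p (- int l - int j) (nprod V (k + int j) ?x b) \<in> Vle (int (sum_list (map snd (a # xs))) + y - k - 1)" .
    have "nprod V (- int l + k - int j) ?x (u p (int j) b) \<in> Vle (?w + (y - int j) - (- int l + k - int j) - 1)"
      by (intro u_Vle a Cons.IH xs Cons.prems)
    also have "?w + (y - int j) - (- int l + k - int j) - 1 = int (sum_list (map snd (a # xs))) + y - k - 1"
      by (simp add: a)
    finally show "nprod V (- int l + k - int j) ?x (u p (int j) b) \<in> Vle (int (sum_list (map snd (a # xs))) + y - k - 1)" .
  qed
  finally show ?case by (simp add: a crop_def[of "(p, l)"])
qed

lemma nprod_Vle:
  assumes "a \<in> Vle x" "b \<in> Vle y"
  shows "nprod V k a b \<in> Vle (x + y - k - 1)"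
proof (rule lin_span_subset[OF lin_nprod_left _ subspace_Vle assms(1)[unfolded Vle_def]])
  fix z assume "z \<in> {foldr crop xs (vac V) | xs. set xs \<subseteq> modes \<and> int (sum_list (map snd xs)) \<le> x}"
  then obtain xs where xs: "z = foldr crop xs (vac V)" "set xs \<subseteq> modes" "int (sum_list (map snd xs)) \<le> x" by blast
  then have "nprod V k z b \<in> Vle (int (sum_list (map snd xs)) + y - k - 1)" using nprod_Vle_word assms(2) by simp
  also have "\<dots> \<subseteq> Vle (x + y - k - 1)" by (rule Vle_mono) (use xs in simp)
  finally show "nprod V k z b \<in> Vle (x + y - k - 1)" .
qed

lemma D_Vle: "a \<in> Vle x \<Longrightarrow> D a \<in> Vle (x + 1)"
  using nprod_Vle[of a x "vac V" 0 "-2"] vac_Vle[of 0] by (simp add: deriv_op_def add.commute)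

lemma jm_Vle: "(D ^^ t) (jm m) \<in> Vle (int (mwt (m, t)))"
  using mon_Vle[of "[(m, t)]"] by (simp add: mon_def mwts_def jop_vac')

lemma jop_Wle: "m < n \<Longrightarrow> y \<in> Wle w \<Longrightarrow> jop (m, t) y \<in> Wle (w + mwt (m, t))"
proof (rule lin_span_subset[OF lin_jop _ subspace_Wle])
  assume m: "m < n" and "y \<in> Wle w"
  then show "y \<in> span {mon ms | ms. (\<forall>(m, t)\<in>set ms. m < n) \<and> mwts ms \<le> w}" by (simp add: Wle_def)
  fix x assume "x \<in> {mon ms | ms. (\<forall>(m, t)\<in>set ms. m < n) \<and> mwts ms \<le> w}"
  then obtain ms where ms: "x = mon ms" "\<forall>(m, t)\<in>set ms. m < n" "mwts ms \<le> w" by blast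
  have "jop (m, t) x = mon ((m, t) # ms)" by (simp add: ms mon_def)
  moreover have "\<forall>(m, t)\<in>set ((m, t) # ms). m < n" "mwts ((m, t) # ms) \<le> w + mwt (m, t)"
    using ms m by (auto simp: mwts_def)
  ultimately show "jop (m, t) x \<in> Wle (w + mwt (m, t))" unfolding Wle_def by (intro span_base) blast
qed

lemma vac_Wle: "vac V \<in> Wle w"
  unfolding Wle_def by (rule span_base) (auto simp: mon_def mwts_def intro!: exI[of _ "[]"])

lemma D_jop: "D (jop (m, t) v) = jop (m, Suc t) v + jop (m, t) (D v)"
  by (simp add: jop_def deriv_prod)

lemma D_mon_Wle: "\<forall>(m, t)\<in>set ms. m < n \<Longrightarrow> D (mon ms) \<in> Wle (mwts ms + 1)"
proof (induction ms)
  case Nil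
  then show ?case by (simp add: mon_def deriv_vac subspace_0[OF subspace_Wle])
next
  case (Cons x ms)
  obtain m t where x: "x = (m, t)" by (cases x)
  have m: "m < n" "\<forall>(m, t)\<in>set ms. m < n" using Cons.prems x by auto
  have "mon ms \<in> Wle (mwts ms)" unfolding Wle_def using m by (intro span_base) auto
  then have 1: "jop (m, Suc t) (mon ms) \<in> Wle (mwts ms + mwt (m, Suc t))" using m by (intro jop_Wle)
  have 2: "jop (m, t) (D (mon ms)) \<in> Wle (mwts ms + 1 + mwt (m, t))" using Cons.IH m by (intro jop_Wle)
  have "mwts ms + mwt (m, Suc t) = mwts (x # ms) + 1" "mwts ms + 1 + mwt (m, t) = mwts (x # ms) + 1"
    by (simp_all add: mwts_def mwt_def x)
  then have "jop (m, Suc t) (mon ms) + jop (m, t) (D (mon ms)) \<in> Wle (mwts (x # ms) + 1)"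
    using subspace_add[OF subspace_Wle] 1 2 by simp
  then show ?case by (simp add: mon_def x D_jop)
qed

lemma D_Wle: "y \<in> Wle w \<Longrightarrow> D y \<in> Wle (w + 1)"
proof (rule lin_span_subset[OF lin_D _ subspace_Wle])
  assume "y \<in> Wle w"
  then show "y \<in> span {mon ms | ms. (\<forall>(m, t)\<in>set ms. m < n) \<and> mwts ms \<le> w}" by (simp add: Wle_def)
  fix x assume "x \<in> {mon ms | ms. (\<forall>(m, t)\<in>set ms. m < n) \<and> mwts ms \<le> w}"
  then obtain ms where ms: "x = mon ms" "\<forall>(m, t)\<in>set ms. m < n" "mwts ms \<le> w" by blast
  then have "D x \<in> Wle (mwts ms + 1)" using D_mon_Wle by simp
  also have "\<dots> \<subseteq> Wle (w + 1)" by (rule Wle_mono) (use ms in simp)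
  finally show "D x \<in> Wle (w + 1)" .
qed

end

context symplectic_fermion_algebra
begin

section \<open>Elimination of the higher generators by induction on the weight\<close>

definition Ile :: "int \<Rightarrow> 'v set" where "Ile w = Inv \<inter> Vle w"

lemma subspace_Ile: "subspace (Ile w)"
  unfolding Ile_def by (intro subspace_inter subspace_Inv subspace_Vle)

lemma Ile_neg: "w < 0 \<Longrightarrow> x \<in> Ile w \<Longrightarrow> x = 0"
  unfolding Ile_def using Vle_neg by blast

lemma nprod_Ile: "a \<in> Ile x \<Longrightarrow> b \<in> Ile y \<Longrightarrow> nprod V k a b \<in> Ile (x + y - k - 1)"
  unfolding Ile_def using nprod_Vle nprod_Inv by blast

lemma D_Ile: "a \<in> Ile x \<Longrightarrow> D a \<in> Ile (x + 1)"
  unfolding Ile_def using D_Vle D_Inv by blast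

lemma jm_Ile: "(D ^^ t) (jm m) \<in> Ile (int (mwt (m, t)))"
  unfolding Ile_def using jm_Vle D_pow_Inv jm_Inv by blast

lemma mon_Ile: "mon ms \<in> Ile (int (mwts ms))"
  unfolding Ile_def using mon_Vle mon_Inv by blast

lemma j_gen_even: "j_gen V n e f k \<in> even_part V"
proof -
  have "sst k \<in> even_part V"
    unfolding S_def
    by (intro subspace_sum[OF subspace_even] subspace_scale[OF subspace_even])
      (simp add: u_odd u_even vac_even conj_less)
  then show ?thesis by (simp add: j_gen_sst subspace_scale[OF subspace_even])
qed

lemma D_even: "a \<in> even_part V \<Longrightarrow> D a \<in> even_part V"
  by (simp add: deriv_op_def nprod_even_even vac_even)

lemma D_pow_even: "a \<in> even_part V \<Longrightarrow> (D ^^ t) a \<in> even_part V"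
  by (induction t) (simp_all add: D_even)

lemma mon_even: "mon ms \<in> even_part V"
  by (induction ms) (simp_all add: mon_def vac_even jop_def nprod_even_even D_pow_even j_gen_even)

lemma koszul_even: "a \<in> even_part V \<Longrightarrow> sc (koszul_sign V a b) (nprod V k b (nprod V m a c)) = nprod V k b (nprod V m a c)"
proof (cases "a \<in> odd_part V")
  case True
  assume "a \<in> even_part V"
  with True have "a = 0" using even_odd_disjoint by blast
  then show ?thesis by (simp add: nprod_zero_left nprod_zero_right)
qed (simp add: koszul_sign_def)

lemma nprod_jm: "nprod V (-1 - int j) ((D ^^ t) (jm m)) y = sc (1 / fact j) (jop (m, t + j) y)"
proof -
  have "(D ^^ j) ((D ^^ t) (jm m)) = (D ^^ (t + j)) (jm m)"
    by (simp add: funpow_add add.commute[of t])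
  then show ?thesis by (simp add: nprod_deriv_pow jop_def)
qed

text \<open>Expanding the product of a monomial with \<open>y\<close> gives either its first factor
  applied to an invariant of weight below \<open>W\<close>, or the remaining factors with a larger
  \<open>i\<close>. The disjunction in the premises excludes that a \<open>y\<close> of weight
  \<open>W\<close> is returned unchanged.\<close>

lemma nprod_mon_Wle:
  assumes IH: "\<And>w. w < W \<Longrightarrow> Ile (int w) \<subseteq> Wle w"
  shows "(\<forall>(m, t)\<in>set ms. m < n) \<Longrightarrow> y \<in> Ile (int y') \<Longrightarrow> ms \<noteq> [] \<or> i \<ge> 1 \<or> y' < W
     \<Longrightarrow> mwts ms + y' + i \<le> W \<Longrightarrow> nprod V (-1 - int i) (mon ms) y \<in> Wle W"
proof (induction ms arbitrary: y y' i)
  case Nil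
  show ?case
  proof (cases "i = 0")
    case True
    then have "y' < W" using Nil by simp
    then have "y \<in> Wle W" using IH Nil.prems(2) Wle_mono[of y' W] by auto
    then show ?thesis using True by (simp add: mon_def vac_left)
  next
    case False
    then show ?thesis by (simp add: mon_def vac_left subspace_0[OF subspace_Wle])
  qed
next
  case (Cons x ms)
  obtain m t where x: "x = (m, t)" by (cases x)
  let ?b = "(D ^^ t) (jm m)" and ?B = "mon ms" and ?w = "mwt (m, t)" and ?k = "-1 - int i"
  have m: "m < n" "\<forall>(m, t)\<in>set ms. m < n" using Cons.prems x by auto
  have wt: "?w + mwts ms + y' + i \<le> W" "?w \<ge> 2" using Cons.prems mwt_ge by (auto simp: x mwts_def)
  have ev: "?b \<in> even_part V" "?b \<in> hom" "?B \<in> hom" by (simp_all add: D_pow_even j_gen_even mon_even)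
  obtain N where N: "\<forall>N'\<ge>N. nprod V ?k (nprod V (-1) ?b ?B) y
     = (\<Sum>j<N'. sc ((-1) ^ j * (of_int (-1) gchoose j))
                (nprod V ((-1) - int j) ?b (nprod V (?k + int j) ?B y)
                  - sc ((- 1) powi (-1) * koszul_sign V ?b ?B)
                      (nprod V ((-1) + ?k - int j) ?B (nprod V (int j) ?b y))))"
    using associator_formula[OF ev(2,3), of ?k "-1" y] by blast
  have "mon (x # ms) = nprod V (-1) ?b ?B" by (simp add: mon_def x jop_def)
  then have "nprod V ?k (mon (x # ms)) y = (\<Sum>j<N. sc ((-1) ^ j * (of_int (-1) gchoose j))
                (nprod V ((-1) - int j) ?b (nprod V (?k + int j) ?B y)
                  - sc ((- 1) powi (-1) * koszul_sign V ?b ?B)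
                      (nprod V ((-1) + ?k - int j) ?B (nprod V (int j) ?b y))))"
    using N by simp
  also have "\<dots> \<in> Wle W"
  proof (intro subspace_sum[OF subspace_Wle] subspace_scale[OF subspace_Wle] subspace_diff[OF subspace_Wle])
    fix j
    let ?z = "nprod V (?k + int j) ?B y" and ?w1 = "int (mwts ms + y' + i) - int j"
    have "?z \<in> Ile (int (mwts ms) + int y' - (?k + int j) - 1)"
      by (rule nprod_Ile[OF mon_Ile Cons.prems(2)])
    then have z: "?z \<in> Ile ?w1" by (simp add: algebra_simps)
    show "nprod V ((-1) - int j) ?b ?z \<in> Wle W"
    proof (cases "?w1 < 0")
      case True
      then have "?z = 0" using Ile_neg z by blast
      then show ?thesis by (simp only: nprod_zero_right subspace_0[OF subspace_Wle])
    next
      case False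
      define w1 where "w1 = mwts ms + y' + i - j"
      have w1: "?w1 = int w1" using False by (simp add: w1_def)
      have "w1 < W" using wt by (simp add: w1_def)
      then have "?z \<in> Wle w1" using IH z w1 by auto
      then have "jop (m, t + j) ?z \<in> Wle (w1 + mwt (m, t + j))" using m by (intro jop_Wle)
      also have "\<dots> \<subseteq> Wle W" by (rule Wle_mono) (use wt False in \<open>simp add: w1_def mwt_def\<close>)
      finally show ?thesis unfolding nprod_jm by (intro subspace_scale[OF subspace_Wle])
    qed
    let ?z' = "nprod V (int j) ?b y" and ?w2 = "int (?w + y') - int j - 1"
    have z': "?z' \<in> Ile ?w2" using nprod_Ile[OF jm_Ile Cons.prems(2), of "int j" t m] by simp
    show "nprod V ((-1) + ?k - int j) ?B ?z' \<in> Wle W"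
    proof (cases "?w2 < 0")
      case True
      then have "?z' = 0" using Ile_neg z' by blast
      then show ?thesis by (simp only: nprod_zero_right subspace_0[OF subspace_Wle])
    next
      case False
      define w2 where "w2 = ?w + y' - j - 1"
      have w2: "?w2 = int w2" using False by (simp add: w2_def)
      have "nprod V (-1 - int (i + 1 + j)) ?B ?z' \<in> Wle W"
        by (rule Cons.IH[OF m(2) z'[unfolded w2]]) (use wt False in \<open>auto simp: w2_def\<close>)
      moreover have "-1 - int (i + 1 + j) = (-1) + ?k - int j" by simp
      ultimately show ?thesis by (simp only:)
    qed
  qed
  finally show ?case .
qed

lemma nprod_Wle:
  assumes IH: "\<And>w. w < W \<Longrightarrow> Ile (int w) \<subseteq> Wle w"
    and "a \<in> Wle x" "b \<in> Ile (int y)" "y < W" "x + y \<le> W"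
  shows "nprod V (-1) a b \<in> Wle W"
proof (rule lin_span_subset[OF lin_nprod_left _ subspace_Wle assms(2)[unfolded Wle_def]])
  fix z assume "z \<in> {mon ms | ms. (\<forall>(m, t)\<in>set ms. m < n) \<and> mwts ms \<le> x}"
  then obtain ms where ms: "z = mon ms" "\<forall>(m, t)\<in>set ms. m < n" "mwts ms \<le> x" by blast
  show "nprod V (-1) z b \<in> Wle W"
  proof -
    have "nprod V (-1 - int 0) (mon ms) b \<in> Wle W"
      by (rule nprod_mon_Wle[OF IH ms(2) assms(3)]) (use ms assms(4,5) in auto)
    then show ?thesis by (simp add: ms(1))
  qed
qed

text \<open>In odd weight every \<open>cre m t\<close> of the expansion has
  \<open>t \<ge> 1\<close>, so one derivative can be pulled out.\<close>

lemma S_odd_total: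
  assumes "a \<ge> 1" "b \<ge> 1" "a + b = Suc p" "even p"
  shows "\<exists>x\<in>Ile (int p). S (- int a) (- int b) (vac V) = D x"
proof -
  let ?M = "{m. 2 * m + 2 \<le> Suc p}"
  obtain c where c: "\<And>v. S (- int a) (- int b) v = (\<Sum>m\<in>?M. sc (c m) (cre m (Suc p - 2 * m - 2) v))"
    using cre_span_S[OF assms(1-3)] unfolding cre_span_def by blast
  have ex: "2 * m + 2 \<le> p" if "m \<in> ?M" for m
    using that assms(4) by (auto simp: le_Suc_eq)
  let ?x = "\<Sum>m\<in>?M. sc (c m) ((D ^^ (p - 2 * m - 2)) (jm m))"
  have "S (- int a) (- int b) (vac V) = (\<Sum>m\<in>?M. sc (c m) (D ((D ^^ (p - 2 * m - 2)) (jm m))))"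
    unfolding c
  proof (rule sum.cong[OF refl])
    fix m assume "m \<in> ?M"
    then have "Suc p - 2 * m - 2 = Suc (p - 2 * m - 2)" using ex by force
    then show "sc (c m) (cre m (Suc p - 2 * m - 2) (vac V)) = sc (c m) (D ((D ^^ (p - 2 * m - 2)) (jm m)))"
      by (simp only: cre_vac funpow.simps comp_apply)
  qed
  also have "\<dots> = D ?x" by (simp only: lin_sum[OF lin_D] lin_scale[OF lin_D])
  finally have 1: "S (- int a) (- int b) (vac V) = D ?x" .
  have 2: "?x \<in> Ile (int p)"
  proof (intro subspace_sum[OF subspace_Ile] subspace_scale[OF subspace_Ile])
    fix m assume "m \<in> ?M"
    then have "mwt (m, p - 2 * m - 2) = p" using ex by (force simp: mwt_def)
    then show "(D ^^ (p - 2 * m - 2)) (jm m) \<in> Ile (int p)" using jm_Ile[of "p - 2 * m - 2" m] by simp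
  qed
  show ?thesis using 1 2 by blast
qed

lemma jm_1: "jm 1 = sst 2"
  by (simp add: j_gen_sst fact_numeral)

lemma jm_sst: "jm m = sc (fact (2 * m) / 2) (S (- int 1) (- int (2 * m + 1)) (vac V))"
proof -
  have "- int (2 * m + 1) = -1 - int (2 * m)" by simp
  then show ?thesis by (simp add: j_gen_sst)
qed

lemma nprod_0_deriv: "nprod V 0 a (D b) = D (nprod V 0 a b)"
  by (simp add: deriv_prod deriv_nprod)

text \<open>For \<open>s = 0\<close> the product is quadratic of odd weight \<open>2 m + 5\<close>,
  so \<open>S_odd_total\<close> applies; the zeroth product commutes with \<open>D\<close>.\<close>

lemma nprod_0_jm_1: "\<exists>x\<in>Ile (int (2 * m + 4 + s)). nprod V 0 (jm 1) ((D ^^ s) (jm m)) = D x"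
proof (induction s)
  case 0
  let ?b = "2 * m + 1"
  have e: "- int 1 + (0 - 1 - int 2) = - int 4" "- int ?b + (0 - 1 - int 2) = - int (2 * m + 4)" by simp_all
  obtain x1 where x1: "x1 \<in> Ile (int (2 * m + 4))" "S (- int 4) (- int ?b) (vac V) = D x1"
    using S_odd_total[of 4 ?b "2 * m + 4"] by auto
  obtain x2 where x2: "x2 \<in> Ile (int (2 * m + 4))" "S (- int 1) (- int (2 * m + 4)) (vac V) = D x2"
    using S_odd_total[of 1 "2 * m + 4" "2 * m + 4"] by auto
  let ?x = "sc (fact (2 * m) / 2) (sc (gam 2 0 (- int 1)) x1 + sc (gam 2 0 (- int ?b)) x2)"
  have "nprod V 0 (jm 1) (jm m) = D ?x"
    unfolding jm_1 jm_sst[of m] nprod_scale_right jop_S e x1(2) x2(2)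
    by (simp add: vac_right lin_0[OF lin_S] lin_scale[OF lin_D] lin_add[OF lin_D])
  moreover have "?x \<in> Ile (int (2 * m + 4))"
    using x1(1) x2(1) by (intro subspace_scale[OF subspace_Ile] subspace_add[OF subspace_Ile])
  ultimately show ?case by (intro bexI[of _ ?x]) simp_all
next
  case (Suc s)
  then obtain x where x: "x \<in> Ile (int (2 * m + 4 + s))" "nprod V 0 (jm 1) ((D ^^ s) (jm m)) = D x" by blast
  then have "nprod V 0 (jm 1) ((D ^^ Suc s) (jm m)) = D (D x)" by (simp add: nprod_0_deriv)
  moreover have "D x \<in> Ile (int (2 * m + 4 + Suc s))" using D_Ile[OF x(1)] by (simp add: algebra_simps)
  ultimately show ?case by blast
qed

text \<open>The derivatives of \<open>?X1\<close> and \<open>?X2\<close> move the indices of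
  \<open>?S3\<close> step by step to those of \<open>?Y\<close>, which is j^(2p+2) up to a
  factor.\<close>

lemma nprod_1_jm_1:
  "\<exists>c x. c \<noteq> 0 \<and> x \<in> Ile (int (2 * p + 3)) \<and> nprod V 1 (jm 1) (jm p) = sc c (jm (Suc p)) + D x"
proof -
  define r where "r = 2 * p + 1"
  let ?vv = "vac V" and ?r = "of_nat r :: complex"
  let ?S3 = "S (- int 3) (- int r) (vac V)" and ?X1 = "S (- int 2) (- int r) (vac V)"
    and ?X2 = "S (- int 1) (- int (r + 1)) (vac V)" and ?Y = "S (- int 1) (- int (r + 2)) (vac V)"
  have e: "- int 1 + (1 - 1 - int 2) = - int 3" "- int r + (1 - 1 - int 2) = - int (r + 2)" by simp_all
  have gam: "gam 2 1 (- int k) = - of_nat k * (1 + of_nat k) ^ 2" for k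
    by (simp add: gam_def cb_def gbinomial_prod_rev numeral_2_eq_2 power2_eq_square field_simps)
  have D1: "D ?X1 = sc 2 ?S3 + sc ?r (S (- int 2) (- int (r + 1)) (vac V))"
  proof -
    have "- int 2 - 1 = - int 3" "- int r - 1 = - int (r + 1)" by simp_all
    then show ?thesis by (simp only: D_S deriv_vac lin_0[OF lin_S]) simp
  qed
  have D2: "D ?X2 = S (- int 2) (- int (r + 1)) (vac V) + sc (?r + 1) ?Y"
  proof -
    have "- int 1 - 1 = - int 2" "- int (r + 1) - 1 = - int (r + 2)" by simp_all
    then show ?thesis by (simp only: D_S deriv_vac lin_0[OF lin_S]) (simp add: add.commute)
  qed
  have S3: "?S3 = D (sc (1 / 2) ?X1 - sc (?r / 2) ?X2) + sc (?r * (?r + 1) / 2) ?Y"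
  proof -
    have "D (sc (1 / 2) ?X1 - sc (?r / 2) ?X2) = sc (1 / 2) (D ?X1) - sc (?r / 2) (D ?X2)"
      by (simp only: lin_diff[OF lin_D] lin_scale[OF lin_D])
    also have "\<dots> = ?S3 - sc (?r * (?r + 1) / 2) ?Y"
      unfolding D1 D2 scale_right_distrib scale_scale by (simp add: mult.commute)
    finally show ?thesis by (simp only: diff_add_cancel)
  qed
  let ?x = "sc (fact (2 * p) / 2 * (-4)) (sc (1 / 2) ?X1 - sc (?r / 2) ?X2)"
  \<comment> \<open>\<open>- 2 r (r + 1)\<close> stems from rewriting \<open>?S3\<close> and
    \<open>- r (r + 1)^2\<close> from \<open>gam\<close>; having the same sign, the two cannot
    cancel.\<close>
  define d where "d = - ?r * (?r + 1) * (?r + 3)"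
  have "nprod V 1 (jm 1) (jm p) = sc (fact (2 * p) / 2) (nprod V 1 (sst 2) (S (- int 1) (- int r) (vac V)))"
    unfolding jm_1 jm_sst[of p] nprod_scale_right r_def ..
  also have "nprod V 1 (sst 2) (S (- int 1) (- int r) (vac V)) = sc (-4) ?S3 + sc (- ?r * (1 + ?r) ^ 2) ?Y"
    unfolding jop_S e gam by (simp add: vac_right lin_0[OF lin_S])
  also have "\<dots> = D (sc (-4) (sc (1 / 2) ?X1 - sc (?r / 2) ?X2)) + sc d ?Y"
  proof -
    have "d = (-4) * (?r * (?r + 1) / 2) + (- ?r * (1 + ?r) ^ 2)"
      by (simp add: d_def power2_eq_square field_simps)
    then have "sc d ?Y = sc (-4) (sc (?r * (?r + 1) / 2) ?Y) + sc (- ?r * (1 + ?r) ^ 2) ?Y"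
      by (simp only: scale_scale scale_left_distrib)
    then show ?thesis unfolding S3 scale_right_distrib[of "-4"] lin_scale[OF lin_D, of "-4"]
      by (simp only: add.assoc)
  qed
  also have "sc (fact (2 * p) / 2) \<dots> = D ?x + sc (fact (2 * p) / 2 * d) ?Y"
    by (simp only: scale_right_distrib lin_scale[OF lin_D] scale_scale)
  also have "?Y = sc (2 / fact (2 * Suc p)) (jm (Suc p))"
  proof -
    have "r + 2 = 2 * Suc p + 1" by (simp add: r_def)
    then show ?thesis unfolding jm_sst[of "Suc p"] by (simp only: scale_scale) (simp del: fact_Suc mult_Suc_right)
  qed
  finally have eq: "nprod V 1 (jm 1) (jm p) = sc (fact (2 * p) / 2 * d * (2 / fact (2 * Suc p))) (jm (Suc p)) + D ?x"
    by (simp only: scale_scale add.commute)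
  have "d \<noteq> 0"
  proof -
    have "d = - of_nat (r * (r + 1) * (r + 3))" by (simp add: d_def algebra_simps)
    then show ?thesis by (simp only: neg_equal_0_iff_equal of_nat_eq_0_iff) (simp add: r_def)
  qed
  then have c: "fact (2 * p) / 2 * d * (2 / fact (2 * Suc p)) \<noteq> 0"
    by (simp del: fact_Suc mult_Suc_right)
  have SI: "S (- int a) (- int b) (vac V) \<in> Ile (int (a + b))" if "a \<ge> 1" "b \<ge> 1" for a b
  proof -
    have "S (- int a) (- int b) (vac V) \<in> Qle 1 (int (a + b))"
      using sop_Qle[OF that vac_Qle[of 0 0]] by simp
    then show ?thesis unfolding Ile_def using Qle_Inv Qle_Vle by blast
  qed
  have "?X1 \<in> Ile (int (2 * p + 3))" "?X2 \<in> Ile (int (2 * p + 3))"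
    using SI[of 2 r] SI[of 1 "r + 1"] by (simp_all add: r_def algebra_simps)
  then have "?x \<in> Ile (int (2 * p + 3))"
    by (intro subspace_scale[OF subspace_Ile] subspace_diff[OF subspace_Ile])
  with eq c show ?thesis by blast
qed

text \<open>The deviation from the derivation rule is the zeroth mode of
  \<open>nprod V 0 (jm 1) ?b\<close>. This state is a derivative by \<open>nprod_0_jm_1\<close>, and
  zeroth modes of derivatives vanish.\<close>

lemma nprod_1_jm_1_Wle:
  assumes IH: "\<And>w. w < W \<Longrightarrow> Ile (int w) \<subseteq> Wle w"
    and W: "W = 2 * p + 4" "n \<le> p" and z: "z \<in> Wle (2 * p + 2)"
  shows "nprod V 1 (jm 1) z \<in> Wle W"
proof (rule lin_span_subset[OF lin_nprod _ subspace_Wle z[unfolded Wle_def]])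
  have A: "nprod V 1 (jm 1) x \<in> Ile (w + 2)" if "x \<in> Ile w" for x w
    using nprod_Ile[OF jm_Ile[of 0 1] that, of 1] by (simp add: mwt_def algebra_simps)
  fix x assume "x \<in> {mon ms | ms. (\<forall>(m, t)\<in>set ms. m < n) \<and> mwts ms \<le> 2 * p + 2}"
  then obtain ms where ms: "x = mon ms" "\<forall>(m, t)\<in>set ms. m < n" "mwts ms \<le> 2 * p + 2" by blast
  show "nprod V 1 (jm 1) x \<in> Wle W"
  proof (cases ms)
    case Nil
    then show ?thesis by (simp add: ms mon_def vac_right subspace_0[OF subspace_Wle])
  next
    case (Cons y rest)
    obtain m t where y: "y = (m, t)" by (cases y)
    let ?b = "(D ^^ t) (jm m)" and ?w = "mwt (m, t)"
    have m: "m < n" and wt: "?w + mwts rest + 2 \<le> W" "?w \<ge> 2"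
      using ms Cons y W mwt_ge by (auto simp: mwts_def)
    have Ab: "nprod V 1 (jm 1) ?b \<in> Ile (int (?w + 2))" using A[OF jm_Ile[of t m]] by (simp add: add.commute)
    show ?thesis
    proof (cases "rest = []")
      case False
      then have rest: "mwts rest \<ge> 2" using mwt_ge[of "hd rest"] by (cases rest) (auto simp: mwts_def)
      let ?c = "mon rest"
      have ev: "jm 1 \<in> even_part V" "jm 1 \<in> hom" "?b \<in> hom" by (simp_all add: j_gen_even D_pow_even)
      obtain N where N: "\<forall>N'\<ge>N. nprod V 1 (jm 1) (nprod V (-1) ?b ?c) - sc (koszul_sign V (jm 1) ?b) (nprod V (-1) ?b (nprod V 1 (jm 1) ?c))
         = (\<Sum>j<N'. sc (of_int 1 gchoose j) (nprod V (1 + (-1) - int j) (nprod V (int j) (jm 1) ?b) ?c))"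
        using commutator_formula[OF ev(2,3), of 1 "-1" ?c] by blast
      have "(\<Sum>j<N + 2. sc (of_int 1 gchoose j) (nprod V (1 + (-1) - int j) (nprod V (int j) (jm 1) ?b) ?c))
        = (\<Sum>j<2. sc (of_int 1 gchoose j) (nprod V (1 + (-1) - int j) (nprod V (int j) (jm 1) ?b) ?c))"
      proof (rule sum.mono_neutral_right)
        have "(1 gchoose j) = (0 :: complex)" if "j \<ge> 2" for j
          using that binomial_gbinomial[of 1 j, where 'a = complex] by (simp add: binomial_eq_0)
        then show "\<forall>j\<in>{..<N + 2} - {..<2}. sc (of_int 1 gchoose j) (nprod V (1 + (-1) - int j) (nprod V (int j) (jm 1) ?b) ?c) = 0"
          by auto
      qed auto
      also have "\<dots> = nprod V 0 (nprod V 0 (jm 1) ?b) ?c + nprod V (-1) (nprod V 1 (jm 1) ?b) ?c"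
        by (simp add: numeral_2_eq_2)
      also have "nprod V 0 (nprod V 0 (jm 1) ?b) ?c = 0"
        using nprod_0_jm_1[where m = m and s = t] by (auto simp: deriv_nprod)
      finally have "nprod V 1 (jm 1) (nprod V (-1) ?b ?c) = nprod V (-1) ?b (nprod V 1 (jm 1) ?c) + nprod V (-1) (nprod V 1 (jm 1) ?b) ?c"
        using N[rule_format, of "N + 2"] unfolding koszul_even[OF ev(1)] by (simp only: le_add1 diff_eq_eq) (simp only: add_0_left add.commute)
      moreover have "x = nprod V (-1) ?b ?c" by (simp add: ms Cons y mon_def jop_def)
      moreover have "nprod V (-1) ?b (nprod V 1 (jm 1) ?c) \<in> Wle W"
      proof -
        have "nprod V 1 (jm 1) ?c \<in> Ile (int (mwts rest + 2))" using A[OF mon_Ile[of rest]] by (simp add: add.commute)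
        moreover have "mwts rest + 2 < W" using W wt ms Cons by (simp add: mwts_def y)
        ultimately have "nprod V 1 (jm 1) ?c \<in> Wle (mwts rest + 2)" using IH by blast
        then have "jop (m, t) (nprod V 1 (jm 1) ?c) \<in> Wle (mwts rest + 2 + ?w)" using m by (intro jop_Wle)
        also have "\<dots> \<subseteq> Wle W" by (rule Wle_mono) (use wt in simp)
        finally show ?thesis by (simp add: jop_def)
      qed
      moreover have "nprod V (-1) (nprod V 1 (jm 1) ?b) ?c \<in> Wle W"
      proof (rule nprod_Wle[OF IH _ mon_Ile])
        have "?w + 2 < W" using rest wt by simp
        then show "nprod V 1 (jm 1) ?b \<in> Wle (?w + 2)" using IH Ab by blast
      qed (use wt in auto)
      ultimately show ?thesis using subspace_add[OF subspace_Wle] by simp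
    next
      case True
      then have x: "x = ?b" by (simp add: ms Cons y mon_def jop_vac')
      show ?thesis
      proof (cases "?w + 2 < W")
        case True
        then have "nprod V 1 (jm 1) ?b \<in> Wle (?w + 2)" using IH Ab by blast
        then show ?thesis using Wle_mono[of "?w + 2" W] True x by auto
      next
        case False
        then have w: "?w = 2 * p + 2" using wt W by simp
        \<comment> \<open>A single factor of maximal weight must carry a derivative because of
          \<open>m < n \<le> p\<close>. Pulling out one \<open>D\<close> leaves a state of smaller
          weight, plus a zeroth product that is itself a derivative.\<close>
        then have "t \<noteq> 0" using m W by (auto simp: mwt_def)
        then obtain s where s: "t = Suc s" by (cases t) auto
        let ?b' = "(D ^^ s) (jm m)"
        have ws: "2 * m + s = 2 * p - 1" "p \<ge> 1" "int (mwt (m, s)) = int (W - 1) - 2" using w s m W by (auto simp: mwt_def)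
        obtain y where y: "y \<in> Ile (int (2 * m + 4 + s))" "nprod V 0 (jm 1) ?b' = D y"
          using nprod_0_jm_1[where m = m and s = s] by blast
        have W1: "2 * m + 4 + s = W - 1" "W - 1 < W" "W - 1 + 1 = W" using ws W by auto
        have 1: "nprod V 1 (jm 1) ?b' \<in> Ile (int (W - 1))" using A[OF jm_Ile[of s m]] unfolding ws(3) by simp
        have "nprod V 1 (jm 1) (D ?b') = D (nprod V 1 (jm 1) ?b' + y)"
          by (simp add: deriv_prod deriv_nprod lin_add[OF lin_D] y(2)[symmetric])
        moreover have "nprod V 1 (jm 1) ?b' + y \<in> Ile (int (W - 1))"
          using 1 y(1) unfolding W1(1) by (rule subspace_add[OF subspace_Ile])
        then have "D (nprod V 1 (jm 1) ?b' + y) \<in> Wle (W - 1 + 1)" using IH[OF W1(2)] by (intro D_Wle) blast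
        ultimately show ?thesis by (simp add: x s W1(3) del: One_nat_def)
      qed
    qed
  qed
qed

text \<open>It suffices to treat monomials of weight \<open>W\<close>. Products and derivatives
  reduce to smaller weight, which leaves single undifferentiated generators: j^(2n) by
  \<open>decoupling\<close>, and j^(2m) with m > n.\<close>

lemma Ile_Wle:
  assumes n: "n \<ge> 1"
  shows "Ile (int W) \<subseteq> Wle W"
proof (induction W rule: less_induct)
  case (less W)
  have mon: "mon ms \<in> Wle W" if "mwts ms \<le> W" for ms
  proof (cases "mwts ms < W")
    case True
    then show ?thesis using less[OF True] mon_Ile Wle_mono[of "mwts ms" W] by auto
  next
    case False
    then have w: "mwts ms = W" using that by simp
    show ?thesis
    proof (cases ms)
      case Nil
      then show ?thesis by (simp add: mon_def vac_Wle)
    next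
      case (Cons x rest)
      obtain m t where x: "x = (m, t)" by (cases x)
      let ?w = "mwt (m, t)"
      have wt: "?w + mwts rest = W" using w by (simp add: Cons x mwts_def)
      have rest: "mon rest \<in> Ile (int (mwts rest))" by (rule mon_Ile)
      have restW: "mwts rest < W" using wt mwt_ge[of "(m, t)"] by simp
      have ms: "mon ms = jop (m, t) (mon rest)" by (simp add: mon_def Cons x)
      consider "m < n" | "m \<ge> n" "rest \<noteq> []" | "m \<ge> n" "rest = []" "t \<ge> 1" | "m = n" "rest = []" "t = 0" | "m > n" "rest = []" "t = 0"
        by linarith
      then show ?thesis
      proof cases
        case 1
        have "mon rest \<in> Wle (mwts rest)" using less[OF restW] rest by blast
        then show ?thesis using jop_Wle[OF 1] wt unfolding ms by (metis add.commute)
      next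
        case 2
        then have "mwts rest \<ge> 2" using mwt_ge[of "hd rest"] by (cases rest) (auto simp: mwts_def)
        then have "?w < W" using wt by simp
        then have "(D ^^ t) (jm m) \<in> Wle ?w" using less jm_Ile by blast
        then show ?thesis unfolding ms jop_def
          using nprod_Wle[OF less _ rest restW] wt by simp
      next
        case 3
        then obtain s where s: "t = Suc s" by (cases t) auto
        have lt: "mwt (m, s) < W" "mwt (m, s) + 1 = W" using wt 3 s by (simp_all add: mwt_def mwts_def)
        then have "(D ^^ s) (jm m) \<in> Wle (mwt (m, s))" using less jm_Ile by blast
        then have "D ((D ^^ s) (jm m)) \<in> Wle (mwt (m, s) + 1)" by (rule D_Wle)
        moreover have "mon ms = D ((D ^^ s) (jm m))"
          unfolding ms 3(2) s by (simp add: mon_def jop_vac')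
        ultimately show ?thesis by (simp only: lt(2))
      next
        case 4
        then have "mon ms = jm n" unfolding ms by (simp add: mon_def jop_vac')
        moreover have "W = 2 * n + 2" using 4 wt by (simp add: mwt_def mwts_def)
        ultimately show ?thesis using decoupling[OF n] by simp
      next
        case 5
        \<comment> \<open>j^(2m) is solved for in \<open>nprod_1_jm_1\<close>: the product of j^2
          with j^(2m-2) lies in \<open>Wle W\<close> by \<open>nprod_1_jm_1_Wle\<close>, and the
          derivative term by induction.\<close>
        define p where "p = m - 1"
        have p: "m = Suc p" "W = 2 * p + 4" "n \<le> p" using 5 wt by (auto simp: p_def mwt_def mwts_def)
        obtain c y where c: "c \<noteq> 0" "y \<in> Ile (int (2 * p + 3))" "nprod V 1 (jm 1) (jm p) = sc c (jm (Suc p)) + D y"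
          using nprod_1_jm_1 by blast
        have "jm p \<in> Ile (int (2 * p + 2))" using jm_Ile[of 0 p] by (simp add: mwt_def)
        then have "jm p \<in> Wle (2 * p + 2)" using less[of "2 * p + 2"] p by auto
        then have 1: "nprod V 1 (jm 1) (jm p) \<in> Wle W" using p by (intro nprod_1_jm_1_Wle[OF less]) auto
        have "y \<in> Wle (2 * p + 3)" using less[of "2 * p + 3"] p c(2) by auto
        then have "D y \<in> Wle (2 * p + 3 + 1)" by (rule D_Wle)
        then have 2: "D y \<in> Wle W" by (simp add: p(2) add.commute)
        have "sc (1 / c) (nprod V 1 (jm 1) (jm p) - D y) \<in> Wle W"
          by (intro subspace_scale[OF subspace_Wle] subspace_diff[OF subspace_Wle] 1 2)
        moreover have "mon ms = sc (1 / c) (nprod V 1 (jm 1) (jm p) - D y)"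
        proof -
          have "mon ms = jm (Suc p)" unfolding ms 5 p(1) by (simp add: mon_def jop_vac')
          then show ?thesis unfolding c(3) using c(1) by simp
        qed
        ultimately show ?thesis by simp
      qed
    qed
  qed
  show ?case
  proof
    fix v assume "v \<in> Ile (int W)"
    then have "v \<in> Mle W (int W)" using Inv_Qle Qle_subset_Mle unfolding Ile_def by blast
    also have "Mle W (int W) \<subseteq> Wle W"
      unfolding Mle_def by (rule span_minimal[OF _ subspace_Wle]) (use mon in auto)
    finally show "v \<in> Wle W" .
  qed
qed

lemma wick_mon: "wick V (map (\<lambda>(m, t). (D ^^ t) (jm m)) ms) = mon ms"
  by (induction ms) (auto simp: wick_def mon_def jop_def)

theorem Sp_invariants_freely_generated:
  assumes n: "n \<ge> 1"
  shows "freely_generates V Inv (map (\<lambda>m. jm m) [0..<n])"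
  unfolding freely_generates_def
proof (intro conjI)
  let ?gens = "map (\<lambda>m. jm m) [0..<n]"
  show "set ?gens \<subseteq> even_part V \<union> odd_part V" by (auto simp: j_gen_even)
  show "strongly_generates V Inv (set ?gens)"
    unfolding strongly_generates_def
  proof
    let ?B = "{wick V xs | xs. set xs \<subseteq> {(D ^^ k) a | k a. a \<in> set ?gens}}"
    show "Inv \<subseteq> span ?B"
    proof
      fix v assume v: "v \<in> Inv"
      obtain W where "v \<in> Vle (int W)" using ex_Vle by blast
      then have "v \<in> Wle W" using v Ile_Wle[OF n] unfolding Ile_def by blast
      moreover have "mon ms \<in> ?B" if ms: "\<forall>(m, t)\<in>set ms. m < n" for ms
        using ms by (intro CollectI exI[of _ "map (\<lambda>(m, t). (D ^^ t) (jm m)) ms"] conjI)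
          (fastforce simp: wick_mon)+
      then have "Wle W \<subseteq> span ?B" unfolding Wle_def by (intro span_mono) blast
      ultimately show "v \<in> span ?B" by blast
    qed
    show "span ?B \<subseteq> Inv"
    proof (rule span_minimal[OF _ subspace_Inv])
      show "?B \<subseteq> Inv"
      proof
        fix z assume "z \<in> ?B"
        then obtain xs where xs: "z = wick V xs" "set xs \<subseteq> {(D ^^ k) a | k a. a \<in> set ?gens}" by blast
        have "wick V xs \<in> Inv" using xs(2)
        proof (induction xs)
          case Nil
          show ?case by (simp add: wick_def vac_Inv)
        next
          case (Cons x xs)
          obtain k m where x: "x = (D ^^ k) (jm m)" using Cons.prems by auto
          have "wick V (x # xs) = nprod V (-1) x (wick V xs)" by (simp add: wick_def)
          moreover have "x \<in> Inv" unfolding x by (rule D_pow_Inv[OF jm_Inv])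
          ultimately show ?case using Cons nprod_Inv by simp
        qed
        then show "z \<in> Inv" using xs(1) by simp
      qed
    qed
  qed
  show "no_nontrivial_relations V ?gens"
    unfolding no_nontrivial_relations_def
  proof (intro allI impI)
    fix P :: "(nat \<times> nat) list \<Rightarrow> complex" and ms
    assume fin: "finite {ms. P ms \<noteq> 0}" and sub: "{ms. P ms \<noteq> 0} \<subseteq> no_monomials V ?gens"
      and rel: "(\<Sum>ms | P ms \<noteq> 0. sc (P ms) (no_monomial_value V ?gens ms)) = 0"
    have lt: "m < n" if "P ms \<noteq> 0" "(m, t) \<in> set ms" for ms m t
      using that sub by (auto simp: no_monomials_def)
    have srt: "srt ms" if "P ms \<noteq> 0" for ms
    proof -
      have "sorted_wrt (\<lambda>(i, k) (i', k'). i < i' \<or> i = i' \<and> (k' < k \<or> k' = k \<and> ?gens ! i \<notin> odd_part V)) ms"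
        using that sub by (auto simp: no_monomials_def)
      then have "sorted_wrt (\<lambda>x y. mkey x \<le> mkey y) ms"
        by (rule sorted_wrt_mono_rel[rotated]) (auto simp: mkey_def less_eq_prod_def)
      then show ?thesis by (simp add: srt_def sorted_map)
    qed
    have val: "no_monomial_value V ?gens ms = mon ms" if "P ms \<noteq> 0" for ms
    proof -
      have "map (\<lambda>(i, k). (D ^^ k) (?gens ! i)) ms = map (\<lambda>(m, t). (D ^^ t) (jm m)) ms"
        by (rule map_cong[OF refl]) (use lt[OF that] in auto)
      then show ?thesis by (simp only: no_monomial_value_def wick_mon)
    qed
    have "(\<Sum>ms | P ms \<noteq> 0. sc (P ms) (mon ms)) = 0" using rel val by simp
    then have "\<forall>ms\<in>{ms. P ms \<noteq> 0}. P ms = 0"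
      using fin srt lt by (intro mon_independent) auto
    then show "P ms = 0" by blast
  qed
qed

end

theorem corollary5p7:
  fixes V :: "('v::ab_group_add, 'x) vertex_data_scheme"
    and n :: nat and e f :: "nat \<Rightarrow> 'v"
  assumes "n \<ge> 1"
    and "symplectic_fermion_algebra V n e f"
  shows "freely_generates V (Sp_invariants V n e f) (map (\<lambda>m. j_gen V n e f (2 * m)) [0..<n])"
  using symplectic_fermion_algebra.Sp_invariants_freely_generated[OF assms(2,1)] .

end
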